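(* Let $n=2m$ be even. Let $\beta\in O_K$ satisfy $O_K=O[\beta]$ and $\beta^{\iota}=-\beta$, and identify $\beta$ with the element $x\mapsto x\beta$ of $\mathfrak g(O)\subset\mathrm{End}_O(O_K)$. Put $U_{K/F}=\{\gamma\in O_K^\times:\gamma\gamma^{\iota}\in O^\times\}$. Then $\theta\mapsto\mathrm{Ind}_{G(O_r,\beta)}^{G(O_r)}\sigma_{\beta,\theta}$ is a bijection of the set of group homomorphisms $\theta:U_{K/F}\to\mathbb C^\times$ which factor through the image of $U_{K/F}$ in $(O_K/\mathfrak p_K^r)^\times$ and satisfy $$\theta(\gamma)=\tau(\varpi^{-l'}T_{K/F}(\beta x))\quad\text{for all }\gamma=1+\varpi^lx\in U_{K/F}\ (x\in O_K)$$ onto $\mathrm{Irr}(G(O_r)\mid\psi_\beta)$, where $G=GO(S_\varepsilon)$.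
   Context: Let $F$ be a non-archimedean local field with integer ring $O$, maximal ideal $\mathfrak p=\varpi O$ and finite residue field $\mathbb F=O/\mathfrak p$ of odd characteristic not dividing $n$; $O_m=O/\mathfrak p^m$. Fix a continuous unitary character $\tau$ of the additive group $F$ with $\{x\in F:\tau(xO)=1\}=O$. For a finite abelian group $A$, $A^\wedge$ is its group of complex characters. A bar denotes reduction modulo $\mathfrak p$. $K/F$ is the unramified extension of degree $n=2m$, with integer ring $O_K$ and maximal ideal $\mathfrak p_K=\varpi O_K$; $\iota\in\mathrm{Gal}(K/F)$ is the unique element of order 2, and $T_{K/F}$ is the trace. Fix $\varepsilon\in O_K^\times$ with $\varepsilon^\iota=\varepsilon$ and let $S_\varepsilon(x,y)=T_{K/F}(\varepsilon xy^\iota)$, a regular symmetric bilinear form on the $F$-space $K$ (unimodular on $O_K$). $G=GO(S_\varepsilon)$ is the $O$-group scheme with $G(L)=\{g\in GL_L(O_K\otimes_OL): S_\varepsilon(xg,yg)=\nu(g)S_\varepsilon(x,y)\ \forall x,y,\ \text{with }\nu(g)\in L^\times\}$ and its Lie algebra $\mathfrak g=\mathfrak{go}(S_\varepsilon)$ is $\mathfrak g(L)=\{X\in\mathrm{End}_L(O_K\otimes_OL): S_\varepsilon(xX,y)+S_\varepsilon(x,yX)=\nu(X)S_\varepsilon(x,y)\ \forall x,y,\ \text{with }\nu(X)\in L\}$ for commutative $O$-algebras $L$ (endomorphisms act from the right). $B(X,Y)=\mathrm{tr}(XY)$, $K_m(O_r)=\ker(G(O_r)\to G(O_m))$ for $0<m<r$.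 Fix $r\ge2$ and write $r=l+l'$ with $l'=l$ if $r=2l$, $l'=l-1$ if $r=2l-1$. $\psi_\beta$ is the character of the abelian group $K_l(O_r)$ with $\psi_\beta(1+\varpi^lX\bmod\mathfrak p^r)=\tau(\varpi^{-l'}B(X,\beta))$, $X\in\mathfrak g(O)$; its stabilizer in $G(O_r)$ is $G(O_r,\beta)=\{g\bmod\mathfrak p^r:\mathrm{Ad}(g)\beta\equiv\beta\pmod{\mathfrak p^{l'}}\}$. $\mathrm{Irr}(G(O_r)\mid\psi_\beta)$ is the set of isomorphism classes of irreducible complex representations of $G(O_r)$ whose restriction to $K_l(O_r)$ contains $\psi_\beta$. $G_\beta$, $\mathfrak g_\beta$ are the centralizers of $\beta$ in $G$, $\mathfrak g$. Here $G_\beta(O_r)=\{\gamma\bmod\mathfrak p_K^r:\gamma\in U_{K/F}\}\subset(O_K/\mathfrak p_K^r)^\times$, so $\theta$ is regarded as a character of $G_\beta(O_r)$. Definition of $\sigma_{\beta,\theta}$, an irreducible representation of $G(O_r,\beta)=G_\beta(O_r)\cdot K_{l'}(O_r)$. If $r=2l$: $\sigma_{\beta,\theta}(gh)=\theta(g)\psi_\beta(h)$ for $g\in G_\beta(O_r)$, $h\in K_l(O_r)$. If $r=2l-1\ge3$: let $Z(O_r,\beta)\subset K_{l-1}(O_r)$ be the subgroup of the elements $1+\varpi^{l-1}X\bmod\mathfrak p^r$ with $\overline X\in\mathfrak g_\beta(\mathbb F)$. For $\rho\in\mathfrak g_\beta(\mathbb F)^\wedge$ let $\psi_{\beta,\rho}$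 be the character $1+\varpi^{l-1}X\mapsto\tau(\varpi^{-l}B(X,\beta)-(2\varpi)^{-1}B(X^2,\beta))\rho(\overline X)$ of $Z(O_r,\beta)$, and $\pi_{\beta,\rho}$ (on $V_{\beta,\rho}$) the unique irreducible representation of $K_{l-1}(O_r)$ whose restriction to $Z(O_r,\beta)$ contains $\psi_{\beta,\rho}$. Fix for each $\rho$ a group homomorphism $U_{\beta,\rho}:G_\beta(O_r)\to GL_{\mathbb C}(V_{\beta,\rho})$ (which exists here) such that $\pi_{\beta,\rho}(g^{-1}xg)=U_{\beta,\rho}(g)^{-1}\pi_{\beta,\rho}(x)U_{\beta,\rho}(g)$ for $g\in G_\beta(O_r)$, $x\in K_{l-1}(O_r)$, and $U_{\beta,\rho}=1$ on $G_\beta(O_r)\cap K_{l-1}(O_r)$. For $\theta\in G_\beta(O_r)^\wedge$ with $\theta=\psi_\beta$ on $G_\beta(O_r)\cap K_l(O_r)$ there is a unique $\rho$ with $\theta=\psi_{\beta,\rho}$ on $G_\beta(O_r)\cap K_{l-1}(O_r)$, and $\sigma_{\beta,\theta}(gh)=\theta(g)U_{\beta,\rho}(g)\pi_{\beta,\rho}(h)$ for $g\in G_\beta(O_r)$, $h\in K_{l-1}(O_r)$. *)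

theory Defs
  imports
    "HOL-Algebra.Module"
    "HOL-Algebra.Bij"
    "HOL-Algebra.QuotRing"
    "HOL-Computational_Algebra.Polynomial"
    "Jordan_Normal_Form.Matrix"
begin

section \<open>Non-archimedean local fields\<close>

text \<open>
  Fields complete for a discrete absolute value \<open>dist 0 x\<close> with finite residue field.
  The metric is part of the type class, so continuity is the library's \<open>continuous_on\<close>.
\<close>

class nonarch_local_field = field + complete_space +
  assumes dist_translate: "dist (x + z) (y + z) = dist x y"
    and dist_0_mult: "dist 0 (x * y) = dist 0 x * dist 0 y"
    and dist_ultrametric: "dist x z \<le> max (dist x y) (dist y z)"
    and discrete_valuation:
      "\<exists>u. 0 < dist 0 u \<and> dist 0 u < 1 \<and> (\<forall>x. dist 0 x < 1 \<longrightarrow> dist 0 x \<le> dist 0 u)"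
    and finite_residue_field: "finite {{y. dist x y < 1} | x. dist 0 x \<le> 1}"

definition integers :: "'a::nonarch_local_field set" where
  "integers = {x. dist 0 x \<le> 1}"

definition max_ideal :: "'a::nonarch_local_field set" where
  "max_ideal = {x. dist 0 x < 1}"

definition residue_char :: "'a::nonarch_local_field itself \<Rightarrow> nat" where
  "residue_char _ = (LEAST p. 0 < p \<and> of_nat p \<in> (max_ideal :: 'a set))"

section \<open>Linear algebra over commutative rings\<close>

definition ring_on :: "'a::comm_ring_1 set \<Rightarrow> 'a ring" where
  "ring_on S = \<lparr>carrier = S, monoid.mult = (*), one = 1, zero = 0, add = (+)\<rparr>"

definition algebra_on :: "('f \<Rightarrow> 'a::comm_ring_1) \<Rightarrow> 'a set \<Rightarrow> ('f, 'a) module" where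
  "algebra_on e S =
     \<lparr>carrier = S, monoid.mult = (*), one = 1, zero = 0, add = (+), smult = (\<lambda>a x. e a * x)\<rparr>"

text \<open>
  \<open>A / J\<close> as an algebra over a quotient of the base ring; the operations on cosets are formed as
  in \<^const>\<open>rcoset_mult\<close>.
\<close>

definition quot_algebra :: "('r, 'a) module \<Rightarrow> 'a set \<Rightarrow> ('r set, 'a set) module" where
  "quot_algebra A J =
     \<lparr>carrier = carrier (A Quot J), monoid.mult = monoid.mult (A Quot J), one = one (A Quot J),
      zero = zero (A Quot J), add = add (A Quot J),
      smult = (\<lambda>C X. \<Union>c\<in>C. \<Union>x\<in>X. J +>\<^bsub>A\<^esub> (c \<odot>\<^bsub>A\<^esub> x))\<rparr>"

definition linear_maps ::
  "('r, 'x) ring_scheme \<Rightarrow> ('r, 'a, 'y) module_scheme \<Rightarrow> ('r, 'b, 'z) module_scheme \<Rightarrow> ('a \<Rightarrow> 'b) set"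
where
  "linear_maps R M N =
     {f \<in> carrier M \<rightarrow> carrier N.
        (\<forall>x\<in>carrier M. \<forall>y\<in>carrier M. f (x \<oplus>\<^bsub>M\<^esub> y) = f x \<oplus>\<^bsub>N\<^esub> f y) \<and>
        (\<forall>a\<in>carrier R. \<forall>x\<in>carrier M. f (a \<odot>\<^bsub>M\<^esub> x) = a \<odot>\<^bsub>N\<^esub> f x)}"

definition endos :: "('r, 'x) ring_scheme \<Rightarrow> ('r, 'a, 'y) module_scheme \<Rightarrow> ('a \<Rightarrow> 'a) set" where
  "endos R M = linear_maps R M M \<inter> extensional (carrier M)"

definition GL :: "('r, 'x) ring_scheme \<Rightarrow> ('r, 'a, 'y) module_scheme \<Rightarrow> ('a \<Rightarrow> 'a) monoid" where
  "GL R M = (BijGroup (carrier M))\<lparr>carrier := linear_maps R M M \<inter> Bij (carrier M)\<rparr>"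

definition module_basis :: "('r, 'x) ring_scheme \<Rightarrow> ('r, 'a, 'y) module_scheme \<Rightarrow> 'a set \<Rightarrow> bool" where
  "module_basis R M B \<longleftrightarrow>
     finite B \<and> B \<subseteq> carrier M \<and>
     (\<forall>x\<in>carrier M. \<exists>!c. c \<in> B \<rightarrow>\<^sub>E carrier R \<and> x = (\<Oplus>\<^bsub>M\<^esub>b\<in>B. c b \<odot>\<^bsub>M\<^esub> b))"

definition coordinates ::
  "('r, 'x) ring_scheme \<Rightarrow> ('r, 'a, 'y) module_scheme \<Rightarrow> 'a set \<Rightarrow> 'a \<Rightarrow> 'a \<Rightarrow> 'r"
where
  "coordinates R M B x =
     (THE c. c \<in> B \<rightarrow>\<^sub>E carrier R \<and> x = (\<Oplus>\<^bsub>M\<^esub>b\<in>B. c b \<odot>\<^bsub>M\<^esub> b))"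

definition endo_trace ::
  "('r, 'x) ring_scheme \<Rightarrow> ('r, 'a, 'y) module_scheme \<Rightarrow> ('a \<Rightarrow> 'a) \<Rightarrow> 'r"
where
  "endo_trace R M X =
     (let B = (SOME B. module_basis R M B) in \<Oplus>\<^bsub>R\<^esub>b\<in>B. coordinates R M B (X b) b)"

text \<open>
  The similitude group of a bilinear form \<open>S\<close> on the \<open>L\<close>-module \<open>M\<close>, and its Lie algebra.
  Endomorphisms act from the right, so the product \<open>g h\<close> is ``first \<open>g\<close>, then \<open>h\<close>''.
\<close>

definition GO ::
  "('r, 'x) ring_scheme \<Rightarrow> ('r, 'a, 'y) module_scheme \<Rightarrow> ('a \<Rightarrow> 'a \<Rightarrow> 'r) \<Rightarrow> ('a \<Rightarrow> 'a) monoid"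
where
  "GO L M S =
     \<lparr>carrier = {g \<in> carrier (GL L M). \<exists>\<nu>\<in>Units L. \<forall>x\<in>carrier M. \<forall>y\<in>carrier M.
                   S (g x) (g y) = \<nu> \<otimes>\<^bsub>L\<^esub> S x y},
      monoid.mult = (\<lambda>g h. h \<otimes>\<^bsub>GL L M\<^esub> g),
      one = \<one>\<^bsub>GL L M\<^esub>\<rparr>"

definition go ::
  "('r, 'x) ring_scheme \<Rightarrow> ('r, 'a, 'y) module_scheme \<Rightarrow> ('a \<Rightarrow> 'a \<Rightarrow> 'r) \<Rightarrow> ('a \<Rightarrow> 'a) set"
where
  "go L M S =
     {X \<in> endos L M. \<exists>\<nu>\<in>carrier L. \<forall>x\<in>carrier M. \<forall>y\<in>carrier M.
        S (X x) y \<oplus>\<^bsub>L\<^esub> S x (X y) = \<nu> \<otimes>\<^bsub>L\<^esub> S x y}"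

section \<open>Complex representations of groups\<close>

abbreviation CC :: "complex ring" where
  "CC \<equiv> ring_on UNIV"

definition characters :: "('g, 'x) monoid_scheme \<Rightarrow> ('g \<Rightarrow> complex) set" where
  "characters A = hom A (units_of CC) \<inter> extensional (carrier A)"

definition group_rep ::
  "('g, 'x) monoid_scheme \<Rightarrow> (complex, 'v, 'y) module_scheme \<Rightarrow> ('g \<Rightarrow> 'v \<Rightarrow> 'v) \<Rightarrow> bool"
where
  "group_rep G V \<rho> \<longleftrightarrow> module CC V \<and> \<rho> \<in> hom G (GL CC V)"

definition irreducible_rep ::
  "('g, 'x) monoid_scheme \<Rightarrow> (complex, 'v, 'y) module_scheme \<Rightarrow> ('g \<Rightarrow> 'v \<Rightarrow> 'v) \<Rightarrow> bool"
where
  "irreducible_rep G V \<rho> \<longleftrightarrow>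
     group_rep G V \<rho> \<and> carrier V \<noteq> {\<zero>\<^bsub>V\<^esub>} \<and>
     (\<forall>W. submodule W CC V \<and> (\<forall>g\<in>carrier G. \<rho> g ` W \<subseteq> W) \<longrightarrow> W = {\<zero>\<^bsub>V\<^esub>} \<or> W = carrier V)"

definition rep_iso ::
  "('g, 'x) monoid_scheme \<Rightarrow> (complex, 'v, 'y) module_scheme \<Rightarrow> ('g \<Rightarrow> 'v \<Rightarrow> 'v) \<Rightarrow>
   (complex, 'w, 'z) module_scheme \<Rightarrow> ('g \<Rightarrow> 'w \<Rightarrow> 'w) \<Rightarrow> bool"
where
  "rep_iso G V \<rho> W \<sigma> \<longleftrightarrow>
     (\<exists>T\<in>linear_maps CC V W. bij_betw T (carrier V) (carrier W) \<and>
        (\<forall>g\<in>carrier G. \<forall>v\<in>carrier V. T (\<rho> g v) = \<sigma> g (T v)))"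

definition contains_character ::
  "(complex, 'v, 'y) module_scheme \<Rightarrow> ('g \<Rightarrow> 'v \<Rightarrow> 'v) \<Rightarrow> 'g set \<Rightarrow> ('g \<Rightarrow> complex) \<Rightarrow> bool"
where
  "contains_character V \<rho> K \<chi> \<longleftrightarrow>
     (\<exists>v\<in>carrier V. v \<noteq> \<zero>\<^bsub>V\<^esub> \<and> (\<forall>k\<in>K. \<rho> k v = \<chi> k \<odot>\<^bsub>V\<^esub> v))"

text \<open>
  Isomorphism classes are represented inside the set of all representations on the spaces
  \<open>\<complex>\<^sup>d\<close>. Only finite-dimensional representations have a nonempty class; for a finite group these
  include all irreducible ones.
\<close>

type_synonym 'g rep_class = "(nat \<times> ('g \<Rightarrow> complex vec \<Rightarrow> complex vec)) set"

definition iso_class ::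
  "('g, 'x) monoid_scheme \<Rightarrow> (complex, 'v, 'y) module_scheme \<Rightarrow> ('g \<Rightarrow> 'v \<Rightarrow> 'v) \<Rightarrow> 'g rep_class"
where
  "iso_class G V \<rho> =
     {(d, \<pi>). group_rep G (module_vec TYPE(complex) d) \<pi> \<and>
              rep_iso G V \<rho> (module_vec TYPE(complex) d) \<pi>}"

definition Irr_containing ::
  "('g, 'x) monoid_scheme \<Rightarrow> 'g set \<Rightarrow> ('g \<Rightarrow> complex) \<Rightarrow> 'g rep_class set"
where
  "Irr_containing G K \<chi> =
     {iso_class G (module_vec TYPE(complex) d) \<pi> | d \<pi>.
        irreducible_rep G (module_vec TYPE(complex) d) \<pi> \<and>
        contains_character (module_vec TYPE(complex) d) \<pi> K \<chi>}"

definition ind_module ::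
  "('g, 'x) monoid_scheme \<Rightarrow> 'g set \<Rightarrow> (complex, 'v, 'y) module_scheme \<Rightarrow> ('g \<Rightarrow> 'v \<Rightarrow> 'v) \<Rightarrow>
   (complex, 'g \<Rightarrow> 'v) module"
where
  "ind_module G H W \<sigma> =
     \<lparr>carrier = {f \<in> carrier G \<rightarrow>\<^sub>E carrier W.
                   \<forall>h\<in>H. \<forall>x\<in>carrier G. f (h \<otimes>\<^bsub>G\<^esub> x) = \<sigma> h (f x)},
      monoid.mult = undefined, one = undefined,
      zero = (\<lambda>x\<in>carrier G. \<zero>\<^bsub>W\<^esub>),
      add = (\<lambda>f f'. \<lambda>x\<in>carrier G. f x \<oplus>\<^bsub>W\<^esub> f' x),
      smult = (\<lambda>c f. \<lambda>x\<in>carrier G. c \<odot>\<^bsub>W\<^esub> f x)\<rparr>"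

definition ind_rep ::
  "('g, 'x) monoid_scheme \<Rightarrow> 'g set \<Rightarrow> (complex, 'v, 'y) module_scheme \<Rightarrow> ('g \<Rightarrow> 'v \<Rightarrow> 'v) \<Rightarrow>
   'g \<Rightarrow> ('g \<Rightarrow> 'v) \<Rightarrow> ('g \<Rightarrow> 'v)"
where
  "ind_rep G H W \<sigma> g =
     (\<lambda>f\<in>carrier (ind_module G H W \<sigma>). \<lambda>x\<in>carrier G. f (x \<otimes>\<^bsub>G\<^esub> g))"

section \<open>The group \<open>GO(S\<^sub>\<epsilon>)\<close> attached to an unramified extension\<close>

definition field_embedding :: "('f::field \<Rightarrow> 'k::field) \<Rightarrow> bool" where
  "field_embedding e \<longleftrightarrow>
     e 1 = 1 \<and> (\<forall>x y. e (x + y) = e x + e y) \<and> (\<forall>x y. e (x * y) = e x * e y)"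

definition Gal :: "('f::field \<Rightarrow> 'k::field) \<Rightarrow> ('k \<Rightarrow> 'k) set" where
  "Gal e = {\<sigma>. field_embedding \<sigma> \<and> bij \<sigma> \<and> (\<forall>a. \<sigma> (e a) = e a)}"

definition adjoin :: "('f::nonarch_local_field \<Rightarrow> 'k::field) \<Rightarrow> 'k \<Rightarrow> 'k set" where
  "adjoin e \<beta> = {poly p \<beta> | p. \<forall>i. coeff p i \<in> e ` integers}"

text \<open>
  In the following locale \<open>\<iota>\<close> is only assumed to have order 2 in the (cyclic) Galois group.
  Finiteness of \<open>K/F\<close> follows from \<open>dim = n > 0\<close>, and separability of the residue extension from
  finiteness of the residue fields, so that unramified means that the uniformizer \<open>\<pi>\<close> of \<open>F\<close> is a
  uniformizer of \<open>K\<close>. The absolute value of \<open>K\<close> is the one that extends that of \<open>F\<close>.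
\<close>

locale unramified_GO =
  fixes emb :: "'f::nonarch_local_field \<Rightarrow> 'k::nonarch_local_field"
    and \<pi> :: 'f
    and \<tau> :: "'f \<Rightarrow> complex"
    and \<iota> :: "'k \<Rightarrow> 'k"
    and \<epsilon> :: 'k
    and n :: nat
  assumes emb: "field_embedding emb"
    and emb_isometry: "\<And>x. dist 0 (emb x) = dist 0 x"
    and degree_pos: "0 < n"
    and degree: "vector_space.dim (\<lambda>a x. emb a * x) UNIV = n"
    and uniformizer: "\<pi> \<noteq> 0" "max_ideal = (*) \<pi> ` integers"
    and unramified: "max_ideal = (*) (emb \<pi>) ` integers"
    and odd_residue_char: "odd (residue_char TYPE('f))"
    and tame: "\<not> residue_char TYPE('f) dvd n"
    and \<tau>_cont: "continuous_on UNIV \<tau>"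
    and \<tau>_add: "\<And>x y. \<tau> (x + y) = \<tau> x * \<tau> y"
    and \<tau>_unitary: "\<And>x. norm (\<tau> x) = 1"
    and \<tau>_conductor: "{x. \<forall>y\<in>integers. \<tau> (x * y) = 1} = integers"
    and \<iota>_Gal: "\<iota> \<in> Gal emb"
    and \<iota>_order: "\<iota> \<noteq> id" "\<iota> \<circ> \<iota> = id"
    and \<epsilon>_unit: "\<epsilon> \<in> Units (ring_on integers)"
    and \<epsilon>_fixed: "\<iota> \<epsilon> = \<epsilon>"
begin

abbreviation OF :: "'f ring" where
  "OF \<equiv> ring_on integers"

abbreviation OK :: "('f, 'k) module" where
  "OK \<equiv> algebra_on emb integers"

definition Tr :: "'k \<Rightarrow> 'f" where
  "Tr x = endo_trace (ring_on UNIV) (algebra_on emb UNIV) (\<lambda>y. y * x)"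

definition S :: "'k \<Rightarrow> 'k \<Rightarrow> 'f" where
  "S x y = Tr (\<epsilon> * x * \<iota> y)"

text \<open>The base change of \<open>O\<^sub>K\<close> to \<open>O\<^sub>r = O/\<pi>\<^sup>rO\<close> is taken to be \<open>O\<^sub>K/\<pi>\<^sup>rO\<^sub>K\<close>.\<close>

definition IF :: "nat \<Rightarrow> 'f set" where
  "IF r = PIdl\<^bsub>OF\<^esub> (\<pi> ^ r)"

definition IK :: "nat \<Rightarrow> 'k set" where
  "IK r = PIdl\<^bsub>OK\<^esub> (emb \<pi> ^ r)"

definition OF_mod :: "nat \<Rightarrow> 'f set ring" where
  "OF_mod r = OF Quot IF r"

definition OK_mod :: "nat \<Rightarrow> ('f set, 'k set) module" where
  "OK_mod r = quot_algebra OK (IK r)"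

definition S_mod :: "nat \<Rightarrow> 'k set \<Rightarrow> 'k set \<Rightarrow> 'f set" where
  "S_mod r C D = (\<Union>x\<in>C. \<Union>y\<in>D. IF r +>\<^bsub>OF\<^esub> S x y)"

text \<open>
  Reduction of endomorphisms from \<open>O\<close> to \<open>O\<^sub>r\<close>, and from \<open>O\<^sub>r\<close> to \<open>O\<^sub>k\<close> for \<open>k \<le> r\<close>. For linear maps
  each union below is a single coset.
\<close>

definition red :: "nat \<Rightarrow> ('k \<Rightarrow> 'k) \<Rightarrow> ('k set \<Rightarrow> 'k set)" where
  "red r X = (\<lambda>C\<in>carrier (OK_mod r). \<Union>x\<in>C. IK r +>\<^bsub>OK\<^esub> X x)"

definition red_mod :: "nat \<Rightarrow> nat \<Rightarrow> ('k set \<Rightarrow> 'k set) \<Rightarrow> ('k set \<Rightarrow> 'k set)" where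
  "red_mod r k g =
     (\<lambda>C\<in>carrier (OK_mod k). \<Union>x\<in>C. \<Union>y\<in>g (IK r +>\<^bsub>OK\<^esub> x). IK k +>\<^bsub>OK\<^esub> y)"

text \<open>\<open>G r\<close> is \<open>G(O\<^sub>r)\<close> and \<open>K r k\<close> is \<open>K\<^sub>k(O\<^sub>r)\<close>.\<close>

definition G :: "nat \<Rightarrow> ('k set \<Rightarrow> 'k set) monoid" where
  "G r = GO (OF_mod r) (OK_mod r) (S_mod r)"

definition K :: "nat \<Rightarrow> nat \<Rightarrow> ('k set \<Rightarrow> 'k set) set" where
  "K r k = kernel (G r) (G k) (red_mod r k)"

text \<open>The product \<open>XY\<close> of endomorphisms acting from the right is \<open>Y \<circ> X\<close>.\<close>

definition B :: "('k \<Rightarrow> 'k) \<Rightarrow> ('k \<Rightarrow> 'k) \<Rightarrow> 'f" where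
  "B X Y = endo_trace OF OK (compose integers Y X)"

definition mul_by :: "'k \<Rightarrow> 'k \<Rightarrow> 'k" where
  "mul_by x = (\<lambda>y\<in>integers. y * x)"

definition one_plus :: "nat \<Rightarrow> ('k \<Rightarrow> 'k) \<Rightarrow> 'k \<Rightarrow> 'k" where
  "one_plus k X = (\<lambda>y\<in>integers. y + emb (\<pi> ^ k) * X y)"

text \<open>\<open>r = l + l'\<close> with \<open>l' = l\<close> for even \<open>r\<close> and \<open>l' = l - 1\<close> for odd \<open>r\<close>.\<close>

definition l :: "nat \<Rightarrow> nat" where
  "l r = (r + 1) div 2"

definition l' :: "nat \<Rightarrow> nat" where
  "l' r = r div 2"

text \<open>
  Every element of \<open>K\<^sub>l(O\<^sub>r)\<close> is \<open>1 + \<pi>\<^sup>l X mod \<pi>\<^sup>r\<close> for some \<open>X\<close> in the Lie algebra over \<open>O\<close>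
  (smoothness), and the value of the character does not depend on the choice of \<open>X\<close>.
\<close>

definition psi :: "nat \<Rightarrow> 'k \<Rightarrow> ('k set \<Rightarrow> 'k set) \<Rightarrow> complex" where
  "psi r \<beta> k =
     (let X = (SOME X. X \<in> go OF OK S \<and> k = red r (one_plus (l r) X))
      in \<tau> (inverse \<pi> ^ l' r * B X (mul_by \<beta>)))"

text \<open>The stabilizer \<open>G(O\<^sub>r, \<beta>)\<close>, with \<open>Ad(g)X = g X g\<inverse>\<close> (as right operators).\<close>

definition Ad :: "nat \<Rightarrow> ('k set \<Rightarrow> 'k set) \<Rightarrow> ('k set \<Rightarrow> 'k set) \<Rightarrow> ('k set \<Rightarrow> 'k set)" where
  "Ad r g X = compose (carrier (OK_mod r)) (inv\<^bsub>G r\<^esub> g) (compose (carrier (OK_mod r)) X g)"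

definition G_stab :: "nat \<Rightarrow> 'k \<Rightarrow> ('k set \<Rightarrow> 'k set) set" where
  "G_stab r \<beta> =
     {g \<in> carrier (G r). red_mod r (l' r) (Ad r g (red r (mul_by \<beta>))) = red (l' r) (mul_by \<beta>)}"

text \<open>\<open>G\<^sub>\<beta>(O\<^sub>r)\<close>, and \<open>\<gg>\<^sub>\<beta>\<close> over the residue field \<open>O\<^sub>1\<close> as an additive group.\<close>

definition G_centr :: "nat \<Rightarrow> 'k \<Rightarrow> ('k set \<Rightarrow> 'k set) set" where
  "G_centr r \<beta> =
     {g \<in> carrier (G r).
        compose (carrier (OK_mod r)) g (red r (mul_by \<beta>)) =
        compose (carrier (OK_mod r)) (red r (mul_by \<beta>)) g}"

definition g_centr :: "'k \<Rightarrow> ('k set \<Rightarrow> 'k set) monoid" where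
  "g_centr \<beta> =
     \<lparr>carrier = {X \<in> go (OF_mod 1) (OK_mod 1) (S_mod 1).
                   compose (carrier (OK_mod 1)) X (red 1 (mul_by \<beta>)) =
                   compose (carrier (OK_mod 1)) (red 1 (mul_by \<beta>)) X},
      monoid.mult = (\<lambda>X Y. \<lambda>x\<in>carrier (OK_mod 1). X x \<oplus>\<^bsub>OK_mod 1\<^esub> Y x),
      one = (\<lambda>x\<in>carrier (OK_mod 1). \<zero>\<^bsub>OK_mod 1\<^esub>)\<rparr>"

section \<open>The characters \<open>\<theta>\<close>\<close>

definition U_KF :: "'k set" where
  "U_KF = {\<gamma> \<in> Units (ring_on integers). \<gamma> * \<iota> \<gamma> \<in> emb ` Units OF}"

definition theta_set :: "nat \<Rightarrow> 'k \<Rightarrow> ('k \<Rightarrow> complex) set" where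
  "theta_set r \<beta> =
     {\<theta> \<in> characters (ring_on U_KF).
        (\<forall>\<gamma>\<in>U_KF. \<forall>\<gamma>'\<in>U_KF. \<gamma> - \<gamma>' \<in> IK r \<longrightarrow> \<theta> \<gamma> = \<theta> \<gamma>') \<and>
        (\<forall>x\<in>integers. 1 + emb (\<pi> ^ l r) * x \<in> U_KF \<longrightarrow>
           \<theta> (1 + emb (\<pi> ^ l r) * x) = \<tau> (inverse \<pi> ^ l' r * Tr (\<beta> * x)))}"

definition theta_mod :: "nat \<Rightarrow> ('k \<Rightarrow> complex) \<Rightarrow> ('k set \<Rightarrow> 'k set) \<Rightarrow> complex" where
  "theta_mod r \<theta> g = \<theta> (SOME \<gamma>. \<gamma> \<in> U_KF \<and> g = red r (mul_by \<gamma>))"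

section \<open>The representations \<open>\<sigma>\<^sub>\<beta>\<^sub>,\<^sub>\<theta>\<close>\<close>

text \<open>
  In \<open>1 + \<pi>\<^sup>k X\<close> with \<open>2k < r\<close> the endomorphism \<open>X\<close> of \<open>O\<^sub>K\<close> cannot be taken in the Lie algebra over
  \<open>O\<close>; only its reduction modulo \<open>\<pi>\<close> lies in the Lie algebra over the residue field.
\<close>

definition Z :: "nat \<Rightarrow> 'k \<Rightarrow> ('k set \<Rightarrow> 'k set) set" where
  "Z r \<beta> =
     {z \<in> K r (l r - 1). \<exists>X\<in>endos OF OK.
        z = red r (one_plus (l r - 1) X) \<and> red 1 X \<in> carrier (g_centr \<beta>)}"

definition psi_Z ::
  "nat \<Rightarrow> 'k \<Rightarrow> (('k set \<Rightarrow> 'k set) \<Rightarrow> complex) \<Rightarrow> ('k set \<Rightarrow> 'k set) \<Rightarrow> complex"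
where
  "psi_Z r \<beta> \<rho> z =
     (let X = (SOME X. X \<in> endos OF OK \<and> z = red r (one_plus (l r - 1) X))
      in \<tau> (inverse \<pi> ^ l r * B X (mul_by \<beta>)
            - inverse (2 * \<pi>) * B (compose integers X X) (mul_by \<beta>)) * \<rho> (red 1 X))"

text \<open>
  A choice, for each \<open>\<rho>\<close>, of an irreducible representation \<open>P \<rho>\<close> of \<open>K\<^sub>l\<^sub>-\<^sub>1(O\<^sub>r)\<close> on \<open>V \<rho>\<close>
  containing \<open>\<psi>\<^sub>\<beta>\<^sub>,\<^sub>\<rho>\<close> and of a compatible homomorphism \<open>U \<rho>\<close>.
\<close>

definition intertwiner_choice ::
  "nat \<Rightarrow> 'k \<Rightarrow> ((('k set \<Rightarrow> 'k set) \<Rightarrow> complex) \<Rightarrow> (complex, 'v) module) \<Rightarrow>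
   ((('k set \<Rightarrow> 'k set) \<Rightarrow> complex) \<Rightarrow> ('k set \<Rightarrow> 'k set) \<Rightarrow> 'v \<Rightarrow> 'v) \<Rightarrow>
   ((('k set \<Rightarrow> 'k set) \<Rightarrow> complex) \<Rightarrow> ('k set \<Rightarrow> 'k set) \<Rightarrow> 'v \<Rightarrow> 'v) \<Rightarrow> bool"
where
  "intertwiner_choice r \<beta> V P U \<longleftrightarrow>
     (\<forall>\<rho>\<in>characters (g_centr \<beta>).
        irreducible_rep ((G r)\<lparr>carrier := K r (l r - 1)\<rparr>) (V \<rho>) (P \<rho>) \<and>
        contains_character (V \<rho>) (P \<rho>) (Z r \<beta>) (psi_Z r \<beta> \<rho>) \<and>
        U \<rho> \<in> hom ((G r)\<lparr>carrier := G_centr r \<beta>\<rparr>) (GL CC (V \<rho>)) \<and>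
        (\<forall>g\<in>G_centr r \<beta>. \<forall>x\<in>K r (l r - 1). \<forall>v\<in>carrier (V \<rho>).
           P \<rho> (inv\<^bsub>G r\<^esub> g \<otimes>\<^bsub>G r\<^esub> x \<otimes>\<^bsub>G r\<^esub> g) v =
           (inv\<^bsub>GL CC (V \<rho>)\<^esub> (U \<rho> g)) (P \<rho> x (U \<rho> g v))) \<and>
        (\<forall>g\<in>G_centr r \<beta> \<inter> K r (l r - 1). U \<rho> g = \<one>\<^bsub>GL CC (V \<rho>)\<^esub>))"

definition rho_of :: "nat \<Rightarrow> 'k \<Rightarrow> ('k \<Rightarrow> complex) \<Rightarrow> ('k set \<Rightarrow> 'k set) \<Rightarrow> complex" where
  "rho_of r \<beta> \<theta> =
     (THE \<rho>. \<rho> \<in> characters (g_centr \<beta>) \<and>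
        (\<forall>g\<in>G_centr r \<beta> \<inter> K r (l r - 1). theta_mod r \<theta> g = psi_Z r \<beta> \<rho> g))"

text \<open>
  A factorization \<open>x = g h\<close> is unique only up to \<open>G\<^sub>\<beta>(O\<^sub>r) \<inter> K\<^sub>k(O\<^sub>r)\<close>; \<open>\<sigma>\<^sub>\<beta>\<^sub>,\<^sub>\<theta>\<close> does not depend on it.
\<close>

definition factors ::
  "nat \<Rightarrow> 'k \<Rightarrow> nat \<Rightarrow> ('k set \<Rightarrow> 'k set) \<Rightarrow> ('k set \<Rightarrow> 'k set) \<times> ('k set \<Rightarrow> 'k set)"
where
  "factors r \<beta> k x = (SOME (g, h). g \<in> G_centr r \<beta> \<and> h \<in> K r k \<and> x = g \<otimes>\<^bsub>G r\<^esub> h)"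

definition sigma_even :: "nat \<Rightarrow> 'k \<Rightarrow> ('k \<Rightarrow> complex) \<Rightarrow> ('k set \<Rightarrow> 'k set) \<Rightarrow> complex \<Rightarrow> complex" where
  "sigma_even r \<beta> \<theta> x =
     (let (g, h) = factors r \<beta> (l r) x in (\<lambda>z. theta_mod r \<theta> g * psi r \<beta> h * z))"

definition sigma_odd ::
  "nat \<Rightarrow> 'k \<Rightarrow> ((('k set \<Rightarrow> 'k set) \<Rightarrow> complex) \<Rightarrow> (complex, 'v) module) \<Rightarrow>
   ((('k set \<Rightarrow> 'k set) \<Rightarrow> complex) \<Rightarrow> ('k set \<Rightarrow> 'k set) \<Rightarrow> 'v \<Rightarrow> 'v) \<Rightarrow>
   ((('k set \<Rightarrow> 'k set) \<Rightarrow> complex) \<Rightarrow> ('k set \<Rightarrow> 'k set) \<Rightarrow> 'v \<Rightarrow> 'v) \<Rightarrow>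
   ('k \<Rightarrow> complex) \<Rightarrow> ('k set \<Rightarrow> 'k set) \<Rightarrow> 'v \<Rightarrow> 'v"
where
  "sigma_odd r \<beta> V P U \<theta> x =
     (let \<rho> = rho_of r \<beta> \<theta>; (g, h) = factors r \<beta> (l r - 1) x
      in (\<lambda>v\<in>carrier (V \<rho>). theta_mod r \<theta> g \<odot>\<^bsub>V \<rho>\<^esub> U \<rho> g (P \<rho> h v)))"

definition ind_sigma ::
  "nat \<Rightarrow> 'k \<Rightarrow> ((('k set \<Rightarrow> 'k set) \<Rightarrow> complex) \<Rightarrow> (complex, 'v) module) \<Rightarrow>
   ((('k set \<Rightarrow> 'k set) \<Rightarrow> complex) \<Rightarrow> ('k set \<Rightarrow> 'k set) \<Rightarrow> 'v \<Rightarrow> 'v) \<Rightarrow>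
   ((('k set \<Rightarrow> 'k set) \<Rightarrow> complex) \<Rightarrow> ('k set \<Rightarrow> 'k set) \<Rightarrow> 'v \<Rightarrow> 'v) \<Rightarrow>
   ('k \<Rightarrow> complex) \<Rightarrow> ('k set \<Rightarrow> 'k set) rep_class"
where
  "ind_sigma r \<beta> V P U \<theta> =
     (if even r then
        iso_class (G r)
          (ind_module (G r) (G_stab r \<beta>) (algebra_on id UNIV) (sigma_even r \<beta> \<theta>))
          (ind_rep (G r) (G_stab r \<beta>) (algebra_on id UNIV) (sigma_even r \<beta> \<theta>))
      else
        iso_class (G r)
          (ind_module (G r) (G_stab r \<beta>) (V (rho_of r \<beta> \<theta>)) (sigma_odd r \<beta> V P U \<theta>))
          (ind_rep (G r) (G_stab r \<beta>) (V (rho_of r \<beta> \<theta>)) (sigma_odd r \<beta> V P U \<theta>)))"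

end

end

theory Submission
  imports
    Defs
    "HOL-Computational_Algebra.Fundamental_Theorem_Algebra"
    "HOL-Algebra.Multiplicative_Group"
begin

text \<open>
 Clifford theory: the stabilizer of \<open>\<psi>\<^sub>\<beta>\<close> is \<open>T = C H\<close>, \<open>C = G\<^sub>\<beta>(O\<^sub>r)\<close>, \<open>H = K\<^bsub>l'\<^esub>(O\<^sub>r)\<close>. For odd \<open>r\<close> the commutator pairing on \<open>H\<close> has
 radical \<open>Z = (C \<inter> H) K\<^sub>l(O\<^sub>r)\<close>, because the trace form is nondegenerate on skew endomorphisms; so each extension
 of \<open>\<psi>\<^sub>\<beta>\<close> to \<open>Z\<close> lies in a unique irreducible representation of \<open>H\<close>, and the representations of \<open>T\<close> over \<open>\<psi>\<^sub>\<beta>\<close>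
 are the \<open>\<theta> \<otimes> U P\<close>. For even \<open>r\<close> the same argument applies with \<open>Z = H = K\<^sub>l(O\<^sub>r)\<close>. Lifting from \<open>O\<^sub>r\<close> to \<open>O\<close> uses square roots
 of \<open>1 + a\<close>, available since 2 is a unit.
\<close>

text \<open>Neither complete reducibility nor character theory enters. Intertwiners are written down
  as averages over finite groups, shown to be nonzero, and upgraded to isomorphisms by Schur's
  lemma. The uniqueness over a character of \<open>Z\<close> comes from the linear independence of
  the operators of \<open>H\<close> modulo \<open>Z\<close>. For a given irreducible
  \<open>W\<close>, the abelian group \<open>C\<close> acts on the space of intertwiners from
  \<open>P\<close> to \<open>W\<close>, and a common eigenvector there produces
  \<open>\<theta>\<close>. The arithmetic obstacle is that elements of \<open>G(O\<^sub>r)\<close>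
  come without lifts to similitudes over \<open>O\<close>: they are handled as reductions of
  \<open>O\<close>-linear maps that are similitudes only modulo \<open>\<pi>\<^sup>r\<close>, and
  adjoints for the form repair them where exact skewness is required. The form is unimodular because
  \<open>Tr 1 = n\<close> is a unit. For odd \<open>r\<close> the formula defining
  \<open>psi_Z\<close> is quadratic in \<open>X\<close>; its multiplicativity on \<open>Z\<close> is
  not computed but read off from the given representation that contains it, and the other extensions
  of \<open>\<psi>\<^sub>\<beta>\<close> to \<open>Z\<close> are reached from one of them through
  characters of the residual Lie algebra \<open>g_centr\<close>.\<close>

abbreviation (input) mult_in ("_ *'_{_}/ _" [70,0,71] 70) where "x *_{G} y == x \<otimes>\<^bsub>G\<^esub> y"
abbreviation (input) add_in ("_ +'_{_}/ _" [65,0,66] 65) where "x +_{G} y == x \<oplus>\<^bsub>G\<^esub> y"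
abbreviation (input) smult_in ("_ \<odot>'_{_}/ _" [70,0,71] 70) where "a \<odot>_{V} x == a \<odot>\<^bsub>V\<^esub> x"
abbreviation (input) zero_in ("0'_{_}") where "0_{G} == \<zero>\<^bsub>G\<^esub>"
abbreviation (input) one_in ("1'_{_}") where "1_{G} == \<one>\<^bsub>G\<^esub>"
abbreviation (input) inv_in ("inv'_{_} _" [0,81] 80) where "inv_{G} x == inv\<^bsub>G\<^esub> x"
abbreviation (input) "\<O> == integers"

lemma ring_on_simps [simp]:
 "carrier (ring_on S) = S" "x *_{ring_on S} y = x * y" "1_{ring_on S} = 1"
 "0_{ring_on S} = 0" "x +_{ring_on S} y = x + y"
 by (simp_all add: ring_on_def)

lemma cring_ring_on:
 fixes S :: "'a::comm_ring_1 set"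
 assumes "0 : S" "1 : S" "!!x y. x : S ==> y : S ==> x + y : S"
  "!!x y. x : S ==> y : S ==> x * y : S" "!!x. x : S ==> - x : S"
 shows "cring (ring_on S)"
proof (rule cringI)
 show "abelian_group (ring_on S)"
  using assms by (intro abelian_groupI) (auto simp: algebra_simps intro: exI bexI[of _ "- _"])
 show "comm_monoid (ring_on S)"
  using assms by (intro comm_monoidI) (auto simp: algebra_simps)
qed (auto simp: algebra_simps)

lemma cring_CC: "cring CC"
 by (rule cring_ring_on) auto

section \<open>Complex vector spaces\<close>

locale cvs =
 fixes V :: "(complex, 'v, 'y) module_scheme" (structure)
 assumes module_CC: "module CC V"

sublocale cvs \<subseteq> module CC V
 by (rule module_CC)

text \<open>The law \<open>0 \<odot> x = \<zero>\<close> provides the additive inverses in the form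
  \<open>(- 1) \<odot> x\<close>, so that no negation has to be exhibited for concrete
  spaces.\<close>

lemma cvsI:
 fixes V (structure)
 assumes "!!x y. x : carrier V ==> y : carrier V ==> x \<oplus> y : carrier V"
  and "\<zero> : carrier V"
  and "!!x y z. x : carrier V ==> y : carrier V ==> z : carrier V ==> (x \<oplus> y) \<oplus> z = x \<oplus> (y \<oplus> z)"
  and "!!x y. x : carrier V ==> y : carrier V ==> x \<oplus> y = y \<oplus> x"
  and "!!x. x : carrier V ==> \<zero> \<oplus> x = x"
  and "!!a x. x : carrier V ==> a \<odot> x : carrier V"
  and "!!a b x. x : carrier V ==> (a + b) \<odot> x = a \<odot> x \<oplus> b \<odot> x"
  and "!!a x y. x : carrier V ==> y : carrier V ==> a \<odot> (x \<oplus> y) = a \<odot> x \<oplus> a \<odot> y"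
  and "!!a b x. x : carrier V ==> (a * b) \<odot> x = a \<odot> (b \<odot> x)"
  and "!!x. x : carrier V ==> 1 \<odot> x = x"
  and "!!x. x : carrier V ==> 0 \<odot> x = \<zero>"
 shows "cvs V"
proof (rule cvs.intro)
 show "Module.module CC V"
 proof (rule moduleI)
  show "abelian_group V"
  proof (rule abelian_groupI)
   fix x assume x: "x : carrier V"
   have "(- 1) \<odot> x \<oplus> x = (- 1 + 1) \<odot> x"
    using x assms(7)[of x "- 1" 1] assms(10) by simp
   then show "EX y:carrier V. y \<oplus> x = \<zero>"
    using x assms(6)[of x "-1"] assms(11) by auto
  qed (use assms in auto)
 qed (use assms cring_CC in auto)
qed

context cvs
begin

lemmas smult_simps [simp] = smult_one[simplified] smult_l_null[simplified] smult_r_null[simplified]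
lemmas smult_add_left = smult_l_distr[simplified]
lemmas smult_add_right = smult_r_distr[simplified]
lemmas smult_assoc = smult_assoc1[simplified]

lemma smult_zero_imp:
 assumes "c \<odot> v = \<zero>" "v : carrier V" "c ~= 0"
 shows "v = \<zero>"
proof -
 have "v = (inverse c * c) \<odot> v" using assms by simp
 also have "\<dots> = inverse c \<odot> (c \<odot> v)" using assms smult_assoc1[of "inverse c" c v] by simp
 finally show ?thesis using assms smult_r_null[of "inverse c"] by simp
qed

lemma smult_cancel:
 assumes "c \<odot> v = d \<odot> v" "v : carrier V" "v ~= \<zero>"
 shows "c = d"
proof (rule ccontr)
 assume "c ~= d"
 have "(c - d) \<odot> v = c \<odot> v \<oplus> (- d) \<odot> v"
  using smult_l_distr[of c "- d" v] assms by simp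
 also have "\<dots> = d \<odot> v \<oplus> (- d) \<odot> v" using assms by simp
 also have "\<dots> = \<zero>" using smult_l_distr[of d "- d" v] assms smult_l_null by simp
 finally show False using smult_zero_imp[of "c - d" v] assms \<open>c ~= d\<close> by simp
qed

text \<open>Differences are written with \<open>(- 1) \<odot> y\<close> throughout, because linear
  maps are specified by their behaviour on sums and multiples only.\<close>

lemma add_neg_eq_zero:
 assumes "x : carrier V" "y : carrier V"
 shows "x \<oplus> (- 1) \<odot> y = \<zero> \<longleftrightarrow> x = y"
proof -
 have y: "y \<oplus> (- 1) \<odot> y = \<zero>"
  using smult_l_distr[of 1 "- 1" y] assms smult_l_null by simp
 then have "(- 1) \<odot> y = \<ominus> y" using assms minus_equality[of "(- 1) \<odot> y" y] add.m_comm by simp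
 then show ?thesis using assms r_neg minus_equality[of x "\<ominus> y"] by auto
qed

lemma submodI:
 assumes "W \<subseteq> carrier V" "\<zero> : W" "!!a b. a : W ==> b : W ==> a \<oplus> b : W"
  "!!a x. x : W ==> a \<odot> x : W"
 shows "submodule W CC V"
proof (rule submoduleI)
 fix a assume a: "a : W"
 then have "a \<oplus> (- 1) \<odot> a = \<zero>" using assms(1) add_neg_eq_zero by auto
 then have "\<ominus> a = (- 1) \<odot> a"
  using assms(1) a minus_equality[of "(- 1) \<odot> a" a] add.m_comm[of a "(- 1) \<odot> a"] by auto
 then show "\<ominus> a : W" using assms(4) a by simp
qed (use assms in auto)

lemma submodD:
 assumes "submodule W CC V"
 shows "W \<subseteq> carrier V" "\<zero> : W" "!!a b. a : W ==> b : W ==> a \<oplus> b : W"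
  "!!a x. x : W ==> a \<odot> x : W"
proof -
 interpret submodule W CC V by fact
 show "W \<subseteq> carrier V" "\<zero> : W" "!!a b. a : W ==> b : W ==> a \<oplus> b : W"
  "!!a x. x : W ==> a \<odot> x : W"
  using subset one_closed m_closed smult_closed by auto
qed

end

lemma linear_mapsD:
 assumes "f : linear_maps R M N"
 shows "!!x. x : carrier M ==> f x : carrier N"
  "!!x y. x : carrier M ==> y : carrier M ==> f (x +_{M} y) = f x +_{N} f y"
  "!!a x. a : carrier R ==> x : carrier M ==> f (a \<odot>_{M} x) = a \<odot>_{N} f x"
 using assms by (auto simp: linear_maps_def)

lemma linear_mapsI:
 assumes "!!x. x : carrier M ==> f x : carrier N"
  "!!x y. x : carrier M ==> y : carrier M ==> f (x +_{M} y) = f x +_{N} f y"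
  "!!a x. a : carrier R ==> x : carrier M ==> f (a \<odot>_{M} x) = a \<odot>_{N} f x"
 shows "f : linear_maps R M N"
 using assms by (auto simp: linear_maps_def)

lemma linear_maps_zero:
 assumes "cvs V" "cvs W" "f : linear_maps CC V W"
 shows "f 0_{V} = 0_{W}"
proof -
 interpret V: cvs V by fact
 interpret W: cvs W by fact
 have "f (0 \<odot>_{V} 0_{V}) = 0 \<odot>_{W} f 0_{V}"
  using linear_mapsD(3)[OF assms(3), of 0 "0_{V}"] by simp
 then show ?thesis
  using V.smult_l_null W.smult_l_null linear_mapsD(1)[OF assms(3), of "0_{V}"] by simp
qed

lemma linear_maps_finsum:
 assumes "cvs V" "cvs W" "f : linear_maps CC V W" "finite A" "g : A \<rightarrow> carrier V"
 shows "f (finsum V g A) = finsum W (%a. f (g a)) A"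
 using assms(4,5)
proof (induction A rule: finite_induct)
 interpret V: cvs V by fact
 interpret W: cvs W by fact
 case empty
 then show ?case using linear_maps_zero assms by simp
next
 interpret V: cvs V by fact
 interpret W: cvs W by fact
 case (insert x F)
 have "f (finsum V g (insert x F)) = f (g x +_{V} finsum V g F)"
  using insert by (subst V.finsum_insert) auto
 also have "\<dots> = f (g x) +_{W} f (finsum V g F)"
  using insert linear_mapsD(2)[OF assms(3)] V.finsum_closed by auto
 also have "\<dots> = finsum W (%a. f (g a)) (insert x F)"
  using insert linear_mapsD(1)[OF assms(3)] by (subst W.finsum_insert) auto
 finally show ?case .
qed

section \<open>Eigenvectors\<close>

locale cvs_endo = cvs V for V :: "(complex, 'v, 'y) module_scheme" (structure) +
 fixes A :: "'v => 'v"
 assumes A_lin: "A : linear_maps CC V V"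
begin

lemma A_closed [simp]: "v : carrier V ==> A v : carrier V"
 and A_add: "v : carrier V ==> w : carrier V ==> A (v \<oplus> w) = A v \<oplus> A w"
 and A_smult: "v : carrier V ==> A (c \<odot> v) = c \<odot> A v"
 using linear_mapsD[OF A_lin] by auto

lemma A_zero [simp]: "A \<zero> = \<zero>"
 by (rule linear_maps_zero[OF _ _ A_lin]) (unfold_locales)

text \<open>The vector \<open>p(A) v\<close>, evaluated by Horner's rule; vectors outside the
  carrier go to zero.\<close>

definition pact :: "complex poly => 'v => 'v" where
 "pact p = fold_coeffs (%a f v. if v : carrier V then a \<odot> v \<oplus> A (f v) else \<zero>) p (%_. \<zero>)"

lemma pact_0 [simp]: "pact 0 v = \<zero>"
 by (simp add: pact_def)

lemma pact_pCons:
 assumes "v : carrier V"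
 shows "pact (pCons a p) v = a \<odot> v \<oplus> A (pact p v)"
 using assms smult_l_null by (cases "p = 0 & a = 0") (auto simp: pact_def)

lemma pact_closed [simp]: "v : carrier V ==> pact p v : carrier V"
 by (induction p) (simp_all add: pact_pCons)

lemma pact_add:
 assumes "v : carrier V"
 shows "pact (p + q) v = pact p v \<oplus> pact q v"
proof (induction p q rule: poly_induct2)
 case (pCons a p b q)
 then show ?case using assms
  by (simp add: pact_pCons smult_add_left A_add a_ac)
qed simp

lemma pact_smult:
 assumes "v : carrier V"
 shows "pact (Polynomial.smult c p) v = c \<odot> pact p v"
 using assms
proof (induction p)
 case 0
 then show ?case using smult_r_null by simp
next
 case (pCons a p)
 then show ?case using smult_assoc1[of c a v]
  by (simp add: pact_pCons smult_r_distr A_smult)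
qed

lemma pact_monom:
 assumes "v : carrier V"
 shows "pact (Polynomial.monom c k) v = c \<odot> (A ^^ k) v" "(A ^^ k) v : carrier V"
proof -
 show cl: "(A ^^ k) v : carrier V" for k using assms by (induction k) auto
 show "pact (Polynomial.monom c k) v = c \<odot> (A ^^ k) v"
 proof (induction k)
  case 0
  then show ?case using assms by (simp add: monom_0 pact_pCons)
 next
  case (Suc k)
  then show ?case using assms smult_l_null cl
   by (simp add: monom_Suc pact_pCons A_smult)
 qed
qed

lemma pact_linear_factor:
 assumes "v : carrier V"
 shows "pact ([:- c, 1:] * q) v = A (pact q v) \<oplus> (- c) \<odot> pact q v"
proof -
 have "[:- c, 1:] * q = pCons 0 q + Polynomial.smult (- c) q" by simp
 then show ?thesis using assms smult_l_null
  by (simp only: pact_add pact_smult pact_pCons) simp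
qed

text \<open>Split off a root: if \<open>p = (X - c) q\<close>, then either \<open>q\<close> already
  annihilates \<open>v\<close>, or \<open>q(A) v\<close> is an eigenvector for \<open>c\<close>; it
  lies in \<open>W\<close> because \<open>W\<close> is stable. Annihilation of a single vector takes
  the place of finite dimension.\<close>

lemma eigenvector:
 assumes "submodule W CC V" "A ` W \<subseteq> W" "v : W" "v ~= \<zero>" "p ~= 0" "pact p v = \<zero>"
 shows "EX w:W. w ~= \<zero> & (EX c. A w = c \<odot> w)"
 using assms(5,6)
proof (induction "degree p" arbitrary: p rule: less_induct)
 case less
 have v: "v : carrier V" using assms submodD(1) by auto
 have pactW: "pact q v : W" for q
 proof (induction q)
  case 0
  then show ?case using submodD(2)[OF assms(1)] by simp
 next
  case (pCons a q)
  then show ?case using submodD(3,4)[OF assms(1)] assms(2,3) v by (auto simp: pact_pCons)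
 qed
 show ?case
 proof (cases "degree p = 0")
  case True
  then obtain a where p: "p = [:a:]" by (metis degree_eq_zeroE)
  with less have "a \<odot> v = \<zero>" using v by (simp add: pact_pCons)
  then show ?thesis using smult_zero_imp v assms(4) less(2) p by auto
 next
  case False
  then have "\<not> constant (poly p)" by (simp add: constant_degree)
  then obtain c where "poly p c = 0" using fundamental_theorem_of_algebra by blast
  then obtain q where p: "p = [:- c, 1:] * q" by (metis poly_eq_0_iff_dvd dvdE)
  then have q: "q ~= 0" using less(2) by auto
  then have d: "degree p = Suc (degree q)"
   unfolding p by (subst degree_mult_eq) auto
  show ?thesis
  proof (cases "pact q v = \<zero>")
   case True
   then show ?thesis using less(1)[of q] d q by auto
  next
   case False
   have e: "A (pact q v) \<oplus> (- c) \<odot> pact q v = \<zero>"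
    using less(3) pact_linear_factor[OF v, of c q] p by metis
   have "(- c) \<odot> pact q v = (- 1) \<odot> (c \<odot> pact q v)"
    using smult_assoc1[of "- 1" c "pact q v"] v by simp
   with e have "A (pact q v) = c \<odot> pact q v"
    using add_neg_eq_zero[of "A (pact q v)" "c \<odot> pact q v"] v by simp
   with False pactW show ?thesis by blast
  qed
 qed
qed

lemma pact_finite_order:
 assumes "v : carrier V" "(A ^^ N) v = v"
 shows "pact (Polynomial.monom 1 N - 1) v = \<zero>"
proof -
 have "pact (Polynomial.monom 1 N + Polynomial.monom (- 1) 0) v = v \<oplus> (- 1) \<odot> v"
  using assms pact_monom(1)[OF assms(1)] by (simp add: pact_add)
 also have "Polynomial.monom 1 N + Polynomial.monom (- 1) 0 = Polynomial.monom 1 N - (1 :: complex poly)"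
  by (simp add: monom_0 one_pCons)
 finally show ?thesis using add_neg_eq_zero assms by simp
qed

end

text \<open>Elimination with a pivot unknown \<open>j\<close> removes one equation and one unknown
  at a time; \<open>c'\<close> gives \<open>j\<close> the value that the removed equation
  \<open>i\<close> dictates.\<close>

lemma homogeneous_system_solution:
 fixes a :: "'k => 'i => complex"
 assumes "finite I" "finite K" "card I < card K"
 shows "EX c. (EX k:K. c k ~= 0) & (ALL i:I. (SUM k:K. c k * a k i) = 0)"
 using assms
proof (induction I arbitrary: K a rule: finite_induct)
 case empty
 then have "K ~= {}" by force
 then show ?case by (intro exI[of _ "%_. 1"]) auto
next
 case (insert i I)
 show ?case
 proof (cases "ALL k:K. a k i = 0")
  case True
  obtain c where "EX k:K. c k ~= 0" "ALL i:I. (SUM k:K. c k * a k i) = 0"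
   using insert.IH[OF insert.prems(1), of a] insert.prems(2) insert.hyps by (auto dest: Suc_lessD)
  then show ?thesis using True by (intro exI[of _ c]) auto
 next
  case False
  then obtain j where j: "j : K" "a j i ~= 0" by auto
  define b where "b k i' = a k i' - a k i / a j i * a j i'" for k i'
  have "card I < card (K - {j})" using insert j by simp
  then obtain c where c: "EX k:K - {j}. c k ~= 0" "ALL i:I. (SUM k:K - {j}. c k * b k i) = 0"
   using insert.IH[of "K - {j}" b] insert.prems by auto
  define c' where "c' = c(j := - (SUM k:K - {j}. c k * a k i / a j i))"
  have "(SUM k:K. c' k * a k i') = (SUM k:K - {j}. c k * b k i')" for i'
  proof -
   have "(SUM k:K. c' k * a k i') = c' j * a j i' + (SUM k:K - {j}. c' k * a k i')"
    using j insert.prems by (simp add: sum.remove)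
   also have "(SUM k:K - {j}. c' k * a k i') = (SUM k:K - {j}. c k * a k i')"
    by (intro sum.cong) (auto simp: c'_def)
   also have "c' j * a j i' = (SUM k:K - {j}. - (c k * a k i / a j i * a j i'))"
    by (simp add: c'_def sum_distrib_right sum_negf)
   finally show ?thesis
    by (simp add: b_def sum.distrib[symmetric] algebra_simps)
  qed
  moreover have "b k i = 0" for k using j by (simp add: b_def)
  ultimately have "ALL i':insert i I. (SUM k:K. c' k * a k i') = 0" using c by simp
  moreover have "EX k:K. c' k ~= 0" using c(1) by (auto simp: c'_def)
  ultimately show ?thesis by blast
 qed
qed

section \<open>Spanning sets and simultaneous eigenvectors\<close>

context cvs
begin

definition spans :: "'v set => bool" where
 "spans S \<longleftrightarrow> finite S & S \<subseteq> carrier V & (ALL v:carrier V. EX c. v = (\<Oplus>s\<in>S. c s \<odot> s))"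

lemma comb_add:
 assumes "S \<subseteq> carrier V"
 shows "(\<Oplus>s\<in>S. c s \<odot> s) \<oplus> (\<Oplus>s\<in>S. d s \<odot> s) = (\<Oplus>s\<in>S. (c s + d s) \<odot> s)"
proof -
 have "(\<Oplus>s\<in>S. (c s + d s) \<odot> s) = (\<Oplus>s\<in>S. c s \<odot> s \<oplus> d s \<odot> s)"
  using assms by (intro finsum_cong') (auto simp: smult_l_distr[simplified])
 also have "\<dots> = (\<Oplus>s\<in>S. c s \<odot> s) \<oplus> (\<Oplus>s\<in>S. d s \<odot> s)"
  using assms by (intro finsum_addf) auto
 finally show ?thesis by simp
qed

lemma comb_smult:
 assumes "S \<subseteq> carrier V" "finite S"
 shows "a \<odot> (\<Oplus>s\<in>S. c s \<odot> s) = (\<Oplus>s\<in>S. (a * c s) \<odot> s)"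
proof -
 have "a \<odot> (\<Oplus>s\<in>S. c s \<odot> s) = (\<Oplus>s\<in>S. a \<odot> (c s \<odot> s))"
  using assms by (intro finsum_smult_ldistr) auto
 also have "\<dots> = (\<Oplus>s\<in>S. (a * c s) \<odot> s)"
  using assms by (intro finsum_cong') (auto simp: smult_assoc1[simplified] subset_iff)
 finally show ?thesis .
qed

lemma comb_zero:
 assumes "S \<subseteq> carrier V" "!!s. s : S ==> c s = 0"
 shows "(\<Oplus>s\<in>S. c s \<odot> s) = \<zero>"
proof -
 have "(\<Oplus>s\<in>S. c s \<odot> s) = (\<Oplus>s\<in>S. \<zero>)"
  using assms smult_l_null by (intro finsum_cong') auto
 then show ?thesis by simp
qed

lemma comb_closed [simp]: "S \<subseteq> carrier V ==> (\<Oplus>s\<in>S. c s \<odot> s) : carrier V"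
 by (intro finsum_closed) auto

text \<open>The \<open>card S + 1\<close> vectors \<open>v, A v, A^2 v, ...\<close> are described by
  \<open>card S\<close> coordinates each, hence satisfy a linear relation; its coefficients are
  those of \<open>p\<close>.\<close>

lemma spans_imp_annihilated:
 assumes "spans S" "cvs_endo V A" "v : carrier V"
 shows "EX p~=0. cvs_endo.pact V A p v = \<zero>"
proof -
 interpret A: cvs_endo V A by fact
 have S: "S \<subseteq> carrier V" "finite S" using assms(1) by (auto simp: spans_def)
 have "EX c. (A ^^ k) v = (\<Oplus>s\<in>S. c s \<odot> s)" for k
  using assms(1,3) A.pact_monom(2) by (auto simp: spans_def)
 then obtain a where a: "(A ^^ k) v = (\<Oplus>s\<in>S. a k s \<odot> s)" for k by metis
 obtain c where c: "EX k:{..card S}. c k ~= 0" "ALL s:S. (SUM k:{..card S}. c k * a k s) = 0"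
  using homogeneous_system_solution[of S "{..card S}" a] S by auto
 define p where "p K = (SUM k:K. Polynomial.monom (c k) k)" for K
 have "A.pact (p K) v = (\<Oplus>s\<in>S. (SUM k:K. c k * a k s) \<odot> s)" if "finite K" for K
  using that
 proof (induction K rule: finite_induct)
  case empty
  then show ?case using comb_zero[OF S(1)] by (simp add: p_def)
 next
  case (insert k K)
  have "A.pact (p (insert k K)) v = A.pact (Polynomial.monom (c k) k) v \<oplus> A.pact (p K) v"
   using insert assms(3) by (simp add: p_def A.pact_add)
  also have "A.pact (Polynomial.monom (c k) k) v = (\<Oplus>s\<in>S. (c k * a k s) \<odot> s)"
   using A.pact_monom assms(3) a comb_smult[OF S] by simp
  finally show ?case using insert comb_add[OF S(1)] by simp
 qed
 then have "A.pact (p {..card S}) v = \<zero>" using c(2) comb_zero[OF S(1)] by simp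
 moreover have "p {..card S} ~= 0"
 proof
  assume z: "p {..card S} = 0"
  have "poly.coeff (p {..card S}) j = c j" if "j <= card S" for j
   using that by (simp add: p_def coeff_sum sum.delta)
  then show False using c(1) z by auto
 qed
 ultimately show ?thesis by blast
qed

text \<open>An eigenspace of one operator is stable under those commuting with it, so eigenspaces
  can be cut down one operator after another. Commutation is required on \<open>W\<close> only,
  since in the application the elements of \<open>Z\<close> commute only up to factors that act
  trivially on \<open>W\<close>.\<close>

lemma common_eigenvector:
 fixes \<rho> :: "'a => 'v => 'v"
 assumes "finite X" "submodule W CC V" "W ~= {\<zero>}"
  and lin: "!!a. a : X ==> \<rho> a : linear_maps CC V V"
  and stab: "!!a. a : X ==> \<rho> a ` W \<subseteq> W"
  and comm: "!!a b v. a : X ==> b : X ==> v : W ==> \<rho> a (\<rho> b v) = \<rho> b (\<rho> a v)"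
  and ann: "!!a v. a : X ==> v : W ==> EX p~=0. cvs_endo.pact V (\<rho> a) p v = \<zero>"
 shows "EX w:W. w ~= \<zero> & (ALL a:X. EX c. \<rho> a w = c \<odot> w)"
proof -
 \<comment> \<open>Induction over the set \<open>Y\<close> of operators already made scalar on
   \<open>W'\<close>; stability under all of \<open>X\<close> has to be carried along.\<close>
 have "\<exists>W'\<subseteq>W. submodule W' CC V & W' ~= {\<zero>} & (ALL a:X. \<rho> a ` W' \<subseteq> W') &
   (ALL a:Y. EX c. ALL w:W'. \<rho> a w = c \<odot> w)" if "finite Y" "Y \<subseteq> X" for Y
  using that
 proof (induction Y rule: finite_induct)
  case empty
  then show ?case using assms(2,3) stab by (intro exI[of _ W]) simp
 next
  case (insert a Y)
  then obtain W' where W': "W' \<subseteq> W" "submodule W' CC V" "W' ~= {\<zero>}"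
   "ALL a:X. \<rho> a ` W' \<subseteq> W'" "ALL a:Y. EX c. ALL w:W'. \<rho> a w = c \<odot> w" by auto
  have a: "a : X" using insert by auto
  interpret A: cvs_endo V "\<rho> a" by unfold_locales (use lin a in auto)
  obtain v where v: "v : W'" "v ~= \<zero>" using W'(3) submodD(2)[OF W'(2)] by blast
  have "v : W" using v W'(1) by blast
  from ann[OF a this] obtain p where "p ~= 0" "A.pact p v = \<zero>" by blast
  then obtain w c where w: "w : W'" "w ~= \<zero>" "\<rho> a w = c \<odot> w"
   using A.eigenvector[OF W'(2) _ v] W'(4) a by blast
  define W'' where "W'' = {w\<in>W'. \<rho> a w = c \<odot> w}"
  have sub: "W' \<subseteq> carrier V" using submodD(1)[OF W'(2)] .
  have "submodule W'' CC V"
  proof (rule submodI)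
   fix x y assume "x : W''" "y : W''"
   then show "x \<oplus> y : W''" using submodD(3)[OF W'(2)] sub
    by (simp add: W''_def A.A_add smult_add_right subset_iff)
  next
   fix d x assume "x : W''"
   then have x: "x : W'" "\<rho> a x = c \<odot> x" by (auto simp: W''_def)
   then have xc: "x : carrier V" using sub by auto
   have "\<rho> a (d \<odot> x) = (d * c) \<odot> x" using xc x by (simp add: A.A_smult smult_assoc)
   also have "\<dots> = c \<odot> (d \<odot> x)" using smult_assoc[OF xc, of c d] by (simp add: mult.commute)
   finally show "d \<odot> x : W''" using submodD(4)[OF W'(2)] x by (simp add: W''_def)
  qed (use submodD(2)[OF W'(2)] sub smult_r_null in \<open>auto simp: W''_def\<close>)
  moreover have "\<rho> b ` W'' \<subseteq> W''" if b: "b : X" for b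
  proof
   fix y assume "y : \<rho> b ` W''"
   then obtain x where x: "x : W'" "\<rho> a x = c \<odot> x" "y = \<rho> b x" by (auto simp: W''_def)
   then have "\<rho> a y = c \<odot> y" using comm[OF a b, of x] W'(1) sub
     linear_mapsD(3)[OF lin[OF b], of c x] by (auto simp: subset_iff)
   then show "y : W''" using x W'(4) b by (auto simp: W''_def)
  qed
  moreover have "W'' ~= {\<zero>}" using w by (auto simp: W''_def)
  moreover have "EX c. ALL w:W''. \<rho> e w = c \<odot> w" if e: "e : insert a Y" for e
  proof (cases "e = a")
   case False
   then obtain d where "ALL w:W'. \<rho> e w = d \<odot> w" using W'(5) e by auto
   then show ?thesis by (auto simp: W''_def)
  qed (auto simp: W''_def)
  moreover have "W'' \<subseteq> W" using W'(1) by (auto simp: W''_def)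
  ultimately show ?case by blast
 qed
 from this[OF assms(1) subset_refl] obtain W' where W': "W' \<subseteq> W" "submodule W' CC V" "W' ~= {\<zero>}"
  "ALL a:X. EX c. ALL w:W'. \<rho> a w = c \<odot> w" by blast
 then obtain v where v: "v : W'" "v ~= \<zero>" using submodD(2)[OF W'(2)] by blast
 then have "ALL a:X. EX c. \<rho> a v = c \<odot> v" using W'(4) by fast
 then show ?thesis using v W'(1) by blast
qed

text \<open>The relation is solved for \<open>j\<close> and the result substituted into every
  expansion.\<close>

lemma spans_remove:
 assumes "spans S" "j : S" "(\<Oplus>s\<in>S. x s \<odot> s) = \<zero>" "x j ~= 0"
 shows "spans (S - {j})"
proof -
 have S: "S \<subseteq> carrier V" "finite S" using assms(1) by (auto simp: spans_def)
 have j: "j : carrier V" using S assms by auto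
 have S': "S - {j} \<subseteq> carrier V" "finite (S - {j})" using S by auto
 have split: "(\<Oplus>s\<in>S. c s \<odot> s) = c j \<odot> j \<oplus> (\<Oplus>s\<in>S - {j}. c s \<odot> s)" for c
 proof -
  have "(\<Oplus>s\<in>insert j (S - {j}). c s \<odot> s) = c j \<odot> j \<oplus> (\<Oplus>s\<in>S - {j}. c s \<odot> s)"
   using S assms(2) by (intro finsum_insert) auto
  then show ?thesis using assms(2) by (simp add: insert_absorb)
 qed
 have "EX d. v = (\<Oplus>s\<in>S - {j}. d s \<odot> s)" if v: "v : carrier V" for v
 proof -
  obtain c where c: "v = (\<Oplus>s\<in>S. c s \<odot> s)" using assms(1) v by (auto simp: spans_def)
  have "v \<oplus> (- (c j / x j)) \<odot> \<zero> = v" using v smult_r_null by simp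
  then have "v = (\<Oplus>s\<in>S. (c s + - (c j / x j) * x s) \<odot> s)"
   using comb_add[OF S(1), of c "%s. - (c j / x j) * x s"] comb_smult[OF S, of "- (c j / x j)" x]
   by (simp add: c assms(3))
  also have "\<dots> = (\<Oplus>s\<in>S - {j}. (c s + - (c j / x j) * x s) \<odot> s)"
   using split[of "%s. c s + - (c j / x j) * x s"] assms(4) smult_l_null[OF j]
    comb_closed[OF S'(1)] by simp
  finally show ?thesis by (rule exI[of _ "%s. c s + - (c j / x j) * x s"])
 qed
 then show ?thesis using S' by (auto simp: spans_def)
qed

end

lemma cvs_module_vec: "cvs (module_vec TYPE(complex) d)"
proof (rule cvsI, unfold module_vec_simps)
 fix x y :: "complex vec"
 assume "x : carrier_vec d" "y : carrier_vec d"
 then show "x + y = y + x" by (rule comm_add_vec)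
qed (auto simp: add_smult_distrib_vec smult_add_distrib_vec smult_smult_assoc)

text \<open>A spanning set of least size admits no nontrivial relation, since
  \<open>spans_remove\<close> would shrink it; its coordinates therefore identify \<open>V\<close>
  with a coordinate space, as the encoding of isomorphism classes demands.\<close>

lemma (in cvs) spans_imp_coordinates:
 assumes "spans S0"
 shows "EX d T. T : linear_maps CC (module_vec TYPE(complex) d) V &
   bij_betw T (carrier_vec d) (carrier V)"
proof -
 obtain S where S: "spans S" and min: "!!S'. spans S' ==> card S <= card S'"
  using ex_has_least_nat[of spans S0 card] assms by auto
 have S': "S \<subseteq> carrier V" "finite S" using S by (auto simp: spans_def)
 obtain h where h: "bij_betw h S {0..<card S}" using ex_bij_betw_finite_nat[OF S'(2)] by auto
 then have hS: "h s < card S" if "s : S" for s using that by (auto simp: bij_betw_def)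
 define T where "T x = (\<Oplus>s\<in>S. (x $ h s) \<odot> s)" for x
 interpret D: cvs "module_vec TYPE(complex) (card S)" by (rule cvs_module_vec)
 have lin: "T : linear_maps CC (module_vec TYPE(complex) (card S)) V"
 proof (rule linear_mapsI)
  fix x y :: "complex vec"
  assume x: "x : carrier (module_vec TYPE(complex) (card S))" "y : carrier (module_vec TYPE(complex) (card S))"
  have "T (x + y) = (\<Oplus>s\<in>S. (x $ h s + y $ h s) \<odot> s)"
   unfolding T_def using x hS S'(1) by (intro finsum_cong') (auto simp: module_vec_simps)
  then show "T (x +_{module_vec TYPE(complex) (card S)} y) = T x \<oplus> T y"
   using comb_add[OF S'(1), of "%s. x $ h s" "%s. y $ h s"] by (simp add: module_vec_simps T_def)
 next
  fix a and x :: "complex vec"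
  assume x: "x : carrier (module_vec TYPE(complex) (card S))"
  have "T (a \<cdot>\<^sub>v x) = (\<Oplus>s\<in>S. (a * x $ h s) \<odot> s)"
   unfolding T_def using x hS S'(1) by (intro finsum_cong') (auto simp: module_vec_simps)
  then show "T (a \<odot>_{module_vec TYPE(complex) (card S)} x) = a \<odot> T x"
   using comb_smult[OF S', of a "%s. x $ h s"] by (simp add: module_vec_simps T_def)
 qed (use S' in \<open>auto simp: T_def\<close>)
 have inj0: "x = 0\<^sub>v (card S)" if x: "x : carrier_vec (card S)" "T x = \<zero>" for x
 proof (rule ccontr)
  assume "x ~= 0\<^sub>v (card S)"
  then obtain i where i: "i < card S" "x $ i ~= 0"
   using x(1) eq_vecI[of "0\<^sub>v (card S)" x] by auto
  then have "i : h ` S" using h by (simp add: bij_betw_def)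
  then obtain j where j: "j : S" "h j = i" by blast
  then have "spans (S - {j})"
   using spans_remove[OF S, of j "%s. x $ h s"] x(2) i by (auto simp: T_def)
  then have "card S <= card (S - {j})" by (rule min)
  then show False using card_Diff1_less[OF S'(2) j(1)] by simp
 qed
 have "inj_on T (carrier_vec (card S))"
 proof (rule inj_onI)
  fix x y assume xy: "x : carrier_vec (card S)" "y : carrier_vec (card S)" "T x = T y"
  have "T (x + (- 1) \<cdot>\<^sub>v y) = T x \<oplus> (- 1) \<odot> T y"
   using linear_mapsD(2,3)[OF lin] xy by (simp add: module_vec_simps)
  also have "\<dots> = \<zero>" using add_neg_eq_zero[of "T x" "T y"] xy S' by (simp add: T_def)
  finally have "x + (- 1) \<cdot>\<^sub>v y = 0\<^sub>v (card S)" using inj0 xy by simp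
  then show "x = y" using D.add_neg_eq_zero[of x y] xy by (simp add: module_vec_simps)
 qed
 moreover have "T ` carrier_vec (card S) = carrier V"
 proof
  show "T ` carrier_vec (card S) \<subseteq> carrier V" using S' by (auto simp: T_def)
  show "carrier V \<subseteq> T ` carrier_vec (card S)"
  proof
   fix v assume "v : carrier V"
   then obtain c where c: "v = (\<Oplus>s\<in>S. c s \<odot> s)" using S by (auto simp: spans_def)
   define x where "x = vec (card S) (%i. c (inv_into S h i))"
   have "T x = v" unfolding T_def c using hS h S'
    by (intro finsum_cong') (auto simp: x_def bij_betw_inv_into_left)
   then show "v : T ` carrier_vec (card S)" by (auto simp: x_def)
  qed
 qed
 ultimately have "bij_betw T (carrier_vec (card S)) (carrier V)" by (simp add: bij_betw_def)
 with lin show ?thesis by blast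
qed

section \<open>Representations of finite groups\<close>

lemma GL_simps:
 "carrier (GL R M) = linear_maps R M M \<inter> Bij (carrier M)"
 "1_{GL R M} = (\<lambda>x\<in>carrier M. x)"
 "f : carrier (GL R M) ==> g : carrier (GL R M) ==> f *_{GL R M} g = compose (carrier M) f g"
 by (auto simp: GL_def BijGroup_def)

locale rep = Gp?: group G + cvs V for G :: "('g, 'x) monoid_scheme" and V :: "(complex, 'v, 'y) module_scheme" +
 fixes \<rho> :: "'g => 'v => 'v"
 assumes hom_GL: "\<rho> : hom G (GL CC V)"
begin

lemma group_rep: "group_rep G V \<rho>"
 using hom_GL module_CC by (simp add: group_rep_def)

lemma in_GL: "g : carrier G ==> \<rho> g : carrier (GL CC V)"
 using hom_GL by (auto simp: hom_def)

lemma lin: "g : carrier G ==> \<rho> g : linear_maps CC V V"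
 and ext: "g : carrier G ==> \<rho> g : extensional (carrier V)"
 using in_GL by (auto simp: GL_simps Bij_def)

lemma closed [simp]: "g : carrier G ==> v : carrier V ==> \<rho> g v : carrier V"
 and add: "g : carrier G ==> v : carrier V ==> w : carrier V ==> \<rho> g (v +_{V} w) = \<rho> g v +_{V} \<rho> g w"
 and smul: "g : carrier G ==> v : carrier V ==> \<rho> g (c \<odot>_{V} v) = c \<odot>_{V} \<rho> g v"
 using linear_mapsD[OF lin] by auto

lemma mult:
 assumes "g : carrier G" "h : carrier G" "v : carrier V"
 shows "\<rho> (g *_{G} h) v = \<rho> g (\<rho> h v)"
proof -
 have "\<rho> (g *_{G} h) = compose (carrier V) (\<rho> g) (\<rho> h)"
  using hom_mult[OF hom_GL assms(1,2)] in_GL assms by (simp add: GL_simps(3))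
 then show ?thesis using assms by (simp add: compose_def)
qed

text \<open>Multiplicativity makes the image of the unit idempotent; being onto, it is the
  identity.\<close>

lemma rep_one [simp]:
 assumes v: "v : carrier V"
 shows "\<rho> 1_{G} v = v"
proof -
 have "bij_betw (\<rho> 1_{G}) (carrier V) (carrier V)"
  using in_GL[of "1_{G}"] by (auto simp: GL_simps Bij_def)
 then obtain w where "w : carrier V" "v = \<rho> 1_{G} w"
  using v unfolding bij_betw_def by (metis imageE)
 then show ?thesis using mult[of "1_{G}" "1_{G}" w] by simp
qed

lemma rep_inv [simp]:
 assumes "g : carrier G" "v : carrier V"
 shows "\<rho> (inv_{G} g) (\<rho> g v) = v" "\<rho> g (\<rho> (inv_{G} g) v) = v"
 using mult[of "inv_{G} g" g v] mult[of g "inv_{G} g" v] assms by auto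

lemma rep_zero [simp]: "g : carrier G ==> \<rho> g 0_{V} = 0_{V}"
 using linear_maps_zero[OF _ _ lin] cvs_axioms by auto

lemma rep_eq_0: "g : carrier G ==> v : carrier V ==> \<rho> g v = 0_{V} \<longleftrightarrow> v = 0_{V}"
 by (metis rep_inv(1) rep_zero Gp.inv_closed)

lemma pow:
 assumes "g : carrier G" "v : carrier V"
 shows "(\<rho> g ^^ k) v = \<rho> (g [^]\<^bsub>G\<^esub> k) v"
proof (induction k)
 case (Suc k)
 have "\<rho> (g [^]\<^bsub>G\<^esub> Suc k) v = \<rho> (g *_{G} g [^]\<^bsub>G\<^esub> k) v"
  using Gp.nat_pow_Suc2[OF assms(1), of k] by presburger
 also have "\<dots> = \<rho> g (\<rho> (g [^]\<^bsub>G\<^esub> k) v)" using mult[OF assms(1) Gp.nat_pow_closed[OF assms(1)] assms(2)] .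
 finally show ?case by (simp only: Suc[symmetric] funpow.simps o_apply)
qed (use assms in simp)

text \<open>\<open>g\<close> has finite order, so \<open>X^N - 1\<close> with \<open>N\<close> the
  group order serves. This also covers spaces not known to be finite-dimensional, such as spaces of
  intertwiners.\<close>

lemma annihilated:
 assumes "finite (carrier G)" "g : carrier G" "v : carrier V"
 shows "EX p~=0. cvs_endo.pact V (\<rho> g) p v = 0_{V}"
proof -
 interpret A: cvs_endo V "\<rho> g" by unfold_locales (rule lin[OF assms(2)])
 have "(\<rho> g ^^ Coset.order G) v = v" using pow[OF assms(2,3)] Gp.pow_order_eq_1[OF assms(2)] assms(3) by simp
 then have "A.pact (Polynomial.monom 1 (Coset.order G) - 1) v = 0_{V}" by (rule A.pact_finite_order[OF assms(3)])
 moreover have "Polynomial.monom 1 (Coset.order G) - 1 ~= (0 :: complex poly)"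
 proof
  assume "Polynomial.monom 1 (Coset.order G) - 1 = (0 :: complex poly)"
  then have "degree (Polynomial.monom 1 (Coset.order G) :: complex poly) = degree (1 :: complex poly)" by simp
  then show False using assms(1) Gp.one_closed by (auto simp: degree_monom_eq Coset.order_def)
 qed
 ultimately show ?thesis by blast
qed

lemma submodule_stable_eq:
 assumes "W \<subseteq> carrier V" "ALL g:carrier G. \<rho> g ` W \<subseteq> W" "g : carrier G"
 shows "\<rho> g ` W = W"
proof
 show "W \<subseteq> \<rho> g ` W"
 proof
  fix w assume w: "w : W"
  then have "\<rho> (inv_{G} g) w : W" "\<rho> g (\<rho> (inv_{G} g) w) = w" using assms by auto
  then show "w : \<rho> g ` W" by (metis imageI)
 qed
qed (use assms in auto)

lemma restrict_subgroup:
 assumes "subgroup H G"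
 shows "rep (G(|carrier := H|)) V \<rho>"
proof -
 interpret H: group "G(|carrier := H|)" using Gp.subgroup_imp_group[OF assms] .
 have "H \<subseteq> carrier G" using subgroup.subset[OF assms] .
 then show ?thesis
  using hom_GL by unfold_locales (auto simp: hom_def)
qed

end

lemma rep_from_group_rep: "group G ==> group_rep G V \<rho> ==> rep G V \<rho>"
 by (simp add: group_rep_def rep_def rep_axioms_def cvs_def)

lemma irreducible_imp_rep: "group G ==> irreducible_rep G V \<rho> ==> rep G V \<rho>"
 by (simp add: irreducible_rep_def rep_from_group_rep)

lemma repI:
 assumes "group G" "cvs V"
  and lin: "!!g. g : carrier G ==> \<rho> g : linear_maps CC V V"
  and ext: "!!g. g : carrier G ==> \<rho> g : extensional (carrier V)"
  and one: "!!v. v : carrier V ==> \<rho> 1_{G} v = v"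
  and mult: "!!g h v. g : carrier G ==> h : carrier G ==> v : carrier V ==> \<rho> (g *_{G} h) v = \<rho> g (\<rho> h v)"
 shows "rep G V \<rho>"
proof -
 interpret group G by fact
 interpret cvs V by fact
 have GL: "\<rho> g : carrier (GL CC V)" if g: "g : carrier G" for g
 proof -
  have i: "\<rho> (inv_{G} g) (\<rho> g v) = v" "\<rho> g (\<rho> (inv_{G} g) v) = v" if "v : carrier V" for v
   using mult[of "inv_{G} g" g v] mult[of g "inv_{G} g" v] one that g by auto
  have "bij_betw (\<rho> g) (carrier V) (carrier V)"
   by (rule bij_betwI[of _ _ _ "\<rho> (inv_{G} g)"]) (use i linear_mapsD(1)[OF lin] g in auto)
  then show ?thesis using lin ext g by (auto simp: GL_simps Bij_def)
 qed
 have "\<rho> (g *_{G} h) = compose (carrier V) (\<rho> g) (\<rho> h)" if "g : carrier G" "h : carrier G" for g h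
  by (rule extensionalityI[of _ "carrier V"]) (use that mult ext in \<open>auto simp: compose_def\<close>)
 then have "\<rho> : hom G (GL CC V)" using GL by (intro homI) (auto simp: GL_simps(3))
 then show ?thesis by unfold_locales
qed

section \<open>Intertwiners and Schur's lemma\<close>

definition intertwiner ::
 "('g, 'x) monoid_scheme => (complex, 'v, 'y) module_scheme => ('g => 'v => 'v) =>
  (complex, 'w, 'z) module_scheme => ('g => 'w => 'w) => ('v => 'w) => bool"
where
 "intertwiner G V \<rho> W \<sigma> T \<longleftrightarrow>
   T : linear_maps CC V W & (ALL g:carrier G. ALL v:carrier V. T (\<rho> g v) = \<sigma> g (T v))"

lemma linear_maps_inj_on:
 assumes "cvs V" "cvs W" "T : linear_maps CC V W"
  and "!!v. v : carrier V ==> T v = 0_{W} ==> v = 0_{V}"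
 shows "inj_on T (carrier V)"
proof (rule inj_onI)
 interpret V: cvs V by fact
 interpret W: cvs W by fact
 fix x y assume xy: "x : carrier V" "y : carrier V" "T x = T y"
 have "T (x +_{V} (- 1) \<odot>_{V} y) = T x +_{W} (- 1) \<odot>_{W} T y"
  using linear_mapsD(2,3)[OF assms(3)] xy by simp
 also have "\<dots> = 0_{W}" using W.add_neg_eq_zero[of "T x" "T y"] xy linear_mapsD(1)[OF assms(3)] by simp
 finally show "x = y" using assms(4) V.add_neg_eq_zero[of x y] xy by simp
qed

lemma schur_inj:
 assumes "group G" "irreducible_rep G V \<rho>" "group_rep G W \<sigma>" "intertwiner G V \<rho> W \<sigma> T"
  and "v0 : carrier V" "T v0 ~= 0_{W}"
 shows "inj_on T (carrier V)"
proof -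
 interpret V: rep G V \<rho> using assms by (auto simp: irreducible_rep_def intro: rep_from_group_rep)
 interpret W: rep G W \<sigma> using assms by (auto intro: rep_from_group_rep)
 have lin: "T : linear_maps CC V W" and int: "!!g v. g : carrier G ==> v : carrier V ==> T (\<rho> g v) = \<sigma> g (T v)"
  using assms(4) by (auto simp: intertwiner_def)
 have T0: "T 0_{V} = 0_{W}" by (rule linear_maps_zero[OF V.cvs_axioms W.cvs_axioms lin])
 let ?N = "{v\<in>carrier V. T v = 0_{W}}"
 have "submodule ?N CC V"
  by (rule V.submodI) (use linear_mapsD[OF lin] T0 in auto)
 moreover have "ALL g:carrier G. \<rho> g ` ?N \<subseteq> ?N" using int by auto
 ultimately have "?N = {0_{V}} \<or> ?N = carrier V" using assms(2) unfolding irreducible_rep_def by blast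
 then have "?N = {0_{V}}" using assms(5,6) by auto
 then show ?thesis by (intro linear_maps_inj_on[OF V.cvs_axioms W.cvs_axioms lin]) auto
qed

lemma schur_surj:
 assumes "group G" "group_rep G V \<rho>" "irreducible_rep G W \<sigma>" "intertwiner G V \<rho> W \<sigma> T"
  and "v0 : carrier V" "T v0 ~= 0_{W}"
 shows "T ` carrier V = carrier W"
proof -
 interpret V: rep G V \<rho> using assms by (auto intro: rep_from_group_rep)
 interpret W: rep G W \<sigma> using assms by (auto simp: irreducible_rep_def intro: rep_from_group_rep)
 have lin: "T : linear_maps CC V W" and int: "!!g v. g : carrier G ==> v : carrier V ==> T (\<rho> g v) = \<sigma> g (T v)"
  using assms(4) by (auto simp: intertwiner_def)
 have T0: "T 0_{V} = 0_{W}" by (rule linear_maps_zero[OF V.cvs_axioms W.cvs_axioms lin])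
 have "submodule (T ` carrier V) CC W"
 proof (rule W.submodI)
  show "0_{W} : T ` carrier V" using T0 by (metis V.zero_closed imageI)
 next
  fix a b assume "a : T ` carrier V" "b : T ` carrier V"
  then show "a +_{W} b : T ` carrier V"
   using linear_mapsD(2)[OF lin] by (auto simp: image_iff) (metis V.M.add.m_closed)
 next
  fix c a assume "a : T ` carrier V"
  then obtain x where "x : carrier V" "a = T x" by auto
  then have "c \<odot>_{W} a = T (c \<odot>_{V} x)" "c \<odot>_{V} x : carrier V" using linear_mapsD(3)[OF lin] by auto
  then show "c \<odot>_{W} a : T ` carrier V" by blast
 qed (use linear_mapsD(1)[OF lin] in auto)
 moreover have "\<sigma> g ` T ` carrier V \<subseteq> T ` carrier V" if "g : carrier G" for g
 proof
  fix y assume "y : \<sigma> g ` T ` carrier V"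
  then obtain v where "v : carrier V" "y = \<sigma> g (T v)" by auto
  then have "y = T (\<rho> g v)" "\<rho> g v : carrier V" using int that by auto
  then show "y : T ` carrier V" by blast
 qed
 ultimately have "T ` carrier V = {0_{W}} \<or> T ` carrier V = carrier W"
  using assms(3) unfolding irreducible_rep_def by blast
 then show ?thesis using assms(5,6) by auto
qed

lemma schur_iso:
 assumes "group G" "irreducible_rep G V \<rho>" "irreducible_rep G W \<sigma>" "intertwiner G V \<rho> W \<sigma> T"
  and "v0 : carrier V" "T v0 ~= 0_{W}"
 shows "rep_iso G V \<rho> W \<sigma>"
proof -
 have "inj_on T (carrier V)" "T ` carrier V = carrier W"
  using schur_inj[OF assms(1,2) _ assms(4-)] schur_surj[OF assms(1) _ assms(3-)] assms(2,3)
  by (auto simp: irreducible_rep_def)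
 then show ?thesis using assms(4) by (auto simp: rep_iso_def intertwiner_def bij_betw_def)
qed

lemma rep_iso_sym:
 assumes "group G" "group_rep G V \<rho>" "group_rep G W \<sigma>" "rep_iso G V \<rho> W \<sigma>"
 shows "rep_iso G W \<sigma> V \<rho>"
proof -
 interpret V: rep G V \<rho> using assms by (auto intro: rep_from_group_rep)
 interpret W: rep G W \<sigma> using assms by (auto intro: rep_from_group_rep)
 obtain T where lin: "T : linear_maps CC V W" and bij: "bij_betw T (carrier V) (carrier W)"
  and int: "!!g v. g : carrier G ==> v : carrier V ==> T (\<rho> g v) = \<sigma> g (T v)"
  using assms(4) by (auto simp: rep_iso_def)
 let ?I = "inv_into (carrier V) T"
 have bij': "bij_betw ?I (carrier W) (carrier V)" using bij by (rule bij_betw_inv_into)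
 have cl: "?I w : carrier V" if "w : carrier W" for w using bij' that by (auto simp: bij_betw_def)
 have TI: "T (?I w) = w" if "w : carrier W" for w using bij that by (simp add: bij_betw_inv_into_right)
 have IT: "?I (T v) = v" if "v : carrier V" for v using bij that by (simp add: bij_betw_inv_into_left)
 have "?I : linear_maps CC W V"
 proof (rule linear_mapsI)
  fix x y assume xy: "x : carrier W" "y : carrier W"
  then have "x +_{W} y = T (?I x +_{V} ?I y)" using linear_mapsD(2)[OF lin] cl TI by simp
  then show "?I (x +_{W} y) = ?I x +_{V} ?I y" using IT cl xy by simp
 next
  fix a x assume x: "x : carrier W"
  then have "a \<odot>_{W} x = T (a \<odot>_{V} ?I x)" using linear_mapsD(3)[OF lin] cl TI by simp
  then show "?I (a \<odot>_{W} x) = a \<odot>_{V} ?I x" using IT cl x by simp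
 qed (use cl in auto)
 moreover have "?I (\<sigma> g w) = \<rho> g (?I w)" if "g : carrier G" "w : carrier W" for g w
 proof -
  have "\<sigma> g w = T (\<rho> g (?I w))" using int cl TI that by simp
  then show ?thesis using IT cl that by simp
 qed
 ultimately show ?thesis using bij' by (auto simp: rep_iso_def)
qed

lemma rep_iso_trans:
 assumes "rep_iso G V \<rho> W \<sigma>" "rep_iso G W \<sigma> X \<pi>"
 shows "rep_iso G V \<rho> X \<pi>"
proof -
 obtain T where T: "T : linear_maps CC V W" "bij_betw T (carrier V) (carrier W)"
  "!!g v. g : carrier G ==> v : carrier V ==> T (\<rho> g v) = \<sigma> g (T v)"
  using assms(1) by (auto simp: rep_iso_def)
 obtain S where S: "S : linear_maps CC W X" "bij_betw S (carrier W) (carrier X)"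
  "!!g v. g : carrier G ==> v : carrier W ==> S (\<sigma> g v) = \<pi> g (S v)"
  using assms(2) by (auto simp: rep_iso_def)
 have "S \<circ> T : linear_maps CC V X"
  using linear_mapsD[OF T(1)] linear_mapsD[OF S(1)] by (intro linear_mapsI) auto
 moreover have "bij_betw (S \<circ> T) (carrier V) (carrier X)" using bij_betw_trans T(2) S(2) by blast
 ultimately show ?thesis using T(3) S(3) linear_mapsD(1)[OF T(1)] by (auto simp: rep_iso_def)
qed

section \<open>Isomorphism classes and coordinate models\<close>

lemma iso_class_eqI:
 assumes "group G" "group_rep G V \<rho>" "group_rep G W \<sigma>" "rep_iso G V \<rho> W \<sigma>"
 shows "iso_class G V \<rho> = iso_class G W \<sigma>"
 using rep_iso_trans[OF assms(4)] rep_iso_trans[OF rep_iso_sym[OF assms]]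
 by (auto simp: iso_class_def)

text \<open>The model \<open>\<pi>\<close> on a coordinate space guarantees that the classes are not
  empty; equality of two empty classes would say nothing.\<close>

lemma iso_class_eqD:
 assumes "group G" "group_rep G V \<rho>" "group_rep G W \<sigma>" "iso_class G V \<rho> = iso_class G W \<sigma>"
  and "group_rep G (module_vec TYPE(complex) d) \<pi>" "rep_iso G W \<sigma> (module_vec TYPE(complex) d) \<pi>"
 shows "rep_iso G V \<rho> W \<sigma>"
proof -
 have "(d, \<pi>) : iso_class G V \<rho>" using assms by (auto simp: iso_class_def)
 then have "rep_iso G V \<rho> (module_vec TYPE(complex) d) \<pi>" by (simp add: iso_class_def)
 then show ?thesis using rep_iso_trans rep_iso_sym[OF assms(1,3,5,6)] by blast
qed

lemma irreducible_rep_iso: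
 assumes "group G" "group_rep G V \<rho>" "irreducible_rep G W \<sigma>" "rep_iso G V \<rho> W \<sigma>"
 shows "irreducible_rep G V \<rho>"
proof -
 interpret V: rep G V \<rho> using assms by (auto intro: rep_from_group_rep)
 interpret W: rep G W \<sigma> using assms by (auto simp: irreducible_rep_def intro: rep_from_group_rep)
 obtain T where lin: "T : linear_maps CC V W" and bij: "bij_betw T (carrier V) (carrier W)"
  and int: "!!g v. g : carrier G ==> v : carrier V ==> T (\<rho> g v) = \<sigma> g (T v)"
  using assms(4) by (auto simp: rep_iso_def)
 have T0: "T 0_{V} = 0_{W}" by (rule linear_maps_zero[OF V.cvs_axioms W.cvs_axioms lin])
 have inj: "inj_on T (carrier V)" and surj: "T ` carrier V = carrier W" using bij by (auto simp: bij_betw_def)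
 show ?thesis unfolding irreducible_rep_def
 proof (intro conjI allI impI)
  show "carrier V ~= {0_{V}}"
   using assms(3) surj T0 by (auto simp: irreducible_rep_def)
  fix Y assume Y: "submodule Y CC V & (ALL g:carrier G. \<rho> g ` Y \<subseteq> Y)"
  note sub = V.submodD[OF conjunct1[OF Y]]
  have "submodule (T ` Y) CC W"
  proof (rule W.submodI)
   show "0_{W} : T ` Y" using T0 sub(2) by (metis imageI)
  next
   fix a b assume "a : T ` Y" "b : T ` Y"
   then obtain x y where "x : Y" "y : Y" "a = T x" "b = T y" by auto
   then have "a +_{W} b = T (x +_{V} y)" "x +_{V} y : Y"
    using linear_mapsD(2)[OF lin, of x y] sub by (auto simp: subset_iff)
   then show "a +_{W} b : T ` Y" by blast
  next
   fix c a assume "a : T ` Y"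
   then obtain x where "x : Y" "a = T x" by auto
   then have "c \<odot>_{W} a = T (c \<odot>_{V} x)" "c \<odot>_{V} x : Y"
    using linear_mapsD(3)[OF lin, of c x] sub by (auto simp: subset_iff)
   then show "c \<odot>_{W} a : T ` Y" by blast
  qed (use linear_mapsD(1)[OF lin] sub in auto)
  moreover have "\<sigma> g ` T ` Y \<subseteq> T ` Y" if "g : carrier G" for g
  proof
   fix y assume "y : \<sigma> g ` T ` Y"
   then obtain v where v: "v : Y" "y = \<sigma> g (T v)" by auto
   then have "y = T (\<rho> g v)" using int[OF that] sub(1) by auto
   moreover have "\<rho> g v : Y" using Y that v(1) by blast
   ultimately show "y : T ` Y" by blast
  qed
  ultimately have "T ` Y = {0_{W}} \<or> T ` Y = carrier W"
   using assms(3) unfolding irreducible_rep_def by blast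
  then show "Y = {0_{V}} \<or> Y = carrier V"
  proof
   assume "T ` Y = {0_{W}}"
   then have "T ` Y = T ` {0_{V}}" using T0 by simp
   then show ?thesis using inj_on_image_eq_iff[OF inj, of Y "{0_{V}}"] sub(1) by auto
  next
   assume "T ` Y = carrier W"
   then show ?thesis using inj_on_image_eq_iff[OF inj sub(1), of "carrier V"] surj by auto
  qed
 qed (rule assms(2))
qed

text \<open>The orbit of a nonzero vector is finite and permuted by the group, so its span is a
  nonzero invariant subspace and hence everything.\<close>

lemma irreducible_spans:
 assumes "group G" "finite (carrier G)" "irreducible_rep G V \<rho>"
 shows "EX S. cvs.spans V S"
proof -
 interpret V: rep G V \<rho> using assms by (auto simp: irreducible_rep_def intro: rep_from_group_rep)
 obtain v where v: "v : carrier V" "v ~= 0_{V}"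
  using assms(3) V.zero_closed by (auto simp: irreducible_rep_def)
 define S where "S = (%g. \<rho> g v) ` carrier G"
 have S: "S \<subseteq> carrier V" "finite S" using v assms(2) by (auto simp: S_def)
 define W where "W = {(\<Oplus>\<^bsub>V\<^esub>s\<in>S. c s \<odot>_{V} s) | c. True}"
 have "submodule W CC V"
 proof (rule V.submodI)
  show "W \<subseteq> carrier V" using V.comb_closed[OF S(1)] by (auto simp: W_def)
  show "0_{V} : W" using V.comb_zero[OF S(1), of "%_. 0"] by (auto simp: W_def intro!: exI[of _ "%_. 0"])
 qed (auto simp: W_def V.comb_add[OF S(1)] V.comb_smult[OF S])
 moreover have "\<rho> g ` W \<subseteq> W" if g: "g : carrier G" for g
 proof
  fix y assume "y : \<rho> g ` W"
  then obtain c where y: "y = \<rho> g (\<Oplus>\<^bsub>V\<^esub>s\<in>S. c s \<odot>_{V} s)" by (auto simp: W_def)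
  have stS: "\<rho> h s : S" if h: "h : carrier G" and s: "s : S" for h s
  proof -
   obtain k where "k : carrier G" "s = \<rho> k v" using s by (auto simp: S_def)
   then have "\<rho> h s = \<rho> (h *_{G} k) v" "h *_{G} k : carrier G" using V.mult h v by auto
   then show ?thesis by (auto simp: S_def)
  qed
  have img: "\<rho> g ` S = S" using V.submodule_stable_eq[OF S(1) _ g] stS by blast
  have inj: "inj_on (\<rho> g) S"
   by (rule inj_on_inverseI[of _ "\<rho> (inv_{G} g)"]) (use S(1) g in auto)
  \<comment> \<open>\<open>\<rho> g\<close> permutes the orbit \<open>S\<close>, so the image of a
    combination is the combination with the permuted coefficients \<open>d\<close>.\<close>
  define d where "d s = c (\<rho> (inv_{G} g) s)" for s
  have "y = (\<Oplus>\<^bsub>V\<^esub>s\<in>S. \<rho> g (c s \<odot>_{V} s))"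
   unfolding y using S by (intro linear_maps_finsum[OF V.cvs_axioms V.cvs_axioms V.lin[OF g]]) auto
  also have "\<dots> = (\<Oplus>\<^bsub>V\<^esub>s\<in>S. d (\<rho> g s) \<odot>_{V} \<rho> g s)"
   using S g by (intro V.finsum_cong') (auto simp: V.smul d_def subset_iff)
  also have "\<dots> = (\<Oplus>\<^bsub>V\<^esub>s\<in>\<rho> g ` S. d s \<odot>_{V} s)"
   using S g by (intro V.finsum_reindex[symmetric] inj) auto
  finally show "y : W" unfolding img by (auto simp: W_def)
 qed
 moreover have "v : W"
 proof -
  have vS: "v : S" unfolding S_def using V.rep_one[OF v(1)] by (metis V.Gp.one_closed imageI)
  have "(\<Oplus>\<^bsub>V\<^esub>s\<in>S. (if v = s then s else 0_{V})) = v"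
   using vS S by (intro V.finsum_singleton) auto
  moreover have "(\<Oplus>\<^bsub>V\<^esub>s\<in>S. (if v = s then 1 else 0) \<odot>_{V} s) = (\<Oplus>\<^bsub>V\<^esub>s\<in>S. (if v = s then s else 0_{V}))"
   using S by (intro V.finsum_cong') auto
  ultimately show ?thesis unfolding W_def by (auto intro!: exI[of _ "%s. if v = s then 1 else 0"])
 qed
 ultimately have "W = carrier V" using assms(3) v unfolding irreducible_rep_def by blast
 then have "V.spans S" using S by (auto simp: V.spans_def W_def)
 then show ?thesis by blast
qed

text \<open>Transport of structure along coordinates. It shows that irreducible representations on
  arbitrary spaces, such as induced modules, have nonempty classes.\<close>

lemma irreducible_coordinates:
 assumes "group G" "finite (carrier G)" "irreducible_rep G V \<rho>"
 shows "EX d \<pi>. irreducible_rep G (module_vec TYPE(complex) d) \<pi> &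
  rep_iso G V \<rho> (module_vec TYPE(complex) d) \<pi>"
proof -
 interpret V: rep G V \<rho> using assms by (auto simp: irreducible_rep_def intro: rep_from_group_rep)
 obtain d T where lin: "T : linear_maps CC (module_vec TYPE(complex) d) V"
  and bij: "bij_betw T (carrier_vec d) (carrier V)"
  using irreducible_spans[OF assms] V.spans_imp_coordinates by blast
 let ?D = "module_vec TYPE(complex) d"
 interpret D: cvs ?D by (rule cvs_module_vec)
 have car: "carrier ?D = carrier_vec d" by (simp add: module_vec_simps)
 let ?I = "inv_into (carrier_vec d) T"
 define \<pi> where "\<pi> g = (\<lambda>x\<in>carrier_vec d. ?I (\<rho> g (T x)))" for g
 have Tcl: "T x : carrier V" if "x : carrier_vec d" for x using bij that by (auto simp: bij_betw_def)
 have Icl: "?I w : carrier_vec d" if "w : carrier V" for w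
  using bij_betw_inv_into[OF bij] that by (auto simp: bij_betw_def)
 have TI: "T (?I w) = w" if "w : carrier V" for w using bij that by (simp add: bij_betw_inv_into_right)
 have IT: "?I (T v) = v" if "v : carrier_vec d" for v using bij that by (simp add: bij_betw_inv_into_left)
 have Tpi: "T (\<pi> g x) = \<rho> g (T x)" "\<pi> g x : carrier_vec d" if "g : carrier G" "x : carrier_vec d" for g x
  using that Tcl TI Icl by (auto simp: \<pi>_def)
 have eqT: "x = y" if "T x = T y" "x : carrier_vec d" "y : carrier_vec d" for x y
  using that bij by (auto simp: bij_betw_def inj_on_def)
 have "rep G ?D \<pi>"
 proof (rule repI)
  fix g assume g: "g : carrier G"
  show "\<pi> g : linear_maps CC ?D ?D"
  proof (rule linear_mapsI)
   fix x y assume xy: "x : carrier ?D" "y : carrier ?D"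
   have "T (\<pi> g (x +_{?D} y)) = T (\<pi> g x +_{?D} \<pi> g y)"
    using xy g Tpi Tcl D.M.add.m_closed[OF xy] linear_mapsD(2)[OF lin] V.add by (simp add: car)
   then show "\<pi> g (x +_{?D} y) = \<pi> g x +_{?D} \<pi> g y"
    using eqT xy g Tpi(2) D.M.add.m_closed by (metis car)
  next
   fix a x assume x: "x : carrier ?D"
   have ax: "a \<odot>_{?D} x : carrier ?D" using x by simp
   have "T (\<pi> g (a \<odot>_{?D} x)) = T (a \<odot>_{?D} \<pi> g x)"
    using x ax g Tpi Tcl linear_mapsD(3)[OF lin] V.smul by (simp add: car)
   moreover have "a \<odot>_{?D} \<pi> g x : carrier ?D"
    using x g Tpi(2) by (intro D.smult_closed) (simp_all add: car)
   ultimately show "\<pi> g (a \<odot>_{?D} x) = a \<odot>_{?D} \<pi> g x"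
    using eqT ax g Tpi(2) by (simp add: car)
  qed (use Tpi g in \<open>auto simp: car\<close>)
  show "\<pi> g : extensional (carrier ?D)" by (simp add: \<pi>_def car)
 next
  fix v assume "v : carrier ?D"
  then show "\<pi> 1_{G} v = v" using IT Tcl by (simp add: \<pi>_def car)
 next
  fix g h v assume gh: "g : carrier G" "h : carrier G" "v : carrier ?D"
  then have "T (\<pi> (g *_{G} h) v) = T (\<pi> g (\<pi> h v))" using Tpi Tcl V.mult by (simp add: car)
  then show "\<pi> (g *_{G} h) v = \<pi> g (\<pi> h v)" using eqT gh Tpi(2) by (simp add: car)
 qed unfold_locales
 then have r: "group_rep G ?D \<pi>" by (rule rep.group_rep)
 have iso: "rep_iso G ?D \<pi> V \<rho>"
  unfolding rep_iso_def using lin bij Tpi by (intro bexI[of _ T]) (auto simp: car)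
 show ?thesis
  using irreducible_rep_iso[OF assms(1) r assms(3) iso] rep_iso_sym[OF assms(1) r V.group_rep iso] by blast
qed

text \<open>Finite dimension gives \<open>A\<close> an eigenvector, and the eigenspace is invariant
  because \<open>A\<close> commutes with the group.\<close>

lemma schur_scalar:
 assumes "group G" "finite (carrier G)" "irreducible_rep G V \<rho>" "intertwiner G V \<rho> V \<rho> A"
 shows "EX c. ALL v:carrier V. A v = c \<odot>_{V} v"
proof -
 interpret V: rep G V \<rho> by (rule irreducible_imp_rep[OF assms(1,3)])
 have "A : linear_maps CC V V" using assms(4) by (simp add: intertwiner_def)
 then interpret A: cvs_endo V A by (intro cvs_endo.intro cvs_endo_axioms.intro V.cvs_axioms)
 have "carrier V ~= {0_{V}}" using assms(3) by (simp add: irreducible_rep_def)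
 then obtain v where v: "v : carrier V" "v ~= 0_{V}" using V.zero_closed by blast
 obtain S where "V.spans S" using irreducible_spans[OF assms(1-3)] by blast
 from V.spans_imp_annihilated[OF this A.cvs_endo_axioms v(1)]
 obtain p where "p ~= 0" "A.pact p v = 0_{V}" by blast
 then obtain w c where w: "w : carrier V" "w ~= 0_{V}" "A w = c \<odot>_{V} w"
  using A.eigenvector[OF V.carrier_is_submodule _ v] A.A_closed by (metis image_subsetI)
 let ?E = "{v\<in>carrier V. A v = c \<odot>_{V} v}"
 have "submodule ?E CC V"
 proof (rule V.submodI)
  fix a x assume x: "x : ?E"
  then have "a \<odot>_{V} (c \<odot>_{V} x) = c \<odot>_{V} (a \<odot>_{V} x)"
   by (simp add: V.smult_assoc[symmetric] mult.commute)
  then show "a \<odot>_{V} x : ?E" using x by (simp add: A.A_smult)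
 qed (auto simp: A.A_add V.smult_add_right)
 moreover have "ALL g:carrier G. \<rho> g ` ?E \<subseteq> ?E"
  using assms(4) by (auto simp: intertwiner_def V.smul)
 ultimately have "?E = {0_{V}} \<or> ?E = carrier V" using assms(3) unfolding irreducible_rep_def by blast
 then have "?E = carrier V" using w by auto
 then show ?thesis by blast
qed

section \<open>Uniqueness of Heisenberg representations\<close>

lemma (in cvs) finsum_const_smult:
 assumes "finite A" "w : carrier V"
 shows "(\<Oplus>a\<in>A. w) = of_nat (card A) \<odot> w"
 using assms
proof (induction A rule: finite_induct)
 case (insert x F)
 then have "(\<Oplus>a\<in>insert x F. w) = w \<oplus> of_nat (card F) \<odot> w"
  by (subst finsum_insert) auto
 also have "\<dots> = (1 + of_nat (card F)) \<odot> w" using insert by (simp add: smult_add_left)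
 finally show ?case using insert by simp
qed simp

lemma (in cvs) finsum_submodule_closed:
 assumes "submodule W CC V" "finite A" "!!a. a : A ==> f a : W"
 shows "(\<Oplus>a\<in>A. f a) : W"
 using assms(2,3)
proof (induction A rule: finite_induct)
 case (insert x F)
 then have "(\<Oplus>a\<in>insert x F. f a) = f x \<oplus> (\<Oplus>a\<in>F. f a)"
  using submodD(1)[OF assms(1)] by (intro finsum_insert) auto
 then show ?case using insert submodD(3)[OF assms(1)] by simp
qed (use submodD(2)[OF assms(1)] in simp)

context rep
begin

lemma finsum_translate_left:
 assumes "k : carrier G" "F : carrier G \<rightarrow> carrier V"
 shows "(\<Oplus>\<^bsub>V\<^esub>h\<in>carrier G. F (k *_{G} h)) = (\<Oplus>\<^bsub>V\<^esub>h\<in>carrier G. F h)"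
proof -
 have "(%h. k *_{G} h) ` carrier G = carrier G"
  using Gp.surj_const_mult[OF assms(1)] by simp
 moreover have "inj_on (%h. k *_{G} h) (carrier G)" using Gp.inj_on_multc Gp.inj_on_cmult[OF assms(1)] by simp
 ultimately show ?thesis using finsum_reindex[of F "%h. k *_{G} h" "carrier G"] assms by simp
qed

lemma finsum_translate_right:
 assumes "k : carrier G" "F : carrier G \<rightarrow> carrier V"
 shows "(\<Oplus>\<^bsub>V\<^esub>h\<in>carrier G. F (h *_{G} k)) = (\<Oplus>\<^bsub>V\<^esub>h\<in>carrier G. F h)"
proof -
 have inj: "inj_on (%h. h *_{G} k) (carrier G)" using Gp.inj_on_multc[OF assms(1)] by simp
 have "(%h. h *_{G} k) ` carrier G = carrier G"
 proof
  show "carrier G \<subseteq> (%h. h *_{G} k) ` carrier G"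
  proof
   fix x assume "x : carrier G"
   then have "x = (x *_{G} inv_{G} k) *_{G} k" "x *_{G} inv_{G} k : carrier G"
    using assms(1) by (auto simp: Gp.m_assoc)
   then show "x : (%h. h *_{G} k) ` carrier G" by blast
  qed
 qed (use assms(1) in auto)
 then show ?thesis using finsum_reindex[of F "%h. h *_{G} k" "carrier G"] assms inj by simp
qed

text \<open>A shortest-relation argument in the manner of Dedekind. Relations are functions
  \<open>f\<close> on \<open>G\<close>, equivariant under \<open>Z\<close>, for which the sum of the
  \<open>f h \<odot> \<rho> h y\<close> vanishes on \<open>Y\<close>. If \<open>x\<close> outside
  \<open>Z\<close> lies in the support, conjugation by a suitable \<open>y\<close> changes the
  coefficient at \<open>x\<close> and fixes the one at the unit, so the difference is a shorter
  relation. A relation supported in \<open>Z\<close> would act as the scalar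
  \<open>card Z * f 1\<close>, which is not zero.\<close>

lemma independent_modulo_character:
 fixes \<chi> :: "'g => complex" and f :: "'g => complex"
 assumes fin: "finite (carrier G)"
  and Z: "subgroup Z G"
  and Y: "submodule Y CC V" "Y ~= {0_{V}}" "!!g. g : carrier G ==> \<rho> g ` Y \<subseteq> Y"
  and scal: "!!z y. z : Z ==> y : Y ==> \<rho> z y = \<chi> z \<odot>_{V} y"
  and comm: "!!x y. x : carrier G ==> y : carrier G ==> inv_{G} y *_{G} x *_{G} y *_{G} inv_{G} x : Z"
  and nondeg: "!!x. x : carrier G ==> x \<notin> Z ==>
   EX y:carrier G. \<chi> (inv_{G} y *_{G} x *_{G} y *_{G} inv_{G} x) ~= 1"
  and equi: "!!z h. z : Z ==> h : carrier G ==> \<chi> z * f (z *_{G} h) = f h"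
  and null: "!!y. y : Y ==> (\<Oplus>\<^bsub>V\<^esub>h\<in>carrier G. f h \<odot>_{V} \<rho> h y) = 0_{V}"
  and h0: "h0 : carrier G"
 shows "f h0 = 0"
proof (rule ccontr)
 assume f0: "f h0 ~= 0"
 have YV: "Y \<subseteq> carrier V" using submodD(1)[OF Y(1)] .
 have ZG: "Z \<subseteq> carrier G" using subgroup.subset[OF Z] .
 define E where "E f \<longleftrightarrow> (ALL z:Z. ALL h:carrier G. \<chi> z * f (z *_{G} h) = f h) &
  (ALL y:Y. (\<Oplus>\<^bsub>V\<^esub>h\<in>carrier G. f h \<odot>_{V} \<rho> h y) = 0_{V})" for f
 define supp where "supp f = {h\<in>carrier G. f h ~= 0}" for f :: "'g => complex"
 \<comment> \<open>Right translation moves any point of the support to the unit, where relations are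
   then compared.\<close>
 have tr: "EX f'. E f' & f' 1_{G} ~= 0 & card (supp f') <= card (supp f)"
  if f: "E f" and a: "a : carrier G" "f a ~= 0" for f a
 proof (intro exI[of _ "%h. f (h *_{G} a)"] conjI)
  show "f (1_{G} *_{G} a) ~= 0" using a by simp
  have "supp (%h. f (h *_{G} a)) \<subseteq> (%h. h *_{G} inv_{G} a) ` supp f"
  proof
   fix h assume "h : supp (%h. f (h *_{G} a))"
   then have "h = (h *_{G} a) *_{G} inv_{G} a" "h *_{G} a : supp f"
    using a by (auto simp: supp_def Gp.m_assoc)
   then show "h : (%h. h *_{G} inv_{G} a) ` supp f" by blast
  qed
  moreover have "finite (supp f)" using fin by (simp add: supp_def)
  ultimately show "card (supp (%h. f (h *_{G} a))) <= card (supp f)"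
   by (meson card_image_le card_mono finite_imageI order_trans)
  show "E (%h. f (h *_{G} a))"
   unfolding E_def
  proof (intro conjI ballI)
   fix z h assume "z : Z" "h : carrier G"
   then show "\<chi> z * f (z *_{G} h *_{G} a) = f (h *_{G} a)"
    using f a ZG by (auto simp: E_def Gp.m_assoc subset_iff)
  next
   fix y assume y: "y : Y"
   define y' where "y' = \<rho> (inv_{G} a) y"
   have y': "y' : Y" using Y(3)[of "inv_{G} a"] a y by (auto simp: y'_def)
   have "\<rho> h y = \<rho> (h *_{G} a) y'" if "h : carrier G" for h
    using that a y YV by (auto simp: y'_def mult)
   then have "(\<Oplus>\<^bsub>V\<^esub>h\<in>carrier G. f (h *_{G} a) \<odot>_{V} \<rho> h y) =
     (\<Oplus>\<^bsub>V\<^esub>h\<in>carrier G. f (h *_{G} a) \<odot>_{V} \<rho> (h *_{G} a) y')"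
    using y' YV a by (intro finsum_cong') auto
   also have "\<dots> = (\<Oplus>\<^bsub>V\<^esub>h\<in>carrier G. f h \<odot>_{V} \<rho> h y')"
    using y' YV a by (intro finsum_translate_right[where F = "%h. f h \<odot>_{V} \<rho> h y'"]) auto
   also have "\<dots> = 0_{V}" using f y' by (simp add: E_def)
   finally show "(\<Oplus>\<^bsub>V\<^esub>h\<in>carrier G. f (h *_{G} a) \<odot>_{V} \<rho> h y) = 0_{V}" .
  qed
 qed
 have "E f" using equi null by (simp add: E_def)
 from tr[OF this h0 f0] have "EX f. E f & f 1_{G} ~= 0" by blast
 then obtain f where f: "E f" "f 1_{G} ~= 0"
  and min: "!!f'. E f' ==> f' 1_{G} ~= 0 ==> card (supp f) <= card (supp f')"
  using ex_has_least_nat[of "%f. E f & f 1_{G} ~= 0" _ "%f. card (supp f)"] by blast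
 show False
 proof (cases "supp f \<subseteq> Z")
  case True
  obtain y where y: "y : Y" "y ~= 0_{V}" using Y(2) submodD(2)[OF Y(1)] by blast
  have yV: "y : carrier V" using y YV by auto
  have finZ: "finite Z" using fin ZG finite_subset by blast
  have "(\<Oplus>\<^bsub>V\<^esub>h\<in>carrier G. f h \<odot>_{V} \<rho> h y) = (\<Oplus>\<^bsub>V\<^esub>h\<in>Z. f 1_{G} \<odot>_{V} y)"
  proof (rule add.finprod_mono_neutral_cong_right[OF fin ZG])
   fix i assume i: "i : carrier G - Z"
   then have "f i = 0" using True by (auto simp: supp_def)
   then show "f i \<odot>_{V} \<rho> i y = 0_{V}" using i yV by simp
  next
   fix z assume z: "z : Z"
   then have "f z \<odot>_{V} \<rho> z y = (f z * \<chi> z) \<odot>_{V} y" using scal y yV by (simp add: smult_assoc)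
   also have "f z * \<chi> z = f 1_{G}" using f(1) z ZG by (force simp: E_def mult.commute)
   finally show "f z \<odot>_{V} \<rho> z y = f 1_{G} \<odot>_{V} y" .
  qed (use yV in auto)
  also have "\<dots> = of_nat (card Z) \<odot>_{V} (f 1_{G} \<odot>_{V} y)" using finZ yV by (simp add: finsum_const_smult)
  also have "\<dots> = (of_nat (card Z) * f 1_{G}) \<odot>_{V} y" using yV by (simp add: smult_assoc)
  finally have "(of_nat (card Z) * f 1_{G}) \<odot>_{V} y = 0_{V}" using f(1) y by (simp add: E_def)
  moreover have "card Z ~= 0" using finZ subgroup.one_closed[OF Z] by auto
  then have "of_nat (card Z) * f 1_{G} ~= 0" using f(2) by simp
  ultimately show False using smult_zero_imp[OF _ yV, of "of_nat (card Z) * f 1_{G}"] y(2) by metis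
 next
  case False
  then obtain x where x: "x : carrier G" "f x ~= 0" "x \<notin> Z" by (auto simp: supp_def)
  then obtain y where y: "y : carrier G" and chi: "\<chi> (inv_{G} y *_{G} x *_{G} y *_{G} inv_{G} x) ~= 1"
   using nondeg by blast
  define c where "c h = inv_{G} y *_{G} h *_{G} y" for h
  have c: "c h : carrier G" if "h : carrier G" for h using that y by (simp add: c_def)
  \<comment> \<open>\<open>f\<close> composed with conjugation is again a relation: apply
    \<open>\<rho> y\<close> to the relation \<open>f\<close> taken at the vector
    \<open>\<rho> (inv y) w\<close>. Since \<open>c h\<close> and \<open>h\<close> differ by an
    element of \<open>Z\<close>, both functions have the same zeros.\<close>
  define f' where "f' h = f (c h) - f h" for h
  have cf: "\<chi> (c h *_{G} inv_{G} h) * f (c h) = f h" if h: "h : carrier G" for h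
  proof -
   have "c h *_{G} inv_{G} h : Z" using comm[OF h y] by (simp add: c_def)
   moreover have "(c h *_{G} inv_{G} h) *_{G} h = c h" using h c[OF h] by (simp add: Gp.m_assoc)
   ultimately show ?thesis using f(1) h unfolding E_def by metis
  qed
  have E': "E f'"
   unfolding E_def
  proof (intro conjI ballI)
   fix z h assume z: "z : Z" and h: "h : carrier G"
   have zG: "z : carrier G" using z ZG by auto
   have cz: "c z : Z"
   proof -
    have "c z *_{G} inv_{G} z : Z" using comm[OF zG y] by (simp add: c_def)
    then have "(c z *_{G} inv_{G} z) *_{G} z : Z" using z subgroup.m_closed[OF Z] by blast
    then show ?thesis using zG c[OF zG] by (simp add: Gp.m_assoc)
   qed
   have cm: "c (z *_{G} h) = c z *_{G} c h"
    using zG h y Gp.inv_solve_left'[of y] by (simp add: c_def Gp.m_assoc Gp.r_inv flip: Gp.m_assoc[of y "inv_{G} y"])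
   \<comment> \<open>Invariance of \<open>\<chi>\<close> under conjugation by \<open>y\<close> is
     forced, because \<open>Z\<close> acts by \<open>\<chi>\<close> on the nonzero space
     \<open>Y\<close> and \<open>Y\<close> is stable under \<open>y\<close>.\<close>
   obtain w where w: "w : Y" "w ~= 0_{V}" using Y(2) submodD(2)[OF Y(1)] by blast
   have wV: "w : carrier V" using w YV by auto
   have yw: "\<rho> y w : Y" using Y(3)[OF y] w by auto
   have "\<chi> (c z) \<odot>_{V} w = \<rho> (inv_{G} y) (\<rho> z (\<rho> y w))"
    using scal[OF cz w(1)] y zG wV by (simp add: c_def mult)
   also have "\<dots> = \<chi> z \<odot>_{V} w" using scal[OF z yw] y wV by (simp add: smul)
   finally have "\<chi> (c z) = \<chi> z" using smult_cancel wV w(2) by blast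
   moreover have "\<chi> (c z) * f (c z *_{G} c h) = f (c h)" "\<chi> z * f (z *_{G} h) = f h"
    using f(1) cz z h c[OF h] by (auto simp: E_def)
   ultimately show "\<chi> z * f' (z *_{G} h) = f' h" by (simp add: f'_def cm algebra_simps)
  next
   fix w assume w: "w : Y"
   have wV: "w : carrier V" using w YV by auto
   define w' where "w' = \<rho> (inv_{G} y) w"
   have w': "w' : Y" "w' : carrier V" using Y(3)[of "inv_{G} y"] y w wV by (auto simp: w'_def)
   define F where "F h = f (inv_{G} y *_{G} h) \<odot>_{V} \<rho> (inv_{G} y *_{G} h) w'" for h
   have Fc: "F : carrier G \<rightarrow> carrier V" using y w' by (auto simp: F_def)
   have s1: "(\<Oplus>\<^bsub>V\<^esub>h\<in>carrier G. f (c h) \<odot>_{V} \<rho> h w) = 0_{V}"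
   proof -
    have "(\<Oplus>\<^bsub>V\<^esub>h\<in>carrier G. F h) = (\<Oplus>\<^bsub>V\<^esub>h\<in>carrier G. f h \<odot>_{V} \<rho> h w')"
     unfolding F_def using y w'
     by (intro finsum_translate_left[where F = "%h. f h \<odot>_{V} \<rho> h w'"]) auto
    then have "(\<Oplus>\<^bsub>V\<^esub>h\<in>carrier G. F h) = 0_{V}" using f(1) w' by (simp add: E_def)
    then have z: "(\<Oplus>\<^bsub>V\<^esub>h\<in>carrier G. F (h *_{G} y)) = 0_{V}"
     using finsum_translate_right[OF y Fc] by simp
    have "f (c h) \<odot>_{V} \<rho> h w = \<rho> y (F (h *_{G} y))" if h: "h : carrier G" for h
    proof -
     have a: "inv_{G} y *_{G} (h *_{G} y) = c h" using h y by (simp add: c_def Gp.m_assoc)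
     have "\<rho> y (\<rho> (c h) w') = \<rho> h w"
      using h y wV by (simp add: c_def w'_def mult)
     then show ?thesis using y c[OF h] w' by (simp add: F_def a smul)
    qed
    then have "(\<Oplus>\<^bsub>V\<^esub>h\<in>carrier G. f (c h) \<odot>_{V} \<rho> h w) = (\<Oplus>\<^bsub>V\<^esub>h\<in>carrier G. \<rho> y (F (h *_{G} y)))"
     using Fc y by (intro finsum_cong') (auto intro!: closed[OF y])
    also have "\<dots> = \<rho> y (\<Oplus>\<^bsub>V\<^esub>h\<in>carrier G. F (h *_{G} y))"
     using Fc y fin by (intro linear_maps_finsum[OF cvs_axioms cvs_axioms lin[OF y], symmetric]) auto
    finally show ?thesis using z y by simp
   qed
   have "(\<Oplus>\<^bsub>V\<^esub>h\<in>carrier G. f' h \<odot>_{V} \<rho> h w) =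
     (\<Oplus>\<^bsub>V\<^esub>h\<in>carrier G. f (c h) \<odot>_{V} \<rho> h w +_{V} (- 1) \<odot>_{V} (f h \<odot>_{V} \<rho> h w))"
    using wV by (intro finsum_cong') (auto simp: f'_def smult_add_left[symmetric] smult_assoc[symmetric])
   also have "\<dots> = (\<Oplus>\<^bsub>V\<^esub>h\<in>carrier G. f (c h) \<odot>_{V} \<rho> h w) +_{V}
     (\<Oplus>\<^bsub>V\<^esub>h\<in>carrier G. (- 1) \<odot>_{V} (f h \<odot>_{V} \<rho> h w))"
    using wV by (intro finsum_addf) auto
   also have "(\<Oplus>\<^bsub>V\<^esub>h\<in>carrier G. (- 1) \<odot>_{V} (f h \<odot>_{V} \<rho> h w)) =
     (- 1) \<odot>_{V} (\<Oplus>\<^bsub>V\<^esub>h\<in>carrier G. f h \<odot>_{V} \<rho> h w)"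
    using wV fin by (intro finsum_smult_ldistr[symmetric]) auto
   finally show "(\<Oplus>\<^bsub>V\<^esub>h\<in>carrier G. f' h \<odot>_{V} \<rho> h w) = 0_{V}"
    using s1 f(1) w by (simp add: E_def)
  qed
  have "f (c x) ~= f x"
  proof
   assume e: "f (c x) = f x"
   have "\<chi> (c x *_{G} inv_{G} x) * f x = f x" using cf[OF x(1)] e by simp
   then show False using chi x(2) by (simp add: c_def)
  qed
  then have "f' x ~= 0" by (simp add: f'_def)
  then obtain f'' where f'': "E f''" "f'' 1_{G} ~= 0" "card (supp f'') <= card (supp f')"
   using tr[OF E' x(1)] by blast
  have "supp f' \<subset> supp f"
  proof
   show "supp f' \<subseteq> supp f"
   proof
    fix h assume "h : supp f'"
    then have h: "h : carrier G" "f (c h) ~= f h" by (auto simp: supp_def f'_def)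
    have "f h ~= 0"
    proof
     assume f0: "f h = 0"
     have "c h *_{G} inv_{G} h : Z" using comm[OF h(1) y] by (simp add: c_def)
     then have u: "inv_{G} (c h *_{G} inv_{G} h) : Z" using subgroup.m_inv_closed[OF Z] by simp
     have "inv_{G} (c h *_{G} inv_{G} h) *_{G} c h = h"
      using h(1) c[OF h(1)] by (simp add: Gp.inv_mult_group Gp.m_assoc)
     then have "\<chi> (inv_{G} (c h *_{G} inv_{G} h)) * f h = f (c h)"
      using f(1) u c[OF h(1)] unfolding E_def by metis
     then show False using f0 h(2) by simp
    qed
    then show "h : supp f" using h by (simp add: supp_def)
   qed
   have "c 1_{G} = 1_{G}" using y by (simp add: c_def)
   then have "f' 1_{G} = 0" by (simp add: f'_def)
   then show "supp f' ~= supp f" using f(2) by (auto simp: supp_def)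
  qed
  moreover have "finite (supp f)" using fin by (simp add: supp_def)
  ultimately have "card (supp f') < card (supp f)" by (rule psubset_card_mono[rotated])
  then show False using min[OF f''(1,2)] f''(3) by simp
 qed
qed

end

text \<open>Average the rank one maps \<open>v \<mapsto> l(v) y\<close>, with \<open>l\<close> a
  linear functional on \<open>V\<close>, over the group. If all these averages vanished at
  \<open>v0\<close>, the numbers \<open>l (\<rho> (inv h) v0)\<close> would form a relation between
  the operators \<open>\<sigma> h\<close> on \<open>Y\<close>; by independence they would all be
  zero, also at the unit, where \<open>l v0\<close> is not.\<close>

lemma heisenberg_intertwiner:
 fixes \<chi> :: "'g => complex"
 assumes grp: "group G" and fin: "finite (carrier G)"
  and irr: "irreducible_rep G V \<rho>" and W: "group_rep G W \<sigma>"
  and Z: "subgroup Z G"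
  and Y: "submodule Y CC W" "Y ~= {0_{W}}" "!!g. g : carrier G ==> \<sigma> g ` Y \<subseteq> Y"
  and scalV: "!!z v. z : Z ==> v : carrier V ==> \<rho> z v = \<chi> z \<odot>_{V} v"
  and scal: "!!z y. z : Z ==> y : Y ==> \<sigma> z y = \<chi> z \<odot>_{W} y"
  and comm: "!!x y. x : carrier G ==> y : carrier G ==> inv_{G} y *_{G} x *_{G} y *_{G} inv_{G} x : Z"
  and nondeg: "!!x. x : carrier G ==> x \<notin> Z ==>
   EX y:carrier G. \<chi> (inv_{G} y *_{G} x *_{G} y *_{G} inv_{G} x) ~= 1"
 shows "EX T. intertwiner G V \<rho> W \<sigma> T & T ` carrier V \<subseteq> Y & (EX v:carrier V. T v ~= 0_{W})"
proof -
 interpret V: rep G V \<rho> by (rule irreducible_imp_rep[OF grp irr])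
 interpret W: rep G W \<sigma> by (rule rep_from_group_rep[OF grp W])
 have YW: "Y \<subseteq> carrier W" using W.submodD(1)[OF Y(1)] .
 have ZG: "Z \<subseteq> carrier G" using subgroup.subset[OF Z] .
 \<comment> \<open>Coordinates serve only to obtain a linear functional \<open>l\<close> that does
   not vanish at \<open>v0\<close>.\<close>
 obtain d \<pi> where iso: "rep_iso G V \<rho> (module_vec TYPE(complex) d) \<pi>"
  using irreducible_coordinates[OF grp fin irr] by blast
 obtain L where L: "L : linear_maps CC V (module_vec TYPE(complex) d)" "bij_betw L (carrier V) (carrier_vec d)"
  using iso by (auto simp: rep_iso_def module_vec_simps)
 have Lcl: "L v : carrier_vec d" if "v : carrier V" for v using L(2) that by (auto simp: bij_betw_def)
 have "carrier V ~= {0_{V}}" using irr by (simp add: irreducible_rep_def)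
 then obtain v0 where v0: "v0 : carrier V" "v0 ~= 0_{V}" using V.zero_closed by blast
 have L0: "L 0_{V} = 0\<^sub>v d"
  using linear_maps_zero[OF V.cvs_axioms cvs_module_vec L(1)] by (simp add: module_vec_simps)
 have "L v0 ~= 0\<^sub>v d" using L(2) v0 L0 by (metis V.zero_closed bij_betw_def inj_onD)
 then obtain i where i: "i < d" "L v0 $ i ~= 0" using Lcl[OF v0(1)] eq_vecI[of "0\<^sub>v d" "L v0"] by auto
 define l where "l v = L v $ i" for v
 have l_add: "l (v +_{V} w) = l v + l w" if "v : carrier V" "w : carrier V" for v w
  using linear_mapsD(2)[OF L(1) that] Lcl[OF that(1)] Lcl[OF that(2)] i(1) by (simp add: l_def module_vec_simps)
 have l_smult: "l (c \<odot>_{V} v) = c * l v" if "v : carrier V" for c v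
  using linear_mapsD(3)[OF L(1)] that Lcl[OF that] i(1) by (simp add: l_def module_vec_simps)
 define T where "T y v = (\<Oplus>\<^bsub>W\<^esub>h\<in>carrier G. l (\<rho> (inv_{G} h) v) \<odot>_{W} \<sigma> h y)" for y v
 have "EX y:Y. T y v0 ~= 0_{W}"
 proof (rule ccontr)
  assume "\<not> ?thesis"
  then have null: "!!y. y : Y ==> T y v0 = 0_{W}" by blast
  have "l (\<rho> (inv_{G} 1_{G}) v0) = 0"
  proof (rule W.independent_modulo_character[where f = "%h. l (\<rho> (inv_{G} h) v0)", OF fin Z Y scal comm nondeg])
   fix z h assume z: "z : Z" and h: "h : carrier G"
   have zG: "z : carrier G" using z ZG by auto
   define u where "u = \<rho> (inv_{G} h) (\<rho> (inv_{G} z) v0)"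
   have "\<rho> (inv_{G} h) v0 = \<rho> (inv_{G} h) (\<chi> z \<odot>_{V} \<rho> (inv_{G} z) v0)"
    using scalV[OF z, of "\<rho> (inv_{G} z) v0"] zG v0 by simp
   also have "\<dots> = \<chi> z \<odot>_{V} u" using zG v0 h by (simp add: V.smul u_def)
   finally have "l (\<rho> (inv_{G} h) v0) = \<chi> z * l u" using l_smult zG v0 h by (simp add: u_def)
   moreover have "u = \<rho> (inv_{G} (z *_{G} h)) v0"
    using zG h v0 by (simp add: u_def V.mult[symmetric] V.Gp.inv_mult_group)
   ultimately show "\<chi> z * l (\<rho> (inv_{G} (z *_{G} h)) v0) = l (\<rho> (inv_{G} h) v0)" by simp
  qed (use null in \<open>auto simp: T_def\<close>)
  then show False using i v0 by (simp add: l_def)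
 qed
 then obtain y where y: "y : Y" "T y v0 ~= 0_{W}" by blast
 have yW: "y : carrier W" using y YW by auto
 have Tcl: "T y v : Y" if "v : carrier V" for v
  unfolding T_def using y(1) Y(3) W.submodD(4)[OF Y(1)]
  by (intro W.finsum_submodule_closed[OF Y(1) fin]) auto
 have "intertwiner G V \<rho> W \<sigma> (T y)"
  unfolding intertwiner_def
 proof (intro conjI ballI linear_mapsI)
  fix v assume "v : carrier V"
  then show "T y v : carrier W" using Tcl YW by auto
 next
  fix v w assume vw: "v : carrier V" "w : carrier V"
  have "T y (v +_{V} w) = (\<Oplus>\<^bsub>W\<^esub>h\<in>carrier G. l (\<rho> (inv_{G} h) v) \<odot>_{W} \<sigma> h y +_{W} l (\<rho> (inv_{G} h) w) \<odot>_{W} \<sigma> h y)"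
   unfolding T_def using vw yW
   by (intro W.finsum_cong') (auto simp: V.add l_add W.smult_add_left)
  also have "\<dots> = T y v +_{W} T y w"
   unfolding T_def using yW by (intro W.finsum_addf) auto
  finally show "T y (v +_{V} w) = T y v +_{W} T y w" .
 next
  fix a v assume v: "v : carrier V"
  have "T y (a \<odot>_{V} v) = (\<Oplus>\<^bsub>W\<^esub>h\<in>carrier G. a \<odot>_{W} (l (\<rho> (inv_{G} h) v) \<odot>_{W} \<sigma> h y))"
   unfolding T_def using v yW
   by (intro W.finsum_cong') (auto simp: V.smul l_smult W.smult_assoc)
  also have "\<dots> = a \<odot>_{W} T y v"
   unfolding T_def using yW fin by (intro W.finsum_smult_ldistr[symmetric]) auto
  finally show "T y (a \<odot>_{V} v) = a \<odot>_{W} T y v" .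
 next
  fix k v assume k: "k : carrier G" and v: "v : carrier V"
  define F where "F h = l (\<rho> (inv_{G} h) (\<rho> k v)) \<odot>_{W} \<sigma> h y" for h
  have "T y (\<rho> k v) = (\<Oplus>\<^bsub>W\<^esub>h\<in>carrier G. F (k *_{G} h))"
   unfolding T_def F_def[symmetric] using k yW
   by (intro W.finsum_translate_left[symmetric]) (auto simp: F_def)
  also have "\<dots> = (\<Oplus>\<^bsub>W\<^esub>h\<in>carrier G. \<sigma> k (l (\<rho> (inv_{G} h) v) \<odot>_{W} \<sigma> h y))"
   using k yW v
   by (intro W.finsum_cong') (auto simp: F_def W.smul W.mult V.Gp.inv_mult_group V.mult)
  also have "\<dots> = \<sigma> k (T y v)"
   unfolding T_def using k yW fin
   by (intro linear_maps_finsum[OF W.cvs_axioms W.cvs_axioms W.lin[OF k], symmetric]) auto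
  finally show "T y (\<rho> k v) = \<sigma> k (T y v)" .
 qed
 then show ?thesis using Tcl y(2) v0(1) by (intro exI[of _ "T y"]) auto
qed

section \<open>Induced representations\<close>

locale ind_data = Gp?: group G + W?: cvs W for G :: "('g, 'x) monoid_scheme" and W :: "(complex, 'v, 'y) module_scheme" +
 fixes H :: "'g set" and \<sigma> :: "'g => 'v => 'v"
 assumes fin: "finite (carrier G)"
  and H: "subgroup H G"
  and rep_H: "rep (G(|carrier := H|)) W \<sigma>"
begin

sublocale S: rep "G(|carrier := H|)" W \<sigma>
 rewrites "carrier (G(|carrier := H|)) = H" and "monoid.mult (G(|carrier := H|)) = monoid.mult G"
  and "one (G(|carrier := H|)) = one G"
 by (rule rep_H) auto

abbreviation "M \<equiv> ind_module G H W \<sigma>"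
abbreviation "R \<equiv> ind_rep G H W \<sigma>"

lemma HG: "h : H ==> h : carrier G"
 using subgroup.subset[OF H] by auto

lemma H_mult: "h : H ==> k : H ==> h *_{G} k : H"
 and H_one: "1_{G} : H" and H_inv: "h : H ==> inv_{G} h : H"
 using subgroup.m_closed[OF H] subgroup.one_closed[OF H] subgroup.m_inv_closed[OF H] by auto

lemma H_mult_iff: "h : H ==> x : carrier G ==> h *_{G} x : H \<longleftrightarrow> x : H"
 "h : H ==> x : carrier G ==> x *_{G} h : H \<longleftrightarrow> x : H"
proof -
 assume h: "h : H" and x: "x : carrier G"
 have "x = inv_{G} h *_{G} (h *_{G} x)" using h x HG by (simp add: Gp.m_assoc[symmetric])
 then show "h *_{G} x : H \<longleftrightarrow> x : H" using h H_mult H_inv by metis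
 have "x = (x *_{G} h) *_{G} inv_{G} h" using h x HG by (simp add: Gp.m_assoc)
 then show "x *_{G} h : H \<longleftrightarrow> x : H" using h H_mult H_inv by metis
qed

lemma carrier_M:
 "f : carrier M \<longleftrightarrow> f : extensional (carrier G) & (ALL x:carrier G. f x : carrier W) &
   (ALL h:H. ALL x:carrier G. f (h *_{G} x) = \<sigma> h (f x))"
 by (auto simp: ind_module_def PiE_def)

lemma M_simps:
 "x : carrier G ==> (f +_{M} f') x = f x +_{W} f' x"
 "x : carrier G ==> (c \<odot>_{M} f) x = c \<odot>_{W} f x"
 "x : carrier G ==> 0_{M} x = 0_{W}"
 "f +_{M} f' : extensional (carrier G)" "c \<odot>_{M} f : extensional (carrier G)"
 "0_{M} : extensional (carrier G)"
 by (auto simp: ind_module_def)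

lemma M_eqI:
 assumes "f : extensional (carrier G)" "f' : extensional (carrier G)"
  "!!x. x : carrier G ==> f x = f' x"
 shows "f = f'"
 using assms by (rule extensionalityI)

lemma M_ext: "f : carrier M ==> f : extensional (carrier G)"
 and M_val [simp]: "f : carrier M ==> x : carrier G ==> f x : carrier W"
 and M_equiv: "f : carrier M ==> h : H ==> x : carrier G ==> f (h *_{G} x) = \<sigma> h (f x)"
 by (auto simp: carrier_M)

lemma cvs_M: "cvs M"
proof (rule cvsI)
 fix x y z assume "x : carrier M" "y : carrier M" "z : carrier M"
 then show "x +_{M} y +_{M} z = x +_{M} (y +_{M} z)"
  by (intro M_eqI) (auto simp: M_simps W.M.a_assoc)
next
 fix x y assume "x : carrier M" "y : carrier M"
 then show "x +_{M} y = y +_{M} x"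
  by (intro M_eqI) (auto simp: M_simps W.M.a_comm)
next
 fix a b x assume "x : carrier M"
 then show "(a + b) \<odot>_{M} x = a \<odot>_{M} x +_{M} b \<odot>_{M} x"
  by (intro M_eqI) (auto simp: M_simps W.smult_add_left)
next
 fix a x y assume "x : carrier M" "y : carrier M"
 then show "a \<odot>_{M} (x +_{M} y) = a \<odot>_{M} x +_{M} a \<odot>_{M} y"
  by (intro M_eqI) (auto simp: M_simps W.smult_add_right)
next
 fix a b x assume "x : carrier M"
 then show "(a * b) \<odot>_{M} x = a \<odot>_{M} (b \<odot>_{M} x)"
  by (intro M_eqI) (auto simp: M_simps W.smult_assoc)
next
 fix x assume "x : carrier M"
 then show "1 \<odot>_{M} x = x" "0 \<odot>_{M} x = 0_{M}" "0_{M} +_{M} x = x"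
  by (auto intro!: M_eqI simp: M_simps M_ext)
qed (auto simp: carrier_M M_simps HG S.add S.smul)

sublocale M: cvs M by (rule cvs_M)

lemma R_apply [simp]: "f : carrier M ==> x : carrier G ==> R g f x = f (x *_{G} g)"
 by (simp add: ind_rep_def)

lemma R_ext: "f : carrier M ==> R g f : extensional (carrier G)"
 by (simp add: ind_rep_def)

lemma R_closed: "g : carrier G ==> f : carrier M ==> R g f : carrier M"
 by (subst carrier_M) (auto simp: R_ext HG Gp.m_assoc M_equiv)

lemma rep_M: "rep G M R"
proof (rule repI)
 fix g assume g: "g : carrier G"
 show "R g : linear_maps CC M M"
 proof (rule linear_mapsI)
  fix x y assume xy: "x : carrier M" "y : carrier M"
  show "R g (x +_{M} y) = R g x +_{M} R g y"
   using xy g M.M.add.m_closed[OF xy] by (intro M_eqI R_ext) (auto simp: M_simps)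
 next
  fix a x assume x: "x : carrier M"
  have "a \<odot>_{M} x : carrier M" using x by (intro M.smult_closed) auto
  then show "R g (a \<odot>_{M} x) = a \<odot>_{M} R g x"
   using x g by (intro M_eqI R_ext) (auto simp: M_simps)
 qed (use g R_closed in auto)
 show "R g : extensional (carrier M)" by (simp add: ind_rep_def)
next
 fix f assume f: "f : carrier M"
 then show "R 1_{G} f = f" by (intro M_eqI R_ext M_ext) auto
next
 fix g h f assume *: "g : carrier G" "h : carrier G" "f : carrier M"
 then show "R (g *_{G} h) f = R g (R h f)"
  using R_closed by (intro M_eqI R_ext) (auto simp: Gp.m_assoc)
qed (unfold_locales)

sublocale R: rep G M R by (rule rep_M)

text \<open>The canonical copy of \<open>W\<close> inside the induced module: the functions
  supported on \<open>H\<close>, recovered from their value at the unit.\<close>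

definition \<delta> :: "'v => 'g => 'v" where
 "\<delta> w = (\<lambda>x\<in>carrier G. if x : H then \<sigma> x w else 0_{W})"

lemma \<delta>_apply: "x : H ==> \<delta> w x = \<sigma> x w" "x : carrier G ==> x \<notin> H ==> \<delta> w x = 0_{W}"
 by (auto simp: \<delta>_def HG)

lemma \<delta>_one [simp]: "w : carrier W ==> \<delta> w 1_{G} = w"
 using \<delta>_apply(1)[OF H_one] S.rep_one by simp

lemma \<delta>_closed: "w : carrier W ==> \<delta> w : carrier M"
proof (subst carrier_M, intro conjI ballI)
 fix h x assume "w : carrier W" "h : H" "x : carrier G"
 then show "\<delta> w (h *_{G} x) = \<sigma> h (\<delta> w x)"
  by (cases "x : H") (auto simp: \<delta>_apply H_mult H_mult_iff HG S.mult)
qed (auto simp: \<delta>_def)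

lemma \<delta>_add: "w : carrier W ==> w' : carrier W ==> \<delta> (w +_{W} w') = \<delta> w +_{M} \<delta> w'"
 by (rule M_eqI) (auto simp: \<delta>_def M_simps S.add)

lemma \<delta>_smult: "w : carrier W ==> \<delta> (c \<odot>_{W} w) = c \<odot>_{M} \<delta> w"
 by (rule M_eqI) (auto simp: \<delta>_def M_simps S.smul)

lemma R_\<delta>: "h : H ==> w : carrier W ==> R h (\<delta> w) = \<delta> (\<sigma> h w)"
 using \<delta>_closed
 by (intro M_eqI R_ext) (auto simp: \<delta>_def HG H_mult_iff S.mult H_mult)

lemma supported_on_H:
 assumes "f : carrier M" "!!x. x : carrier G ==> x \<notin> H ==> f x = 0_{W}"
 shows "f = \<delta> (f 1_{G})"
proof (rule M_eqI)
 fix x assume x: "x : carrier G"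
 show "f x = \<delta> (f 1_{G}) x"
  using assms M_equiv[OF assms(1), of x "1_{G}"] x by (cases "x : H") (auto simp: \<delta>_apply)
qed (use assms(1) in \<open>auto simp: M_ext \<delta>_def\<close>)

text \<open>Subtracting a translate of \<open>\<delta> (f a)\<close> removes the coset
  \<open>H a\<close> from the support of \<open>f\<close> and leaves the other values alone, so the
  support shrinks until nothing is left.\<close>

lemma generated_by_\<delta>:
 assumes X: "submodule X CC M" "ALL g:carrier G. R g ` X \<subseteq> X"
  and \<delta>X: "!!w. w : carrier W ==> \<delta> w : X" and f: "f : carrier M"
 shows "f : X"
 using f
proof (induction "card {x\<in>carrier G. f x ~= 0_{W}}" arbitrary: f rule: less_induct)
 case less
 note XD = M.submodD[OF X(1)]
 show ?case
 proof (cases "ALL x:carrier G. f x = 0_{W}")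
  case True
  then have "f = 0_{M}" using less by (intro M_eqI M_ext) (auto simp: M_simps)
  then show ?thesis using XD by simp
 next
  case False
  then obtain a where a: "a : carrier G" "f a ~= 0_{W}" by blast
  define d where "d = R (inv_{G} a) (\<delta> (f a))"
  have fa: "f a : carrier W" using less a by auto
  have dX: "d : X" using X(2) \<delta>X[OF fa] a unfolding d_def by blast
  have dM: "d : carrier M" using dX XD(1) by auto
  define f' where "f' = f +_{M} (- 1) \<odot>_{M} d"
  have f'M: "f' : carrier M" unfolding f'_def
   using less dM M.smult_closed by (intro M.M.add.m_closed) auto
  have f'v: "f' x = f x +_{W} (- 1) \<odot>_{W} d x" if "x : carrier G" for x
   using that by (simp add: f'_def M_simps)
  have dv: "d x = (if x *_{G} inv_{G} a : H then f x else 0_{W})" if x: "x : carrier G" for x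
  proof -
   have e: "d x = \<delta> (f a) (x *_{G} inv_{G} a)"
    unfolding d_def using x \<delta>_closed[OF fa] by simp
   have "x = (x *_{G} inv_{G} a) *_{G} a" using x a by (simp add: Gp.m_assoc)
   then have "f x = \<sigma> (x *_{G} inv_{G} a) (f a)" if "x *_{G} inv_{G} a : H"
    using M_equiv[OF less(2) that a(1)] by simp
   then show ?thesis using e x a by (auto simp: \<delta>_apply)
  qed
  have sm: "f' x = (if x *_{G} inv_{G} a : H then 0_{W} else f x)" if x: "x : carrier G" for x
   using f'v[OF x] dv[OF x] less(2) x W.add_neg_eq_zero[of "f x" "f x"] by auto
  have "f' a = 0_{W}" using sm[OF a(1)] a H_one by simp
  then have "a : {x\<in>carrier G. f x ~= 0_{W}} - {x\<in>carrier G. f' x ~= 0_{W}}"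
   using a by simp
  moreover have "{x\<in>carrier G. f' x ~= 0_{W}} \<subseteq> {x\<in>carrier G. f x ~= 0_{W}}"
  proof (intro Collect_mono impI conjI)
   fix x assume x: "x : carrier G & f' x ~= 0_{W}"
   then show "x : carrier G" ..
   show "f x ~= 0_{W}" using x sm[of x] by (metis (no_types))
  qed
  ultimately have "{x\<in>carrier G. f' x ~= 0_{W}} \<subset> {x\<in>carrier G. f x ~= 0_{W}}" by blast
  then have "card {x\<in>carrier G. f' x ~= 0_{W}} < card {x\<in>carrier G. f x ~= 0_{W}}"
   using fin by (intro psubset_card_mono) auto
  then have "f' : X" using less(1) f'M by blast
  then have "f' +_{M} d : X" using XD dX by blast
  moreover have "f' +_{M} d = f"
  proof (rule M_eqI)
   fix x assume x: "x : carrier G"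
   then show "(f' +_{M} d) x = f x" using sm[OF x] dv[OF x] less(2) by (simp add: M_simps)
  qed (auto simp: M_simps M_ext less)
  ultimately show ?thesis by simp
 qed
qed

text \<open>Frobenius reciprocity by summing over all of \<open>G\<close> rather than over cosets.
  The summand depends only on the coset of \<open>x\<close>, hence the factor \<open>card H\<close>
  in the value at \<open>\<delta> w\<close>.\<close>

lemma frobenius_map:
 assumes V: "group_rep G V \<rho>" and \<phi>: "intertwiner (G(|carrier := H|)) W \<sigma> V \<rho> \<phi>"
  and w: "w : carrier W" "\<phi> w ~= 0_{V}"
 shows "EX \<Phi>. intertwiner G M R V \<rho> \<Phi> & (EX f:carrier M. \<Phi> f ~= 0_{V})"
proof -
 interpret V: rep G V \<rho> by (rule rep_from_group_rep[OF Gp.is_group V])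
 have lin: "\<phi> : linear_maps CC W V" and eq: "!!h w. h : H ==> w : carrier W ==> \<phi> (\<sigma> h w) = \<rho> h (\<phi> w)"
  using \<phi> by (auto simp: intertwiner_def)
 note cl = linear_mapsD(1)[OF lin]
 define \<Phi> where "\<Phi> f = (\<Oplus>\<^bsub>V\<^esub>x\<in>carrier G. \<rho> (inv_{G} x) (\<phi> (f x)))" for f
 have "intertwiner G M R V \<rho> \<Phi>"
  unfolding intertwiner_def
 proof (intro conjI ballI linear_mapsI)
  fix f assume "f : carrier M"
  then show "\<Phi> f : carrier V" unfolding \<Phi>_def using cl by (intro V.finsum_closed) auto
 next
  fix f f' assume f: "f : carrier M" "f' : carrier M"
  have "\<Phi> (f +_{M} f') = (\<Oplus>\<^bsub>V\<^esub>x\<in>carrier G. \<rho> (inv_{G} x) (\<phi> (f x)) +_{V} \<rho> (inv_{G} x) (\<phi> (f' x)))"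
   unfolding \<Phi>_def using f cl linear_mapsD(2)[OF lin]
   by (intro V.finsum_cong') (auto simp: M_simps V.add)
  also have "\<dots> = \<Phi> f +_{V} \<Phi> f'"
   unfolding \<Phi>_def using f cl by (intro V.finsum_addf) auto
  finally show "\<Phi> (f +_{M} f') = \<Phi> f +_{V} \<Phi> f'" .
 next
  fix a f assume f: "f : carrier M"
  have "\<Phi> (a \<odot>_{M} f) = (\<Oplus>\<^bsub>V\<^esub>x\<in>carrier G. a \<odot>_{V} \<rho> (inv_{G} x) (\<phi> (f x)))"
   unfolding \<Phi>_def using f cl linear_mapsD(3)[OF lin]
   by (intro V.finsum_cong') (auto simp: M_simps V.smul)
  also have "\<dots> = a \<odot>_{V} \<Phi> f"
   unfolding \<Phi>_def using f cl fin by (intro V.finsum_smult_ldistr[symmetric]) auto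
  finally show "\<Phi> (a \<odot>_{M} f) = a \<odot>_{V} \<Phi> f" .
 next
  fix g f assume g: "g : carrier G" and f: "f : carrier M"
  define F where "F x = \<rho> g (\<rho> (inv_{G} x) (\<phi> (f x)))" for x
  have Fc: "F : carrier G \<rightarrow> carrier V" using f g cl by (auto simp: F_def)
  have "\<rho> (inv_{G} x) (\<phi> (f (x *_{G} g))) = F (x *_{G} g)" if x: "x : carrier G" for x
  proof -
   have "inv_{G} x = g *_{G} inv_{G} (x *_{G} g)"
    using x g by (simp add: Gp.inv_mult_group Gp.m_assoc[symmetric])
   then show ?thesis using V.mult[of g "inv_{G} (x *_{G} g)" "\<phi> (f (x *_{G} g))"] x g f cl
    by (simp add: F_def)
  qed
  then have "\<Phi> (R g f) = (\<Oplus>\<^bsub>V\<^esub>x\<in>carrier G. F (x *_{G} g))"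
   unfolding \<Phi>_def using f g Fc by (intro V.finsum_cong') auto
  also have "\<dots> = (\<Oplus>\<^bsub>V\<^esub>x\<in>carrier G. F x)" by (rule V.finsum_translate_right[OF g Fc])
  also have "\<dots> = \<rho> g (\<Phi> f)"
   unfolding \<Phi>_def F_def using f g cl fin
   by (intro linear_maps_finsum[OF V.cvs_axioms V.cvs_axioms V.lin[OF g], symmetric]) auto
  finally show "\<Phi> (R g f) = \<rho> g (\<Phi> f)" .
 qed
 moreover have "\<Phi> (\<delta> w) ~= 0_{V}"
 proof -
  have HG': "H \<subseteq> carrier G" using HG by auto
  have finH: "finite H" using fin HG' finite_subset by blast
  have "\<Phi> (\<delta> w) = (\<Oplus>\<^bsub>V\<^esub>x\<in>H. \<phi> w)"
   unfolding \<Phi>_def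
  proof (rule V.add.finprod_mono_neutral_cong_right[OF fin HG'])
   fix x assume x: "x : carrier G - H"
   then show "\<rho> (inv_{G} x) (\<phi> (\<delta> w x)) = 0_{V}"
    using linear_maps_zero[OF W.cvs_axioms V.cvs_axioms lin] by (simp add: \<delta>_apply)
  next
   fix x assume x: "x : H"
   then show "\<rho> (inv_{G} x) (\<phi> (\<delta> w x)) = \<phi> w"
    using eq[OF x w(1)] HG cl w by (simp add: \<delta>_apply)
  qed (use \<delta>_closed[OF w(1)] cl w in auto)
  also have "\<dots> = of_nat (card H) \<odot>_{V} \<phi> w" using finH cl w by (intro V.finsum_const_smult) auto
  finally show ?thesis
   using V.smult_zero_imp[of "of_nat (card H)" "\<phi> w"] cl[OF w(1)] w(2) finH H_one card_eq_0_iff[of H] by force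
 qed
 ultimately show ?thesis using \<delta>_closed[OF w(1)] by blast
qed

end

text \<open>Clifford theory for an isotypic representation of the stabilizer \<open>H\<close> of a character of \<open>N\<close>.\<close>

locale ind_clifford = ind_data +
 fixes N and \<psi> :: "'a => complex"
 assumes N: "N \<lhd> G" and NH: "N \<subseteq> H"
  and N_scalar: "!!n w. n : N ==> w : carrier W ==> \<sigma> n w = \<psi> n \<odot>_{W} w"
  and separated: "!!x. x : carrier G ==> x \<notin> H ==> EX n:N. \<psi> (x *_{G} n *_{G} inv_{G} x) ~= \<psi> n"
begin

lemma NG: "n : N ==> n : carrier G"
 using NH HG by auto

lemma conj_N: "x : carrier G ==> n : N ==> x *_{G} n *_{G} inv_{G} x : N"
 using normal.inv_op_closed2[OF N] by auto

text \<open>Normality of \<open>N\<close> lets \<open>n\<close> be moved to the left of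
  \<open>x\<close>: at the point \<open>x\<close> the group \<open>N\<close> acts through the
  conjugate of \<open>\<psi>\<close> by \<open>x\<close>. The arguments below rest on telling these
  conjugates apart.\<close>

lemma translate_N:
 assumes "f : carrier M" "x : carrier G" "n : N"
 shows "f (x *_{G} n) = \<psi> (x *_{G} n *_{G} inv_{G} x) \<odot>_{W} f x"
proof -
 have "x *_{G} n = (x *_{G} n *_{G} inv_{G} x) *_{G} x"
  using assms NG by (simp add: Gp.m_assoc)
 moreover have "x *_{G} n *_{G} inv_{G} x : N" using conj_N assms by blast
 ultimately show ?thesis using M_equiv[OF assms(1) _ assms(2)] N_scalar NH assms
  by (metis M_val subsetD)
qed

lemma \<delta>_eigen: "n : N ==> w : carrier W ==> R n (\<delta> w) = \<psi> n \<odot>_{M} \<delta> w"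
 using R_\<delta>[of n w] NH by (auto simp: N_scalar \<delta>_smult)

text \<open>Outside \<open>H\<close> the conjugate of \<open>\<psi>\<close> differs from
  \<open>\<psi>\<close>, which forces \<open>f x\<close> to vanish there. Thus the
  \<open>\<psi>\<close>-eigenspace of \<open>N\<close> is the copy of \<open>W\<close>, and
  \<open>W\<close> can be recovered from the induced representation.\<close>

lemma eigen_supported:
 assumes "f : carrier M" "!!n. n : N ==> R n f = \<psi> n \<odot>_{M} f"
 shows "f = \<delta> (f 1_{G})"
proof (rule supported_on_H[OF assms(1)])
 fix x assume x: "x : carrier G" "x \<notin> H"
 then obtain n where n: "n : N" "\<psi> (x *_{G} n *_{G} inv_{G} x) ~= \<psi> n" using separated by blast
 have "R n f x = (\<psi> n \<odot>_{M} f) x" using assms(2)[OF n(1)] by simp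
 then have "\<psi> (x *_{G} n *_{G} inv_{G} x) \<odot>_{W} f x = \<psi> n \<odot>_{W} f x"
  using translate_N[OF assms(1) x(1) n(1)] x assms(1) by (simp add: M_simps)
 then show "f x = 0_{W}" using W.smult_cancel n(2) assms(1) x by (metis M_val)
qed

text \<open>A nonzero invariant subspace \<open>X\<close> contains an \<open>f\<close> of least
  support among those not vanishing at the unit. Such an \<open>f\<close> is supported on
  \<open>H\<close>, so \<open>X\<close> meets the copy of \<open>W\<close>; irreducibility of
  \<open>W\<close> puts the whole copy into \<open>X\<close>, and the copy generates.\<close>

lemma irreducible_M:
 assumes irr: "irreducible_rep (G(|carrier := H|)) W \<sigma>"
 shows "irreducible_rep G M R"
 unfolding irreducible_rep_def
proof (intro conjI allI impI)
 show "group_rep G M R" by (rule R.group_rep)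
 have "carrier W ~= {0_{W}}" using irr by (simp add: irreducible_rep_def)
 then obtain w0 where w0: "w0 : carrier W" "w0 ~= 0_{W}" using W.M.zero_closed by blast
 then have "\<delta> w0 ~= 0_{M}" using \<delta>_one[OF w0(1)] M_simps(3)[OF Gp.one_closed] by metis
 then show "carrier M ~= {0_{M}}" using \<delta>_closed[OF w0(1)] by blast
 fix X assume X: "submodule X CC M & (ALL g:carrier G. R g ` X \<subseteq> X)"
 note XD = M.submodD[OF conjunct1[OF X]]
 have XR: "R g f : X" if "g : carrier G" "f : X" for g f using X that by blast
 show "X = {0_{M}} \<or> X = carrier M"
 proof (cases "X = {0_{M}}")
  case False
  then obtain f0 where f0: "f0 : X" "f0 ~= 0_{M}" using XD(2) by blast
  have "EX a:carrier G. f0 a ~= 0_{W}"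
  proof (rule ccontr)
   assume "\<not> ?thesis"
   then have "f0 = 0_{M}" using f0(1) XD(1) by (intro M_eqI M_ext) (auto simp: M_simps)
   then show False using f0 by simp
  qed
  then obtain a where a: "a : carrier G" "f0 a ~= 0_{W}" by blast
  have "R a f0 : X" "R a f0 1_{G} ~= 0_{W}" using XR f0 a XD(1) by auto
  then obtain f where f: "f : X" "f 1_{G} ~= 0_{W}"
   and min: "!!f'. f' : X ==> f' 1_{G} ~= 0_{W} ==>
    card {x\<in>carrier G. f x ~= 0_{W}} <= card {x\<in>carrier G. f' x ~= 0_{W}}"
   using ex_has_least_nat[of "%f. f : X & f 1_{G} ~= 0_{W}" "R a f0" "%f. card {x\<in>carrier G. f x ~= 0_{W}}"]
   by blast
  have fM: "f : carrier M" using f XD(1) by auto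
  have "f = \<delta> (f 1_{G})"
  proof (rule supported_on_H[OF fM], rule ccontr)
   fix x assume x: "x : carrier G" "x \<notin> H" "f x ~= 0_{W}"
   then obtain n where n: "n : N" "\<psi> (x *_{G} n *_{G} inv_{G} x) ~= \<psi> n" using separated by blast
   \<comment> \<open>The operator \<open>R n - c\<close> multiplies \<open>f y\<close> by a number
     that is zero for \<open>y = x\<close> and nonzero at the unit, which shortens the
     support.\<close>
   define c where "c = \<psi> (x *_{G} n *_{G} inv_{G} x)"
   define f' where "f' = R n f +_{M} (- c) \<odot>_{M} f"
   have f'X: "f' : X" unfolding f'_def using XR[OF NG[OF n(1)] f(1)] f(1) XD by blast
   have f'v: "f' y = (\<psi> (y *_{G} n *_{G} inv_{G} y) - c) \<odot>_{W} f y" if y: "y : carrier G" for y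
    using y fM translate_N[OF fM y n(1)] W.smult_add_left[of "f y" "\<psi> (y *_{G} n *_{G} inv_{G} y)" "- c"]
    by (simp add: f'_def M_simps)
   have "f' 1_{G} = (\<psi> n - c) \<odot>_{W} f 1_{G}" using f'v[OF Gp.one_closed] NG[OF n(1)] by simp
   then have "f' 1_{G} ~= 0_{W}" using W.smult_zero_imp[of "\<psi> n - c" "f 1_{G}"] f(2) n(2) fM by (auto simp: c_def)
   moreover have "{x\<in>carrier G. f' x ~= 0_{W}} \<subset> {x\<in>carrier G. f x ~= 0_{W}}"
   proof
    show "{x\<in>carrier G. f' x ~= 0_{W}} \<subseteq> {x\<in>carrier G. f x ~= 0_{W}}" using f'v by auto
    have "f' x = 0_{W}" using f'v[OF x(1)] x fM by (simp add: c_def)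
    then show "{x\<in>carrier G. f' x ~= 0_{W}} ~= {x\<in>carrier G. f x ~= 0_{W}}" using x by blast
   qed
   then have "card {x\<in>carrier G. f' x ~= 0_{W}} < card {x\<in>carrier G. f x ~= 0_{W}}"
    using fin by (intro psubset_card_mono) auto
   ultimately show False using min[OF f'X] by simp
  qed
  then have \<delta>1: "\<delta> (f 1_{G}) : X" using f(1) by simp
  define X0 where "X0 = {w\<in>carrier W. \<delta> w : X}"
  have "submodule X0 CC W"
  proof (rule W.submodI)
   have "\<delta> 0_{W} = 0 \<odot>_{M} \<delta> 0_{W}" using \<delta>_smult[of "0_{W}" 0] by simp
   then show "0_{W} : X0" using XD(2) \<delta>_closed[OF W.M.zero_closed] by (simp add: X0_def)
  qed (auto simp: X0_def \<delta>_add \<delta>_smult XD)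
  moreover have "ALL h:H. \<sigma> h ` X0 \<subseteq> X0"
  proof (intro ballI subsetI)
   fix h y assume h: "h : H" and "y : \<sigma> h ` X0"
   then obtain w where w: "w : carrier W" "\<delta> w : X" "y = \<sigma> h w" by (auto simp: X0_def)
   then show "y : X0" using XR[OF HG[OF h] w(2)] R_\<delta>[OF h w(1)] h by (simp add: X0_def)
  qed
  moreover have "f 1_{G} : X0" using \<delta>1 fM by (simp add: X0_def)
  then have "X0 ~= {0_{W}}" using f(2) by blast
  moreover have "!!Y. submodule Y CC W ==> ALL h:H. \<sigma> h ` Y \<subseteq> Y ==> Y = {0_{W}} \<or> Y = carrier W"
   using irr by (simp add: irreducible_rep_def)
  ultimately have "X0 = carrier W" by blast
  then have "\<delta> w : X" if "w : carrier W" for w using that by (auto simp: X0_def)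
  then have "carrier M \<subseteq> X" using generated_by_\<delta> X by blast
  then show ?thesis using XD(1) by blast
 qed simp
qed

end

text \<open>An isomorphism carries the \<open>\<psi>\<close>-eigenspace of \<open>N\<close> into the
  \<open>\<psi>\<close>-eigenspace, that is, one copy of the inducing space into the other;
  \<open>L\<close> reads this off at the unit.\<close>

lemma ind_iso_imp_intertwiner:
 assumes 1: "ind_clifford G W H \<sigma> N \<psi>" and 2: "ind_clifford G W' H \<sigma>' N \<psi>"
  and iso: "rep_iso G (ind_module G H W \<sigma>) (ind_rep G H W \<sigma>) (ind_module G H W' \<sigma>') (ind_rep G H W' \<sigma>')"
 shows "EX A. intertwiner (G(|carrier := H|)) W \<sigma> W' \<sigma>' A & (ALL w:carrier W. w ~= 0_{W} --> A w ~= 0_{W'})"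
proof -
 interpret A: ind_clifford G W H \<sigma> N \<psi> by fact
 interpret B: ind_clifford G W' H \<sigma>' N \<psi> by fact
 obtain T where lin: "T : linear_maps CC A.M B.M" and bij: "bij_betw T (carrier A.M) (carrier B.M)"
  and int: "!!g f. g : carrier G ==> f : carrier A.M ==> T (A.R g f) = B.R g (T f)"
  using iso by (auto simp: rep_iso_def)
 note cl = linear_mapsD(1)[OF lin]
 define L where "L w = T (A.\<delta> w) 1_{G}" for w
 have eig: "T (A.\<delta> w) = B.\<delta> (L w)" if w: "w : carrier W" for w
  unfolding L_def
 proof (rule B.eigen_supported)
  fix n assume n: "n : N"
  then show "B.R n (T (A.\<delta> w)) = \<psi> n \<odot>_{B.M} T (A.\<delta> w)"
   using int[OF A.NG[OF n] A.\<delta>_closed[OF w]] A.\<delta>_eigen[OF n w]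
    linear_mapsD(3)[OF lin _ A.\<delta>_closed[OF w], of "\<psi> n"] by simp
 qed (use cl A.\<delta>_closed[OF w] in auto)
 have "intertwiner (G(|carrier := H|)) W \<sigma> W' \<sigma>' L"
  unfolding intertwiner_def
 proof (intro conjI ballI linear_mapsI)
  fix h w assume "h : carrier (G(|carrier := H|))" and w: "w : carrier W"
  then have h: "h : H" by simp
  have "L (\<sigma> h w) = B.R h (T (A.\<delta> w)) 1_{G}"
   unfolding L_def A.R_\<delta>[OF h w, symmetric] using int[OF A.HG[OF h] A.\<delta>_closed[OF w]] by simp
  also have "\<dots> = T (A.\<delta> w) (h *_{G} 1_{G})" using cl A.\<delta>_closed[OF w] A.HG[OF h] by simp
  also have "\<dots> = \<sigma>' h (L w)" unfolding L_def using cl A.\<delta>_closed[OF w] h by (intro B.M_equiv) auto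
  finally show "L (\<sigma> h w) = \<sigma>' h (L w)" .
 next
  fix x y assume "x : carrier W" "y : carrier W"
  then show "L (x +_{W} y) = L x +_{W'} L y"
   using linear_mapsD(2)[OF lin A.\<delta>_closed A.\<delta>_closed] by (simp add: L_def A.\<delta>_add B.M_simps)
 next
  fix a x assume "x : carrier W"
  then show "L (a \<odot>_{W} x) = a \<odot>_{W'} L x"
   using linear_mapsD(3)[OF lin _ A.\<delta>_closed] by (simp add: L_def A.\<delta>_smult B.M_simps)
 qed (use cl A.\<delta>_closed in \<open>auto simp: L_def\<close>)
 moreover have "L w ~= 0_{W'}" if w: "w : carrier W" "w ~= 0_{W}" for w
 proof
  assume "L w = 0_{W'}"
  moreover have "B.\<delta> 0_{W'} = 0_{B.M}"
   using B.\<delta>_smult[of "0_{W'}" 0] B.\<delta>_closed[of "0_{W'}"] by simp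
  ultimately have "T (A.\<delta> w) = T 0_{A.M}"
   using eig[OF w(1)] linear_maps_zero[OF A.M.cvs_axioms B.M.cvs_axioms lin] by simp
  then have "A.\<delta> w = 0_{A.M}"
   using bij A.\<delta>_closed[OF w(1)] by (simp add: bij_betw_def inj_on_def)
  then show False using w A.\<delta>_one[OF w(1)] A.M_simps(3)[OF A.Gp.one_closed] by metis
 qed
 ultimately show ?thesis by blast
qed

section \<open>The parametrization by characters of the centralizer\<close>

text \<open>The inverse in \<open>GL CC V\<close> is a definite description; this reduces it to a
  pointwise inverse, so that the inverses in the hypothesis on \<open>U\<close> can be
  computed.\<close>

lemma GL_inv_eqI:
 assumes "f : carrier (GL CC V)" "f' : carrier (GL CC V)"
  "!!v. v : carrier V ==> f' (f v) = v" "!!v. v : carrier V ==> f (f' v) = v"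
 shows "inv_{GL CC V} f = f'"
 unfolding m_inv_def
proof (rule the_equality)
 have comp: "g *_{GL CC V} h = 1_{GL CC V} \<longleftrightarrow> (ALL v:carrier V. g (h v) = v)"
  if "g : carrier (GL CC V)" "h : carrier (GL CC V)" for g h
  using that by (auto simp: GL_simps(2,3) compose_def fun_eq_iff restrict_def)
 show "f' : carrier (GL CC V) & f *_{GL CC V} f' = 1_{GL CC V} & f' *_{GL CC V} f = 1_{GL CC V}"
  using assms by (simp add: comp)
 fix g assume g: "g : carrier (GL CC V) & f *_{GL CC V} g = 1_{GL CC V} & g *_{GL CC V} f = 1_{GL CC V}"
 show "g = f'"
 proof (rule extensionalityI[of _ "carrier V"])
  fix v assume v: "v : carrier V"
  then have "f' v : carrier V" using assms(2) by (auto simp: GL_simps Bij_def bij_betw_def)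
  moreover have "g : carrier (GL CC V)" "g *_{GL CC V} f = 1_{GL CC V}" using g by auto
  ultimately have "g (f (f' v)) = f' v" using comp[of g f] assms(1) by blast
  then show "g v = f' v" using assms(4)[OF v] by simp
 qed (use g assms in \<open>auto simp: GL_simps Bij_def\<close>)
qed

text \<open>The group theory common to both parities: \<open>N\<close> is \<open>K r (l r)\<close>,
  \<open>H\<close> is \<open>K r (l' r)\<close>, \<open>C\<close> the centralizer and
  \<open>T\<close> the stabilizer. The family \<open>\<psi>Z\<close> lists the extensions of
  \<open>\<psi>\<close> to \<open>Z\<close>, each once (\<open>\<psi>Z_inj\<close>) and all of them
  (\<open>\<psi>Z_surj\<close>). For odd \<open>r\<close> the index is the character
  \<open>\<rho>\<close>; for even \<open>r\<close> one has \<open>N = Z = H\<close> and a single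
  index.\<close>

locale heis_data =
 fixes G :: "('g, 'x) monoid_scheme" (structure) and N Z H C T :: "'g set" and \<psi> :: "'g => complex"
  and I :: "'i set" and \<psi>Z :: "'i => 'g => complex"
  and V :: "'i => (complex, 'v, 'y) module_scheme" and P U :: "'i => 'g => 'v => 'v"
 assumes grp: "group G" and fin: "finite (carrier G)"
  and N_normal: "N \<lhd> G" and H_normal: "H \<lhd> G" and Z_subgroup: "subgroup Z G"
  and C_subgroup: "subgroup C G" and T_subgroup: "subgroup T G"
  and NZ: "N \<subseteq> Z" and ZH: "Z \<subseteq> H"
  and C_comm: "!!c d. c : C ==> d : C ==> c \<otimes> d = d \<otimes> c"
  and T_eq: "T = {c \<otimes> h | c h. c : C & h : H}"
  and \<psi>_mult: "!!n n'. n : N ==> n' : N ==> \<psi> (n \<otimes> n') = \<psi> n * \<psi> n'"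
  and stab: "!!x n. x : T ==> n : N ==> \<psi> (x \<otimes> n \<otimes> inv x) = \<psi> n"
  and not_stab: "!!x. x : carrier G ==> x \<notin> T ==> EX n:N. \<psi> (x \<otimes> n \<otimes> inv x) ~= \<psi> n"
  and CHZ: "C \<inter> H \<subseteq> Z" and Z_decomp: "!!z. z : Z ==> EX c:C \<inter> H. EX n:N. z = c \<otimes> n"
  and comm_N: "!!h k. h : H ==> k : H ==> inv k \<otimes> h \<otimes> k \<otimes> inv h : N"
  and comm_Z: "!!h k. h : Z ==> k : H ==> \<psi> (inv k \<otimes> h \<otimes> k \<otimes> inv h) = 1"
  and nondeg: "!!h. h : H ==> h \<notin> Z ==> EX k:H. \<psi> (inv k \<otimes> h \<otimes> k \<otimes> inv h) ~= 1"
  and P_irr: "!!i. i : I ==> irreducible_rep (G(|carrier := H|)) (V i) (P i)"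
  and P_char: "!!i. i : I ==> contains_character (V i) (P i) Z (\<psi>Z i)"
  and U_hom: "!!i. i : I ==> U i : hom (G(|carrier := C|)) (GL CC (V i))"
  and U_conj: "!!i g x v. i : I ==> g : C ==> x : H ==> v : carrier (V i) ==>
   P i (inv g \<otimes> x \<otimes> g) v = (inv_{GL CC (V i)} (U i g)) (P i x (U i g v))"
  and U_one: "!!i g. i : I ==> g : C \<inter> H ==> U i g = 1_{GL CC (V i)}"
  and \<psi>Z_N: "!!i n. i : I ==> n : N ==> \<psi>Z i n = \<psi> n"
  and \<psi>Z_inj: "!!i j. i : I ==> j : I ==> ALL z:Z. \<psi>Z i z = \<psi>Z j z ==> i = j"
  and \<psi>Z_surj: "!!\<chi>. [|!!z w. z : Z ==> w : Z ==> \<chi> (z \<otimes> w) = \<chi> z * \<chi> w;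
   !!n. n : N ==> \<chi> n = \<psi> n; !!z. z : Z ==> \<chi> z ~= 0|] ==> EX i:I. ALL z:Z. \<psi>Z i z = \<chi> z"
  and \<psi>_nz: "!!n. n : N ==> \<psi> n ~= 0"
begin

sublocale group G by (rule grp)

definition Theta :: "('g => complex) set" where
 "Theta = {\<theta> : characters (G(|carrier := C|)). ALL n:C \<inter> N. \<theta> n = \<psi> n}"

text \<open>The extension of \<open>\<psi>\<close> to \<open>Z\<close> that is compatible with
  \<open>\<theta>\<close>; for odd \<open>r\<close> it becomes \<open>rho_of\<close>.\<close>

definition idx :: "('g => complex) => 'i" where
 "idx \<theta> = (THE i. i : I & (ALL g:C \<inter> H. \<theta> g = \<psi>Z i g))"

lemma HG: "h : H ==> h : carrier G" and CG: "c : C ==> c : carrier G"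
 using subgroup.subset[OF normal_imp_subgroup[OF H_normal]] subgroup.subset[OF C_subgroup] by auto

lemma NH: "n : N ==> n : H" and ZG: "z : Z ==> z : carrier G" and NG: "n : N ==> n : carrier G"
 using NZ ZH HG by auto

lemma H_subgroup: "subgroup H G" and N_subgroup: "subgroup N G"
 using normal_imp_subgroup H_normal N_normal by auto

lemma C_closed: "c : C ==> d : C ==> c \<otimes> d : C" "\<one> : C" "c : C ==> inv c : C"
 and H_closed: "h : H ==> k : H ==> h \<otimes> k : H" "\<one> : H" "h : H ==> inv h : H"
 and N_closed: "n : N ==> n' : N ==> n \<otimes> n' : N" "\<one> : N" "n : N ==> inv n : N"
 and Z_closed: "z : Z ==> w : Z ==> z \<otimes> w : Z" "\<one> : Z" "z : Z ==> inv z : Z"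
 using C_subgroup H_subgroup N_subgroup Z_subgroup
 by (auto simp: subgroup.m_closed subgroup.one_closed subgroup.m_inv_closed)

lemma CT: "c : C ==> c : T" and HT: "h : H ==> h : T"
proof -
 show "c : T" if "c : C" using that CG H_closed(2) unfolding T_eq by force
 show "h : T" if "h : H" using that HG C_closed(2) unfolding T_eq by force
qed

lemma TG: "x : T ==> x : carrier G"
 using T_subgroup subgroup.subset by blast

lemma conj_H: "x : carrier G ==> h : H ==> inv x \<otimes> h \<otimes> x : H"
 and conj_N: "x : carrier G ==> n : N ==> inv x \<otimes> n \<otimes> x : N"
 by (auto intro: normal.inv_op_closed1[OF H_normal] normal.inv_op_closed1[OF N_normal])

lemma \<psi>_conj: "x : T ==> n : N ==> \<psi> (inv x \<otimes> n \<otimes> x) = \<psi> n"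
 using stab[of "inv x" n] subgroup.m_inv_closed[OF T_subgroup] TG by simp

lemma group_H: "group (G(|carrier := H|))" and group_C: "group (G(|carrier := C|))"
 and group_T: "group (G(|carrier := T|))"
 using subgroup_imp_group H_subgroup C_subgroup T_subgroup by auto

lemma inv_H: "h : H ==> inv_{G(|carrier := H|)} h = inv h"
 using m_inv_consistent[OF H_subgroup] by simp

lemma rep_P: "i : I ==> rep (G(|carrier := H|)) (V i) (P i)"
 using irreducible_imp_rep[OF group_H P_irr] .

lemma rep_U:
 assumes i: "i : I"
 shows "rep (G(|carrier := C|)) (V i) (U i)"
proof -
 interpret P: rep "G(|carrier := H|)" "V i" "P i" by (rule rep_P[OF i])
 show ?thesis
  using U_hom[OF i] group_C P.cvs_axioms by (simp add: rep_def rep_axioms_def)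
qed

text \<open>A simultaneous eigenspace of \<open>Z\<close> is stable under \<open>H\<close>, because \<open>\<psi>\<close> kills \<open>[H, Z]\<close>.\<close>

lemma Z_eigenspace_stable:
 assumes r: "rep (G(|carrier := H|)) W \<sigma>" and i: "i : I"
  and w: "w : carrier W" "!!z. z : Z ==> \<sigma> z w = \<psi>Z i z \<odot>_{W} w"
  and h: "h : H" and z: "z : Z"
 shows "\<sigma> z (\<sigma> h w) = \<psi>Z i z \<odot>_{W} \<sigma> h w"
proof -
 interpret S: rep "G(|carrier := H|)" W \<sigma> by fact
 define n where "n = inv h \<otimes> z \<otimes> h \<otimes> inv z"
 have n: "n : N" "\<psi> n = 1" using comm_N[OF _ h] comm_Z[OF z h] z ZH by (auto simp: n_def)
 have zH: "z : H" using z ZH by auto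
 have e: "z \<otimes> h = h \<otimes> (n \<otimes> z)"
  using HG[OF h] ZG[OF z] by (simp add: n_def m_assoc inv_solve_left)
   (simp add: m_assoc[symmetric])
 have "\<sigma> z (\<sigma> h w) = \<sigma> (h \<otimes> (n \<otimes> z)) w" using S.mult[of z h w] zH h w(1) e by simp
 also have "\<dots> = \<sigma> h (\<sigma> n (\<sigma> z w))" using S.mult h zH NH[OF n(1)] w(1) H_closed by simp
 also have "\<dots> = \<psi>Z i z \<odot>_{W} \<sigma> h w"
  using w n z NZ S.smul[of n w] S.smul[of h w] h NH[OF n(1)] \<psi>Z_N[OF i n(1)]
  by (auto simp: w(2)[OF z] S.smul)
 finally show ?thesis .
qed

text \<open>The eigenspace of \<open>Z\<close> is stable under \<open>H\<close> and contains the
  vector supplied by \<open>P_char\<close>, so irreducibility makes it the whole space.\<close>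

lemma P_scalar:
 assumes i: "i : I" and z: "z : Z" and v: "v : carrier (V i)"
 shows "P i z v = \<psi>Z i z \<odot>_{V i} v"
proof -
 interpret P: rep "G(|carrier := H|)" "V i" "P i" by (rule rep_P[OF i])
 let ?E = "{v : carrier (V i). ALL z:Z. P i z v = \<psi>Z i z \<odot>_{V i} v}"
 have "submodule ?E CC (V i)"
 proof (rule P.submodI)
  fix a b assume "a : ?E" "b : ?E"
  then show "a +_{V i} b : ?E" using ZH by (auto simp: P.add P.smult_add_right subset_iff)
 next
  fix a x assume x: "x : ?E"
  then have "a \<odot>_{V i} (c \<odot>_{V i} x) = c \<odot>_{V i} (a \<odot>_{V i} x)" for c
   by (simp add: P.smult_assoc[symmetric] mult.commute)
  then show "a \<odot>_{V i} x : ?E" using x ZH by (auto simp: P.smul subset_iff)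
 qed (use ZH in auto)
 moreover have "ALL h:H. P i h ` ?E \<subseteq> ?E"
 proof (intro ballI subsetI)
  fix h y assume h: "h : H" and "y : P i h ` ?E"
  then obtain w where w: "w : carrier (V i)" "!!z. z : Z ==> P i z w = \<psi>Z i z \<odot>_{V i} w" "y = P i h w"
   by auto
  have "P i z y = \<psi>Z i z \<odot>_{V i} y" if "z : Z" for z
   unfolding w(3) by (rule Z_eigenspace_stable[OF rep_P[OF i] i w(1,2) h that])
  moreover have "y : carrier (V i)" using w h by simp
  ultimately show "y : ?E" by blast
 qed
 moreover obtain v0 where v0: "v0 : carrier (V i)" "v0 ~= 0_{V i}" "ALL z:Z. P i z v0 = \<psi>Z i z \<odot>_{V i} v0"
  using P_char[OF i] by (auto simp: contains_character_def)
 moreover have "!!Y. submodule Y CC (V i) ==> ALL h:H. P i h ` Y \<subseteq> Y ==> Y = {0_{V i}} \<or> Y = carrier (V i)"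
  using P_irr[OF i] by (simp add: irreducible_rep_def)
 ultimately have "?E = carrier (V i)" by blast
 then show ?thesis using z v by blast
qed

lemma V_nonzero:
 assumes i: "i : I"
 shows "EX v:carrier (V i). v ~= 0_{V i}"
 using P_char[OF i] by (auto simp: contains_character_def)

lemma \<theta>_mult:
 assumes "\<theta> : Theta" "c : C" "d : C"
 shows "\<theta> (c \<otimes> d) = \<theta> c * \<theta> d" "\<theta> c ~= 0"
proof -
 have h: "\<theta> : hom (G(|carrier := C|)) (units_of CC)" using assms by (simp add: Theta_def characters_def)
 show "\<theta> (c \<otimes> d) = \<theta> c * \<theta> d" using hom_mult[OF h] assms by (simp add: units_of_def)
 have "\<theta> c : Units CC" using h assms by (auto simp: hom_def units_of_def)
 then show "\<theta> c ~= 0" by (auto simp: Units_def)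
qed

lemma \<theta>_one: "\<theta> : Theta ==> \<theta> \<one> = 1"
 using \<theta>_mult[of \<theta> \<one> \<one>] C_closed by auto

lemma \<psi>_one: "\<psi> \<one> = 1"
 using \<psi>_mult[of \<one> \<one>] \<psi>_nz[of \<one>] N_closed by auto

text \<open>On \<open>Z\<close>, where every element is a product of some \<open>c\<close> in
  \<open>C \<inter> H\<close> and some \<open>n\<close> in \<open>N\<close>, put
  \<open>\<chi> (c \<otimes> n) = \<theta> c * \<psi> n\<close>. This is well defined since
  \<open>\<theta>\<close> and \<open>\<psi>\<close> agree on \<open>C \<inter> N\<close>, and
  multiplicative since \<open>\<psi>\<close> is invariant under \<open>C\<close>; so it occurs in
  the family \<open>\<psi>Z\<close>.\<close>

lemma idx_ex1:
 assumes \<theta>: "\<theta> : Theta"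
 shows "EX! i. i : I & (ALL g:C \<inter> H. \<theta> g = \<psi>Z i g)"
proof -
 define \<chi> where "\<chi> z = (let p = (SOME p. fst p : C \<inter> H & snd p : N & z = fst p \<otimes> snd p) in \<theta> (fst p) * \<psi> (snd p))" for z
 have \<theta>N: "\<theta> n = \<psi> n" if "n : C" "n : N" for n using \<theta> that by (auto simp: Theta_def)
 have \<chi>: "\<chi> (c \<otimes> n) = \<theta> c * \<psi> n" if c: "c : C \<inter> H" and n: "n : N" for c n
 proof -
  define p where "p = (SOME p. fst p : C \<inter> H & snd p : N & c \<otimes> n = fst p \<otimes> snd p)"
  have "fst p : C \<inter> H & snd p : N & c \<otimes> n = fst p \<otimes> snd p"
   unfolding p_def by (rule someI[of _ "(c, n)"]) (use c n in auto)
  then obtain d m where p: "p = (d, m)" and d: "d : C" "d : H" and m: "m : N" and e: "c \<otimes> n = d \<otimes> m"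
   by (cases p) auto
  have G: "c : carrier G" "n : carrier G" "d : carrier G" "m : carrier G" using c d n m CG NG by auto
  have q: "inv d \<otimes> c = m \<otimes> inv n"
   using e G by (metis inv_closed inv_solve_left inv_solve_right m_assoc m_closed)
  have a: "inv d \<otimes> c : C" "m \<otimes> inv n : N" using c d n m C_closed N_closed by auto
  then have "\<theta> (inv d \<otimes> c) = \<psi> (m \<otimes> inv n)" using \<theta>N q by simp
  moreover have "\<theta> c = \<theta> d * \<theta> (inv d \<otimes> c)"
   using \<theta>_mult(1)[OF \<theta> d(1) a(1)] G by (simp add: m_assoc[symmetric])
  moreover have "\<psi> m = \<psi> (m \<otimes> inv n) * \<psi> n"
   using \<psi>_mult[OF a(2) n] G by (simp add: m_assoc)
  ultimately have "\<theta> d * \<psi> m = \<theta> c * \<psi> n" by simp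
  moreover have "\<chi> (c \<otimes> n) = \<theta> (fst p) * \<psi> (snd p)" unfolding \<chi>_def Let_def p_def ..
  ultimately show ?thesis by (simp add: p)
 qed
 have "EX i:I. ALL z:Z. \<psi>Z i z = \<chi> z"
 proof (rule \<psi>Z_surj)
  fix z w assume "z : Z" "w : Z"
  then obtain c n d m where z: "c : C \<inter> H" "n : N" "z = c \<otimes> n" and w: "d : C \<inter> H" "m : N" "w = d \<otimes> m"
   using Z_decomp by meson
  have G: "c : carrier G" "n : carrier G" "d : carrier G" "m : carrier G" using z w CG NG by auto
  have "z \<otimes> w = (c \<otimes> d) \<otimes> ((inv d \<otimes> n \<otimes> d) \<otimes> m)"
   using G unfolding z(3) w(3) by (simp add: m_assoc inv_solve_left) (simp add: m_assoc[symmetric])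
  moreover have "c \<otimes> d : C \<inter> H" "inv d \<otimes> n \<otimes> d : N" using z w C_closed H_closed conj_N G by auto
  ultimately have "\<chi> (z \<otimes> w) = \<theta> (c \<otimes> d) * (\<psi> (inv d \<otimes> n \<otimes> d) * \<psi> m)"
   using \<chi>[of "c \<otimes> d" "(inv d \<otimes> n \<otimes> d) \<otimes> m"] \<psi>_mult w N_closed by simp
  also have "\<dots> = \<chi> z * \<chi> w"
   using \<chi> z w \<theta>_mult(1)[OF \<theta>] \<psi>_conj[OF CT] by simp
  finally show "\<chi> (z \<otimes> w) = \<chi> z * \<chi> w" .
 next
  fix n assume n: "n : N"
  then show "\<chi> n = \<psi> n" using \<chi>[of \<one> n] C_closed H_closed \<theta>_one[OF \<theta>] NG by simp
 next
  fix z assume "z : Z"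
  then obtain c n where "c : C \<inter> H" "n : N" "z = c \<otimes> n" using Z_decomp by meson
  then show "\<chi> z ~= 0" using \<chi> \<theta>_mult(2)[OF \<theta>] \<psi>_nz by auto
 qed
 then obtain i where i: "i : I" "ALL z:Z. \<psi>Z i z = \<chi> z" by blast
 have iC: "\<theta> g = \<psi>Z i g" if g: "g : C \<inter> H" for g
 proof -
  have "\<chi> (g \<otimes> \<one>) = \<theta> g * \<psi> \<one>" by (rule \<chi>[OF g N_closed(2)])
  then have "\<chi> g = \<theta> g" using g CG \<psi>_one by auto
  then show ?thesis using i CHZ g by auto
 qed
 show ?thesis
 proof (rule ex1I[of _ i])
  fix j assume j: "j : I & (ALL g:C \<inter> H. \<theta> g = \<psi>Z j g)"
  have "\<psi>Z j z = \<psi>Z i z" if z: "z : Z" for z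
  proof -
   obtain c n where c: "c : C \<inter> H" "n : N" "z = c \<otimes> n" using Z_decomp z by meson
   \<comment> \<open>Multiplicativity of \<open>\<psi>Z k\<close> is read off from its scalar action
     on the nonzero space \<open>V k\<close>.\<close>
   have mult: "\<psi>Z k (c \<otimes> n) = \<psi>Z k c * \<psi>Z k n" if k: "k : I" for k
   proof -
    interpret P: rep "G(|carrier := H|)" "V k" "P k" by (rule rep_P[OF k])
    obtain v where v: "v : carrier (V k)" "v ~= 0_{V k}" using V_nonzero[OF k] by blast
    have zs: "c : Z" "n : Z" using c CHZ NZ by auto
    have "\<psi>Z k (c \<otimes> n) \<odot>_{V k} v = P k (c \<otimes> n) v" using P_scalar[OF k] zs Z_closed v by simp
    also have "\<dots> = P k c (P k n v)" using P.mult[of c n v] zs ZH v by auto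
    also have "\<dots> = \<psi>Z k c \<odot>_{V k} (\<psi>Z k n \<odot>_{V k} v)" using P_scalar[OF k] zs v by simp
    also have "\<dots> = (\<psi>Z k c * \<psi>Z k n) \<odot>_{V k} v" using v by (simp add: P.smult_assoc)
    finally show ?thesis using P.smult_cancel v by blast
   qed
   have "\<psi>Z j c = \<psi>Z i c" using j iC c(1) by metis
   then show ?thesis using mult[of i] mult[of j] i(1) j \<psi>Z_N c by simp
  qed
  then show "j = i" using \<psi>Z_inj j i by blast
 qed (use i iC in auto)
qed

lemma idx:
 assumes "\<theta> : Theta"
 shows "idx \<theta> : I" "!!g. g : C ==> g : H ==> \<theta> g = \<psi>Z (idx \<theta>) g"
 using theI'[OF idx_ex1[OF assms]] by (auto simp: idx_def)

lemma idx_eqI: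
 assumes "\<theta> : Theta" "i : I" "!!g. g : C ==> g : H ==> \<theta> g = \<psi>Z i g"
 shows "idx \<theta> = i"
 unfolding idx_def using idx_ex1[OF assms(1)] assms by (intro the1_equality) auto

lemma U_inv:
 assumes i: "i : I" and g: "g : C"
 shows "inv_{GL CC (V i)} (U i g) = U i (inv g)"
proof -
 interpret U: rep "G(|carrier := C|)" "V i" "U i" by (rule rep_U[OF i])
 have "inv_{G(|carrier := C|)} g = inv g" using m_inv_consistent[OF C_subgroup g] by simp
 then show ?thesis
  using U.in_GL[of g] U.in_GL[of "inv g"] U.rep_inv[of g] g C_closed by (intro GL_inv_eqI) auto
qed

lemma U_P:
 assumes i: "i : I" and g: "g : C" and x: "x : H" and v: "v : carrier (V i)"
 shows "U i g (P i (inv g \<otimes> x \<otimes> g) v) = P i x (U i g v)"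
proof -
 interpret P: rep "G(|carrier := H|)" "V i" "P i" by (rule rep_P[OF i])
 interpret U: rep "G(|carrier := C|)" "V i" "U i" by (rule rep_U[OF i])
 have "inv_{G(|carrier := C|)} g = inv g" using m_inv_consistent[OF C_subgroup g] by simp
 then show ?thesis
  using U_conj[OF i g x v] U_inv[OF i g] U.rep_inv(2)[of g "P i x (U i g v)"] g x v by simp
qed

end

section \<open>Spaces of intertwiners\<close>

definition hom_module ::
 "('g, 'x) monoid_scheme => (complex, 'v, 'y) module_scheme => ('g => 'v => 'v) =>
  (complex, 'w, 'z) module_scheme => ('g => 'w => 'w) => (complex, 'v => 'w) module"
where
 "hom_module G V \<rho> W \<sigma> =
   (|carrier = {T. intertwiner G V \<rho> W \<sigma> T} \<inter> extensional (carrier V),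
   monoid.mult = undefined, one = undefined,
   zero = (\<lambda>v\<in>carrier V. 0_{W}),
   add = (%S T. \<lambda>v\<in>carrier V. S v +_{W} T v),
   smult = (%c T. \<lambda>v\<in>carrier V. c \<odot>_{W} T v)|)"

lemma hom_module_simps:
 "T : carrier (hom_module G V \<rho> W \<sigma>) \<longleftrightarrow> intertwiner G V \<rho> W \<sigma> T & T : extensional (carrier V)"
 "v : carrier V ==> (S +_{hom_module G V \<rho> W \<sigma>} T) v = S v +_{W} T v"
 "v : carrier V ==> (c \<odot>_{hom_module G V \<rho> W \<sigma>} T) v = c \<odot>_{W} T v"
 "v : carrier V ==> 0_{hom_module G V \<rho> W \<sigma>} v = 0_{W}"
 "S +_{hom_module G V \<rho> W \<sigma>} T : extensional (carrier V)"
 "c \<odot>_{hom_module G V \<rho> W \<sigma>} T : extensional (carrier V)"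
 "0_{hom_module G V \<rho> W \<sigma>} : extensional (carrier V)"
 by (auto simp: hom_module_def)

lemma intertwinerD:
 assumes "intertwiner G V \<rho> W \<sigma> T"
 shows "!!v. v : carrier V ==> T v : carrier W"
  "!!v w. v : carrier V ==> w : carrier V ==> T (v +_{V} w) = T v +_{W} T w"
  "!!c v. v : carrier V ==> T (c \<odot>_{V} v) = c \<odot>_{W} T v"
  "!!g v. g : carrier G ==> v : carrier V ==> T (\<rho> g v) = \<sigma> g (T v)"
 using assms by (auto simp: intertwiner_def linear_maps_def)

lemma intertwinerI:
 assumes "!!v. v : carrier V ==> T v : carrier W"
  "!!v w. v : carrier V ==> w : carrier V ==> T (v +_{V} w) = T v +_{W} T w"
  "!!c v. v : carrier V ==> T (c \<odot>_{V} v) = c \<odot>_{W} T v"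
  "!!g v. g : carrier G ==> v : carrier V ==> T (\<rho> g v) = \<sigma> g (T v)"
 shows "intertwiner G V \<rho> W \<sigma> T"
 using assms by (auto simp: intertwiner_def linear_maps_def)

text \<open>Intertwiners are kept extensional, so that two points of the space are equal as soon as
  they agree on the carrier; otherwise laws such as that of the zero element would fail as equations
  between functions.\<close>

lemma cvs_hom_module:
 assumes "rep G V \<rho>" "rep G W \<sigma>"
 shows "cvs (hom_module G V \<rho> W \<sigma>)"
proof -
 interpret V: rep G V \<rho> by fact
 interpret W: rep G W \<sigma> by fact
 let ?E = "hom_module G V \<rho> W \<sigma>"
 have val: "S v : carrier W" if "S : carrier ?E" "v : carrier V" for S v
  using that intertwinerD(1) by (auto simp: hom_module_simps)
 have ext: "S : extensional (carrier V)" if "S : carrier ?E" for S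
  using that by (simp add: hom_module_simps)
 note eqI = extensionalityI[of _ "carrier V"]
 have add: "S +_{?E} T : carrier ?E" if S: "S : carrier ?E" and T: "T : carrier ?E" for S T
 proof (subst hom_module_simps, intro conjI intertwinerI)
  note SD = intertwinerD[OF conjunct1[OF hom_module_simps(1)[THEN iffD1, OF S]]]
  note TD = intertwinerD[OF conjunct1[OF hom_module_simps(1)[THEN iffD1, OF T]]]
  fix v w c g
  show "(S +_{?E} T) v : carrier W" if "v : carrier V" using that SD TD by (simp add: hom_module_simps)
  show "(S +_{?E} T) (v +_{V} w) = (S +_{?E} T) v +_{W} (S +_{?E} T) w" if "v : carrier V" "w : carrier V"
   using that SD(1,2) TD(1,2) by (simp add: hom_module_simps W.M.add.m_ac)
  show "(S +_{?E} T) (c \<odot>_{V} v) = c \<odot>_{W} (S +_{?E} T) v" if "v : carrier V"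
   using that SD(1,3) TD(1,3) by (simp add: hom_module_simps W.smult_add_right)
  show "(S +_{?E} T) (\<rho> g v) = \<sigma> g ((S +_{?E} T) v)" if "g : carrier G" "v : carrier V"
   using that SD(1,4) TD(1,4) by (simp add: hom_module_simps W.add)
 qed (simp add: hom_module_simps)
 have smul: "c \<odot>_{?E} S : carrier ?E" if S: "S : carrier ?E" for c S
 proof (subst hom_module_simps, intro conjI intertwinerI)
  note SD = intertwinerD[OF conjunct1[OF hom_module_simps(1)[THEN iffD1, OF S]]]
  fix v w a g
  show "(c \<odot>_{?E} S) v : carrier W" if "v : carrier V" using that SD by (simp add: hom_module_simps)
  show "(c \<odot>_{?E} S) (v +_{V} w) = (c \<odot>_{?E} S) v +_{W} (c \<odot>_{?E} S) w" if "v : carrier V" "w : carrier V"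
   using that SD(1,2) by (simp add: hom_module_simps W.smult_add_right)
  show "(c \<odot>_{?E} S) (a \<odot>_{V} v) = a \<odot>_{W} (c \<odot>_{?E} S) v" if "v : carrier V"
   using that SD(1,3) by (simp add: hom_module_simps W.smult_assoc[symmetric] mult.commute)
  show "(c \<odot>_{?E} S) (\<rho> g v) = \<sigma> g ((c \<odot>_{?E} S) v)" if "g : carrier G" "v : carrier V"
   using that SD(1,4) by (simp add: hom_module_simps W.smul)
 qed (simp add: hom_module_simps)
 have zero: "0_{?E} : carrier ?E"
  by (subst hom_module_simps, intro conjI intertwinerI) (auto simp: hom_module_simps)
 show ?thesis
 proof (rule cvsI)
  show "!!x y z. x : carrier ?E ==> y : carrier ?E ==> z : carrier ?E ==>
    x +_{?E} y +_{?E} z = x +_{?E} (y +_{?E} z)"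
   by (rule eqI) (auto simp: hom_module_simps(2-) val W.M.add.m_assoc)
  show "!!x y. x : carrier ?E ==> y : carrier ?E ==> x +_{?E} y = y +_{?E} x"
   by (rule eqI) (auto simp: hom_module_simps(2-) val W.M.add.m_comm)
  show "!!x. x : carrier ?E ==> 0_{?E} +_{?E} x = x"
   by (rule eqI) (auto simp: hom_module_simps(2-) val ext)
  show "!!a b x. x : carrier ?E ==> (a + b) \<odot>_{?E} x = a \<odot>_{?E} x +_{?E} b \<odot>_{?E} x"
   by (rule eqI) (auto simp: hom_module_simps(2-) val W.smult_add_left)
  show "!!a x y. x : carrier ?E ==> y : carrier ?E ==>
    a \<odot>_{?E} (x +_{?E} y) = a \<odot>_{?E} x +_{?E} a \<odot>_{?E} y"
   by (rule eqI) (auto simp: hom_module_simps(2-) val W.smult_add_right)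
  show "!!a b x. x : carrier ?E ==> (a * b) \<odot>_{?E} x = a \<odot>_{?E} (b \<odot>_{?E} x)"
   by (rule eqI) (auto simp: hom_module_simps(2-) val W.smult_assoc)
  show "!!x. x : carrier ?E ==> 1 \<odot>_{?E} x = x"
   by (rule eqI) (auto simp: hom_module_simps(2-) val ext)
  show "!!x. x : carrier ?E ==> 0 \<odot>_{?E} x = 0_{?E}"
   by (rule eqI) (auto simp: hom_module_simps(2-) val ext)
 qed (use add smul zero in auto)
qed

text \<open>\<open>s\<close> is prescribed for every factorization \<open>g \<otimes> h\<close>,
  although factorizations are not unique; \<open>factor_indep\<close> will show that the actual
  representations meet this requirement.\<close>

locale heis_sigma = heis_data +
 fixes s :: "('a => complex) => 'a => 'd => 'd"
 assumes s_eq: "!!\<theta> g h. \<theta> : Theta ==> g : C ==> h : H ==>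
  s \<theta> (g \<otimes> h) = (\<lambda>v\<in>carrier (V (idx \<theta>)). \<theta> g \<odot>_{V (idx \<theta>)} U (idx \<theta>) g (P (idx \<theta>) h v))"
begin

lemma s_apply:
 assumes "\<theta> : Theta" "g : C" "h : H" "v : carrier (V (idx \<theta>))"
 shows "s \<theta> (g \<otimes> h) v = \<theta> g \<odot>_{V (idx \<theta>)} U (idx \<theta>) g (P (idx \<theta>) h v)"
 using s_eq[OF assms(1-3)] assms(4) by simp

lemma s_H:
 assumes \<theta>: "\<theta> : Theta" and h: "h : H" and v: "v : carrier (V (idx \<theta>))"
 shows "s \<theta> h v = P (idx \<theta>) h v"
proof -
 interpret U: rep "G(|carrier := C|)" "V (idx \<theta>)" "U (idx \<theta>)" by (rule rep_U[OF idx(1)[OF \<theta>]])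
 interpret P: rep "G(|carrier := H|)" "V (idx \<theta>)" "P (idx \<theta>)" by (rule rep_P[OF idx(1)[OF \<theta>]])
 show ?thesis
  using s_apply[OF \<theta> C_closed(2) h v] HG[OF h] h v \<theta>_one[OF \<theta>] U.rep_one[of "P (idx \<theta>) h v"] by simp
qed

text \<open>Sorting \<open>g h g' h'\<close> into \<open>(g g') (k h')\<close>, with
  \<open>k\<close> the conjugate of \<open>h\<close> by \<open>g'\<close>, turns multiplicativity
  into the rule that \<open>U\<close> intertwines \<open>P\<close> with its conjugates.\<close>

lemma rep_s:
 assumes \<theta>: "\<theta> : Theta"
 shows "rep (G(|carrier := T|)) (V (idx \<theta>)) (s \<theta>)"
proof -
 let ?V = "V (idx \<theta>)"
 note i = idx(1)[OF \<theta>]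
 interpret U: rep "G(|carrier := C|)" ?V "U (idx \<theta>)" by (rule rep_U[OF i])
 interpret P: rep "G(|carrier := H|)" ?V "P (idx \<theta>)" by (rule rep_P[OF i])
 show ?thesis
 proof (rule repI[OF group_T U.cvs_axioms])
  fix x assume "x : carrier (G(|carrier := T|))"
  then obtain g h where x: "x = g \<otimes> h" "g : C" "h : H" by (auto simp: T_eq)
  show "s \<theta> x : extensional (carrier ?V)" using s_eq[OF \<theta> x(2,3)] x(1) by simp
  show "s \<theta> x : linear_maps CC ?V ?V"
  proof (rule linear_mapsI)
   fix v assume v: "v : carrier ?V"
   then show "s \<theta> x v : carrier ?V" using x s_apply[OF \<theta> x(2,3) v] by simp
   fix c
   have "c \<odot>_{?V} v : carrier ?V" using v by simp
   then show "s \<theta> x (c \<odot>_{?V} v) = c \<odot>_{?V} s \<theta> x v"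
    using x v s_apply[OF \<theta> x(2,3)]
    by (simp add: P.smul U.smul U.smult_assoc[symmetric] mult.commute)
  next
   fix v w assume vw: "v : carrier ?V" "w : carrier ?V"
   then have "v +_{?V} w : carrier ?V" by simp
   then show "s \<theta> x (v +_{?V} w) = s \<theta> x v +_{?V} s \<theta> x w"
    using x vw s_apply[OF \<theta> x(2,3)] by (simp add: P.add U.add U.smult_add_right)
  qed
 next
  fix v assume v: "v : carrier ?V"
  then show "s \<theta> 1_{G(|carrier := T|)} v = v" using s_H[OF \<theta> H_closed(2) v] P.rep_one[OF v] by simp
 next
  fix x y v assume "x : carrier (G(|carrier := T|))" "y : carrier (G(|carrier := T|))" and v: "v : carrier ?V"
  then obtain g h g' h' where x: "x = g \<otimes> h" "g : C" "h : H" and y: "y = g' \<otimes> h'" "g' : C" "h' : H"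
   unfolding T_eq by auto
  have G: "g : carrier G" "h : carrier G" "g' : carrier G" "h' : carrier G" using x y CG HG by auto
  define k where "k = inv g' \<otimes> h \<otimes> g'"
  have k: "k : H" "k : carrier G" using conj_H[OF G(3) x(3)] HG by (auto simp: k_def)
  have "g' \<otimes> k = h \<otimes> g'" using G by (simp add: k_def m_assoc) (simp add: m_assoc[symmetric])
  then have "x \<otimes> y = (g \<otimes> g') \<otimes> (k \<otimes> h')"
   using G k unfolding x(1) y(1) by (metis m_assoc m_closed)
  then have "s \<theta> (x \<otimes> y) v = \<theta> (g \<otimes> g') \<odot>_{?V} U (idx \<theta>) (g \<otimes> g') (P (idx \<theta>) (k \<otimes> h') v)"
   using s_apply[OF \<theta> C_closed(1)[OF x(2) y(2)] H_closed(1)[OF k(1) y(3)] v] by simp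
  also have "P (idx \<theta>) (k \<otimes> h') v = P (idx \<theta>) k (P (idx \<theta>) h' v)"
   using P.mult[of k h' v] k y v by simp
  also have "U (idx \<theta>) (g \<otimes> g') \<dots> = U (idx \<theta>) g (U (idx \<theta>) g' \<dots>)"
   using U.mult[of g g' "P (idx \<theta>) k (P (idx \<theta>) h' v)"] x y k v by simp
  also have "U (idx \<theta>) g' (P (idx \<theta>) k (P (idx \<theta>) h' v)) = P (idx \<theta>) h (U (idx \<theta>) g' (P (idx \<theta>) h' v))"
   unfolding k_def using U_P[OF i y(2) x(3)] y v by simp
  also have "\<theta> (g \<otimes> g') \<odot>_{?V} U (idx \<theta>) g \<dots> =
    \<theta> g \<odot>_{?V} U (idx \<theta>) g (P (idx \<theta>) h (\<theta> g' \<odot>_{?V} U (idx \<theta>) g' (P (idx \<theta>) h' v)))"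
   using \<theta>_mult(1)[OF \<theta> x(2) y(2)] x y v by (simp add: P.smul U.smul U.smult_assoc)
  also have "\<dots> = s \<theta> x (s \<theta> y v)"
   using x y v s_apply[OF \<theta> x(2,3)] s_apply[OF \<theta> y(2,3) v] by simp
  finally show "s \<theta> (x *_{G(|carrier := T|)} y) v = s \<theta> x (s \<theta> y v)" by simp
 qed
qed

text \<open>On the subgroup \<open>H\<close> this is \<open>P\<close>, which is irreducible
  already.\<close>

lemma irreducible_s:
 assumes \<theta>: "\<theta> : Theta"
 shows "irreducible_rep (G(|carrier := T|)) (V (idx \<theta>)) (s \<theta>)"
proof -
 let ?V = "V (idx \<theta>)"
 note i = idx(1)[OF \<theta>]
 interpret S: rep "G(|carrier := T|)" ?V "s \<theta>" by (rule rep_s[OF \<theta>])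
 have irr: "!!Y. submodule Y CC ?V ==> ALL h:H. P (idx \<theta>) h ` Y \<subseteq> Y ==> Y = {0_{?V}} \<or> Y = carrier ?V"
  and nz: "carrier ?V ~= {0_{?V}}"
  using P_irr[OF i] by (auto simp: irreducible_rep_def)
 have "Y = {0_{?V}} \<or> Y = carrier ?V" if Y: "submodule Y CC ?V" "ALL g:T. s \<theta> g ` Y \<subseteq> Y" for Y
 proof (rule irr[OF Y(1)], intro ballI)
  fix h assume h: "h : H"
  have "P (idx \<theta>) h ` Y = s \<theta> h ` Y"
   using s_H[OF \<theta> h] S.submodD(1)[OF Y(1)] by (intro image_cong) auto
  then show "P (idx \<theta>) h ` Y \<subseteq> Y" using Y(2) HT[OF h] by auto
 qed
 then show ?thesis using S.group_rep nz by (simp add: irreducible_rep_def)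
qed

lemma ind_clifford_s:
 assumes \<theta>: "\<theta> : Theta"
 shows "ind_clifford G (V (idx \<theta>)) T (s \<theta>) N \<psi>"
proof -
 interpret S: rep "G(|carrier := T|)" "V (idx \<theta>)" "s \<theta>" by (rule rep_s[OF \<theta>])
 show ?thesis
 proof (intro ind_clifford.intro ind_data.intro ind_data_axioms.intro ind_clifford_axioms.intro
   grp S.cvs_axioms fin T_subgroup N_normal)
  show "rep (G(|carrier := T|)) (V (idx \<theta>)) (s \<theta>)" by (rule rep_s[OF \<theta>])
  show "N \<subseteq> T" using NH HT by auto
 next
  fix n w assume n: "n : N" and w: "w : carrier (V (idx \<theta>))"
  then show "s \<theta> n w = \<psi> n \<odot>_{V (idx \<theta>)} w"
   using s_H[OF \<theta> NH[OF n] w] P_scalar[OF idx(1)[OF \<theta>] _ w] NZ \<psi>Z_N[OF idx(1)[OF \<theta>] n] by auto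
 next
  fix x assume "x : carrier G" "x \<notin> T"
  then show "EX n:N. \<psi> (x \<otimes> n \<otimes> inv x) ~= \<psi> n" by (rule not_stab)
 qed
qed

abbreviation "IM \<theta> \<equiv> ind_module G T (V (idx \<theta>)) (s \<theta>)"
abbreviation "IR \<theta> \<equiv> ind_rep G T (V (idx \<theta>)) (s \<theta>)"

lemma Ind_irreducible:
 assumes \<theta>: "\<theta> : Theta"
 shows "irreducible_rep G (IM \<theta>) (IR \<theta>)"
 using ind_clifford.irreducible_M[OF ind_clifford_s[OF \<theta>] irreducible_s[OF \<theta>]] .

text \<open>The functions \<open>\<delta> w\<close> are eigenvectors of \<open>N\<close> for
  \<open>\<psi>\<close>; they only have to be carried over to the coordinate model that represents
  the class.\<close>

lemma Ind_in_Irr: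
 assumes \<theta>: "\<theta> : Theta"
 shows "iso_class G (IM \<theta>) (IR \<theta>) : Irr_containing G N \<psi>"
proof -
 interpret I: ind_clifford G "V (idx \<theta>)" T "s \<theta>" N \<psi> by (rule ind_clifford_s[OF \<theta>])
 obtain d \<pi> where \<pi>: "irreducible_rep G (module_vec TYPE(complex) d) \<pi>"
  "rep_iso G (IM \<theta>) (IR \<theta>) (module_vec TYPE(complex) d) \<pi>"
  using irreducible_coordinates[OF grp fin Ind_irreducible[OF \<theta>]] by blast
 let ?D = "module_vec TYPE(complex) d"
 interpret D: rep G ?D \<pi> by (rule irreducible_imp_rep[OF grp \<pi>(1)])
 obtain L where L: "L : linear_maps CC (IM \<theta>) ?D" "bij_betw L (carrier (IM \<theta>)) (carrier ?D)"
  "!!g v. g : carrier G ==> v : carrier (IM \<theta>) ==> L (IR \<theta> g v) = \<pi> g (L v)"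
  using \<pi>(2) by (auto simp: rep_iso_def)
 obtain w where w: "w : carrier (V (idx \<theta>))" "w ~= 0_{V (idx \<theta>)}" using V_nonzero[OF idx(1)[OF \<theta>]] by blast
 have dM: "I.\<delta> w : carrier (IM \<theta>)" by (rule I.\<delta>_closed[OF w(1)])
 have "I.\<delta> w ~= 0_{IM \<theta>}" using I.\<delta>_one[OF w(1)] w I.M_simps(3)[OF one_closed] by metis
 moreover have "L 0_{IM \<theta>} = 0_{?D}" by (rule linear_maps_zero[OF I.M.cvs_axioms D.cvs_axioms L(1)])
 ultimately have "L (I.\<delta> w) ~= 0_{?D}"
  using L(2) dM I.M.M.zero_closed by (metis bij_betw_def inj_onD)
 moreover have "\<pi> n (L (I.\<delta> w)) = \<psi> n \<odot>_{?D} L (I.\<delta> w)" if n: "n : N" for n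
  using L(3)[OF NG[OF n] dM] I.\<delta>_eigen[OF n w(1)] linear_mapsD(3)[OF L(1) _ dM, of "\<psi> n"] by simp
 moreover have "L (I.\<delta> w) : carrier ?D" using linear_mapsD(1)[OF L(1) dM] .
 ultimately have "contains_character ?D \<pi> N \<psi>" unfolding contains_character_def by blast
 moreover have "iso_class G (IM \<theta>) (IR \<theta>) = iso_class G ?D \<pi>"
  by (rule iso_class_eqI[OF grp I.R.group_rep D.group_rep \<pi>(2)])
 ultimately show ?thesis unfolding Irr_containing_def using \<pi>(1) by blast
qed

lemma finite_H: "finite H"
 using finite_subset[OF _ fin] HG by blast

text \<open>The isomorphism restricts to a map \<open>A\<close> of the inducing spaces that is
  injective at zero. Comparing the action of \<open>Z\<close> gives equal indices, Schur's lemma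
  over \<open>H\<close> makes \<open>A\<close> a scalar, and comparing the action of
  \<open>C\<close> gives equal characters.\<close>

lemma Ind_inj:
 assumes \<theta>: "\<theta> : Theta" and \<theta>': "\<theta>' : Theta"
  and eq: "iso_class G (IM \<theta>) (IR \<theta>) = iso_class G (IM \<theta>') (IR \<theta>')"
 shows "\<theta> = \<theta>'"
proof -
 interpret I: ind_clifford G "V (idx \<theta>)" T "s \<theta>" N \<psi> by (rule ind_clifford_s[OF \<theta>])
 interpret J: ind_clifford G "V (idx \<theta>')" T "s \<theta>'" N \<psi> by (rule ind_clifford_s[OF \<theta>'])
 obtain d \<pi> where "irreducible_rep G (module_vec TYPE(complex) d) \<pi>"
  "rep_iso G (IM \<theta>') (IR \<theta>') (module_vec TYPE(complex) d) \<pi>"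
  using irreducible_coordinates[OF grp fin Ind_irreducible[OF \<theta>']] by blast
 then have "rep_iso G (IM \<theta>) (IR \<theta>) (IM \<theta>') (IR \<theta>')"
  using iso_class_eqD[OF grp I.R.group_rep J.R.group_rep eq] by (auto simp: irreducible_rep_def)
 from ind_iso_imp_intertwiner[OF ind_clifford_s[OF \<theta>] ind_clifford_s[OF \<theta>'] this]
 obtain A where A: "intertwiner (G(|carrier := T|)) (V (idx \<theta>)) (s \<theta>) (V (idx \<theta>')) (s \<theta>') A"
  and A0: "!!w. w : carrier (V (idx \<theta>)) ==> w ~= 0_{V (idx \<theta>)} ==> A w ~= 0_{V (idx \<theta>')}"
  by blast
 note AD = intertwinerD[OF A]
 note i = idx(1)[OF \<theta>] and j = idx(1)[OF \<theta>']
 interpret P: rep "G(|carrier := H|)" "V (idx \<theta>)" "P (idx \<theta>)" by (rule rep_P[OF i])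
 interpret P': rep "G(|carrier := H|)" "V (idx \<theta>')" "P (idx \<theta>')" by (rule rep_P[OF j])
 obtain w where w: "w : carrier (V (idx \<theta>))" "w ~= 0_{V (idx \<theta>)}" using V_nonzero[OF i] by blast
 have AH: "A (P (idx \<theta>) h v) = P (idx \<theta>') h (A v)" if "h : H" "v : carrier (V (idx \<theta>))" for h v
  using AD(4)[of h v] that HT s_H[OF \<theta> that] s_H[OF \<theta>' that(1) AD(1)[OF that(2)]] by simp
 have "\<psi>Z (idx \<theta>) z = \<psi>Z (idx \<theta>') z" if z: "z : Z" for z
 proof -
  have "\<psi>Z (idx \<theta>) z \<odot>_{V (idx \<theta>')} A w = A (P (idx \<theta>) z w)"
   using P_scalar[OF i z w(1)] AD(3)[OF w(1)] by simp
  also have "\<dots> = \<psi>Z (idx \<theta>') z \<odot>_{V (idx \<theta>')} A w"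
   using AH[OF _ w(1)] z ZH P_scalar[OF j z AD(1)[OF w(1)]] by auto
  finally show ?thesis using J.W.smult_cancel AD(1)[OF w(1)] A0[OF w] by blast
 qed
 then have ij: "idx \<theta>' = idx \<theta>" using \<psi>Z_inj i j by metis
 let ?V = "V (idx \<theta>)"
 interpret U: rep "G(|carrier := C|)" ?V "U (idx \<theta>)" by (rule rep_U[OF i])
 have "intertwiner (G(|carrier := H|)) ?V (P (idx \<theta>)) ?V (P (idx \<theta>)) A"
  by (rule intertwinerI) (use AD AH ij in auto)
 from schur_scalar[OF group_H _ P_irr[OF i] this]
 obtain c where c: "!!v. v : carrier ?V ==> A v = c \<odot>_{?V} v"
  using finite_H by auto
 have c0: "c ~= 0" using c[OF w(1)] A0[OF w] ij w by auto
 have "\<theta> g = \<theta>' g" if g: "g : C" for g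
 proof -
  have Uw: "U (idx \<theta>) g w : carrier ?V" "U (idx \<theta>) g w ~= 0_{?V}"
   using g w U.rep_eq_0[of g w] by auto
  have s1: "s \<theta> g v = \<theta> g \<odot>_{?V} U (idx \<theta>) g v" if "v : carrier ?V" for v
   using s_apply[OF \<theta> g H_closed(2) that] CG[OF g] P.rep_one[OF that] by simp
  have s2: "s \<theta>' g v = \<theta>' g \<odot>_{?V} U (idx \<theta>) g v" if "v : carrier ?V" for v
   using s_apply[OF \<theta>' g H_closed(2)] CG[OF g] P.rep_one[OF that] ij that by simp
  have sc: "s \<theta> g w : carrier ?V" using s1[OF w(1)] Uw by simp
  have "c \<odot>_{?V} s \<theta> g w = s \<theta>' g (c \<odot>_{?V} w)"
   using AD(4)[of g w] CT[OF g] w c[OF w(1)] c[OF sc] by simp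
  then have "(c * \<theta> g) \<odot>_{?V} U (idx \<theta>) g w = (c * \<theta>' g) \<odot>_{?V} U (idx \<theta>) g w"
   using s1[OF w(1)] s2[of "c \<odot>_{?V} w"] w Uw g by (simp add: U.smul I.W.smult_assoc[symmetric] mult.commute)
  then have "c * \<theta> g = c * \<theta>' g" using I.W.smult_cancel Uw by blast
  then show ?thesis using c0 by simp
 qed
 moreover have "\<theta> : extensional C" "\<theta>' : extensional C"
  using \<theta> \<theta>' by (auto simp: Theta_def characters_def)
 ultimately show ?thesis by (intro extensionalityI[of _ C]) auto
qed

text \<open>\<open>\<psi>\<close> kills the commutators of \<open>Z\<close>, so on the
  \<open>\<psi>\<close>-eigenspace of \<open>N\<close> the elements of \<open>Z\<close> act by
  commuting operators. The eigenvalues on a common eigenvector form an extension of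
  \<open>\<psi>\<close> to \<open>Z\<close>, which must be one of the
  \<open>\<psi>Z\<close>.\<close>

lemma character_eigenspace:
 assumes r: "rep G W \<pi>" and con: "contains_character W \<pi> N \<psi>"
 shows "EX i:I. EX w:carrier W. w ~= 0_{W} & (ALL z:Z. \<pi> z w = \<psi>Z i z \<odot>_{W} w)"
proof -
 interpret W: rep G W \<pi> by fact
 let ?Y = "{w\<in>carrier W. ALL n:N. \<pi> n w = \<psi> n \<odot>_{W} w}"
 have Y: "submodule ?Y CC W"
 proof (rule W.submodI)
  fix a b assume "a : ?Y" "b : ?Y"
  then show "a +_{W} b : ?Y" using NG by (auto simp: W.add W.smult_add_right)
 next
  fix a x assume x: "x : ?Y"
  then have "a \<odot>_{W} (c \<odot>_{W} x) = c \<odot>_{W} (a \<odot>_{W} x)" for c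
   by (simp add: W.smult_assoc[symmetric] mult.commute)
  then show "a \<odot>_{W} x : ?Y" using x NG by (auto simp: W.smul)
 qed (use NG in auto)
 have T_stable: "\<pi> x w : ?Y" if x: "x : T" and w: "w : ?Y" for x w
 proof -
  have "\<pi> n (\<pi> x w) = \<psi> n \<odot>_{W} \<pi> x w" if n: "n : N" for n
  proof -
   have G: "x : carrier G" "n : carrier G" using TG x NG n by auto
   define m where "m = inv x \<otimes> n \<otimes> x"
   have m: "m : N" "\<psi> m = \<psi> n" using conj_N[OF G(1) n] \<psi>_conj[OF x n] by (auto simp: m_def)
   have "n \<otimes> x = x \<otimes> m" using G by (simp add: m_def m_assoc) (simp add: m_assoc[symmetric])
   then have "\<pi> n (\<pi> x w) = \<pi> x (\<pi> m w)" using G NG[OF m(1)] w by (simp add: W.mult[symmetric])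
   also have "\<dots> = \<psi> n \<odot>_{W} \<pi> x w" using m w G by (simp add: W.smul)
   finally show ?thesis .
  qed
  then show ?thesis using w TG[OF x] by simp
 qed
 have ZT: "z : T" if "z : Z" for z using HT ZH that by auto
 have "EX w:?Y. w ~= 0_{W} & (ALL z:Z. EX c. \<pi> z w = c \<odot>_{W} w)"
 proof (rule W.common_eigenvector[OF _ Y])
  show "finite Z" using finite_subset[OF _ fin] ZG by blast
  show "?Y ~= {0_{W}}" using con by (auto simp: contains_character_def)
  show "\<pi> z : linear_maps CC W W" if "z : Z" for z using W.lin ZG that by auto
  show "\<pi> z ` ?Y \<subseteq> ?Y" if "z : Z" for z using T_stable[OF ZT[OF that]] by blast
  show "\<pi> a (\<pi> b v) = \<pi> b (\<pi> a v)" if a: "a : Z" and b: "b : Z" and v: "v : ?Y" for a b v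
  proof -
   have G: "a : carrier G" "b : carrier G" using a b ZG by auto
   define n where "n = inv (inv a) \<otimes> b \<otimes> inv a \<otimes> inv b"
   have n: "n : N" "\<psi> n = 1"
    using comm_N[of b "inv a"] comm_Z[of b "inv a"] a b ZH H_closed by (auto simp: n_def)
   have "a \<otimes> b = n \<otimes> (b \<otimes> a)" using G by (simp add: n_def m_assoc) (simp add: m_assoc[symmetric])
   then have "\<pi> a (\<pi> b v) = \<pi> n (\<pi> b (\<pi> a v))" using G NG[OF n(1)] v by (simp add: W.mult[symmetric])
   moreover have "\<pi> b (\<pi> a v) : ?Y" using T_stable ZT a b v by blast
   ultimately show ?thesis using n by simp
  qed
  show "EX p~=0. cvs_endo.pact W (\<pi> a) p v = 0_{W}" if "a : Z" "v : ?Y" for a v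
   using W.annihilated[OF fin ZG] that by blast
 qed
 then obtain w where w: "w : ?Y" "w ~= 0_{W}" "ALL z:Z. EX c. \<pi> z w = c \<odot>_{W} w" by blast
 have wW: "w : carrier W" using w by simp
 from w(3) obtain \<chi> where \<chi>: "ALL z:Z. \<pi> z w = \<chi> z \<odot>_{W} w" by metis
 have "EX i:I. ALL z:Z. \<psi>Z i z = \<chi> z"
 proof (rule \<psi>Z_surj)
  fix a b assume a: "a : Z" and b: "b : Z"
  have "\<chi> (a \<otimes> b) \<odot>_{W} w = \<pi> a (\<pi> b w)"
   using \<chi> Z_closed(1)[OF a b] W.mult[OF ZG[OF a] ZG[OF b] wW] by simp
  also have "\<dots> = (\<chi> a * \<chi> b) \<odot>_{W} w"
   using \<chi> a b ZG wW by (simp add: W.smul W.smult_assoc[symmetric] mult.commute)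
  finally show "\<chi> (a \<otimes> b) = \<chi> a * \<chi> b" using W.smult_cancel wW w(2) by blast
 next
  fix n assume n: "n : N"
  then have "n : Z" "\<pi> n w = \<psi> n \<odot>_{W} w" using w(1) NZ by auto
  then have "\<chi> n \<odot>_{W} w = \<psi> n \<odot>_{W} w" using \<chi> by simp
  then show "\<chi> n = \<psi> n" using W.smult_cancel wW w(2) by blast
 next
  fix z assume z: "z : Z"
  show "\<chi> z ~= 0"
  proof
   assume "\<chi> z = 0"
   then have "\<pi> z w = 0_{W}" using \<chi> z wW by simp
   then show False using W.rep_eq_0[OF ZG[OF z] wW] w(2) by simp
  qed
 qed
 then obtain i where "i : I" "ALL z:Z. \<psi>Z i z = \<chi> z" by blast
 then have "ALL z:Z. \<pi> z w = \<psi>Z i z \<odot>_{W} w" using \<chi> by simp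
 then show ?thesis using \<open>i : I\<close> w(2) wW by blast
qed

text \<open>The \<open>Z\<close>-eigenspace in \<open>W\<close> receives a nonzero
  \<open>H\<close>-map from \<open>P i\<close>. It remains to find one that is equivariant under
  \<open>C\<close> up to a character: this is where commutativity of \<open>C\<close>
  enters.\<close>

lemma Ind_surj:
 assumes irr: "irreducible_rep G W \<pi>" and con: "contains_character W \<pi> N \<psi>"
 shows "EX \<theta>:Theta. rep_iso G (IM \<theta>) (IR \<theta>) W \<pi>"
proof -
 interpret W: rep G W \<pi> by (rule irreducible_imp_rep[OF grp irr])
 interpret WH: rep "G(|carrier := H|)" W \<pi> by (rule W.restrict_subgroup[OF H_subgroup])
 obtain i w where i: "i : I" and w: "w : carrier W" "w ~= 0_{W}" "ALL z:Z. \<pi> z w = \<psi>Z i z \<odot>_{W} w"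
  using character_eigenspace[OF W.rep_axioms con] by blast
 let ?Y = "{w\<in>carrier W. ALL z:Z. \<pi> z w = \<psi>Z i z \<odot>_{W} w}"
 have Y: "submodule ?Y CC W"
 proof (rule W.submodI)
  fix a b assume "a : ?Y" "b : ?Y"
  then show "a +_{W} b : ?Y" using ZG by (auto simp: W.add W.smult_add_right)
 next
  fix a x assume x: "x : ?Y"
  then have "a \<odot>_{W} (c \<odot>_{W} x) = c \<odot>_{W} (a \<odot>_{W} x)" for c
   by (simp add: W.smult_assoc[symmetric] mult.commute)
  then show "a \<odot>_{W} x : ?Y" using x ZG by (auto simp: W.smul)
 qed (use ZG in auto)
 have YH: "\<pi> h y : ?Y" if h: "h : H" and y: "y : ?Y" for h y
  using Z_eigenspace_stable[OF WH.rep_axioms i _ _ h, of y] y HG[OF h] by simp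
 interpret P: rep "G(|carrier := H|)" "V i" "P i" by (rule rep_P[OF i])
 interpret U: rep "G(|carrier := C|)" "V i" "U i" by (rule rep_U[OF i])
 have "EX T0. intertwiner (G(|carrier := H|)) (V i) (P i) W \<pi> T0 & T0 ` carrier (V i) \<subseteq> ?Y &
   (EX v:carrier (V i). T0 v ~= 0_{W})"
 proof (rule heisenberg_intertwiner[OF group_H _ P_irr[OF i] WH.group_rep, where Z = Z and \<chi> = "\<psi>Z i"])
  show "finite (carrier (G(|carrier := H|)))" using finite_H by simp
  show "subgroup Z (G(|carrier := H|))" using subgroup_incl[OF Z_subgroup H_subgroup] ZH by simp
  show "?Y ~= {0_{W}}" using w by blast
  show "\<pi> g ` ?Y \<subseteq> ?Y" if "g : carrier (G(|carrier := H|))" for g using YH that by auto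
  show "P i z v = \<psi>Z i z \<odot>_{V i} v" if "z : Z" "v : carrier (V i)" for z v using P_scalar[OF i that] .
 next
  fix x y assume "x : carrier (G(|carrier := H|))" "y : carrier (G(|carrier := H|))"
  then show "inv_{G(|carrier := H|)} y *_{G(|carrier := H|)} x *_{G(|carrier := H|)} y
    *_{G(|carrier := H|)} inv_{G(|carrier := H|)} x : Z"
   using comm_N NZ by (auto simp: inv_H)
 next
  fix x assume "x : carrier (G(|carrier := H|))" and xZ: "x \<notin> Z"
  then have x: "x : H" by simp
  obtain k where k: "k : H" "\<psi> (inv k \<otimes> x \<otimes> k \<otimes> inv x) ~= 1" using nondeg[OF x xZ] by blast
  then show "EX y:carrier (G(|carrier := H|)). \<psi>Z i (inv_{G(|carrier := H|)} y *_{G(|carrier := H|)} x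
    *_{G(|carrier := H|)} y *_{G(|carrier := H|)} inv_{G(|carrier := H|)} x) ~= 1"
   using x comm_N[OF x k(1)] \<psi>Z_N[OF i] by (intro bexI[of _ k]) (auto simp: inv_H)
 qed (use Y in auto)
 then obtain T0 v0 where T0: "intertwiner (G(|carrier := H|)) (V i) (P i) W \<pi> T0"
  and v0: "v0 : carrier (V i)" "T0 v0 ~= 0_{W}" by blast
 let ?E = "hom_module (G(|carrier := H|)) (V i) (P i) W \<pi>"
 interpret E: cvs ?E by (rule cvs_hom_module[OF P.rep_axioms WH.rep_axioms])
 have ED: "f v : carrier W" "f (v +_{V i} v') = f v +_{W} f v'" "f (c \<odot>_{V i} v) = c \<odot>_{W} f v"
  "h : H ==> f (P i h v) = \<pi> h (f v)" "f : extensional (carrier (V i))"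
  if "f : carrier ?E" "v : carrier (V i)" "v' : carrier (V i)" for f v v' c h
  using that by (auto simp: hom_module_simps intertwiner_def linear_maps_def)
 \<comment> \<open>\<open>C\<close> acts on the \<open>H\<close>-intertwiners by conjugation,
   through \<open>U\<close> on the source and \<open>\<pi>\<close> on the target; the relation
   between \<open>U\<close> and \<open>P\<close> keeps the result an
   \<open>H\<close>-intertwiner.\<close>
 define act where "act c = (\<lambda>f\<in>carrier ?E. \<lambda>v\<in>carrier (V i). \<pi> c (f (U i (inv c) v)))" for c
 have act: "act c f v = \<pi> c (f (U i (inv c) v))" if "f : carrier ?E" "v : carrier (V i)" for c f v
  using that by (simp add: act_def)
 have act_ext: "act c f : extensional (carrier (V i))" if "f : carrier ?E" for c f
  using that by (simp add: act_def)
 have UC: "U i (inv c) v : carrier (V i)" if "c : C" "v : carrier (V i)" for c v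
  using that C_closed by simp
 have act_cl: "act c f : carrier ?E" if c: "c : C" and f: "f : carrier ?E" for c f
 proof (subst hom_module_simps, intro conjI intertwinerI act_ext f)
  fix v w a h
  show "act c f v : carrier W" if "v : carrier (V i)"
   using that c f CG ED(1)[OF f UC[OF c that] UC[OF c that]] by (simp add: act)
  show "act c f (v +_{V i} w) = act c f v +_{W} act c f w" if v: "v : carrier (V i)" and w: "w : carrier (V i)"
   using v w c f CG[OF c] C_closed(3)[OF c] ED(1,2)[OF f UC[OF c v] UC[OF c w]] ED(1)[OF f UC[OF c w] UC[OF c w]]
   by (simp add: act U.add W.add)
  show "act c f (a \<odot>_{V i} v) = a \<odot>_{W} act c f v" if v: "v : carrier (V i)"
   using v c f CG[OF c] C_closed(3)[OF c] ED(1,3)[OF f UC[OF c v] UC[OF c v]]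
   by (simp add: act U.smul W.smul)
  show "act c f (P i h v) = \<pi> h (act c f v)" if h': "h : carrier (G(|carrier := H|))" and v: "v : carrier (V i)"
  proof -
   have h: "h : H" using h' by simp
   have G: "c : carrier G" "h : carrier G" using c h CG HG by auto
   define k where "k = inv c \<otimes> h \<otimes> c"
   have k: "k : H" "k : carrier G" using conj_H[OF G(1) h] HG by (auto simp: k_def)
   have "inv (inv c) \<otimes> k \<otimes> inv c = h" using G by (simp add: k_def m_assoc) (simp add: m_assoc[symmetric])
   then have "U i (inv c) (P i h v) = P i k (U i (inv c) v)"
    using U_P[OF i C_closed(3)[OF c] k(1) v] by simp
   then have "act c f (P i h v) = \<pi> c (\<pi> k (f (U i (inv c) v)))"
    using act[OF f, of "P i h v" c] ED(4)[OF f UC[OF c v] UC[OF c v] k(1)] h v by simp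
   also have "\<dots> = \<pi> (c \<otimes> k) (f (U i (inv c) v))"
    using W.mult G k ED(1)[OF f UC[OF c v] UC[OF c v]] by simp
   also have "c \<otimes> k = h \<otimes> c" using G by (simp add: k_def m_assoc) (simp add: m_assoc[symmetric])
   also have "\<pi> (h \<otimes> c) (f (U i (inv c) v)) = \<pi> h (act c f v)"
    using W.mult G ED(1)[OF f UC[OF c v] UC[OF c v]] act[OF f v] by simp
   finally show ?thesis .
  qed
 qed
 interpret A: rep "G(|carrier := C|)" ?E act
 proof (rule repI[OF group_C E.cvs_axioms])
  fix c assume "c : carrier (G(|carrier := C|))"
  then have c: "c : C" by simp
  show "act c : extensional (carrier ?E)" by (simp add: act_def)
  show "act c : linear_maps CC ?E ?E"
  proof (rule linear_mapsI)
   fix f f' assume f: "f : carrier ?E" "f' : carrier ?E"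
   show "act c (f +_{?E} f') = act c f +_{?E} act c f'"
   proof (rule extensionalityI[of _ "carrier (V i)"])
    fix v assume v: "v : carrier (V i)"
    have s: "f +_{?E} f' : carrier ?E" using f by simp
    show "act c (f +_{?E} f') v = (act c f +_{?E} act c f') v"
     using act[OF s v, of c] act[OF f(1) v, of c] act[OF f(2) v, of c] v UC[OF c v] CG[OF c]
      ED(1)[OF f(1) UC[OF c v] UC[OF c v]] ED(1)[OF f(2) UC[OF c v] UC[OF c v]]
     by (simp add: hom_module_simps(2) W.add)
   qed (use act_ext f hom_module_simps(5) in auto)
  next
   fix a f assume f: "f : carrier ?E"
   show "act c (a \<odot>_{?E} f) = a \<odot>_{?E} act c f"
   proof (rule extensionalityI[of _ "carrier (V i)"])
    fix v assume v: "v : carrier (V i)"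
    have s: "a \<odot>_{?E} f : carrier ?E" using f by simp
    show "act c (a \<odot>_{?E} f) v = (a \<odot>_{?E} act c f) v"
     using act[OF s v, of c] act[OF f v, of c] v UC[OF c v] CG[OF c]
      ED(1)[OF f UC[OF c v] UC[OF c v]] by (simp add: hom_module_simps(3) W.smul)
   qed (use act_ext f hom_module_simps(6) in auto)
  qed (use act_cl c in auto)
 next
  fix f assume f: "f : carrier ?E"
  have "act \<one> f = f"
  proof (rule extensionalityI[of _ "carrier (V i)"])
   fix v assume v: "v : carrier (V i)"
   have "U i \<one> v = v" using U.rep_one[OF v] by simp
   then show "act \<one> f v = f v" using act[OF f v, of \<one>] ED(1)[OF f v v] by simp
  qed (use act_ext f ED(5) v0 in auto)
  then show "act 1_{G(|carrier := C|)} f = f" by simp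
 next
  fix c d f assume "c : carrier (G(|carrier := C|))" "d : carrier (G(|carrier := C|))" and f: "f : carrier ?E"
  then have c: "c : C" and d: "d : C" by auto
  have "act (c \<otimes> d) f = act c (act d f)"
  proof (rule extensionalityI[of _ "carrier (V i)"])
   fix v assume v: "v : carrier (V i)"
   have G: "c : carrier G" "d : carrier G" using c d CG by auto
   note v' = UC[OF c v]
   have "U i (inv (c \<otimes> d)) v = U i (inv d) (U i (inv c) v)"
    using U.mult[of "inv d" "inv c" v] c d G v C_closed(3) by (simp add: inv_mult_group)
   then have "act (c \<otimes> d) f v = \<pi> c (\<pi> d (f (U i (inv d) (U i (inv c) v))))"
    using act[OF f v] W.mult G ED(1)[OF f UC[OF d v'] v'] by simp
   then show "act (c \<otimes> d) f v = act c (act d f) v"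
    using act[OF act_cl[OF d f] v, of c] act[OF f v', of d] by simp
  qed (use act_ext act_cl d f in auto)
  then show "act (c *_{G(|carrier := C|)} d) f = act c (act d f)" by simp
 qed
 have finC: "finite C" using finite_subset[OF _ fin] CG by blast
 \<comment> \<open>The eigenvalues of \<open>C\<close> on such an \<open>f\<close> will be the
   values of \<open>\<theta>\<close>.\<close>
 have "EX f:carrier ?E. f ~= 0_{?E} & (ALL c:C. EX a. act c f = a \<odot>_{?E} f)"
 proof (rule E.common_eigenvector[OF finC E.carrier_is_submodule])
  have "restrict T0 (carrier (V i)) : carrier ?E"
   using T0 by (auto simp: hom_module_simps intertwiner_def linear_maps_def)
  moreover have "restrict T0 (carrier (V i)) ~= 0_{?E}"
  proof
   assume "restrict T0 (carrier (V i)) = 0_{?E}"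
   then have "restrict T0 (carrier (V i)) v0 = 0_{?E} v0" by simp
   then show False using v0 by (simp add: hom_module_simps(4))
  qed
  ultimately show "carrier ?E ~= {0_{?E}}" by blast
  show "act c : linear_maps CC ?E ?E" if "c : C" for c using A.lin that by simp
  show "act c ` carrier ?E \<subseteq> carrier ?E" if "c : C" for c using act_cl that by auto
  show "act c (act d f) = act d (act c f)" if "c : C" "d : C" "f : carrier ?E" for c d f
   using A.mult[of c d f] A.mult[of d c f] C_comm[of c d] that by simp
  show "EX p~=0. cvs_endo.pact ?E (act c) p f = 0_{?E}" if "c : C" "f : carrier ?E" for c f
   using A.annihilated[of c f] finC that by simp
 qed
 then obtain f where f: "f : carrier ?E" "f ~= 0_{?E}" "ALL c:C. EX a. act c f = a \<odot>_{?E} f" by blast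
 then obtain t where t: "ALL c:C. act c f = t c \<odot>_{?E} f" by metis
 define \<theta> where "\<theta> = restrict t C"
 have \<theta>: "act c f = \<theta> c \<odot>_{?E} f" if "c : C" for c using t that by (simp add: \<theta>_def)
 have fU: "\<pi> c (f v) = \<theta> c \<odot>_{W} f (U i c v)" if c: "c : C" and v: "v : carrier (V i)" for c v
 proof -
  have Uv: "U i c v : carrier (V i)" using c v by simp
  have "U i (inv c) (U i c v) = v"
   using U.mult[of "inv c" c v] U.rep_one[OF v] c v C_closed CG[OF c] by simp
  then show ?thesis using \<theta>[OF c] act[OF f(1) Uv, of c] hom_module_simps(3)[of _ "V i", OF Uv] by metis
 qed
 have \<theta>m: "\<theta> (c \<otimes> d) = \<theta> c * \<theta> d" if c: "c : C" and d: "d : C" for c d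
 proof -
  have "\<theta> (c \<otimes> d) \<odot>_{?E} f = act c (act d f)"
   using A.mult[of c d f] \<theta>[OF C_closed(1)[OF c d]] c d f(1) by simp
  also have "\<dots> = (\<theta> c * \<theta> d) \<odot>_{?E} f"
   using \<theta> c d f(1) A.smul[of c f "\<theta> d"] by (simp add: E.smult_assoc[symmetric] mult.commute)
  finally show ?thesis using E.smult_cancel f(1,2) by blast
 qed
 have \<theta>nz: "\<theta> c ~= 0" if c: "c : C" for c
 proof
  assume "\<theta> c = 0"
  then have "act c f = 0_{?E}" using \<theta>[OF c] f(1) by simp
  then show False using A.rep_eq_0[of c f] c f by simp
 qed
 have "EX v:carrier (V i). f v ~= 0_{W}"
 proof (rule ccontr)
  assume "\<not> ?thesis"
  then have "f = 0_{?E}"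
   using ED(5)[OF f(1) v0(1) v0(1)] hom_module_simps(7)
   by (intro extensionalityI[of _ "carrier (V i)"]) (auto simp: hom_module_simps(4))
  then show False using f(2) by simp
 qed
 then obtain v where v: "v : carrier (V i)" "f v ~= 0_{W}" by blast
 have fv: "f v : carrier W" using ED(1)[OF f(1) v(1) v(1)] .
 \<comment> \<open>On \<open>C \<inter> H\<close> the operator \<open>U i c\<close> is trivial, so
   \<open>\<theta>\<close> must agree with the scalar by which \<open>P i\<close> acts. This ties
   the index of \<open>\<theta>\<close> to \<open>i\<close>.\<close>
 have \<theta>Z: "\<theta> c = \<psi>Z i c" if c: "c : C" "c : H" for c
 proof -
  have cZ: "c : Z" using CHZ c by auto
  have "U i c v = v" using U_one[OF i, of c] c v(1) by (simp add: GL_simps(2))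
  then have "\<theta> c \<odot>_{W} f v = f (P i c v)" using fU[OF c(1) v(1)] ED(4)[OF f(1) v(1) v(1) c(2)] by simp
  also have "\<dots> = \<psi>Z i c \<odot>_{W} f v" using P_scalar[OF i cZ v(1)] ED(3)[OF f(1) v(1) v(1)] by simp
  finally show ?thesis using W.smult_cancel fv v(2) by blast
 qed
 have \<theta>T: "\<theta> : Theta"
 proof -
  have "\<theta> : hom (G(|carrier := C|)) (units_of CC)"
  proof (rule homI)
   fix c assume "c : carrier (G(|carrier := C|))"
   then have "\<theta> c * inverse (\<theta> c) = 1" using \<theta>nz by simp
   then show "\<theta> c : carrier (units_of CC)"
    by (auto simp: units_of_def Units_def mult.commute intro!: exI[of _ "inverse (\<theta> c)"])
  qed (use \<theta>m in \<open>simp add: units_of_def\<close>)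
  moreover have "\<theta> n = \<psi> n" if "n : C" "n : N" for n using \<theta>Z[of n] NH that \<psi>Z_N[OF i] by simp
  ultimately show ?thesis by (simp add: Theta_def characters_def \<theta>_def)
 qed
 have i': "idx \<theta> = i" by (rule idx_eqI[OF \<theta>T i]) (rule \<theta>Z)
 have "intertwiner (G(|carrier := T|)) (V (idx \<theta>)) (s \<theta>) W \<pi> f"
  unfolding i'
 proof (rule intertwinerI)
  fix x v assume "x : carrier (G(|carrier := T|))" and v: "v : carrier (V i)"
  then obtain g h where x: "x = g \<otimes> h" "g : C" "h : H" by (auto simp: T_eq)
  have Pv: "P i h v : carrier (V i)" using x v by simp
  have "f (s \<theta> x v) = \<theta> g \<odot>_{W} f (U i g (P i h v))"
   using s_apply[OF \<theta>T x(2,3)] ED(3)[OF f(1)] x v Pv by (simp add: i')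
  also have "\<dots> = \<pi> g (\<pi> h (f v))" using fU[OF x(2) Pv] ED(4)[OF f(1) v v x(3)] by simp
  also have "\<dots> = \<pi> x (f v)" using W.mult x CG HG ED(1)[OF f(1) v v] by simp
  finally show "f (s \<theta> x v) = \<pi> x (f v)" .
 qed (use ED f(1) in auto)
 interpret I: ind_clifford G "V (idx \<theta>)" T "s \<theta>" N \<psi> by (rule ind_clifford_s[OF \<theta>T])
 obtain F f0 where F: "intertwiner G (IM \<theta>) (IR \<theta>) W \<pi> F" "f0 : carrier (IM \<theta>)" "F f0 ~= 0_{W}"
  using I.frobenius_map[OF W.group_rep \<open>intertwiner _ _ (s \<theta>) W \<pi> f\<close>, of v] v i' by auto
 have "rep_iso G (IM \<theta>) (IR \<theta>) W \<pi>" 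
  using schur_iso[OF grp Ind_irreducible[OF \<theta>T] irr] F by blast
 with \<theta>T show ?thesis by blast
qed

theorem Ind_bij: "bij_betw (%\<theta>. iso_class G (IM \<theta>) (IR \<theta>)) Theta (Irr_containing G N \<psi>)"
 unfolding bij_betw_def
proof
 show "inj_on (%\<theta>. iso_class G (IM \<theta>) (IR \<theta>)) Theta" using Ind_inj by (auto intro: inj_onI)
 show "(%\<theta>. iso_class G (IM \<theta>) (IR \<theta>)) ` Theta = Irr_containing G N \<psi>"
 proof
  show "Irr_containing G N \<psi> \<subseteq> (%\<theta>. iso_class G (IM \<theta>) (IR \<theta>)) ` Theta"
  proof
   fix X assume "X : Irr_containing G N \<psi>"
   then obtain d \<pi> where X: "X = iso_class G (module_vec TYPE(complex) d) \<pi>"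
    and irr: "irreducible_rep G (module_vec TYPE(complex) d) \<pi>"
    and con: "contains_character (module_vec TYPE(complex) d) \<pi> N \<psi>"
    by (auto simp: Irr_containing_def)
   obtain \<theta> where \<theta>: "\<theta> : Theta" "rep_iso G (IM \<theta>) (IR \<theta>) (module_vec TYPE(complex) d) \<pi>"
    using Ind_surj[OF irr con] by blast
   have "iso_class G (IM \<theta>) (IR \<theta>) = X"
    unfolding X using Ind_irreducible[OF \<theta>(1)] irr \<theta>(2)
    by (intro iso_class_eqI[OF grp]) (auto simp: irreducible_rep_def)
   with \<theta>(1) show "X : (%\<theta>. iso_class G (IM \<theta>) (IR \<theta>)) ` Theta" by blast
  qed
 qed (use Ind_in_Irr in auto)
qed

end

section \<open>Non-archimedean absolute values\<close>

abbreviation av :: "'a::nonarch_local_field => real" where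
 "av x \<equiv> dist 0 x"

lemma dist_av: "dist x (y :: 'a::nonarch_local_field) = av (y - x)"
 using dist_translate[of x "- x" y] by simp

lemma av_minus [simp]: "av (- x) = av (x :: 'a::nonarch_local_field)"
 using dist_translate[of "- x" x 0] by (simp add: dist_commute)

lemma av_add: "av (x + y) <= max (av x) (av (y :: 'a::nonarch_local_field))"
 using dist_ultrametric[of 0 "x + y" x] by (simp add: dist_av[of x])

lemma av_diff: "av (x - y) <= max (av x) (av (y :: 'a::nonarch_local_field))"
 using av_add[of x "- y"] by simp

lemma av_mult [simp]: "av (x * y) = av x * av (y :: 'a::nonarch_local_field)"
 by (rule dist_0_mult)

lemma av_one [simp]: "av (1 :: 'a::nonarch_local_field) = 1"
 using av_mult[of 1 "1 :: 'a"] by simp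

lemma av_power [simp]: "av (x ^ k) = av (x :: 'a::nonarch_local_field) ^ k"
 by (induction k) auto

lemma av_inverse [simp]: "av (inverse x) = inverse (av (x :: 'a::nonarch_local_field))"
proof (cases "x = 0")
 case False
 then have "av x * av (inverse x) = 1" using av_mult[of x "inverse x"] by simp
 then show ?thesis by (metis inverse_unique)
qed simp

lemma av_divide [simp]: "av (x / y) = av x / av (y :: 'a::nonarch_local_field)"
 by (simp add: divide_inverse)

lemma av_sum_le:
 assumes "finite A" "0 <= c" "!!a. a : A ==> av (f a :: 'a::nonarch_local_field) <= c"
 shows "av (SUM a:A. f a) <= c"
 using assms
proof (induction A rule: finite_induct)
 case (insert x F)
 then show ?case using av_add[of "f x" "sum f F"] by fastforce
qed simp

lemma av_add_eq:
 assumes "av y < av (x :: 'a::nonarch_local_field)"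
 shows "av (x + y) = av x"
 using av_add[of x y] av_diff[of "x + y" y] assms by auto

lemma integers_iff: "x : \<O> \<longleftrightarrow> av x <= 1"
 by (simp add: integers_def)

lemma integers_closed [simp, intro]:
 "0 : \<O>" "1 : \<O>"
 "x : \<O> ==> y : \<O> ==> x + y : \<O>"
 "x : \<O> ==> y : \<O> ==> x - y : \<O>"
 "x : \<O> ==> y : \<O> ==> x * y : \<O>"
 "x : \<O> ==> - x : \<O>"
 "x : \<O> ==> x ^ k : \<O>"
 using av_add[of x y] av_diff[of x y]
 by (auto simp: integers_iff mult_le_one power_le_one)

lemma of_nat_integers [simp, intro]: "of_nat k : (\<O> :: 'a::nonarch_local_field set)"
 by (induction k) auto

lemma numeral_integers [simp, intro]: "numeral k : (\<O> :: 'a::nonarch_local_field set)"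
 using of_nat_integers[of "numeral k"] by simp

lemma sum_integers [intro]: "(!!a. a : A ==> f a : \<O>) ==> (SUM a:A. f a) : \<O>"
 by (induction A rule: infinite_finite_induct) auto

lemma Units_integers: "x : Units (ring_on \<O>) \<longleftrightarrow> av x = 1"
proof
 assume "x : Units (ring_on \<O>)"
 then obtain y where "av x <= 1" "av y <= 1" "x * y = 1"
  by (auto simp: Units_def integers_iff)
 then show "av x = 1" using av_mult[of x y] mult_le_one[of "av x" "av y"]
  by (metis av_one dual_order.antisym mult.right_neutral mult_left_mono zero_le_dist)
next
 assume x: "av x = 1"
 then have "x ~= 0" by auto
 then show "x : Units (ring_on \<O>)"
  using x by (auto simp: Units_def integers_iff intro!: bexI[of _ "inverse x"])
qed

text \<open>The class axiom speaks of finitely many balls; a centre is chosen in each.\<close>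

lemma finite_residue_reps:
 "\<exists>R\<subseteq>\<O> :: 'a::nonarch_local_field set. finite R & (ALL x:\<O>. EX a:R. av (x - a) < 1)"
proof -
 let ?C = "{{y. dist x y < 1} | x :: 'a. dist 0 x <= 1}"
 define r where "r C = (SOME x :: 'a. C = {y. dist x y < 1} & dist 0 x <= 1)" for C
 have r: "C = {y. dist (r C) y < 1} & dist 0 (r C) <= 1" if "C : ?C" for C
  unfolding r_def
  by (rule someI_ex[where P = "%x. C = {y. dist x y < 1} & dist 0 x <= 1", OF CollectD[OF that]])
 show ?thesis
 proof (intro exI[of _ "r ` ?C"] conjI ballI)
  show "r ` ?C \<subseteq> \<O>"
  proof (rule image_subsetI)
   fix C assume "C : ?C"
   then show "r C : \<O>" using conjunct2[OF r[of C]] by (simp add: integers_iff)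
  qed
  show "finite (r ` ?C)" by (rule finite_imageI) (rule finite_residue_field)
  fix x :: 'a assume "x : \<O>"
  define D where "D = {y. dist x y < 1}"
  have D: "D : ?C" using \<open>x : \<O>\<close>
   unfolding D_def integers_iff by (intro CollectI exI[of _ x] conjI refl)
  have "x : D" by (simp add: D_def)
  then have "x : {y. dist (r D) y < 1}"
   by (rule subst[where P = "%S. x : S", OF conjunct1[OF r[OF D]]])
  then have "av (x - r D) < 1" by (simp add: dist_av[of "r D"])
  then show "EX a:r ` ?C. av (x - a) < 1" using imageI[OF D, of r] by blast
 qed
qed

text \<open>Two natural numbers share a residue class because there are only finitely many, so some
  positive integer lies in the maximal ideal and the \<open>LEAST\<close> is attained; division with
  remainder then gives divisibility.\<close>

lemma residue_char_dvd:
 fixes k :: nat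
 assumes "of_nat k : (max_ideal :: 'a::nonarch_local_field set)"
 shows "residue_char TYPE('a) dvd k"
  and "0 < residue_char TYPE('a)" and "of_nat (residue_char TYPE('a)) : (max_ideal :: 'a set)"
proof -
 have mi: "x : max_ideal \<longleftrightarrow> av x < 1" for x :: 'a by (simp add: max_ideal_def)
 obtain R :: "'a set" where R: "finite R" "ALL x:\<O>. EX a:R. av (x - a) < 1"
  using finite_residue_reps by blast
 then have "EX a:R. av (of_nat j - a) < 1" for j by auto
 then obtain f where f: "f j : R" "av (of_nat j - f j) < 1" for j by metis
 have "finite (range f)" using finite_subset[OF _ R(1), of "range f"] f(1) by blast
 then have "\<not> inj f" using finite_imageD[of f UNIV] by auto
 then obtain i0 j0 where ij0: "i0 ~= j0" "f i0 = f j0" by (auto simp: inj_def)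
 obtain i j where ij: "i < j" "f i = f j"
  using ij0 by (cases i0 j0 rule: linorder_cases) (auto simp: that)
 have "of_nat (j - i) = (of_nat j - f j) - (of_nat i - f i)" using ij by (simp add: of_nat_diff)
 then have "av (of_nat (j - i) :: 'a) < 1"
  using av_diff[of "of_nat j - f j" "of_nat i - f i"] f(2)[of i] f(2)[of j] by auto
 then have "EX p. 0 < p & of_nat p : (max_ideal :: 'a set)" using ij mi by (intro exI[of _ "j - i"]) auto
 then have p: "0 < residue_char TYPE('a) & of_nat (residue_char TYPE('a)) : (max_ideal :: 'a set)"
  unfolding residue_char_def by (rule LeastI_ex)
 then show "0 < residue_char TYPE('a)" "of_nat (residue_char TYPE('a)) : (max_ideal :: 'a set)" by auto
 let ?p = "residue_char TYPE('a)"
 have "of_nat k = of_nat ?p * of_nat (k div ?p) + (of_nat (k mod ?p) :: 'a)"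
  by (metis mult_div_mod_eq of_nat_add of_nat_mult)
 then have "(of_nat (k mod ?p) :: 'a) = of_nat k - of_nat ?p * of_nat (k div ?p)" by simp
 moreover have "av (of_nat ?p * of_nat (k div ?p) :: 'a) < 1"
 proof -
  have "av (of_nat (k div ?p) :: 'a) <= 1" using of_nat_integers integers_iff by blast
  moreover have "av (of_nat ?p :: 'a) < 1" using p mi by blast
  ultimately show ?thesis
   using mult_left_le[of "av (of_nat (k div ?p) :: 'a)" "av (of_nat ?p :: 'a)"] by simp
 qed
 ultimately have "av (of_nat (k mod ?p) :: 'a) < 1"
  using av_diff[of "of_nat k" "of_nat ?p * of_nat (k div ?p) :: 'a"] assms mi by fastforce
 moreover have "k mod ?p < ?p" using p by simp
 ultimately have "k mod ?p = 0"
  using not_less_Least[of "k mod ?p" "%p. 0 < p & of_nat p : (max_ideal :: 'a set)"] mi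
  by (auto simp: residue_char_def)
 then show "?p dvd k" by auto
qed

section \<open>The extension \<open>K/F\<close>\<close>

context unramified_GO
begin

lemma emb_simps [simp]:
 "emb 0 = 0" "emb 1 = 1" "emb (a + b) = emb a + emb b" "emb (a * b) = emb a * emb b"
 "emb (- a) = - emb a" "emb (a - b) = emb a - emb b" "emb (a ^ k) = emb a ^ k"
 "emb (of_nat k) = of_nat k" "emb (numeral w) = numeral w"
proof -
 have a: "emb (a + b) = emb a + emb b" for a b using emb by (simp add: field_embedding_def)
 have m: "emb (a * b) = emb a * emb b" for a b using emb by (simp add: field_embedding_def)
 have o: "emb 1 = 1" using emb by (simp add: field_embedding_def)
 have "emb 0 + 0 = emb 0 + emb 0" using a[of 0 0] by simp
 then have z: "emb 0 = 0" by (simp only: add_left_cancel)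
 have n: "emb (- a) = - emb a" for a using a[of a "- a"] z by (simp add: eq_neg_iff_add_eq_0 add.commute)
 have N: "emb (of_nat k) = of_nat k" for k by (induction k) (auto simp: a o z)
 show "emb 0 = 0" "emb 1 = 1" "emb (a + b) = emb a + emb b" "emb (a * b) = emb a * emb b"
  "emb (- a) = - emb a" "emb (of_nat k) = of_nat k" by fact+
 show "emb (a - b) = emb a - emb b" using a[of a "- b"] n by simp
 show "emb (a ^ k) = emb a ^ k" by (induction k) (auto simp: m o)
 show "emb (numeral w) = numeral w" using N[of "numeral w"] by simp
qed

lemma emb_av [simp]: "av (emb x) = av x"
 by (rule emb_isometry)

lemma emb_eq_0 [simp]: "emb x = 0 \<longleftrightarrow> x = 0"
 using emb_av[of x] by (metis dist_eq_0_iff)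

lemma emb_inverse [simp]: "emb (inverse x) = inverse (emb x)"
proof (cases "x = 0")
 case False
 then have "emb x * emb (inverse x) = 1" using emb_simps(4)[of x "inverse x"] by simp
 then show ?thesis by (metis inverse_unique)
qed simp

lemma emb_integers [simp]: "emb x : \<O> \<longleftrightarrow> x : \<O>"
 by (simp add: integers_iff)

section \<open>The filtration by powers of the uniformizer\<close>

definition q :: real where "q = av \<pi>"

lemma q_pos: "0 < q" and q_less: "q < 1"
proof -
 show "0 < q" using uniformizer(1) by (simp add: q_def)
 have "\<pi> * 1 : max_ideal" using uniformizer(2) by blast
 then show "q < 1" by (simp add: max_ideal_def q_def)
qed

lemma av_less_1_F: "av (x :: 'f) < 1 ==> av x <= q"
proof -
 assume "av x < 1"
 then have "x : (*) \<pi> ` \<O>" using uniformizer(2) by (auto simp: max_ideal_def)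
 then show "av x <= q" using q_pos by (auto simp: integers_iff q_def mult_left_le)
qed

lemma av_less_1_K: "av (x :: 'k) < 1 ==> av x <= q"
proof -
 assume "av x < 1"
 then have "x : (*) (emb \<pi>) ` \<O>" using unramified by (auto simp: max_ideal_def)
 then show "av x <= q" using q_pos by (auto simp: integers_iff q_def mult_left_le)
qed

lemma q_pow_pos [simp]: "0 < q ^ k" "0 <= q ^ k" "q ^ k <= 1"
 using q_pos q_less by (auto simp: power_le_one)

lemma q_pow_mono: "j <= k ==> q ^ k <= q ^ j"
 using q_pos q_less by (simp add: power_decreasing)

lemma av_pi_power [simp]: "av (\<pi> ^ k) = q ^ k" "av (emb \<pi> ^ k) = q ^ k" "av (emb \<pi>) = q" "av \<pi> = q"
 by (auto simp: q_def)

lemma pi_nz [simp]: "\<pi> ~= 0" by (rule uniformizer(1))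

lemma pi_integers [simp, intro]: "\<pi> : \<O>" "emb \<pi> : \<O>"
 using q_less by (auto simp: integers_iff)

text \<open>The ideals are balls of radius \<open>q ^ k\<close>; from here on, membership is an
  estimate of absolute values.\<close>

lemma IK_iff: "x : IK k \<longleftrightarrow> av x <= q ^ k"
proof
 assume "x : IK k"
 then obtain y where "av y <= 1" "x = y * emb \<pi> ^ k"
  by (auto simp: IK_def cgenideal_def algebra_on_def integers_iff)
 then show "av x <= q ^ k" by (simp add: mult_left_le_one_le)
next
 assume x: "av x <= q ^ k"
 then have "x / emb \<pi> ^ k : \<O>" "x = x / emb \<pi> ^ k * emb \<pi> ^ k" using q_pos by (simp_all add: integers_iff)
 then show "x : IK k" unfolding IK_def cgenideal_def algebra_on_def
  by (intro CollectI exI[of _ "x / emb \<pi> ^ k"]) simp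
qed

lemma IF_iff: "x : IF k \<longleftrightarrow> av x <= q ^ k"
proof
 assume "x : IF k"
 then obtain y where "av y <= 1" "x = y * \<pi> ^ k"
  by (auto simp: IF_def cgenideal_def integers_iff)
 then show "av x <= q ^ k" by (simp add: mult_left_le_one_le)
next
 assume x: "av x <= q ^ k"
 then have "x / \<pi> ^ k : \<O>" "x = x / \<pi> ^ k * \<pi> ^ k" using q_pos by (simp_all add: integers_iff)
 then show "x : IF k" unfolding IF_def cgenideal_def ring_on_simps
  by (intro CollectI exI[of _ "x / \<pi> ^ k"]) simp
qed

lemma emb_IK [simp]: "emb x : IK k \<longleftrightarrow> x : IF k"
 by (simp add: IK_iff IF_iff)

lemma IK_0: "IK 0 = \<O>" and IF_0: "IF 0 = \<O>"
 by (auto simp: IK_iff IF_iff integers_iff)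

lemma IK_closed [intro]:
 "0 : IK k" "x : IK k ==> y : IK k ==> x + y : IK k" "x : IK k ==> y : IK k ==> x - y : IK k"
 "x : IK k ==> - x : IK k" "(!!a. a : A ==> f a : IK k) ==> (SUM a:A. f a) : IK k"
proof -
 show p: "x : IK k ==> y : IK k ==> x + y : IK k" for x y using av_add[of x y] by (auto simp: IK_iff)
 show "x : IK k ==> y : IK k ==> x - y : IK k" using av_diff[of x y] by (auto simp: IK_iff)
 show "(!!a. a : A ==> f a : IK k) ==> (SUM a:A. f a) : IK k"
  by (induction A rule: infinite_finite_induct) (auto simp: p, auto simp: IK_iff)
qed (auto simp: IK_iff)

lemma IF_closed [intro]:
 "0 : IF k" "x : IF k ==> y : IF k ==> x + y : IF k" "x : IF k ==> y : IF k ==> x - y : IF k"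
 "x : IF k ==> - x : IF k" "(!!a. a : A ==> f a : IF k) ==> (SUM a:A. f a) : IF k"
proof -
 show p: "x : IF k ==> y : IF k ==> x + y : IF k" for x y using av_add[of x y] by (auto simp: IF_iff)
 show "x : IF k ==> y : IF k ==> x - y : IF k" using av_diff[of x y] by (auto simp: IF_iff)
 show "(!!a. a : A ==> f a : IF k) ==> (SUM a:A. f a) : IF k"
  by (induction A rule: infinite_finite_induct) (auto simp: p, auto simp: IF_iff)
qed (auto simp: IF_iff)

lemma IK_mult: "x : IK j ==> y : IK k ==> x * y : IK (j + k)"
 and IF_mult: "a : IF j ==> b : IF k ==> a * b : IF (j + k)"
 using q_pos by (auto simp: IK_iff IF_iff power_add intro!: mult_mono)

lemma IK_mult_integers: "x : IK k ==> y : \<O> ==> x * y : IK k" "x : IK k ==> y : \<O> ==> y * x : IK k"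
 and IF_mult_integers: "a : IF k ==> b : \<O> ==> a * b : IF k" "a : IF k ==> b : \<O> ==> b * a : IF k"
 using IK_mult[of x k y 0] IF_mult[of a k b 0] by (auto simp: IK_0 IF_0 mult.commute)

lemma IK_mono: "j <= k ==> x : IK k ==> x : IK j" and IF_mono: "j <= k ==> a : IF k ==> a : IF j"
 using q_pow_mono[of j k] by (auto simp: IK_iff IF_iff)

lemma IK_integers: "x : IK k ==> x : \<O>" and IF_integers: "a : IF k ==> a : \<O>"
 using order_trans[OF _ q_pow_pos(3)[of k]] by (auto simp: IK_iff IF_iff integers_iff)

lemma pi_power_mult_IK [simp]: "emb \<pi> ^ j * x : IK (j + k) \<longleftrightarrow> x : IK k"
 and pi_power_mult_IF [simp]: "\<pi> ^ j * a : IF (j + k) \<longleftrightarrow> a : IF k"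
 using q_pos by (auto simp: IK_iff IF_iff power_add)

lemma IK_cancel: "emb \<pi> ^ j * x : IK k ==> j <= k ==> x : IK (k - j)"
 and IF_cancel: "\<pi> ^ j * a : IF k ==> j <= k ==> a : IF (k - j)"
 using pi_power_mult_IK[of j x "k - j"] pi_power_mult_IF[of j a "k - j"] by auto

lemma pi_power_IK: "x : \<O> ==> k <= j ==> emb \<pi> ^ j * x : IK k"
 and pi_power_IF: "a : \<O> ==> k <= j ==> \<pi> ^ j * a : IF k"
 using pi_power_mult_IK[of j x 0] pi_power_mult_IF[of j a 0] IK_mono[of k j] IF_mono[of k j]
 by (auto simp: IK_0 IF_0)

lemma IK_decomp: "x : IK k ==> EX y:\<O>. x = emb \<pi> ^ k * y"
 using IK_cancel[of k "x / emb \<pi> ^ k" k] by (intro bexI[of _ "x / emb \<pi> ^ k"]) (auto simp: IK_0)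

lemma IF_decomp: "a : IF k ==> EX b:\<O>. a = \<pi> ^ k * b"
 using IF_cancel[of k "a / \<pi> ^ k" k] by (intro bexI[of _ "a / \<pi> ^ k"]) (auto simp: IF_0)

lemma IK_1_iff: "x : IK 1 \<longleftrightarrow> av x < 1" and IF_1_iff: "a : IF 1 \<longleftrightarrow> av a < 1"
 using av_less_1_K av_less_1_F q_less by (auto simp: IK_iff IF_iff)

lemma IK_Inter: "(!!k. x : IK k) ==> x = 0"
proof (rule ccontr)
 assume a: "!!k. x : IK k" and x: "x ~= 0"
 have "0 < av x" using x by simp
 then obtain k where "q ^ k < av x" using real_arch_pow_inv[of "av x" q] q_less by auto
 then show False using a[of k] by (simp add: IK_iff)
qed

lemma denominator_K: "EX k y. y : \<O> & (x :: 'k) = inverse (emb \<pi> ^ k) * y"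
proof -
 obtain k where "av x < (1 / q) ^ k" using real_arch_pow[of "1 / q" "av x"] q_pos q_less by auto
 then have "q ^ k * av x <= 1" using q_pos by (simp add: field_simps power_divide)
 then show ?thesis by (intro exI[of _ k] exI[of _ "emb \<pi> ^ k * x"]) (simp add: integers_iff)
qed

text \<open>An odd residue characteristic dividing 2 would be 1, which is not in the maximal
  ideal.\<close>

lemma av_two [simp]: "av (2 :: 'f) = 1" "av (2 :: 'k) = 1"
proof -
 have "of_nat 2 \<notin> (max_ideal :: 'f set)"
 proof
  assume a: "of_nat 2 : (max_ideal :: 'f set)"
  note p = residue_char_dvd[OF a]
  have "residue_char TYPE('f) <= 2" using p(1) dvd_imp_le by auto
  then have "residue_char TYPE('f) = 1" using p(2) odd_residue_char by (cases "residue_char TYPE('f) = 2") auto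
  then show False using p(3) by (simp add: max_ideal_def)
 qed
 then have "\<not> av (2 :: 'f) < 1" by (simp add: max_ideal_def)
 moreover have "av (2 :: 'f) <= 1" using numeral_integers integers_iff by blast
 ultimately show "av (2 :: 'f) = 1" by simp
 then show "av (2 :: 'k) = 1" using emb_av[of 2] by simp
qed

lemma two_nz [simp]: "(2 :: 'f) ~= 0" "(2 :: 'k) ~= 0"
 using av_two by (metis dist_self zero_neq_one)+

lemma half_integers [simp, intro]: "x : \<O> ==> x / (2 :: 'f) : \<O>" "y : \<O> ==> y / (2 :: 'k) : \<O>"
 by (auto simp: integers_iff)

text \<open>Tameness in the form used for unimodularity, where \<open>n\<close> appears as the trace
  of \<open>1\<close>.\<close>

lemma av_degree: "av (of_nat n :: 'f) = 1"
proof -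
 have "of_nat n \<notin> (max_ideal :: 'f set)" using residue_char_dvd(1)[of n] tame by blast
 moreover have "av (of_nat n :: 'f) <= 1" using of_nat_integers integers_iff by blast
 ultimately show ?thesis by (simp add: max_ideal_def)
qed

text \<open>Digit expansions: representatives modulo the next power are obtained by adding one more
  residue digit.\<close>

lemma finite_reps: "\<exists>R\<subseteq>\<O> :: 'k set. finite R & (ALL x:\<O>. EX a:R. x - a : IK k)"
proof (induction k)
 case 0
 show ?case by (intro exI[of _ "{0}"]) (auto simp: IK_0)
next
 case (Suc k)
 then obtain R where R: "R \<subseteq> \<O>" "finite R" "ALL x:\<O>. EX a:R. x - a : IK k" by blast
 obtain Q :: "'k set" where Q: "Q \<subseteq> \<O>" "finite Q" "ALL x:\<O>. EX a:Q. av (x - a) < 1"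
  using finite_residue_reps by blast
 show ?case
 proof (intro exI[of _ "(%(a, b). a + emb \<pi> ^ k * b) ` (R \<times> Q)"] conjI ballI)
  show "(%(a, b). a + emb \<pi> ^ k * b) ` (R \<times> Q) \<subseteq> \<O>" using R(1) Q(1) by auto
  show "finite ((%(a, b). a + emb \<pi> ^ k * b) ` (R \<times> Q))" using R(2) Q(2) by simp
  fix x :: 'k assume "x : \<O>"
  then obtain a where a: "a : R" "x - a : IK k" using R(3) by blast
  then obtain y where y: "y : \<O>" "x - a = emb \<pi> ^ k * y" using IK_decomp by blast
  then obtain b where b: "b : Q" "y - b : IK 1" using Q(3) IK_1_iff by blast
  have "x - (a + emb \<pi> ^ k * b) = emb \<pi> ^ k * (y - b)" using y(2) by (simp add: algebra_simps)
  then have "x - (a + emb \<pi> ^ k * b) : IK (Suc k)" using pi_power_mult_IK[of k "y - b" 1] b(2) by simp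
  then show "EX c:(%(a, b). a + emb \<pi> ^ k * b) ` (R \<times> Q). x - c : IK (Suc k)" using a b by force
 qed
qed

end

section \<open>Free modules and traces\<close>

text \<open>Coordinates are given as linear functions \<open>p b\<close> with the expansion
  property; the invariance of the trace needs nothing more. The locale is used twice, for
  \<open>O\<^sub>K\<close> over \<open>O\<close> and for \<open>K\<close> over
  \<open>F\<close>.\<close>

locale free_basis =
 fixes e :: "'f::comm_ring_1 => 'k::comm_ring_1" and R :: "'f set" and M :: "'k set"
  and B :: "'k set" and p :: "'k => 'k => 'f"
 assumes e_hom: "e 0 = 0" "e 1 = 1" "!!a b. e (a + b) = e a + e b" "!!a b. e (a * b) = e a * e b"
  and R_closed: "0 : R" "1 : R" "!!a b. a : R ==> b : R ==> a + b : R" "!!a b. a : R ==> b : R ==> a * b : R"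
   "!!a. a : R ==> - a : R"
  and M_closed: "0 : M" "!!x y. x : M ==> y : M ==> x + y : M" "!!a x. a : R ==> x : M ==> e a * x : M"
   "!!x. x : M ==> - x : M"
  and fin_B: "finite B" and B_sub: "B \<subseteq> M"
  and p_closed: "!!b x. b : B ==> x : M ==> p b x : R"
  and p_expand: "!!x. x : M ==> x = (SUM b:B. e (p b x) * b)"
  and p_add: "!!b x y. b : B ==> x : M ==> y : M ==> p b (x + y) = p b x + p b y"
  and p_scale: "!!b a x. b : B ==> a : R ==> x : M ==> p b (e a * x) = a * p b x"

definition linear_on :: "('f => 'k::comm_ring_1) => 'f set => 'k set => ('k => 'k) => bool" where
 "linear_on e R M X \<longleftrightarrow> (ALL x:M. X x : M) & (ALL x:M. ALL y:M. X (x + y) = X x + X y) &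
   (ALL a:R. ALL x:M. X (e a * x) = e a * X x)"

lemma linear_onD:
 assumes "linear_on e R M X"
 shows "!!x. x : M ==> X x : M" "!!x y. x : M ==> y : M ==> X (x + y) = X x + X y"
  "!!a x. a : R ==> x : M ==> X (e a * x) = e a * X x"
 using assms by (auto simp: linear_on_def)

context free_basis
begin

lemma sum_M: "(!!a. a : A ==> f a : M) ==> (SUM a:A. f a) : M"
 by (induction A rule: infinite_finite_induct) (auto simp: M_closed)

lemma additive_zero:
 assumes "!!x y. x : M ==> y : M ==> X (x + y) = X x + (X y :: 'z::ab_group_add)"
 shows "X 0 = 0"
 using assms[of 0 0] M_closed(1) by simp

lemma additive_sum:
 assumes "!!x y. x : M ==> y : M ==> X (x + y) = X x + (X y :: 'z::ab_group_add)"
  and "!!a. a : A ==> f a : M" and "finite A"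
 shows "X (SUM a:A. f a) = (SUM a:A. X (f a))"
 using assms(3,2)
proof (induction A rule: finite_induct)
 case empty
 show ?case using additive_zero[of X] assms(1) by simp
next
 case (insert x F)
 then show ?case using assms(1)[of "f x" "sum f F"] sum_M[of F f] by simp
qed

lemma p_comb:
 assumes "finite A" "!!c. c : A ==> a c : R" "!!c. c : A ==> x c : M" "b : B"
 shows "p b (SUM c:A. e (a c) * x c) = (SUM c:A. a c * p b (x c))"
 using assms additive_sum[of "p b" A "%c. e (a c) * x c"] p_add M_closed(3) by (simp add: p_scale)

lemma linear_expand:
 assumes X: "linear_on e R M X" and x: "x : M"
 shows "X x = (SUM b:B. e (p b x) * X b)"
proof -
 have "X x = X (SUM b:B. e (p b x) * b)" using p_expand[OF x] by simp
 also have "\<dots> = (SUM b:B. X (e (p b x) * b))"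
  using linear_onD(2)[OF X] B_sub p_closed x M_closed(3) fin_B by (intro additive_sum) auto
 also have "\<dots> = (SUM b:B. e (p b x) * X b)"
  using linear_onD(3)[OF X] B_sub p_closed x by (intro sum.cong) auto
 finally show ?thesis .
qed

definition trace :: "('k => 'k) => 'f" where
 "trace X = (SUM b:B. p b (X b))"

text \<open>Expand \<open>X b\<close> in \<open>C\<close>, swap the sums and contract over
  \<open>B\<close>. This matters because \<open>endo_trace\<close> refers to an unspecified
  basis.\<close>

lemma trace_basis_independent:
 assumes C: "free_basis e R M C q" and X: "linear_on e R M X"
 shows "free_basis.trace C q X = trace X"
proof -
 interpret C: free_basis e R M C q by fact
 have XB: "X b : M" if "b : B \<or> b : C" for b using that linear_onD(1)[OF X] B_sub C.B_sub by auto
 have "trace X = (SUM b:B. p b (SUM c:C. e (q c (X b)) * c))"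
  unfolding trace_def using C.p_expand XB by (intro sum.cong) auto
 also have "\<dots> = (SUM b:B. SUM c:C. q c (X b) * p b c)"
  using C.p_closed XB C.B_sub C.fin_B by (intro sum.cong refl p_comb) auto
 also have "\<dots> = (SUM c:C. SUM b:B. q c (X b) * p b c)" by (rule sum.swap)
 also have "\<dots> = (SUM c:C. q c (X c))"
 proof (intro sum.cong refl)
  fix c assume c: "c : C"
  then have cM: "c : M" using C.B_sub by auto
  have "q c (X c) = q c (SUM b:B. e (p b c) * X b)" using linear_expand[OF X cM] by simp
  also have "\<dots> = (SUM b:B. p b c * q c (X b))"
   using p_closed cM XB fin_B c by (intro C.p_comb) auto
  finally show "(SUM b:B. q c (X b) * p b c) = q c (X c)" by (simp add: mult.commute)
 qed
 finally show ?thesis by (simp add: C.trace_def)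
qed

lemma trace_commute:
 assumes X: "linear_on e R M X" and Y: "linear_on e R M Y"
 shows "trace (%x. X (Y x)) = trace (%x. Y (X x))"
proof -
 have *: "trace (%x. X (Y x)) = (SUM b:B. SUM c:B. p c (Y b) * p b (X c))"
  if X: "linear_on e R M X" and Y: "linear_on e R M Y" for X Y
  unfolding trace_def
 proof (intro sum.cong refl)
  fix b assume b: "b : B"
  then have Yb: "Y b : M" using linear_onD(1)[OF Y] B_sub by auto
  have "p b (X (Y b)) = p b (SUM c:B. e (p c (Y b)) * X c)" using linear_expand[OF X Yb] by simp
  also have "\<dots> = (SUM c:B. p c (Y b) * p b (X c))"
   using p_closed Yb B_sub linear_onD(1)[OF X] b fin_B by (intro p_comb) auto
  finally show "p b (X (Y b)) = (SUM c:B. p c (Y b) * p b (X c))" .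
 qed
 show ?thesis unfolding *[OF X Y] *[OF Y X] by (subst sum.swap) (simp add: mult.commute)
qed

lemma finsum_algebra_on:
 assumes "finite A" "!!a. a : A ==> f a : M"
 shows "finsum (algebra_on e M) f A = sum f A"
proof -
 interpret abelian_group "algebra_on e M"
  by (rule abelian_groupI) (auto simp: algebra_on_def M_closed algebra_simps intro: bexI[of _ "- _"])
 have ca: "carrier (algebra_on e M) = M" by (simp add: algebra_on_def)
 show ?thesis using assms
 proof (induction A rule: finite_induct)
  case empty
  show ?case using finsum_empty by (simp add: algebra_on_def)
 next
  case (insert x F)
  then have "finsum (algebra_on e M) f (insert x F) = f x +_{algebra_on e M} finsum (algebra_on e M) f F"
   using ca by (intro finsum_insert) auto
  then show ?case using insert by (simp add: algebra_on_def)
 qed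
qed

lemma finsum_ring_on:
 assumes "finite A" "!!a. a : A ==> f a : R"
 shows "finsum (ring_on R) f A = sum f A"
proof -
 interpret cring "ring_on R" by (rule cring_ring_on) (use R_closed in auto)
 show ?thesis using assms
 proof (induction A rule: finite_induct)
  case (insert x F)
  then have "finsum (ring_on R) f (insert x F) = f x +_{ring_on R} finsum (ring_on R) f F"
   by (intro finsum_insert) auto
  then show ?case using insert by simp
 qed simp
qed

lemma finsum_comb:
 assumes "finite A" "A \<subseteq> M" "c : A \<rightarrow> R"
 shows "(\<Oplus>\<^bsub>algebra_on e M\<^esub>b\<in>A. c b \<odot>_{algebra_on e M} b) = (SUM b:A. e (c b) * b)"
proof -
 have "(%b. c b \<odot>_{algebra_on e M} b) = (%b. e (c b) * b)" by (simp add: algebra_on_def)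
 then show ?thesis using finsum_algebra_on[of A "%b. e (c b) * b"] assms M_closed(3) by auto
qed

lemma module_basis_iff:
 assumes "finite A" "A \<subseteq> M"
 shows "module_basis (ring_on R) (algebra_on e M) A \<longleftrightarrow>
  (ALL x:M. EX! c. c : A \<rightarrow>\<^sub>E R & x = (SUM b:A. e (c b) * b))"
proof -
 have "c : A \<rightarrow>\<^sub>E R & x = (\<Oplus>\<^bsub>algebra_on e M\<^esub>b\<in>A. c b \<odot>_{algebra_on e M} b) \<longleftrightarrow>
   c : A \<rightarrow>\<^sub>E R & x = (SUM b:A. e (c b) * b)" for c x
  using finsum_comb[OF assms, of c] by (auto simp: PiE_def)
 then show ?thesis using assms by (simp add: module_basis_def algebra_on_def)
qed

lemma module_basis_B:
 assumes \<delta>: "!!b c. b : B ==> c : B ==> p b c = (if b = c then 1 else 0)"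
 shows "module_basis (ring_on R) (algebra_on e M) B"
 unfolding module_basis_iff[OF fin_B B_sub]
proof (intro ballI ex1I conjI)
 fix x assume x: "x : M"
 show "(\<lambda>b\<in>B. p b x) : B \<rightarrow>\<^sub>E R" using p_closed x by auto
 show "x = (SUM b:B. e ((\<lambda>b\<in>B. p b x) b) * b)" using p_expand[OF x] by simp
 fix c assume c: "c : B \<rightarrow>\<^sub>E R & x = (SUM b:B. e (c b) * b)"
 show "c = (\<lambda>b\<in>B. p b x)"
 proof (rule extensionalityI[of _ B])
  fix b assume b: "b : B"
  have "p b x = (SUM d:B. c d * p b d)"
   unfolding conjunct2[OF c] by (rule p_comb[OF fin_B _ _ b]) (use c B_sub in auto)
  also have "\<dots> = (SUM d:B. if d = b then c d else 0)" using \<delta> b by (intro sum.cong) auto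
  also have "\<dots> = c b" using b fin_B by simp
  finally show "c b = (\<lambda>b\<in>B. p b x) b" using b by simp
 qed (use c in \<open>auto simp: PiE_def\<close>)
qed

text \<open>The basis picked by \<open>SOME\<close> is again a \<open>free_basis\<close>, with
  coordinates taken from the unique expansions, so independence of the basis applies.\<close>

lemma endo_trace_eq:
 assumes \<delta>: "!!b c. b : B ==> c : B ==> p b c = (if b = c then 1 else 0)"
  and X: "linear_on e R M X"
 shows "endo_trace (ring_on R) (algebra_on e M) X = trace X"
proof -
 define A where "A = (SOME B. module_basis (ring_on R) (algebra_on e M) B)"
 have mb: "module_basis (ring_on R) (algebra_on e M) A"
  unfolding A_def by (rule someI[of "module_basis (ring_on R) (algebra_on e M)", OF module_basis_B[OF \<delta>]])
 have A: "finite A" "A \<subseteq> M" using mb by (auto simp: module_basis_def algebra_on_def)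
 have ex1: "EX! c. c : A \<rightarrow>\<^sub>E R & x = (SUM b:A. e (c b) * b)" if "x : M" for x
  using mb that unfolding module_basis_iff[OF A] by blast
 define q where "q x = (THE c. c : A \<rightarrow>\<^sub>E R & x = (SUM b:A. e (c b) * b))" for x
 have q: "q x : A \<rightarrow>\<^sub>E R & x = (SUM b:A. e (q x b) * b)" if "x : M" for x
  unfolding q_def by (rule theI'[OF ex1[OF that]])
 have qI: "q x = c" if "x : M" "c : A \<rightarrow>\<^sub>E R" "x = (SUM b:A. e (c b) * b)" for x c
  unfolding q_def by (rule the1_equality[OF ex1[OF that(1)]]) (use that in auto)
 have co: "coordinates (ring_on R) (algebra_on e M) A x = q x" for x
 proof -
  have "c : A \<rightarrow>\<^sub>E R & x = (\<Oplus>\<^bsub>algebra_on e M\<^esub>b\<in>A. c b \<odot>_{algebra_on e M} b) \<longleftrightarrow>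
   c : A \<rightarrow>\<^sub>E R & x = (SUM b:A. e (c b) * b)" for c
   using finsum_comb[OF A, of c] by (auto simp: PiE_def)
  then show ?thesis by (simp add: coordinates_def q_def)
 qed
 interpret Q: free_basis e R M A "%b x. q x b"
 proof (intro free_basis.intro e_hom R_closed M_closed A)
  fix b x assume "b : A" "x : M"
  then show "q x b : R" using q[of x] by auto
 next
  fix x assume "x : M"
  then show "x = (SUM b:A. e (q x b) * b)" using q[of x] by blast
 next
  fix b x y assume b: "b : A" and xy: "x : M" "y : M"
  have "q (x + y) = (\<lambda>b\<in>A. q x b + q y b)"
  proof (rule qI)
   show "(\<lambda>b\<in>A. q x b + q y b) : A \<rightarrow>\<^sub>E R" using q xy R_closed(3) by (auto simp: PiE_def Pi_def)
   have "x + y = (SUM b:A. e (q x b) * b) + (SUM b:A. e (q y b) * b)" using q xy by simp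
   then show "x + y = (SUM b:A. e ((\<lambda>b\<in>A. q x b + q y b) b) * b)"
    by (simp add: e_hom distrib_right sum.distrib)
  qed (use xy M_closed in auto)
  then show "q (x + y) b = q x b + q y b" using b by simp
 next
  fix b a x assume b: "b : A" and a: "a : R" and x: "x : M"
  have "q (e a * x) = (\<lambda>b\<in>A. a * q x b)"
  proof (rule qI)
   show "(\<lambda>b\<in>A. a * q x b) : A \<rightarrow>\<^sub>E R" using q x a R_closed(4) by (auto simp: PiE_def Pi_def)
   have "e a * x = e a * (SUM b:A. e (q x b) * b)" using q x by simp
   then show "e a * x = (SUM b:A. e ((\<lambda>b\<in>A. a * q x b) b) * b)"
    by (simp add: e_hom sum_distrib_left mult.assoc)
  qed (use x a M_closed in auto)
  then show "q (e a * x) b = a * q x b" using b by simp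
 qed
 have "trace X = (SUM b:A. q (X b) b)"
  using trace_basis_independent[OF Q.free_basis_axioms X] by (simp add: Q.trace_def)
 also have "\<dots> = (\<Oplus>\<^bsub>ring_on R\<^esub>b\<in>A. q (X b) b)"
 proof (rule finsum_ring_on[symmetric, OF A(1)])
  fix b assume b: "b : A"
  then have "X b : M" using A(2) linear_onD(1)[OF X] by auto
  then show "q (X b) b : R" using q[of "X b"] b by auto
 qed
 also have "\<dots> = (\<Oplus>\<^bsub>ring_on R\<^esub>b\<in>A. coordinates (ring_on R) (algebra_on e M) A (X b) b)"
  by (simp only: co)
 finally show ?thesis by (simp add: endo_trace_def A_def[symmetric] Let_def)
qed

end

section \<open>An integral basis\<close>

context unramified_GO
begin

text \<open>
 Representatives of a basis of the residue field of \<open>K\<close> form a basis of \<open>O\<^sub>K\<close> over \<open>O\<close>: they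
 generate by successive approximation, and a linear relation can be made primitive.
\<close>

lemma integral_basis_exists:
 "EX (Bs :: 'k set) co. finite Bs & Bs \<subseteq> \<O> &
  (ALL x. x = (SUM b:Bs. emb (co b x) * b)) &
  (ALL x:\<O>. ALL b:Bs. co b x : \<O>) &
  (ALL c. (SUM b:Bs. emb (c b) * b) = 0 --> (ALL b:Bs. c b = 0))"
proof -
 define gen where "gen Bs \<longleftrightarrow> finite Bs & Bs \<subseteq> \<O> &
  (ALL x:\<O>. EX a. (ALL b:Bs. a b : \<O>) & x - (SUM b:Bs. emb (a b) * b) : IK 1)" for Bs :: "'k set"
 obtain R :: "'k set" where R: "R \<subseteq> \<O>" "finite R" "ALL x:\<O>. EX a:R. x - a : IK 1"
  using finite_reps by blast
 have "gen R"
  unfolding gen_def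
 proof (intro conjI ballI R(1,2))
  fix x :: 'k assume "x : \<O>"
  then obtain a where a: "a : R" "x - a : IK 1" using R(3) by blast
  have "(SUM b:R. emb (if b = a then 1 else 0) * b) = (SUM b:R. if b = a then b else 0)"
   by (intro sum.cong) auto
  then have "(SUM b:R. emb (if b = a then 1 else 0) * b) = a" using a(1) R(2) by simp
  then show "EX c. (ALL b:R. c b : \<O>) & x - (SUM b:R. emb (c b) * b) : IK 1"
   using a(2) by (intro exI[of _ "%b. if b = a then 1 else 0"]) auto
 qed
 \<comment> \<open>Least size among generating sets modulo \<open>\<pi>\<close> replaces the choice
   of a basis of the residue field.\<close>
 then obtain Bs where Bs: "gen Bs" and min: "!!B. gen B ==> card Bs <= card B"
  using ex_has_least_nat[of gen R card] by blast
 have fin: "finite Bs" and sub: "Bs \<subseteq> \<O>" using Bs by (auto simp: gen_def)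
 have comb_int: "(SUM b:Bs. emb (c b) * b) : \<O>" if "!!b. b : Bs ==> c b : \<O>" for c
  using that sub by (intro sum_integers) auto
 \<comment> \<open>A relation modulo \<open>\<pi>\<close> with a unit coefficient at
   \<open>j\<close> would express \<open>j\<close> through the others and contradict
   minimality.\<close>
 have indep: "c j : IF 1"
  if c: "!!b. b : Bs ==> c b : \<O>" and rel: "(SUM b:Bs. emb (c b) * b) : IK 1" and j: "j : Bs" for c j
 proof (rule ccontr)
  assume "c j \<notin> IF 1"
  then have cj: "av (c j) = 1" using c[OF j] IF_1_iff[of "c j"] by (simp add: integers_iff)
  then have cjnz: "c j ~= 0" by auto
  define u where "u = inverse (c j)"
  have u: "u : \<O>" "u * c j = 1" using cj cjnz by (simp_all add: u_def integers_iff)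
  have "gen (Bs - {j})"
   unfolding gen_def
  proof (intro conjI ballI)
   fix x :: 'k assume "x : \<O>"
   then obtain a where a: "ALL b:Bs. a b : \<O>" "x - (SUM b:Bs. emb (a b) * b) : IK 1"
    using Bs by (auto simp: gen_def)
   define a' where "a' b = a b - a j * u * c b" for b
   have "(SUM b:Bs. emb (a' b) * b) = (SUM b:Bs. emb (a b) * b) - emb (a j * u) * (SUM b:Bs. emb (c b) * b)"
    by (simp add: a'_def sum_subtractf sum_distrib_left algebra_simps)
   moreover have "(SUM b:Bs. emb (a' b) * b) = (SUM b:Bs - {j}. emb (a' b) * b)"
   proof -
    have "a' j = 0" using u(2) by (simp add: a'_def mult.assoc)
    then show ?thesis using j fin by (simp add: sum.remove[of Bs j])
   qed
   ultimately have e: "x - (SUM b:Bs - {j}. emb (a' b) * b) =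
     (x - (SUM b:Bs. emb (a b) * b)) + emb (a j * u) * (SUM b:Bs. emb (c b) * b)" by simp
   have "emb (a j * u) * (SUM b:Bs. emb (c b) * b) : IK 1"
    using a(1) j u(1) by (intro IK_mult_integers rel) (auto simp del: emb_simps(4))
   then have "x - (SUM b:Bs - {j}. emb (a' b) * b) : IK 1" unfolding e by (rule IK_closed(2)[OF a(2)])
   moreover have "ALL b:Bs - {j}. a' b : \<O>" using a(1) c j u(1) by (auto simp: a'_def)
   ultimately show "EX a. (ALL b:Bs - {j}. a b : \<O>) & x - (SUM b:Bs - {j}. emb (a b) * b) : IK 1"
    by blast
  qed (use fin sub in auto)
  then have "card Bs <= card (Bs - {j})" by (rule min)
  then show False using card_Diff1_less[OF fin j] by simp
 qed
 \<comment> \<open>Dividing by the largest coefficient makes the combination primitive, hence of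
   absolute value 1. The resulting estimate yields both the integrality of coordinates and linear
   independence.\<close>
 have bound: "av (c j) <= av (SUM b:Bs. emb (c b) * b)" if j: "j : Bs" for c :: "'k => 'f" and j
 proof -
  define m where "m = arg_max_on (%b. av (c b)) Bs"
  have m: "m : Bs" "!!b. b : Bs ==> av (c b) <= av (c m)"
  proof -
   let ?A = "(%b. av (c b)) ` Bs"
   have A: "finite ?A" "?A ~= {}" using fin j by auto
   obtain m' where m'1: "m' : Bs" "Max ?A = av (c m')" using Max_in[OF A] by auto
   have "av (c b) <= av (c m')" if "b : Bs" for b using Max_ge[OF A(1) imageI[OF that]] m'1(2) by simp
   note m' = m'1(1) this
   have "is_arg_max (%b. av (c b)) (%b. b : Bs) m'" using m' by (auto simp: is_arg_max_def not_less)
   then have "is_arg_max (%b. av (c b)) (%b. b : Bs) m"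
    unfolding m_def arg_max_on_def arg_max_def by (rule someI)
   then show "m : Bs" "!!b. b : Bs ==> av (c b) <= av (c m)" by (auto simp: is_arg_max_def not_less)
  qed
  show ?thesis
  proof (cases "c m = 0")
   case True
   then show ?thesis using m(2)[OF j] by simp
  next
   case False
   define d where "d b = c b / c m" for b
   have d: "d b : \<O>" if "b : Bs" for b
    using m(2)[OF that] False by (simp add: d_def integers_iff)
   have "d m \<notin> IF 1" using False by (simp only: d_def IF_1_iff) simp
   then have "(SUM b:Bs. emb (d b) * b) \<notin> IK 1" using indep[of d m] d m(1) by blast
   then have "av (SUM b:Bs. emb (d b) * b) = 1"
    using comb_int[of d] d by (simp only: IK_1_iff integers_iff) simp
   moreover have "(SUM b:Bs. emb (c b) * b) = emb (c m) * (SUM b:Bs. emb (d b) * b)"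
    using False by (simp add: sum_distrib_left d_def mult.assoc[symmetric] emb_simps(4)[symmetric] del: emb_simps(4))
   ultimately show ?thesis using m(2)[OF j] by simp
  qed
 qed
 have "EX a y. y : \<O> & (ALL b:Bs. a b : \<O>) & x = (SUM b:Bs. emb (a b) * b) + emb \<pi> * y"
  if x: "x : \<O>" for x
 proof -
  obtain a where a: "ALL b:Bs. a b : \<O>" "x - (SUM b:Bs. emb (a b) * b) : IK 1"
   using Bs x by (auto simp: gen_def)
  then obtain y where "y : \<O>" "x - (SUM b:Bs. emb (a b) * b) = emb \<pi> ^ 1 * y"
   using IK_decomp by blast
  then show ?thesis using a(1) by (intro exI[of _ a] exI[of _ y]) (simp add: algebra_simps)
 qed
 \<comment> \<open>\<open>a x\<close> is one digit of \<open>x\<close> and \<open>r x\<close> the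
   remainder after division by \<open>\<pi>\<close>; iterating \<open>r\<close> expands
   \<open>x\<close> into a convergent series of digits.\<close>
 then obtain a r where ar: "!!x. x : \<O> ==> r x : \<O> & (ALL b:Bs. a x b : \<O>) &
   x = (SUM b:Bs. emb (a x b) * b) + emb \<pi> * r x" by metis
 have span_int: "EX c. (ALL b:Bs. c b : \<O>) & x = (SUM b:Bs. emb (c b) * b)" if x: "x : \<O>" for x
 proof -
  define z where "z k = (r ^^ k) x" for k
  have z: "z k : \<O>" for k unfolding z_def by (induction k) (use x ar in auto)
  define s where "s b N = (\<Sum>k<N. \<pi> ^ k * a (z k) b)" for b N
  have s_int: "s b N : \<O>" if "b : Bs" for b N
   unfolding s_def using ar[OF z] that by (intro sum_integers) auto
  have xs: "x = (SUM b:Bs. emb (s b N) * b) + emb \<pi> ^ N * z N" for N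
  proof (induction N)
   case 0
   then show ?case by (simp add: s_def z_def)
  next
   case (Suc N)
   have "z N = (SUM b:Bs. emb (a (z N) b) * b) + emb \<pi> * z (Suc N)"
    using ar[OF z[of N]] by (simp add: z_def)
   then have "emb \<pi> ^ N * z N = emb \<pi> ^ N * ((SUM b:Bs. emb (a (z N) b) * b) + emb \<pi> * z (Suc N))"
    by (rule arg_cong)
   then have "emb \<pi> ^ N * z N = (SUM b:Bs. emb (\<pi> ^ N * a (z N) b) * b) + emb \<pi> ^ Suc N * z (Suc N)"
    by (simp add: distrib_left sum_distrib_left mult.assoc mult.left_commute)
   then show ?case using Suc by (simp add: s_def sum.distrib algebra_simps)
  qed
  have tail: "av (s b M - s b N) <= q ^ N" if b: "b : Bs" and MN: "N <= M" for b M N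
  proof -
   have "s b M - s b N = (SUM k:{N..<M}. \<pi> ^ k * a (z k) b)"
    unfolding s_def using MN by (simp add: sum_diff_nat_ivl[of 0 N M, symmetric] atLeast0LessThan)
   also have "av \<dots> <= q ^ N"
   proof (rule av_sum_le)
    fix k assume k: "k : {N..<M}"
    have "\<pi> ^ k * a (z k) b : IF N" using k ar[OF z] b by (intro pi_power_IF) auto
    then show "av (\<pi> ^ k * a (z k) b) <= q ^ N" by (simp add: IF_iff)
   qed auto
   finally show ?thesis .
  qed
  have "EX l. s b \<longlonglongrightarrow> l" if b: "b : Bs" for b
  proof -
   have "Cauchy (s b)"
    unfolding Cauchy_altdef2
   proof (intro allI impI)
    fix e :: real assume "0 < e"
    then obtain N where N: "q ^ N < e" using real_arch_pow_inv q_less by blast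
    have "dist (s b M) (s b N) < e" if "N <= M" for M
     using tail[OF b that] N by (simp add: dist_commute[of "s b M"] dist_av[of "s b N"])
    then show "EX N. ALL n>=N. dist (s b n) (s b N) < e" by blast
   qed
   then show ?thesis using Cauchy_convergent_iff convergent_def by blast
  qed
  then obtain c where c: "!!b. b : Bs ==> s b \<longlonglongrightarrow> c b" by metis
  have near: "av (c b - s b N) <= q ^ N" if b: "b : Bs" for b N
  proof -
   have "(%M. dist (s b N) (s b M)) \<longlonglongrightarrow> dist (s b N) (c b)" using c[OF b] by (intro tendsto_intros)
   moreover have "eventually (%M. dist (s b N) (s b M) <= q ^ N) sequentially"
    by (rule eventually_mono[OF eventually_ge_at_top[of N]]) (simp add: dist_av[of "s b N"] tail[OF b])
   ultimately have "dist (s b N) (c b) <= q ^ N" by (rule tendsto_upperbound) simp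
   then show ?thesis by (simp add: dist_av[of "s b N"])
  qed
  have "x - (SUM b:Bs. emb (c b) * b) : IK N" for N
  proof -
   have e: "x - (SUM b:Bs. emb (c b) * b) = emb \<pi> ^ N * z N - (SUM b:Bs. emb (c b - s b N) * b)"
    using xs[of N] by (simp add: sum_subtractf algebra_simps)
   have "(SUM b:Bs. emb (c b - s b N) * b) : IK N"
    using near sub by (intro IK_closed(5) IK_mult_integers) (auto simp: IF_iff simp del: emb_simps)
   then show ?thesis unfolding e by (rule IK_closed(3)[OF pi_power_IK[OF z order_refl]])
  qed
  then have "x - (SUM b:Bs. emb (c b) * b) = 0" by (rule IK_Inter)
  moreover have "c b : \<O>" if "b : Bs" for b
   using near[OF that, of 0] by (simp add: s_def integers_iff)
  ultimately show ?thesis by (intro exI[of _ c]) auto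
 qed
 have span: "EX c. x = (SUM b:Bs. emb (c b) * b)" for x
 proof -
  obtain k y where y: "y : \<O>" "x = inverse (emb \<pi> ^ k) * y" using denominator_K by blast
  then obtain c where "y = (SUM b:Bs. emb (c b) * b)" using span_int by blast
  then have "x = (SUM b:Bs. emb (inverse (\<pi> ^ k) * c b) * b)"
   using y(2) by (simp add: sum_distrib_left algebra_simps)
  then show ?thesis by (rule exI[of _ "%b. inverse (\<pi> ^ k) * c b"])
 qed
 then obtain co where co: "!!x. x = (SUM b:Bs. emb (co x b) * b)" by metis
 show ?thesis
 proof (intro exI[of _ Bs] exI[of _ "%b x. co x b"] conjI allI ballI impI fin sub co)
  fix x b :: 'k assume "x : \<O>" "b : Bs"
  then show "co x b : \<O>" using bound[of b "co x"] co[of x] by (simp add: integers_iff)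
 next
  fix c :: "'k => 'f" and b :: 'k assume "(SUM b:Bs. emb (c b) * b) = 0" "b : Bs"
  then have "av (c b) <= 0" using bound[of b c] by simp
  then show "c b = 0" by (metis dist_eq_0_iff dual_order.antisym zero_le_dist)
 qed
qed

end

context unramified_GO
begin

definition integral_basis :: "'k set => ('k => 'k => 'f) => bool" where
 "integral_basis A p \<longleftrightarrow> finite A & A \<subseteq> \<O> &
  (ALL x. x = (SUM b:A. emb (p b x) * b)) &
  (ALL x:\<O>. ALL b:A. p b x : \<O>) &
  (ALL c. (SUM b:A. emb (c b) * b) = 0 --> (ALL b:A. c b = 0))"

text \<open>One basis is fixed for both structures, so that traces over \<open>O\<close> and over
  \<open>F\<close> are given by the same formula.\<close>

definition Bs :: "'k set" where "Bs = (SOME A. EX p. integral_basis A p)"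
definition co :: "'k => 'k => 'f" where "co = (SOME p. integral_basis Bs p)"

lemma basis_co:
 "finite Bs" "Bs \<subseteq> \<O>" "!!x. x = (SUM b:Bs. emb (co b x) * b)"
 "!!x b. x : \<O> ==> b : Bs ==> co b x : \<O>"
 "!!c b. (SUM b:Bs. emb (c b) * b) = 0 ==> b : Bs ==> c b = 0"
proof -
 have "EX A p. integral_basis A p" unfolding integral_basis_def by (rule integral_basis_exists)
 then have "EX p. integral_basis Bs p" unfolding Bs_def by (rule someI_ex)
 then have "integral_basis Bs co" unfolding co_def by (rule someI_ex)
 then show "finite Bs" "Bs \<subseteq> \<O>" "!!x. x = (SUM b:Bs. emb (co b x) * b)"
  "!!x b. x : \<O> ==> b : Bs ==> co b x : \<O>"
  "!!c b. (SUM b:Bs. emb (c b) * b) = 0 ==> b : Bs ==> c b = 0"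
  unfolding integral_basis_def by blast+
qed

lemma co_unique:
 assumes "x = (SUM b:Bs. emb (c b) * b)" "b : Bs"
 shows "co b x = c b"
proof -
 have "(SUM b:Bs. emb (co b x - c b) * b) = (SUM b:Bs. emb (co b x) * b) - (SUM b:Bs. emb (c b) * b)"
  by (simp add: sum_subtractf algebra_simps)
 also have "\<dots> = 0" using basis_co(3)[of x] assms(1) by simp
 finally show ?thesis using basis_co(5)[of "%b. co b x - c b" b] assms(2) by simp
qed

lemma co_add: "b : Bs ==> co b (x + y) = co b x + co b y"
proof (rule co_unique)
 show "x + y = (SUM b:Bs. emb (co b x + co b y) * b)"
  using basis_co(3)[of x] basis_co(3)[of y] by (simp add: distrib_right sum.distrib)
qed

lemma co_scale: "b : Bs ==> co b (emb a * x) = a * co b x"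
proof (rule co_unique)
 have "emb a * x = emb a * (SUM b:Bs. emb (co b x) * b)" using basis_co(3)[of x] by simp
 then show "emb a * x = (SUM b:Bs. emb (a * co b x) * b)" by (simp add: sum_distrib_left mult.assoc)
qed

lemma co_delta: "b : Bs ==> c : Bs ==> co b c = (if b = c then 1 else 0)"
proof (rule co_unique)
 assume "c : Bs"
 have "(SUM b:Bs. emb (if b = c then 1 else 0) * b) = (SUM b:Bs. if b = c then b else 0)"
  by (intro sum.cong) auto
 then show "c = (SUM b:Bs. emb (if b = c then 1 else 0) * b)" using \<open>c : Bs\<close> basis_co(1) by simp
qed

lemma basis_K: "free_basis emb UNIV UNIV Bs co"
 by unfold_locales (use basis_co(1,2,3) co_add co_scale in auto)

lemma basis_O: "free_basis emb \<O> \<O> Bs co"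
 by unfold_locales (use basis_co co_add co_scale in auto)

sublocale BK: free_basis emb UNIV UNIV Bs co by (rule basis_K)
sublocale BO: free_basis emb \<O> \<O> Bs co by (rule basis_O)

section \<open>Traces, the involution and the form\<close>

abbreviation lin :: "('k => 'k) => bool" where
 "lin \<equiv> linear_on emb \<O> \<O>"

definition tr :: "('k => 'k) => 'f" where
 "tr X = (SUM b:Bs. co b (X b))"

lemma endo_trace_O: "lin X ==> endo_trace OF OK X = tr X"
 using BO.endo_trace_eq[OF co_delta] by (simp add: BO.trace_def tr_def)

lemma tr_commute: "lin X ==> lin Y ==> tr (%x. X (Y x)) = tr (%x. Y (X x))"
 using BO.trace_commute by (simp add: BO.trace_def tr_def)

lemma Tr_eq: "Tr x = (SUM b:Bs. co b (b * x))"
proof -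
 have "linear_on emb UNIV UNIV (%y. y * x)" by (simp add: linear_on_def algebra_simps)
 then show ?thesis unfolding Tr_def using BK.endo_trace_eq[OF co_delta] by (simp add: BK.trace_def)
qed

lemma Tr_add: "Tr (x + y) = Tr x + Tr y"
 by (simp add: Tr_eq distrib_left co_add sum.distrib)

lemma Tr_scale: "Tr (emb a * x) = a * Tr x"
proof -
 have "co b (b * (emb a * x)) = a * co b (b * x)" if "b : Bs" for b
  using co_scale[OF that, of a "b * x"] by (simp add: mult.left_commute)
 then show ?thesis by (simp add: Tr_eq sum_distrib_left)
qed

lemma Tr_minus: "Tr (- x) = - Tr x"
 using Tr_scale[of "- 1" x] by simp

lemma Tr_integers: "x : \<O> ==> Tr x : \<O>"
 unfolding Tr_eq using basis_co(2) by (intro sum_integers basis_co(4)) auto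

lemma Tr_IF: "x : IK k ==> Tr x : IF k"
proof -
 assume "x : IK k"
 then obtain y where "y : \<O>" "x = emb (\<pi> ^ k) * y" using IK_decomp by force
 then show ?thesis using Tr_scale[of "\<pi> ^ k" y] Tr_integers[of y] pi_power_IF[of "Tr y" k k] by simp
qed

lemma co_IF: "x : IK k ==> b : Bs ==> co b x : IF k"
proof -
 assume "x : IK k" and b: "b : Bs"
 then obtain y where "y : \<O>" "x = emb (\<pi> ^ k) * y" using IK_decomp by force
 then show ?thesis using co_scale[OF b, of "\<pi> ^ k" y] basis_co(4)[of y b] b pi_power_IF[of "co b y" k k] by simp
qed

interpretation VK: vector_space "%a x. emb a * x"
 by unfold_locales (auto simp: algebra_simps)

lemma span_Bs: "VK.span Bs = UNIV"
proof -
 have "EX u. x = (SUM b:Bs. emb (u b) * b)" for x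
  by (rule exI[of _ "%b. co b x"]) (rule basis_co(3))
 then show ?thesis unfolding VK.span_finite[OF basis_co(1)] surj_def by blast
qed

lemma independent_Bs: "VK.independent Bs"
 unfolding VK.dependent_finite[OF basis_co(1)] using basis_co(5) by blast

lemma card_Bs: "card Bs = n"
 using VK.dim_eq_card[of Bs UNIV] span_Bs independent_Bs degree by simp

interpretation VKF: finite_dimensional_vector_space "%a x. emb a * x" Bs
 by unfold_locales (use basis_co(1) independent_Bs span_Bs in auto)

lemma F_linear_inj_imp_surj:
 assumes "!!x y. f (x + y) = f x + f y" "!!a x. f (emb a * x) = emb a * f x" "!!x. f x = 0 ==> x = 0"
 shows "surj f"
proof -
 have l: "Vector_Spaces.linear (%a x. emb a * x) (%a x. emb a * x) f"
  unfolding Vector_Spaces.linear_iff using assms(1,2) VK.vector_space_axioms by blast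
 have "inj f"
 proof (rule injI)
  fix x y assume e: "f x = f y"
  have "f (x - y) + f y = f x" using assms(1)[of "x - y" y] by simp
  then have "x - y = 0" using assms(3)[of "x - y"] e by simp
  then show "x = y" by simp
 qed
 then show ?thesis by (rule VKF.linear_inj_imp_surj[OF l])
qed

lemma Tr_one: "Tr 1 = of_nat n"
 by (simp add: Tr_eq co_delta card_Bs)

lemma \<iota>_simps [simp]:
 "\<iota> (x + y) = \<iota> x + \<iota> y" "\<iota> (x * y) = \<iota> x * \<iota> y" "\<iota> 1 = 1" "\<iota> 0 = 0" "\<iota> (- x) = - \<iota> x"
 "\<iota> (x - y) = \<iota> x - \<iota> y" "\<iota> (emb a) = emb a" "\<iota> (\<iota> x) = x" "\<iota> (x ^ k) = \<iota> x ^ k"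
 "\<iota> (numeral w) = numeral w"
proof -
 have G: "field_embedding \<iota>" "!!a. \<iota> (emb a) = emb a" using \<iota>_Gal by (auto simp: Gal_def)
 have a: "\<iota> (x + y) = \<iota> x + \<iota> y" for x y using G(1) by (simp add: field_embedding_def)
 have m: "\<iota> (x * y) = \<iota> x * \<iota> y" for x y using G(1) by (simp add: field_embedding_def)
 have o: "\<iota> 1 = 1" using G(1) by (simp add: field_embedding_def)
 have z: "\<iota> 0 = 0" using G(2)[of 0] by simp
 have n: "\<iota> (- x) = - \<iota> x" for x using a[of x "- x"] z by (simp add: eq_neg_iff_add_eq_0 add.commute)
 show "\<iota> (x + y) = \<iota> x + \<iota> y" "\<iota> (x * y) = \<iota> x * \<iota> y" "\<iota> 1 = 1" "\<iota> 0 = 0" "\<iota> (- x) = - \<iota> x" "\<iota> (emb a) = emb a"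
  by (fact a m o z n G(2))+
 show "\<iota> (x - y) = \<iota> x - \<iota> y" using a[of x "- y"] n by simp
 show "\<iota> (\<iota> x) = x" using \<iota>_order(2) by (metis comp_apply id_apply)
 show "\<iota> (x ^ k) = \<iota> x ^ k" by (induction k) (auto simp: m o)
 show "\<iota> (numeral w) = numeral w" using G(2)[of "numeral w"] by simp
qed

lemma \<iota>_eq_0 [simp]: "\<iota> x = 0 \<longleftrightarrow> x = 0"
 by (metis \<iota>_simps(4,8))

text \<open>Multiplication by \<open>\<iota> x\<close> is conjugate under \<open>\<iota>\<close> to
  multiplication by \<open>x\<close>, and conjugate maps have the same trace.\<close>

lemma Tr_\<iota>: "Tr (\<iota> x) = Tr x"
proof -
 have lm: "linear_on emb UNIV UNIV (%y. y * x)" for x by (simp add: linear_on_def algebra_simps)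
 have li: "linear_on emb UNIV UNIV \<iota>" by (simp add: linear_on_def)
 have l2: "linear_on emb UNIV UNIV (%y. \<iota> y * x)" by (simp add: linear_on_def algebra_simps)
 have "BK.trace (%y. y * \<iota> x) = BK.trace (%y. \<iota> (\<iota> y * x))" by simp
 also have "\<dots> = BK.trace (%y. \<iota> (\<iota> y) * x)" by (rule BK.trace_commute[OF li l2])
 finally show ?thesis by (simp add: BK.trace_def Tr_eq)
qed

lemma \<epsilon>_av: "av \<epsilon> = 1" and \<epsilon>_nz [simp]: "\<epsilon> ~= 0" and \<epsilon>_int [simp, intro]: "\<epsilon> : \<O>"
proof -
 show "av \<epsilon> = 1" using \<epsilon>_unit Units_integers by blast
 then show "\<epsilon> ~= 0" "\<epsilon> : \<O>" by (auto simp: integers_iff)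
qed

lemma S_simps:
 "S (x + y) z = S x z + S y z" "S x (y + z) = S x y + S x z"
 "S (x - y) z = S x z - S y z" "S x (y - z) = S x y - S x z"
 "S (- x) y = - S x y" "S x (- y) = - S x y"
 "S (emb a * x) y = a * S x y" "S x (emb a * y) = a * S x y"
 "S 0 y = 0" "S x 0 = 0"
proof -
 show a: "S (x + y) z = S x z + S y z" for x y z by (simp add: S_def Tr_add[symmetric] algebra_simps)
 show b: "S x (y + z) = S x y + S x z" for x y z by (simp add: S_def Tr_add[symmetric] algebra_simps)
 show c: "S (emb a * x) y = a * S x y" for a x y by (simp add: S_def Tr_scale[symmetric] algebra_simps)
 show d: "S x (emb a * y) = a * S x y" for a x y by (simp add: S_def Tr_scale[symmetric] algebra_simps)
 show m: "S (- x) y = - S x y" "S x (- y) = - S x y" for x y using c[of "- 1"] d[of x "- 1"] by simp_all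
 show "S (x - y) z = S x z - S y z" "S x (y - z) = S x y - S x z"
  using a[of x "- y" z] b[of x y "- z"] m by simp_all
 show "S 0 y = 0" "S x 0 = 0" using c[of 0 0 y] d[of x 0 0] by simp_all
qed

lemma S_sym: "S x y = S y x"
 using Tr_\<iota>[of "\<epsilon> * x * \<iota> y"] \<epsilon>_fixed by (simp add: S_def mult.assoc mult.commute[of "\<iota> x"])

lemma S_sum: "S (SUM a:A. f a) y = (SUM a:A. S (f a) y)" "S x (SUM a:A. f a) = (SUM a:A. S x (f a))"
 by (induction A rule: infinite_finite_induct) (auto simp: S_simps)

lemma S_mult_left: "S (x * c) y = S x (y * \<iota> c)"
 by (simp add: S_def mult_ac)

lemma lin_closed:
 "lin (%x. x)" "lin X ==> lin Y ==> lin (%x. X (Y x))" "lin X ==> lin Y ==> lin (%x. X x + Y x)"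
 "lin X ==> lin Y ==> lin (%x. X x - Y x)" "lin X ==> c : \<O> ==> lin (%x. X x * c)"
 "lin X ==> c : \<O> ==> lin (%x. c * X x)" "c : \<O> ==> lin (%x. x * c)"
 "lin (%x. 0)" "lin X ==> lin (%x. - X x)"
 by (auto simp: linear_on_def algebra_simps)

lemma lin_half: "lin X ==> lin (%x. X x / 2)"
 by (auto simp: linear_on_def add_divide_distrib)

lemma lin_zero: "lin X ==> X 0 = 0"
 using BO.additive_zero linear_onD(2) by blast

lemma lin_minus: "lin X ==> x : \<O> ==> X (- x) = - X x"
 using linear_onD(3)[of emb \<O> \<O> X "- 1" x] by simp

lemma lin_diff: "lin X ==> x : \<O> ==> y : \<O> ==> X (x - y) = X x - X y"
 using linear_onD(2)[of emb \<O> \<O> X x "- y"] lin_minus[of X y] by simp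

lemma lin_IK: "lin X ==> x : IK k ==> X x : IK k"
proof -
 assume X: "lin X" and "x : IK k"
 then obtain y where "y : \<O>" "x = emb (\<pi> ^ k) * y" using IK_decomp by force
 then have "X x = emb (\<pi> ^ k) * X y" "X y : \<O>"
  using linear_onD(3)[OF X, of "\<pi> ^ k" y] linear_onD(1)[OF X] by auto
 then show ?thesis using pi_power_IK[of "X y" k k] by simp
qed

lemma tr_simps:
 "tr (%x. X x + Y x) = tr X + tr Y" "tr (%x. - X x) = - tr X" "tr (%x. X x - Y x) = tr X - tr Y"
 "tr (%x. emb a * X x) = a * tr X"
proof -
 have p: "tr (%x. X x + Y x) = tr X + tr Y" for X Y by (simp add: tr_def co_add sum.distrib)
 have s: "tr (%x. emb a * X x) = a * tr X" for a X by (simp add: tr_def co_scale sum_distrib_left)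
 have m: "tr (%x. - X x) = - tr X" for X using s[of "- 1" X] by simp
 show "tr (%x. X x + Y x) = tr X + tr Y" "tr (%x. emb a * X x) = a * tr X" "tr (%x. - X x) = - tr X"
  by (fact p s m)+
 show "tr (%x. X x - Y x) = tr X - tr Y" using p[of X "%x. - Y x"] m[of Y] by simp
qed

lemma tr_IF: "(!!x. x : \<O> ==> X x : IK k) ==> tr X : IF k"
 unfolding tr_def using basis_co(2) by (intro IF_closed(5) co_IF) auto

lemma tr_integers: "lin X ==> tr X : \<O>"
 using tr_IF[of X 0] by (auto simp: IK_0 IF_0 linear_on_def)

lemma tr_mult: "tr (%x. x * c) = Tr c"
 by (simp add: tr_def Tr_eq)

text \<open>The test map \<open>Z x = emb (co c x) * y\<close> has rank one, so the trace of its
  composite with \<open>X\<close> is the single coordinate \<open>co c (X y)\<close>, where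
  \<open>c\<close> is chosen such that this is outside \<open>IF k\<close>.\<close>

lemma tr_nondegenerate:
 assumes X: "lin X" and b: "y : \<O>" "X y \<notin> IK k"
 shows "EX Z. lin Z & tr (%x. X (Z x)) \<notin> IF k"
proof -
 have "EX c:Bs. co c (X y) \<notin> IF k"
 proof (rule ccontr)
  assume "\<not> ?thesis"
  then have "(SUM c:Bs. emb (co c (X y)) * c) : IK k"
   using basis_co(2) by (intro IK_closed(5) IK_mult_integers) auto
  then show False using b(2) by (simp only: basis_co(3)[symmetric])
 qed
 then obtain c where c: "c : Bs" "co c (X y) \<notin> IF k" by blast
 define Z where "Z x = emb (co c x) * y" for x
 have Z: "lin Z"
  unfolding linear_on_def Z_def
 proof (intro conjI ballI)
  show "emb (co c x) * y : \<O>" if "x : \<O>" for x using basis_co(4)[OF that c(1)] b(1) by simp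
  show "emb (co c (x + x')) * y = emb (co c x) * y + emb (co c x') * y" for x x'
   unfolding co_add[OF c(1), of x x'] emb_simps(3) by (rule distrib_right)
  show "emb (co c (emb a * x)) * y = emb a * (emb (co c x) * y)" for a x
   unfolding co_scale[OF c(1), of a x] emb_simps(4) by (rule mult.assoc)
 qed
 have "tr (%x. X (Z x)) = (SUM b:Bs. co b (emb (co c b) * X y))"
  unfolding tr_def using linear_onD(3)[OF X] b(1) basis_co(2,4) c(1)
  by (intro sum.cong) (auto simp: Z_def subset_iff)
 also have "\<dots> = (SUM b:Bs. if b = c then co b (X y) else 0)"
  using c(1) by (intro sum.cong) (auto simp: co_scale co_delta)
 also have "\<dots> = co c (X y)" using c(1) basis_co(1) by simp
 finally have "tr (%x. X (Z x)) \<notin> IF k" using c(2) by simp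
 with Z show ?thesis by (intro exI[of _ Z] conjI)
qed

end

section \<open>Unimodularity and adjoints\<close>

locale GO_beta = unramified_GO emb \<pi> \<tau> \<iota> \<epsilon> n
 for emb :: "'f::nonarch_local_field => 'k::nonarch_local_field" and \<pi> \<tau> \<iota> \<epsilon> n +
 fixes \<beta> :: 'k
 assumes \<beta>_int [simp, intro]: "\<beta> : \<O>" and gen: "\<O> = adjoin emb \<beta>" and \<iota>_\<beta>: "\<iota> \<beta> = - \<beta>"
begin

text \<open>Integrality is preserved because \<open>O\<^sub>K = O[\<beta>]\<close> and
  \<open>\<iota> \<beta> = - \<beta>\<close>; no appeal is made to uniqueness of extended absolute
  values.\<close>

lemma \<iota>_integers_imp: "x : \<O> ==> \<iota> x : \<O>"
proof -
 have "\<iota> (poly p \<beta>) : \<O>" if "ALL i. poly.coeff p i : emb ` \<O>" for p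
  using that
 proof (induction p)
  case (pCons a p)
  have "a : emb ` \<O>" using pCons.prems[rule_format, of 0] by simp
  moreover have "ALL i. poly.coeff p i : emb ` \<O>" using pCons.prems by (metis coeff_pCons_Suc)
  ultimately show ?case using pCons.IH by (auto simp: \<iota>_\<beta>)
 qed simp
 then show "x : \<O> ==> \<iota> x : \<O>" unfolding gen adjoin_def by auto
qed

lemma \<iota>_integers [simp]: "\<iota> x : \<O> \<longleftrightarrow> x : \<O>"
 using \<iota>_integers_imp[of x] \<iota>_integers_imp[of "\<iota> x"] by auto

lemma \<iota>_IK [simp]: "\<iota> x : IK k \<longleftrightarrow> x : IK k"
proof -
 have "\<iota> x : IK k" if "x : IK k" for x
 proof -
  obtain y where "y : \<O>" "x = emb (\<pi> ^ k) * y" using IK_decomp \<open>x : IK k\<close> by force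
  then have "\<iota> x = emb \<pi> ^ k * \<iota> y" "\<iota> y : \<O>"
   by (auto simp del: emb_simps(7)) (simp add: emb_simps(7))
  then show ?thesis using pi_power_IK[of "\<iota> y" k k] by simp
 qed
 from this[of x] this[of "\<iota> x"] show ?thesis by auto
qed

lemma S_IF: "x : IK k ==> y : \<O> ==> S x y : IF k" "x : \<O> ==> y : IK k ==> S x y : IF k"
proof -
 show "S x y : IF k" if "x : IK k" "y : \<O>"
  unfolding S_def using that by (intro Tr_IF IK_mult_integers(1) IK_mult_integers(2)[of x]) auto
 show "S x y : IF k" if "x : \<O>" "y : IK k"
  unfolding S_def using that by (intro Tr_IF IK_mult_integers(2)[of "\<iota> y"]) auto
qed

lemma S_integers: "x : \<O> ==> y : \<O> ==> S x y : \<O>"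
 using S_IF(1)[of x 0 y] by (simp add: IK_0 IF_0)

text \<open>Write \<open>z = \<pi>^j * u\<close> with \<open>u\<close> a unit and pair it with the
  inverse of \<open>\<epsilon> * \<iota> u\<close>. The result is
  \<open>\<pi>^j * Tr 1 = \<pi>^j * n\<close>, and \<open>n\<close> is a unit, so
  \<open>j >= k\<close>.\<close>

lemma S_unimodular:
 assumes z: "z : \<O>" and S: "!!x. x : \<O> ==> S x z : IF k"
 shows "z : IK k"
proof (rule ccontr)
 assume zk: "z \<notin> IK k"
 define j where "j = (LEAST j. z \<notin> IK (Suc j))"
 have ex: "EX j. z \<notin> IK (Suc j)" using zk IK_mono[of k "Suc k" z] by auto
 then have j1: "z \<notin> IK (Suc j)" unfolding j_def by (rule LeastI_ex)
 have j2: "z : IK j"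
 proof (cases j)
  case 0
  then show ?thesis using z IK_0 by simp
 next
  case (Suc i)
  then show ?thesis using not_less_Least[of i "%j. z \<notin> IK (Suc j)"] by (auto simp: j_def)
 qed
 then have jk: "j < k" using zk IK_mono[of k j z] by (meson leI)
 obtain u where u: "u : \<O>" "z = emb \<pi> ^ j * u" using IK_decomp[OF j2] by blast
 have "u \<notin> IK 1" using j1 u(2) pi_power_mult_IK[of j u 1] by simp
 then have "\<iota> u \<notin> IK 1" "\<iota> u : \<O>" using u(1) by auto
 then have au: "av (\<iota> u) = 1" using IK_1_iff[of "\<iota> u"] by (simp add: integers_iff)
 then have unz: "\<iota> u ~= 0" by auto
 define x where "x = inverse (\<epsilon> * \<iota> u)"
 have "x : \<O>" using au \<epsilon>_av by (simp add: x_def integers_iff)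
 moreover have "S x z = \<pi> ^ j * of_nat n"
 proof -
  have "\<epsilon> * x * \<iota> z = emb (\<pi> ^ j) * 1" using unz by (simp add: u(2) x_def field_simps)
  then show ?thesis unfolding S_def using Tr_scale[of "\<pi> ^ j" 1] Tr_one by simp
 qed
 ultimately have "\<pi> ^ j * of_nat n : IF k" using S by metis
 then have "q ^ j <= q ^ k" using av_degree by (simp add: IF_iff)
 then show False using jk q_pos q_less power_strict_decreasing[of j k q] by simp
qed

text \<open>\<open>\<Psi>\<close> packs the pairings with the basis into an endomorphism of
  \<open>K\<close>; it is injective by unimodularity at all levels, hence onto by dimension. That
  the representing vector is integral is unimodularity once more, after clearing
  denominators.\<close>

lemma S_represent:
 assumes add: "!!x y. x : \<O> ==> y : \<O> ==> \<phi> (x + y) = \<phi> x + \<phi> y"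
  and scale: "!!a x. a : \<O> ==> x : \<O> ==> \<phi> (emb a * x) = a * \<phi> x"
  and int: "!!x. x : \<O> ==> \<phi> x : \<O>"
 shows "EX z:\<O>. ALL x:\<O>. \<phi> x = S x z"
proof -
 define \<Psi> where "\<Psi> z = (SUM b:Bs. emb (S b z) * b)" for z
 have expand: "S x z = (SUM b:Bs. co b x * S b z)" for x z
  using arg_cong[OF basis_co(3)[of x], of "%y. S y z"] by (simp only: S_sum S_simps)
 have "surj \<Psi>"
 proof (rule F_linear_inj_imp_surj)
  show "\<Psi> (x + y) = \<Psi> x + \<Psi> y" for x y by (simp add: \<Psi>_def S_simps distrib_right sum.distrib)
  show "\<Psi> (emb a * x) = emb a * \<Psi> x" for a x
   by (simp add: \<Psi>_def S_simps sum_distrib_left mult.assoc)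
  fix z assume "\<Psi> z = 0"
  have "S b z = 0" if "b : Bs" for b
   by (rule basis_co(5)[where c = "%b. S b z", OF \<open>\<Psi> z = 0\<close>[unfolded \<Psi>_def] that])
  then have S0: "S x z = 0" for x unfolding expand[of x z] by (intro sum.neutral) simp
  obtain k y where y: "y : \<O>" "z = inverse (emb \<pi> ^ k) * y" using denominator_K by blast
  have "y = emb (\<pi> ^ k) * z" using y(2) by simp
  then have "S x y = 0" for x using S0 by (simp only: S_simps) simp
  then have "y : IK j" for j using S_unimodular[OF y(1), of j] IF_closed(1) by simp
  then have "y = 0" by (rule IK_Inter)
  then show "z = 0" using y(2) by simp
 qed
 then obtain z where z: "(SUM b:Bs. emb (\<phi> b) * b) = \<Psi> z" by (rule surjE)
 have Sb: "S b z = \<phi> b" if "b : Bs" for b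
 proof -
  have "(SUM b:Bs. emb (S b z - \<phi> b) * b) = 0"
   using z by (simp add: \<Psi>_def left_diff_distrib sum_subtractf z[unfolded \<Psi>_def])
  from basis_co(5)[where c = "%b. S b z - \<phi> b", OF this that] show ?thesis by simp
 qed
 have "\<phi> x = (SUM b:Bs. co b x * \<phi> b)" if x: "x : \<O>" for x
 proof -
  have "\<phi> x = \<phi> (SUM b:Bs. emb (co b x) * b)" by (rule arg_cong[OF basis_co(3)])
  also have "\<dots> = (SUM b:Bs. \<phi> (emb (co b x) * b))"
   using basis_co(1,2) basis_co(4)[OF x] by (intro BO.additive_sum[where X = \<phi>, OF add]) auto
  also have "\<dots> = (SUM b:Bs. co b x * \<phi> b)"
   using scale basis_co(2,4) x by (intro sum.cong) auto
  finally show ?thesis .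
 qed
 then have Sz: "\<phi> x = S x z" if "x : \<O>" for x
  using that Sb unfolding expand[of x z] by (metis (no_types, lifting) sum.cong)
 obtain k y where y: "y : \<O>" "z = inverse (emb \<pi> ^ k) * y" using denominator_K by blast
 have yz: "y = emb (\<pi> ^ k) * z" using y(2) by simp
 have "S x y : IF k" if "x : \<O>" for x
  unfolding yz S_simps(8) using Sz[OF that] int[OF that] by (intro pi_power_IF) simp_all
 then have "y : IK k" by (rule S_unimodular[OF y(1)])
 then have "emb \<pi> ^ k * z : IK k" by (simp only: yz emb_simps)
 from IK_cancel[OF this order_refl] have "z : \<O>" by (simp add: IK_0)
 then show ?thesis using Sz by blast
qed

lemma S_cancel:
 assumes "z : \<O>" "z' : \<O>" "!!x. x : \<O> ==> S x z = S x z'"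
 shows "z = z'"
proof -
 have "z - z' : IK k" for k
  using S_unimodular[of "z - z'" k] assms IF_closed(1) by (simp add: S_simps)
 then show ?thesis using IK_Inter[of "z - z'"] by simp
qed

definition adj :: "('k => 'k) => 'k => 'k" where
 "adj X y = (SOME z. z : \<O> & (ALL x:\<O>. S (X x) y = S x z))"

lemma adj:
 assumes X: "lin X" and y: "y : \<O>"
 shows "adj X y : \<O>" "!!x. x : \<O> ==> S (X x) y = S x (adj X y)"
proof -
 have "EX z:\<O>. ALL x:\<O>. S (X x) y = S x z"
  by (rule S_represent) (use linear_onD[OF X] y S_integers in \<open>auto simp: S_simps\<close>)
 then have "EX z. z : \<O> & (ALL x:\<O>. S (X x) y = S x z)" by blast
 from someI_ex[OF this] show "adj X y : \<O>" "!!x. x : \<O> ==> S (X x) y = S x (adj X y)"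
  by (auto simp: adj_def)
qed

lemma lin_adj:
 assumes X: "lin X"
 shows "lin (adj X)"
 unfolding linear_on_def
proof (intro conjI ballI)
 show "adj X x : \<O>" if "x : \<O>" for x by (rule adj(1)[OF X that])
 show "adj X (x + y) = adj X x + adj X y" if "x : \<O>" "y : \<O>" for x y
  by (rule S_cancel) (use that adj[OF X] in \<open>auto simp: S_simps adj(2)[OF X, symmetric]\<close>)
 show "adj X (emb a * x) = emb a * adj X x" if "a : \<O>" "x : \<O>" for a x
  by (rule S_cancel) (use that adj[OF X] in \<open>auto simp: S_simps adj(2)[OF X, symmetric]\<close>)
qed

text \<open>The vectors \<open>d b\<close> represent the coordinate functions, so they form the
  basis dual to \<open>Bs\<close> for \<open>S\<close>. Moving \<open>X\<close> across
  \<open>S\<close> and expanding \<open>d b\<close> in \<open>Bs\<close> leads from one trace to the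
  other.\<close>

lemma tr_adj:
 assumes X: "lin X"
 shows "tr (adj X) = tr X"
proof -
 have "EX d:\<O>. ALL x:\<O>. co b x = S x d" if b: "b : Bs" for b
  by (rule S_represent) (use b co_add co_scale basis_co(4) in auto)
 then obtain d where d: "!!b. b : Bs ==> d b : \<O>" "!!b x. b : Bs ==> x : \<O> ==> co b x = S x (d b)"
  by metis
 have Xb: "X b : \<O>" if "b : Bs" for b using linear_onD(1)[OF X] basis_co(2) that by auto
 have bi: "b : \<O>" if "b : Bs" for b using basis_co(2) that by auto
 have dual: "y = (SUM b:Bs. emb (S b y) * d b)" if y: "y : \<O>" for y
 proof (rule S_cancel[OF y])
  show "(SUM b:Bs. emb (S b y) * d b) : \<O>" using d(1) bi S_integers y by (intro sum_integers) auto
  fix x :: 'k assume x: "x : \<O>"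
  have "S x y = S (SUM b:Bs. emb (co b x) * b) y" by (rule arg_cong[OF basis_co(3)])
  also have "\<dots> = (SUM b:Bs. co b x * S b y)" by (simp add: S_sum S_simps)
  also have "\<dots> = (SUM b:Bs. S b y * S x (d b))"
   using d(2) x by (intro sum.cong) (auto simp: mult.commute)
  finally show "S x y = S x (SUM b:Bs. emb (S b y) * d b)" by (simp only: S_sum S_simps)
 qed
 have "tr X = (SUM b:Bs. S b (adj X (d b)))"
  unfolding tr_def using d Xb bi adj(2)[OF X] by (intro sum.cong) auto
 also have "\<dots> = (SUM b:Bs. SUM c:Bs. co c (d b) * S b (adj X c))"
 proof (intro sum.cong refl)
  fix b assume b: "b : Bs"
  have "adj X (d b) = (SUM c:Bs. emb (co c (d b)) * adj X c)" by (rule BO.linear_expand[OF lin_adj[OF X] d(1)[OF b]])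
  then have "S b (adj X (d b)) = S b (SUM c:Bs. emb (co c (d b)) * adj X c)" by (rule arg_cong)
  then show "S b (adj X (d b)) = (SUM c:Bs. co c (d b) * S b (adj X c))"
   by (simp add: S_sum S_simps)
 qed
 also have "\<dots> = (SUM c:Bs. SUM b:Bs. co c (d b) * S b (adj X c))" by (rule sum.swap)
 also have "\<dots> = (SUM c:Bs. co c (adj X c))"
 proof (intro sum.cong refl)
  fix c assume c: "c : Bs"
  have A: "adj X c : \<O>" by (rule adj(1)[OF X bi[OF c]])
  have "co c (adj X c) = co c (SUM b:Bs. emb (S b (adj X c)) * d b)" by (rule arg_cong[OF dual[OF A]])
  also have "\<dots> = (SUM b:Bs. S b (adj X c) * co c (d b))"
   using d(1) bi S_integers A basis_co(1) c by (intro BO.p_comb) auto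
  finally show "(SUM b:Bs. co c (d b) * S b (adj X c)) = co c (adj X c)" by (simp add: mult.commute)
 qed
 finally show ?thesis by (simp add: tr_def)
qed

end

section \<open>The groups \<open>G(O\<^sub>r)\<close>\<close>

context GO_beta
begin

section \<open>Residue rings as sets of cosets\<close>

definition cK :: "nat => 'k => 'k set" where "cK r x = {y. y - x : IK r}"
definition cF :: "nat => 'f => 'f set" where "cF r a = {b. b - a : IF r}"

lemma coset_OK: "IK r +>\<^bsub>OK\<^esub> x = cK r x"
proof -
 have "IK r +>\<^bsub>OK\<^esub> x = (\<Union>h\<in>IK r. {h + x})" by (simp add: a_r_coset_def' algebra_on_def)
 also have "\<dots> = cK r x"
 proof
  show "cK r x \<subseteq> (\<Union>h\<in>IK r. {h + x})"
  proof
   fix y assume "y : cK r x"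
   then have "y - x : IK r" "y = (y - x) + x" by (auto simp: cK_def)
   then show "y : (\<Union>h\<in>IK r. {h + x})" by blast
  qed
 qed (auto simp: cK_def)
 finally show ?thesis .
qed

lemma coset_OF: "IF r +>\<^bsub>OF\<^esub> a = cF r a"
proof -
 have "IF r +>\<^bsub>OF\<^esub> a = (\<Union>h\<in>IF r. {h + a})" by (simp add: a_r_coset_def')
 also have "\<dots> = cF r a"
 proof
  show "cF r a \<subseteq> (\<Union>h\<in>IF r. {h + a})"
  proof
   fix b assume "b : cF r a"
   then have "b - a : IF r" "b = (b - a) + a" by (auto simp: cF_def)
   then show "b : (\<Union>h\<in>IF r. {h + a})" by blast
  qed
 qed (auto simp: cF_def)
 finally show ?thesis .
qed

lemma cK_self [simp]: "x : cK r x" and cF_self [simp]: "a : cF r a"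
 by (auto simp: cK_def cF_def)

lemma cK_mem: "y : cK r x \<longleftrightarrow> y - x : IK r" and cF_mem: "b : cF r a \<longleftrightarrow> b - a : IF r"
 by (auto simp: cK_def cF_def)

lemma cK_eq: "cK r x = cK r y \<longleftrightarrow> x - y : IK r"
proof
 assume "cK r x = cK r y"
 then have "x : cK r y" using cK_self by blast
 then show "x - y : IK r" by (simp add: cK_mem)
next
 assume d: "x - y : IK r"
 have "z - x : IK r \<longleftrightarrow> z - y : IK r" for z
  using IK_closed(2)[OF _ d, of "z - x"] IK_closed(3)[OF _ d, of "z - y"] by (auto simp: algebra_simps)
 then show "cK r x = cK r y" by (simp add: cK_def)
qed

lemma cF_eq: "cF r x = cF r y \<longleftrightarrow> x - y : IF r"
proof
 assume "cF r x = cF r y"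
 then have "x : cF r y" using cF_self by blast
 then show "x - y : IF r" by (simp add: cF_mem)
next
 assume d: "x - y : IF r"
 have "z - x : IF r \<longleftrightarrow> z - y : IF r" for z
  using IF_closed(2)[OF _ d, of "z - x"] IF_closed(3)[OF _ d, of "z - y"] by (auto simp: algebra_simps)
 then show "cF r x = cF r y" by (simp add: cF_def)
qed

lemma cK_integers: "x : \<O> ==> y : cK r x ==> y : \<O>"
 and cF_integers: "a : \<O> ==> b : cF r a ==> b : \<O>"
proof -
 show "y : \<O>" if "x : \<O>" "y : cK r x"
  using integers_closed(3)[OF IK_integers[of "y - x" r] that(1)] that(2) by (simp add: cK_mem)
 show "b : \<O>" if "a : \<O>" "b : cF r a"
  using integers_closed(3)[OF IF_integers[of "b - a" r] that(1)] that(2) by (simp add: cF_mem)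
qed

lemma carrier_OK_mod: "carrier (OK_mod r) = cK r ` \<O>"
proof -
 have "carrier (OK_mod r) = (\<Union>x\<in>\<O>. {IK r +>\<^bsub>OK\<^esub> x})"
  by (simp add: OK_mod_def quot_algebra_def FactRing_def A_RCOSETS_def' algebra_on_def)
 then show ?thesis by (auto simp: coset_OK)
qed

lemma carrier_OF_mod: "carrier (OF_mod r) = cF r ` \<O>"
proof -
 have "carrier (OF_mod r) = (\<Union>x\<in>\<O>. {IF r +>\<^bsub>OF\<^esub> x})"
  by (simp add: OF_mod_def FactRing_def A_RCOSETS_def')
 then show ?thesis by (auto simp: coset_OF)
qed

lemma OK_mod_add: "cK r x +_{OK_mod r} cK r y = cK r (x + y)"
proof -
 have "cK r x +_{OK_mod r} cK r y = (\<Union>a\<in>cK r x. \<Union>b\<in>cK r y. {a + b})"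
  by (simp add: OK_mod_def quot_algebra_def FactRing_def set_add_def' algebra_on_def)
 also have "\<dots> = cK r (x + y)"
 proof
  show "(\<Union>a\<in>cK r x. \<Union>b\<in>cK r y. {a + b}) \<subseteq> cK r (x + y)"
  proof
   fix z assume "z : (\<Union>a\<in>cK r x. \<Union>b\<in>cK r y. {a + b})"
   then obtain a b where "a - x : IK r" "b - y : IK r" "z = a + b" by (auto simp: cK_mem)
   then show "z : cK r (x + y)" using IK_closed(2)[of "a - x" r "b - y"] by (simp add: cK_mem algebra_simps)
  qed
  show "cK r (x + y) \<subseteq> (\<Union>a\<in>cK r x. \<Union>b\<in>cK r y. {a + b})"
  proof
   fix z assume "z : cK r (x + y)"
   then have "z - y : cK r x" "z = (z - y) + y" by (auto simp: cK_mem algebra_simps)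
   then show "z : (\<Union>a\<in>cK r x. \<Union>b\<in>cK r y. {a + b})" using cK_self by blast
  qed
 qed
 finally show ?thesis .
qed

lemma OK_mod_zero: "0_{OK_mod r} = cK r 0"
 by (simp add: OK_mod_def quot_algebra_def FactRing_def cK_def)

lemma UN_cK:
 assumes "!!y. y : cK r x ==> f y = c"
 shows "(\<Union>y\<in>cK r x. f y) = c"
 using assms cK_self[of x r] by blast

lemma UN_cF:
 assumes "!!y. y : cF r x ==> f y = c"
 shows "(\<Union>y\<in>cF r x. f y) = c"
 using assms cF_self[of x r] by blast

lemma OK_mod_smult:
 assumes "a : \<O>" "x : \<O>"
 shows "cF r a \<odot>_{OK_mod r} cK r x = cK r (emb a * x)"
proof -
 have "cF r a \<odot>_{OK_mod r} cK r x = (\<Union>b\<in>cF r a. \<Union>y\<in>cK r x. cK r (emb b * y))"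
  by (simp add: OK_mod_def quot_algebra_def algebra_on_def coset_OK[unfolded algebra_on_def])
 also have "\<dots> = cK r (emb a * x)"
 proof (intro UN_cF UN_cK)
  fix b y assume b: "b : cF r a" and y: "y : cK r x"
  have "emb b * y - emb a * x = emb (b - a) * y + emb a * (y - x)" by (simp add: algebra_simps)
  moreover have "emb (b - a) * y : IK r"
   using b cK_integers[OF assms(2) y] by (intro IK_mult_integers(1)) (simp_all add: cF_mem del: emb_simps)
  moreover have "emb a * (y - x) : IK r" using y assms by (intro IK_mult_integers(2)) (simp_all add: cK_mem)
  ultimately show "cK r (emb b * y) = cK r (emb a * x)" unfolding cK_eq using IK_closed(2) by simp
 qed
 finally show ?thesis .
qed

lemma OF_mod_mult:
 assumes "a : \<O>" "b : \<O>"
 shows "cF r a *_{OF_mod r} cF r b = cF r (a * b)"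
proof -
 have "cF r a *_{OF_mod r} cF r b = (\<Union>c\<in>cF r a. \<Union>d\<in>cF r b. cF r (c * d))"
  by (simp add: OF_mod_def FactRing_def rcoset_mult_def coset_OF)
 also have "\<dots> = cF r (a * b)"
 proof (intro UN_cF)
  fix c d assume c: "c : cF r a" and d: "d : cF r b"
  have "c * d - a * b = (c - a) * d + a * (d - b)" by (simp add: algebra_simps)
  moreover have "(c - a) * d : IF r" using c cF_integers[OF assms(2) d] by (intro IF_mult_integers(1)) (simp_all add: cF_mem)
  moreover have "a * (d - b) : IF r" using d assms by (intro IF_mult_integers(2)) (simp_all add: cF_mem)
  ultimately show "cF r (c * d) = cF r (a * b)" unfolding cF_eq using IF_closed(2) by simp
 qed
 finally show ?thesis .
qed

lemma OF_mod_add: "cF r x +_{OF_mod r} cF r y = cF r (x + y)"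
proof -
 have "cF r x +_{OF_mod r} cF r y = (\<Union>a\<in>cF r x. \<Union>b\<in>cF r y. {a + b})"
  by (simp add: OF_mod_def FactRing_def set_add_def')
 also have "\<dots> = cF r (x + y)"
 proof
  show "(\<Union>a\<in>cF r x. \<Union>b\<in>cF r y. {a + b}) \<subseteq> cF r (x + y)"
  proof
   fix z assume "z : (\<Union>a\<in>cF r x. \<Union>b\<in>cF r y. {a + b})"
   then obtain a b where "a - x : IF r" "b - y : IF r" "z = a + b" by (auto simp: cF_mem)
   then show "z : cF r (x + y)" using IF_closed(2)[of "a - x" r "b - y"] by (simp add: cF_mem algebra_simps)
  qed
  show "cF r (x + y) \<subseteq> (\<Union>a\<in>cF r x. \<Union>b\<in>cF r y. {a + b})"
  proof
   fix z assume "z : cF r (x + y)"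
   then have "z - y : cF r x" "z = (z - y) + y" by (auto simp: cF_mem algebra_simps)
   then show "z : (\<Union>a\<in>cF r x. \<Union>b\<in>cF r y. {a + b})" using cF_self by blast
  qed
 qed
 finally show ?thesis .
qed

lemma OF_mod_one: "1_{OF_mod r} = cF r 1"
 by (simp add: OF_mod_def FactRing_def coset_OF)

lemma Units_OF_mod:
 assumes r: "1 <= r" and a: "a : \<O>"
 shows "cF r a : Units (OF_mod r) \<longleftrightarrow> av a = 1"
proof
 assume "cF r a : Units (OF_mod r)"
 then obtain b where b: "b : \<O>" "cF r b *_{OF_mod r} cF r a = cF r 1"
  by (auto simp: Units_def carrier_OF_mod OF_mod_one)
 then have "b * a - 1 : IF r" using a by (simp add: OF_mod_mult cF_eq)
 then have "b * a - 1 : IF 1" using IF_mono[OF r] by blast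
 then have d: "av (b * a - 1) < 1" by (simp only: IF_1_iff)
 have "av (1 + (b * a - 1)) = av (1 :: 'f)" by (rule av_add_eq) (use d in simp)
 then have "av b * av a = 1" by simp
 then show "av a = 1" using a b(1) unfolding integers_iff
  by (metis dual_order.antisym mult_left_le_one_le zero_le_dist)
next
 assume a1: "av a = 1"
 then have "a ~= 0" by auto
 then have "inverse a : \<O>" "inverse a * a = 1" "a * inverse a = 1" using a1 by (auto simp: integers_iff)
 then show "cF r a : Units (OF_mod r)"
  unfolding Units_def using a OF_mod_mult[of a "inverse a" r] OF_mod_mult[of "inverse a" a r]
  by (auto simp: carrier_OF_mod OF_mod_one)
qed

lemma S_mod_cK:
 assumes "x : \<O>" "y : \<O>"
 shows "S_mod r (cK r x) (cK r y) = cF r (S x y)"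
 unfolding S_mod_def coset_OF
proof (intro UN_cK)
 fix x' y' assume x': "x' : cK r x" and y': "y' : cK r y"
 have "S x' y' - S x y = S (x' - x) y' + S x (y' - y)" by (simp add: S_simps)
 moreover have "S (x' - x) y' : IF r" using x' cK_integers[OF assms(2) y'] by (intro S_IF) (simp_all add: cK_mem)
 moreover have "S x (y' - y) : IF r" using y' assms by (intro S_IF) (simp_all add: cK_mem)
 ultimately show "cF r (S x' y') = cF r (S x y)" unfolding cF_eq using IF_closed(2) by simp
qed

section \<open>Linear lifts of maps between residue modules\<close>

definition cg :: "nat => ('k => 'k) => ('k => 'k) => bool" where
 "cg r X Y \<longleftrightarrow> (ALL x:\<O>. X x - Y x : IK r)"

text \<open>A similitude only modulo \<open>\<pi>\<^sup>r\<close>: elements of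
  \<open>G(O\<^sub>r)\<close> are represented by such maps, and no lift to a similitude over
  \<open>O\<close> is chosen.\<close>

definition sim :: "nat => ('k => 'k) => bool" where
 "sim r X \<longleftrightarrow> (EX \<nu>:\<O>. av \<nu> = 1 & (ALL x:\<O>. ALL y:\<O>. S (X x) (X y) - \<nu> * S x y : IF r))"

lemma cgD: "cg r X Y ==> x : \<O> ==> X x - Y x : IK r"
 by (simp add: cg_def)

lemma cg_refl: "cg r X X" and cg_sym: "cg r X Y ==> cg r Y X"
 and cg_trans: "cg r X Y ==> cg r Y Z' ==> cg r X Z'"
proof -
 show "cg r X X" by (simp add: cg_def IK_closed)
 show "cg r X Y ==> cg r Y X" unfolding cg_def using IK_closed(4) by (metis minus_diff_eq)
 assume "cg r X Y" "cg r Y Z'"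
 then show "cg r X Z'" unfolding cg_def
 proof (intro ballI)
  fix x :: 'k assume *: "ALL x:\<O>. X x - Y x : IK r" "ALL x:\<O>. Y x - Z' x : IK r" "x : \<O>"
  then have "(X x - Y x) + (Y x - Z' x) : IK r" by (intro IK_closed(2)) auto
  then show "X x - Z' x : IK r" by simp
 qed
qed

lemma cg_mono: "k <= r ==> cg r X Y ==> cg k X Y"
 unfolding cg_def using IK_mono by blast

lemma red_apply:
 assumes X: "lin X" and x: "x : \<O>"
 shows "red r X (cK r x) = cK r (X x)"
proof -
 have "red r X (cK r x) = (\<Union>y\<in>cK r x. cK r (X y))"
  using x by (simp add: red_def carrier_OK_mod coset_OK)
 also have "\<dots> = cK r (X x)"
 proof (rule UN_cK)
  fix y assume y: "y : cK r x"
  then have "X y - X x = X (y - x)" "y - x : IK r"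
   using lin_diff[OF X cK_integers[OF x y] x] by (auto simp: cK_mem)
  then show "cK r (X y) = cK r (X x)" unfolding cK_eq using lin_IK[OF X] by simp
 qed
 finally show ?thesis .
qed

lemma red_ext: "red r X : extensional (carrier (OK_mod r))"
 by (simp add: red_def)

lemma red_eq:
 assumes "lin X" "lin Y"
 shows "red r X = red r Y \<longleftrightarrow> cg r X Y"
proof
 assume e: "red r X = red r Y"
 show "cg r X Y"
  unfolding cg_def
 proof
  fix x :: 'k assume x: "x : \<O>"
  have "cK r (X x) = cK r (Y x)" using red_apply[OF assms(1) x, of r] red_apply[OF assms(2) x, of r] e by simp
  then show "X x - Y x : IK r" by (simp add: cK_eq)
 qed
next
 assume c: "cg r X Y"
 show "red r X = red r Y"
 proof (rule extensionalityI[OF red_ext red_ext])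
  fix C assume "C : carrier (OK_mod r)"
  then obtain x where x: "x : \<O>" "C = cK r x" by (auto simp: carrier_OK_mod)
  then show "red r X C = red r Y C" using red_apply[OF assms(1)] red_apply[OF assms(2)] cgD[OF c] by (simp add: cK_eq)
 qed
qed

lemma red_cong: "(!!x. x : \<O> ==> X x = Y x) ==> red r X = red r Y"
proof (rule extensionalityI[OF red_ext red_ext])
 fix C assume e: "!!x. x : \<O> ==> X x = Y x" and "C : carrier (OK_mod r)"
 then obtain x where x: "x : \<O>" "C = cK r x" by (auto simp: carrier_OK_mod)
 have "(\<Union>y\<in>cK r x. cK r (X y)) = (\<Union>y\<in>cK r x. cK r (Y y))"
  using e cK_integers[OF x(1)] by (intro SUP_cong) auto
 then show "red r X C = red r Y C" using x by (simp add: red_def carrier_OK_mod coset_OK)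
qed

lemma compose_red:
 assumes "lin X" "lin Y"
 shows "compose (carrier (OK_mod r)) (red r Y) (red r X) = red r (%x. Y (X x))"
proof (rule extensionalityI[of _ "carrier (OK_mod r)"])
 fix C assume C: "C : carrier (OK_mod r)"
 then obtain x where x: "x : \<O>" "C = cK r x" by (auto simp: carrier_OK_mod)
 have "X x : \<O>" using linear_onD(1)[OF assms(1)] x by blast
 then show "compose (carrier (OK_mod r)) (red r Y) (red r X) C = red r (%x. Y (X x)) C"
  using C x red_apply[OF assms(1) x(1)] red_apply[OF assms(2)] red_apply[OF lin_closed(2)[OF assms(2,1)] x(1)]
  by (simp add: compose_def)
qed (simp_all add: red_ext)

lemma red_mod_red:
 assumes X: "lin X" and k: "k <= r"
 shows "red_mod r k (red r X) = red k X"
proof (rule extensionalityI[of _ "carrier (OK_mod k)"])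
 fix C assume C: "C : carrier (OK_mod k)"
 then obtain x where x: "x : \<O>" "C = cK k x" by (auto simp: carrier_OK_mod)
 have "red_mod r k (red r X) C = (\<Union>y\<in>cK k x. \<Union>z\<in>red r X (cK r y). cK k z)"
  using C x by (simp add: red_mod_def coset_OK)
 also have "\<dots> = cK k (X x)"
 proof (rule UN_cK)
  fix y assume y: "y : cK k x"
  have yi: "y : \<O>" by (rule cK_integers[OF x(1) y])
  have "(\<Union>z\<in>cK r (X y). cK k z) = cK k (X x)"
  proof (rule UN_cK)
   fix z assume "z : cK r (X y)"
   then have "z - X y : IK k" using IK_mono[OF k] by (simp add: cK_mem)
   moreover have "X y - X x : IK k" using lin_IK[OF X, of "y - x" k] lin_diff[OF X yi x(1)] y by (simp add: cK_mem)
   ultimately have "(z - X y) + (X y - X x) : IK k" by (rule IK_closed(2))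
   then show "cK k z = cK k (X x)" by (simp add: cK_eq)
  qed
  then show "(\<Union>z\<in>red r X (cK r y). cK k z) = cK k (X x)" using red_apply[OF X yi] by simp
 qed
 finally show "red_mod r k (red r X) C = red k X C" using red_apply[OF X x(1), of k] x(2) by simp
qed (simp_all add: red_ext red_mod_def)

lemma finite_OK_mod: "finite (carrier (OK_mod r))"
proof -
 obtain R :: "'k set" where R: "R \<subseteq> \<O>" "finite R" "ALL x:\<O>. EX a:R. x - a : IK r"
  using finite_reps by blast
 have "cK r ` \<O> \<subseteq> cK r ` R"
 proof (rule image_subsetI)
  fix x :: 'k assume "x : \<O>"
  then obtain a where a: "a : R" "x - a : IK r" using R(3) by blast
  then have "cK r x = cK r a" by (simp only: cK_eq)
  then show "cK r x : cK r ` R" using a(1) by blast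
 qed
 then show ?thesis unfolding carrier_OK_mod using R(2) finite_subset by blast
qed

text \<open>\<open>O\<^sub>K\<close> is free over \<open>O\<close>, so the images of the basis
  vectors may be lifted independently; linearity of \<open>g\<close> extends the agreement to all
  combinations.\<close>

lemma lin_lift:
 assumes g: "g : linear_maps (OF_mod r) (OK_mod r) (OK_mod r)"
 shows "EX X. lin X & (ALL x:\<O>. g (cK r x) = cK r (X x))"
proof -
 have "EX y:\<O>. g (cK r b) = cK r y" if "b : Bs" for b
  using linear_mapsD(1)[OF g, of "cK r b"] basis_co(2) that by (auto simp: carrier_OK_mod)
 then obtain y where y: "!!b. b : Bs ==> y b : \<O>" "!!b. b : Bs ==> g (cK r b) = cK r (y b)" by metis
 define X where "X x = (SUM b:Bs. emb (co b x) * y b)" for x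
 have X: "lin X"
  unfolding linear_on_def
 proof (intro conjI ballI)
  show "X x : \<O>" if "x : \<O>" for x
   unfolding X_def using y(1) basis_co(4)[OF that] by (intro sum_integers) simp
  show "X (x + x') = X x + X x'" for x x'
   unfolding X_def sum.distrib[symmetric]
   by (intro sum.cong refl) (simp only: co_add emb_simps distrib_right)
  show "X (emb a * x) = emb a * X x" for a x
   unfolding X_def sum_distrib_left
   by (intro sum.cong refl) (simp only: co_scale emb_simps mult.assoc)
 qed
 have part: "g (cK r (SUM b:A. emb (c b) * b)) = cK r (SUM b:A. emb (c b) * y b)"
  if "finite A" "A \<subseteq> Bs" "!!b. b : Bs ==> c b : \<O>" for A c
  using that(1,2)
 proof (induction A rule: finite_induct)
  case empty
  have "g (cF r 0 \<odot>_{OK_mod r} cK r 0) = cF r 0 \<odot>_{OK_mod r} g (cK r 0)"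
   by (rule linear_mapsD(3)[OF g]) (auto simp: carrier_OF_mod carrier_OK_mod)
  moreover obtain z where "z : \<O>" "g (cK r 0) = cK r z"
   using linear_mapsD(1)[OF g, of "cK r 0"] by (auto simp: carrier_OK_mod)
  ultimately show ?case by (simp add: OK_mod_smult)
 next
  case (insert b A)
  have b: "b : Bs" "b : \<O>" "c b : \<O>" using insert.prems basis_co(2) that(3) by auto
  have s: "(SUM b:A. emb (c b) * b) : \<O>"
  proof (rule sum_integers)
   fix a assume "a : A"
   then have "a : Bs" using insert.prems by blast
   then show "emb (c a) * a : \<O>" using that(3) subsetD[OF basis_co(2)] by (intro integers_closed(5)) simp_all
  qed
  have gb: "g (cK r (emb (c b) * b)) = cK r (emb (c b) * y b)"
   using linear_mapsD(3)[OF g, of "cF r (c b)" "cK r b"] b y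
   by (simp add: carrier_OF_mod carrier_OK_mod OK_mod_smult)
  have "g (cK r (SUM b:insert b A. emb (c b) * b)) =
    g (cK r (emb (c b) * b) +_{OK_mod r} cK r (SUM b:A. emb (c b) * b))"
   using insert.hyps by (simp add: OK_mod_add)
  also have "\<dots> = g (cK r (emb (c b) * b)) +_{OK_mod r} g (cK r (SUM b:A. emb (c b) * b))"
   using b s by (intro linear_mapsD(2)[OF g]) (auto simp: carrier_OK_mod)
  finally show ?case using gb insert by (simp add: OK_mod_add)
 qed
 have "g (cK r x) = cK r (X x)" if x: "x : \<O>" for x
  using part[OF basis_co(1) subset_refl, of "%b. co b x"] basis_co(4)[OF x]
  unfolding X_def basis_co(3)[of x, symmetric] by blast
 with X show ?thesis by (intro exI[of _ X]) simp
qed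

text \<open>\<open>S (X w) (X (x - y))\<close> is small when \<open>X x - X y\<close> is, and equals
  a unit times \<open>S w (x - y)\<close> modulo \<open>\<pi>\<^sup>r\<close>; unimodularity then
  applies.\<close>

lemma sim_inj:
 assumes X: "lin X" and s: "sim r X" and xy: "x : \<O>" "y : \<O>" and e: "X x - X y : IK r"
 shows "x - y : IK r"
proof (rule S_unimodular)
 show i: "x - y : \<O>" using xy by simp
 obtain \<nu> where \<nu>: "\<nu> : \<O>" "av \<nu> = 1"
  "!!x y. x : \<O> ==> y : \<O> ==> S (X x) (X y) - \<nu> * S x y : IF r"
  using s by (auto simp: sim_def)
 fix w :: 'k assume w: "w : \<O>"
 have "S (X w) (X (x - y)) : IF r"
  using lin_diff[OF X xy] e linear_onD(1)[OF X w] by (intro S_IF(2)) simp_all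
 moreover have "S (X w) (X (x - y)) - \<nu> * S w (x - y) : IF r" by (rule \<nu>(3)[OF w i])
 ultimately have "\<nu> * S w (x - y) : IF r" using IF_closed(3)[of "S (X w) (X (x - y))" r] by fastforce
 then show "S w (x - y) : IF r" using \<nu>(2) by (simp add: IF_iff)
qed

lemma red_linear: "lin X ==> red r X : linear_maps (OF_mod r) (OK_mod r) (OK_mod r)"
proof (rule linear_mapsI)
 assume X: "lin X"
 fix C assume "C : carrier (OK_mod r)"
 then obtain x where x: "x : \<O>" "C = cK r x" by (auto simp: carrier_OK_mod)
 then show "red r X C : carrier (OK_mod r)" using red_apply[OF X x(1)] linear_onD(1)[OF X x(1)] by (auto simp: carrier_OK_mod)
 fix D assume "D : carrier (OK_mod r)"
 then obtain y where y: "y : \<O>" "D = cK r y" by (auto simp: carrier_OK_mod)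
 show "red r X (C +_{OK_mod r} D) = red r X C +_{OK_mod r} red r X D"
  using x y red_apply[OF X x(1)] red_apply[OF X y(1)] red_apply[OF X integers_closed(3)[OF x(1) y(1)]]
   linear_onD(2)[OF X x(1) y(1)] by (simp add: OK_mod_add)
next
 assume X: "lin X"
 fix A C assume "A : carrier (OF_mod r)" "C : carrier (OK_mod r)"
 then obtain a x where x: "a : \<O>" "A = cF r a" "x : \<O>" "C = cK r x"
  by (auto simp: carrier_OK_mod carrier_OF_mod)
 have "emb a * x : \<O>" using x by simp
 then show "red r X (A \<odot>_{OK_mod r} C) = A \<odot>_{OK_mod r} red r X C"
  using x red_apply[OF X x(3)] red_apply[OF X, of "emb a * x"] linear_onD(3)[OF X x(1,3)] linear_onD(1)[OF X x(3)]
  by (simp add: OK_mod_smult)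
qed

text \<open>Injectivity suffices because \<open>OK_mod r\<close> is finite.\<close>

lemma in_GL_red:
 assumes X: "lin X" and s: "sim r X"
 shows "red r X : carrier (GL (OF_mod r) (OK_mod r))"
proof -
 have "bij_betw (red r X) (carrier (OK_mod r)) (carrier (OK_mod r))"
 proof -
  have "inj_on (red r X) (carrier (OK_mod r))"
  proof (rule inj_onI)
   fix C D assume CD: "C : carrier (OK_mod r)" "D : carrier (OK_mod r)" "red r X C = red r X D"
   then obtain x y where xy: "x : \<O>" "C = cK r x" "y : \<O>" "D = cK r y" by (auto simp: carrier_OK_mod)
   then have "X x - X y : IK r" using CD(3) red_apply[OF X] by (simp add: cK_eq)
   then show "C = D" using sim_inj[OF X s xy(1,3)] xy by (simp add: cK_eq)
  qed
  moreover have "red r X ` carrier (OK_mod r) \<subseteq> carrier (OK_mod r)"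
   using calculation linear_mapsD(1)[OF red_linear[OF X]] by auto
  ultimately show ?thesis using endo_inj_surj[OF finite_OK_mod] by (simp add: bij_betw_def)
 qed
 then show ?thesis using red_linear[OF X] by (simp add: GL_simps Bij_def red_ext)
qed

text \<open>Both the map and its multiplier are lifted; the multiplier stays a unit because
  \<open>r >= 1\<close>. From here on group elements are handled through their linear lifts.\<close>

lemma carrier_G:
 assumes r: "1 <= r"
 shows "g : carrier (G r) \<longleftrightarrow> (EX X. lin X & sim r X & g = red r X)"
proof
 assume "g : carrier (G r)"
 then have g: "g : carrier (GL (OF_mod r) (OK_mod r))"
  and "EX \<nu>:Units (OF_mod r). ALL x:carrier (OK_mod r). ALL y:carrier (OK_mod r).
   S_mod r (g x) (g y) = \<nu> *_{OF_mod r} S_mod r x y"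
  by (auto simp: G_def GO_def)
 then obtain N where N: "N : Units (OF_mod r)"
  "!!x y. x : carrier (OK_mod r) ==> y : carrier (OK_mod r) ==> S_mod r (g x) (g y) = N *_{OF_mod r} S_mod r x y"
  by blast
 obtain \<nu> where \<nu>: "\<nu> : \<O>" "N = cF r \<nu>" using N(1) by (auto simp: Units_def carrier_OF_mod)
 have \<nu>1: "av \<nu> = 1" using N(1) \<nu> Units_OF_mod[OF r] by blast
 have gl: "g : linear_maps (OF_mod r) (OK_mod r) (OK_mod r)" "g : extensional (carrier (OK_mod r))"
  using g by (auto simp: GL_simps Bij_def)
 obtain X where X: "lin X" "!!x. x : \<O> ==> g (cK r x) = cK r (X x)" using lin_lift[OF gl(1)] by blast
 have "g = red r X"
 proof (rule extensionalityI[OF gl(2) red_ext])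
  fix C assume "C : carrier (OK_mod r)"
  then obtain x where "x : \<O>" "C = cK r x" by (auto simp: carrier_OK_mod)
  then show "g C = red r X C" using X(2) red_apply[OF X(1)] by simp
 qed
 moreover have "sim r X"
  unfolding sim_def
 proof (intro bexI[of _ \<nu>] conjI ballI \<nu>1 \<nu>(1))
  fix x y :: 'k assume xy: "x : \<O>" "y : \<O>"
  have "S_mod r (cK r (X x)) (cK r (X y)) = cF r \<nu> *_{OF_mod r} S_mod r (cK r x) (cK r y)"
   using N(2)[of "cK r x" "cK r y"] X(2) xy \<nu> by (simp add: carrier_OK_mod)
  then have "cF r (S (X x) (X y)) = cF r (\<nu> * S x y)"
   using xy linear_onD(1)[OF X(1)] S_integers \<nu>(1) by (simp add: S_mod_cK OF_mod_mult)
  then show "S (X x) (X y) - \<nu> * S x y : IF r" by (simp only: cF_eq)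
 qed
 ultimately show "EX X. lin X & sim r X & g = red r X" using X(1) by (intro exI[of _ X]) simp
next
 assume "EX X. lin X & sim r X & g = red r X"
 then obtain X where X: "lin X" "sim r X" "g = red r X" by blast
 obtain \<nu> where \<nu>: "\<nu> : \<O>" "av \<nu> = 1"
  "!!x y. x : \<O> ==> y : \<O> ==> S (X x) (X y) - \<nu> * S x y : IF r"
  using X(2) by (auto simp: sim_def)
 have "S_mod r (g C) (g D) = cF r \<nu> *_{OF_mod r} S_mod r C D"
  if "C : carrier (OK_mod r)" "D : carrier (OK_mod r)" for C D
 proof -
  obtain x y where xy: "x : \<O>" "C = cK r x" "y : \<O>" "D = cK r y"
   using \<open>C : carrier (OK_mod r)\<close> \<open>D : carrier (OK_mod r)\<close> by (auto simp: carrier_OK_mod)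
  have "S_mod r (g C) (g D) = cF r (S (X x) (X y))"
   using xy red_apply[OF X(1)] linear_onD(1)[OF X(1)] X(3) by (simp add: S_mod_cK)
  also have "\<dots> = cF r (\<nu> * S x y)" using \<nu>(3) xy by (simp add: cF_eq)
  also have "\<dots> = cF r \<nu> *_{OF_mod r} S_mod r C D" using xy \<nu>(1) S_integers by (simp add: S_mod_cK OF_mod_mult)
  finally show ?thesis .
 qed
 moreover have "cF r \<nu> : Units (OF_mod r)" using Units_OF_mod[OF r \<nu>(1)] \<nu>(2) by simp
 ultimately show "g : carrier (G r)" using in_GL_red[OF X(1,2)] X(3) by (auto simp: G_def GO_def)
qed

section \<open>The group law on reductions\<close>

lemma red_carrier: "1 <= r ==> lin X ==> sim r X ==> red r X : carrier (G r)"
 unfolding carrier_G by (intro exI[of _ X] conjI refl)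

text \<open>Elements act from the right, so the left factor is applied first.\<close>

lemma G_mult:
 assumes "1 <= r" "lin X" "sim r X" "lin Y" "sim r Y"
 shows "red r X *_{G r} red r Y = red r (%x. Y (X x))"
proof -
 have "red r X *_{G r} red r Y = red r Y *_{GL (OF_mod r) (OK_mod r)} red r X" by (simp add: G_def GO_def)
 also have "\<dots> = compose (carrier (OK_mod r)) (red r Y) (red r X)"
  by (rule GL_simps(3)[OF in_GL_red in_GL_red]) (use assms in auto)
 also have "\<dots> = red r (%x. Y (X x))" by (rule compose_red[OF assms(2,4)])
 finally show ?thesis .
qed

lemma G_one: "1_{G r} = red r (%x. x)"
proof (rule extensionalityI[of _ "carrier (OK_mod r)"])
 fix C assume C: "C : carrier (OK_mod r)"
 then obtain x where x: "x : \<O>" "C = cK r x" by (auto simp: carrier_OK_mod)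
 then show "1_{G r} C = red r (%x. x) C" using C red_apply[OF lin_closed(1) x(1)] by (simp add: G_def GO_def GL_simps)
qed (simp_all add: red_ext, simp add: G_def GO_def GL_simps)

lemma sim_id: "sim r (%x. x)"
 unfolding sim_def by (intro bexI[of _ 1]) (auto simp: IF_closed)

lemma sim_comp:
 assumes X: "lin X" "sim r X" and Y: "lin Y" "sim r Y"
 shows "sim r (%x. Y (X x))"
proof -
 obtain \<nu> where \<nu>: "\<nu> : \<O>" "av \<nu> = 1"
  "!!x y. x : \<O> ==> y : \<O> ==> S (X x) (X y) - \<nu> * S x y : IF r"
  using X(2) by (auto simp: sim_def)
 obtain \<mu> where \<mu>: "\<mu> : \<O>" "av \<mu> = 1"
  "!!x y. x : \<O> ==> y : \<O> ==> S (Y x) (Y y) - \<mu> * S x y : IF r"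
  using Y(2) by (auto simp: sim_def)
 show ?thesis
  unfolding sim_def
 proof (intro bexI[of _ "\<mu> * \<nu>"] conjI ballI)
  fix x y :: 'k assume xy: "x : \<O>" "y : \<O>"
  have "S (Y (X x)) (Y (X y)) - \<mu> * S (X x) (X y) : IF r"
   using \<mu>(3) linear_onD(1)[OF X(1)] xy by blast
  moreover have "\<mu> * (S (X x) (X y) - \<nu> * S x y) : IF r" using \<nu>(3)[OF xy] \<mu>(1) by (rule IF_mult_integers(2))
  ultimately have "(S (Y (X x)) (Y (X y)) - \<mu> * S (X x) (X y)) + \<mu> * (S (X x) (X y) - \<nu> * S x y) : IF r"
   by (rule IF_closed(2))
  then show "S (Y (X x)) (Y (X y)) - \<mu> * \<nu> * S x y : IF r" by (simp add: algebra_simps)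
 qed (use \<nu>(1,2) \<mu>(1,2) in auto)
qed

lemma sim_cg:
 assumes X: "lin X" "sim r X" and Y: "lin Y" and c: "cg r X Y"
 shows "sim r Y"
proof -
 obtain \<nu> where \<nu>: "\<nu> : \<O>" "av \<nu> = 1"
  "!!x y. x : \<O> ==> y : \<O> ==> S (X x) (X y) - \<nu> * S x y : IF r"
  using X(2) by (auto simp: sim_def)
 show ?thesis
  unfolding sim_def
 proof (intro bexI[of _ \<nu>] conjI ballI \<nu>(1,2))
  fix x y :: 'k assume xy: "x : \<O>" "y : \<O>"
  have i: "X x : \<O>" "X y : \<O>" "Y x : \<O>" "Y y : \<O>"
   using linear_onD(1)[OF X(1)] linear_onD(1)[OF Y] xy by auto
  have "S (X x - Y x) (X y) : IF r" "S (Y x) (X y - Y y) : IF r"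
   using S_IF cgD[OF c] xy i by auto
  then have "S (X x - Y x) (X y) + S (Y x) (X y - Y y) : IF r" by (rule IF_closed(2))
  from IF_closed(3)[OF \<nu>(3)[OF xy] this] show "S (Y x) (Y y) - \<nu> * S x y : IF r"
   by (simp add: S_simps algebra_simps)
 qed
qed

text \<open>The candidate is the adjoint divided by the multiplier. It is a left inverse by
  unimodularity, and bijectivity on the finite set \<open>OK_mod r\<close> makes it
  two-sided.\<close>

lemma sim_inverse:
 assumes r: "1 <= r" and X: "lin X" "sim r X"
 shows "EX Y. lin Y & sim r Y & cg r (%x. Y (X x)) (%x. x) & cg r (%x. X (Y x)) (%x. x)"
proof -
 obtain \<nu> where \<nu>: "\<nu> : \<O>" "av \<nu> = 1"
  "!!x y. x : \<O> ==> y : \<O> ==> S (X x) (X y) - \<nu> * S x y : IF r"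
  using X(2) by (auto simp: sim_def)
 have \<nu>0: "\<nu> ~= 0" using \<nu>(2) by auto
 have \<nu>': "inverse \<nu> : \<O>" "av (inverse \<nu>) = 1" using \<nu>(2) by (simp_all add: integers_iff)
 define Y where "Y x = emb (inverse \<nu>) * adj X x" for x
 have Y: "lin Y" unfolding Y_def by (rule lin_closed(6)[OF lin_adj[OF X(1)]]) (use \<nu>' emb_integers in blast)
 have Yi: "Y x : \<O>" and Xi: "X x : \<O>" if "x : \<O>" for x
  using linear_onD(1)[OF Y that] linear_onD(1)[OF X(1) that] .
 have YX: "cg r (%x. Y (X x)) (%x. x)"
  unfolding cg_def
 proof
  fix x :: 'k assume x: "x : \<O>"
  show "Y (X x) - x : IK r"
  proof (rule S_unimodular)
   show "Y (X x) - x : \<O>" using Yi Xi x by auto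
   fix w :: 'k assume w: "w : \<O>"
   have "S w (Y (X x) - x) = inverse \<nu> * (S (X w) (X x) - \<nu> * S w x)"
    using adj(2)[OF X(1) Xi[OF x] w] \<nu>0 unfolding Y_def by (simp only: S_simps) (simp add: algebra_simps)
   then show "S w (Y (X x) - x) : IF r" using IF_mult_integers(2)[OF \<nu>(3)[OF w x] \<nu>'(1)] by simp
  qed
 qed
 have surj: "EX x':\<O>. x - X x' : IK r" if x: "x : \<O>" for x
 proof -
  have "bij_betw (red r X) (carrier (OK_mod r)) (carrier (OK_mod r))"
   using in_GL_red[OF X] by (auto simp: GL_simps Bij_def)
  then have "cK r x : red r X ` carrier (OK_mod r)" using x by (simp add: bij_betw_def carrier_OK_mod)
  then obtain x' where x': "x' : \<O>" "cK r x = red r X (cK r x')" by (auto simp: carrier_OK_mod)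
  then have "cK r x = cK r (X x')" using red_apply[OF X(1)] by simp
  then show ?thesis using x'(1) by (auto simp: cK_eq)
 qed
 have XY: "cg r (%x. X (Y x)) (%x. x)"
  unfolding cg_def
 proof
  fix x :: 'k assume x: "x : \<O>"
  obtain x' where x': "x' : \<O>" "x - X x' : IK r" using surj[OF x] by blast
  have "Y x - Y (X x') : IK r" using lin_IK[OF Y x'(2)] lin_diff[OF Y x Xi[OF x'(1)]] by simp
  moreover have "Y (X x') - x' : IK r" using cgD[OF YX x'(1)] .
  ultimately have "(Y x - Y (X x')) + (Y (X x') - x') : IK r" by (rule IK_closed(2))
  then have "Y x - x' : IK r" by simp
  then have "X (Y x) - X x' : IK r" using lin_IK[OF X(1)] lin_diff[OF X(1) Yi[OF x] x'(1)] by metis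
  from IK_closed(3)[OF this x'(2)] show "X (Y x) - x : IK r"
   using IK_closed(2)[OF \<open>X (Y x) - X x' : IK r\<close> IK_closed(4)[OF x'(2)]] by (simp add: algebra_simps)
 qed
 have "sim r Y"
  unfolding sim_def
 proof (intro bexI[of _ "inverse \<nu>"] conjI ballI \<nu>')
  fix x y :: 'k assume xy: "x : \<O>" "y : \<O>"
  have a: "S (X (Y x)) (X (Y y)) - \<nu> * S (Y x) (Y y) : IF r" using \<nu>(3) Yi xy by blast
  have "S (X (Y x) - x) (X (Y y)) : IF r" "S x (X (Y y) - y) : IF r"
   using S_IF cgD[OF XY] xy Yi Xi by auto
  then have "S (X (Y x) - x) (X (Y y)) + S x (X (Y y) - y) : IF r" by (rule IF_closed(2))
  from IF_closed(3)[OF this a] have b: "\<nu> * S (Y x) (Y y) - S x y : IF r"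
   by (simp add: S_simps algebra_simps)
  have "S (Y x) (Y y) - inverse \<nu> * S x y = inverse \<nu> * (\<nu> * S (Y x) (Y y) - S x y)"
   using \<nu>0 by (simp add: right_diff_distrib mult.assoc[symmetric])
  then show "S (Y x) (Y y) - inverse \<nu> * S x y : IF r" using IF_mult_integers(2)[OF b \<nu>'(1)] by simp
 qed
 with Y YX XY show ?thesis by (intro exI[of _ Y]) simp
qed

lemma group_G:
 assumes r: "1 <= r"
 shows "group (G r)"
proof (rule groupI)
 fix g h k assume "g : carrier (G r)" "h : carrier (G r)"
 then obtain X Y where X: "lin X" "sim r X" "g = red r X" and Y: "lin Y" "sim r Y" "h = red r Y"
  unfolding carrier_G[OF r] by blast
 have XY: "lin (%x. Y (X x))" "sim r (%x. Y (X x))" using lin_closed(2) sim_comp X Y by auto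
 have gh: "g *_{G r} h = red r (%x. Y (X x))" using G_mult[OF r] X Y by simp
 show "g *_{G r} h : carrier (G r)" unfolding gh carrier_G[OF r] using XY by (intro exI[of _ "%x. Y (X x)"]) simp
 assume "k : carrier (G r)"
 then obtain Z' where Z': "lin Z'" "sim r Z'" "k = red r Z'" unfolding carrier_G[OF r] by blast
 have YZ: "lin (%x. Z' (Y x))" "sim r (%x. Z' (Y x))" using lin_closed(2) sim_comp Z' Y by auto
 have "g *_{G r} h *_{G r} k = red r (%x. Z' (Y (X x)))"
  unfolding gh Z'(3) by (rule G_mult[OF r XY Z'(1,2)])
 moreover have "h *_{G r} k = red r (%x. Z' (Y x))" unfolding Y(3) Z'(3) by (rule G_mult[OF r Y(1,2) Z'(1,2)])
 moreover have "g *_{G r} red r (%x. Z' (Y x)) = red r (%x. Z' (Y (X x)))"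
  unfolding X(3) by (rule G_mult[OF r X(1,2) YZ])
 ultimately show "g *_{G r} h *_{G r} k = g *_{G r} (h *_{G r} k)" by simp
next
 show "1_{G r} : carrier (G r)" unfolding carrier_G[OF r] G_one
  by (intro exI[of _ "%x. x"] conjI refl lin_closed(1) sim_id)
next
 fix g assume "g : carrier (G r)"
 then obtain X where X: "lin X" "sim r X" "g = red r X" unfolding carrier_G[OF r] by blast
 show "1_{G r} *_{G r} g = g" unfolding X(3) G_one by (rule G_mult[OF r lin_closed(1) sim_id X(1,2)])
 obtain Y where Y: "lin Y" "sim r Y" "cg r (%x. X (Y x)) (%x. x)" using sim_inverse[OF r X(1,2)] by blast
 have "red r Y *_{G r} g = red r (%x. X (Y x))" unfolding X(3) by (rule G_mult[OF r Y(1,2) X(1,2)])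
 also have "\<dots> = 1_{G r}" unfolding G_one using red_eq[OF lin_closed(2)[OF X(1) Y(1)] lin_closed(1)] Y(3) by blast
 finally show "EX h:carrier (G r). h *_{G r} g = 1_{G r}"
  using carrier_G[OF r, of "red r Y"] Y(1,2) by blast
qed

lemma finite_G: "finite (carrier (G r))"
proof (rule finite_subset)
 show "carrier (G r) \<subseteq> carrier (OK_mod r) \<rightarrow>\<^sub>E carrier (OK_mod r)"
  by (auto simp: G_def GO_def GL_simps Bij_def PiE_def dest: linear_mapsD(1))
 show "finite (carrier (OK_mod r) \<rightarrow>\<^sub>E carrier (OK_mod r))" by (intro finite_PiE finite_OK_mod)
qed

lemma G_inv:
 assumes r: "1 <= r" and X: "lin X" "sim r X" and Y: "lin Y" "sim r Y" and c: "cg r (%x. Y (X x)) (%x. x)"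
 shows "inv_{G r} (red r X) = red r Y"
proof -
 interpret group "G r" by (rule group_G[OF r])
 have X': "red r X : carrier (G r)" "red r Y : carrier (G r)"
  using red_carrier[OF r] X Y by simp_all
 have "red r X *_{G r} red r Y = 1_{G r}"
  unfolding G_mult[OF r X Y] G_one using red_eq[OF lin_closed(2)[OF Y(1) X(1)] lin_closed(1)] c by blast
 then show ?thesis by (rule inv_equality[OF inv_comm[OF _ X'] X'])
qed

lemma sim_mono: "k <= r ==> sim r X ==> sim k X"
 unfolding sim_def using IF_mono by blast

lemma red_mod_hom:
 assumes k: "1 <= k" "k <= r"
 shows "group_hom (G r) (G k) (red_mod r k)"
proof -
 have r: "1 <= r" using k by simp
 have "red_mod r k : hom (G r) (G k)"
 proof (rule homI)
  fix g assume "g : carrier (G r)"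
  then obtain X where X: "lin X" "sim r X" "g = red r X" unfolding carrier_G[OF r] by blast
  then show "red_mod r k g : carrier (G k)"
   unfolding carrier_G[OF k(1)] using red_mod_red[OF X(1) k(2)] sim_mono[OF k(2)] by blast
  fix h assume "h : carrier (G r)"
  then obtain Y where Y: "lin Y" "sim r Y" "h = red r Y" unfolding carrier_G[OF r] by blast
  show "red_mod r k (g *_{G r} h) = red_mod r k g *_{G k} red_mod r k h"
   unfolding X(3) Y(3) G_mult[OF r X(1,2) Y(1,2)] red_mod_red[OF lin_closed(2)[OF Y(1) X(1)] k(2)]
    red_mod_red[OF X(1) k(2)] red_mod_red[OF Y(1) k(2)]
   using G_mult[OF k(1) X(1) sim_mono[OF k(2) X(2)] Y(1) sim_mono[OF k(2) Y(2)]] by simp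
 qed
 then show ?thesis using group_G[OF r] group_G[OF k(1)] by (simp add: group_hom_def group_hom_axioms_def)
qed

lemma K_normal: "1 <= k ==> k <= r ==> K r k \<lhd> G r"
 unfolding K_def by (rule group_hom.normal_kernel[OF red_mod_hom])

lemma K_iff:
 assumes k: "1 <= k" "k <= r" and X: "lin X" "sim r X"
 shows "red r X : K r k \<longleftrightarrow> cg k X (%x. x)"
proof -
 have r: "1 <= r" using k by simp
 have "red r X : carrier (G r)" unfolding carrier_G[OF r] using X by blast
 then show ?thesis
  unfolding K_def kernel_def using red_mod_red[OF X(1) k(2)] red_eq[OF X(1) lin_closed(1)] G_one by auto
qed

text \<open>\<open>A\<close> is merely linear: it is the deviation of a lift from the identity,
  divided by \<open>\<pi>\<^sup>k\<close>. Its closeness to the Lie algebra, to limited precision,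
  is the content of \<open>go_lift\<close>.\<close>

lemma K_lift:
 assumes k: "1 <= k" "k <= r" and g: "g : K r k"
 shows "EX A. lin A & sim r (%x. x + emb \<pi> ^ k * A x) & g = red r (%x. x + emb \<pi> ^ k * A x)"
proof -
 have r: "1 <= r" using k by simp
 have "g : carrier (G r)" using g by (simp add: K_def kernel_def)
 then obtain X where X: "lin X" "sim r X" "g = red r X" unfolding carrier_G[OF r] by blast
 have c: "cg k X (%x. x)" using K_iff[OF k X(1,2)] X(3) g by simp
 define A where "A x = (X x - x) / emb \<pi> ^ k" for x
 have e: "x + emb \<pi> ^ k * A x = X x" for x by (simp add: A_def)
 have "lin A"
  unfolding linear_on_def
 proof (intro conjI ballI)
  show "A x : \<O>" if x: "x : \<O>" for x
  proof -
   have "emb \<pi> ^ k * A x : IK k" using cgD[OF c x] by (simp add: A_def)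
   from IK_cancel[OF this order_refl] show ?thesis by (simp add: IK_0)
  qed
  show "A (x + y) = A x + A y" if "x : \<O>" "y : \<O>" for x y
   unfolding A_def linear_onD(2)[OF X(1) that] by (simp add: add_divide_distrib[symmetric])
  show "A (emb a * x) = emb a * A x" if "a : \<O>" "x : \<O>" for a x
   unfolding A_def linear_onD(3)[OF X(1) that] by (simp add: right_diff_distrib[symmetric])
 qed
 with X show ?thesis unfolding e[symmetric] by (intro exI[of _ A]) (simp add: e)
qed

end

section \<open>Square roots and the group \<open>U\<^sub>K\<^sub>/\<^sub>F\<close>\<close>

context GO_beta
begin

text \<open>Completeness of \<open>K\<close>, phrased with ideals instead of the metric.\<close>

lemma IK_limit:
 assumes s: "!!i. s (Suc i) - s i : IK i"
 shows "EX x. ALL i. x - s i : IK i"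
proof -
 have tail: "s M - s N : IK N" if "N <= M" for M N
  using that
 proof (induction M rule: dec_induct)
  case base
  show ?case by (simp add: IK_closed(1))
 next
  case (step M)
  have "(s (Suc M) - s M) + (s M - s N) : IK N"
   by (intro IK_closed(2) step.IH IK_mono[OF step.hyps(1) s])
  then show ?case by simp
 qed
 have "Cauchy s"
  unfolding Cauchy_altdef2
 proof (intro allI impI)
  fix e :: real assume "0 < e"
  then obtain N where N: "q ^ N < e" using real_arch_pow_inv q_less by blast
  have "dist (s M) (s N) < e" if "N <= M" for M
   using tail[OF that] N by (simp add: dist_commute[of "s M"] dist_av[of "s N"] IK_iff)
  then show "EX N. ALL n>=N. dist (s n) (s N) < e" by blast
 qed
 then obtain x where x: "s \<longlonglongrightarrow> x" using Cauchy_convergent_iff convergent_def by blast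
 have "x - s N : IK N" for N
 proof -
  have "(%M. dist (s N) (s M)) \<longlonglongrightarrow> dist (s N) x" using x by (intro tendsto_intros)
  moreover have "eventually (%M. dist (s N) (s M) <= q ^ N) sequentially"
   by (rule eventually_mono[OF eventually_ge_at_top[of N]])
    (use tail in \<open>simp add: dist_av[of "s N"] IK_iff\<close>)
  ultimately have "dist (s N) x <= q ^ N" by (rule tendsto_upperbound) simp
  then show ?thesis by (simp add: dist_av[of "s N"] IK_iff)
 qed
 then show ?thesis by blast
qed

lemma IK_half: "x : IK k ==> x / 2 : IK k" and IF_half: "a : IF k ==> a / 2 : IF k"
 by (simp_all add: IK_iff IF_iff)

text \<open>The equation reads \<open>x = (a - x\<^sup>2) / 2\<close>; since 2 is a unit, iteration
  from \<open>0\<close> stays in \<open>IK k\<close>, and the map contracts on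
  \<open>IK 1\<close>.\<close>

lemma sqrt_exists:
 assumes k: "1 <= k" and a: "a : IK k"
 shows "EX x:IK k. (1 + x)\<^sup>2 = 1 + a"
proof -
 define s where "s i = ((%x. (a - x\<^sup>2) / 2) ^^ i) 0" for i
 have s0: "s 0 = 0" and ss: "s (Suc i) = (a - (s i)\<^sup>2) / 2" for i by (simp_all add: s_def)
 have sk: "s i : IK k" for i
 proof (induction i)
  case (Suc i)
  have "s i * s i : IK k" using IK_mult_integers(1)[OF Suc IK_integers[OF Suc]] .
  then show ?case unfolding ss power2_eq_square by (intro IK_half IK_closed(3) a)
 qed (simp add: s0 IK_closed(1))
 have s1: "s i : IK 1" for i using IK_mono[OF k sk] .
 have d: "s (Suc i) - s i : IK i" for i
 proof (induction i)
  case 0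
  show ?case using IK_integers[OF IK_closed(3)[OF sk sk]] by (simp only: IK_0)
 next
  case (Suc i)
  have "s (Suc (Suc i)) - s (Suc i) = (a - (s (Suc i))\<^sup>2) / 2 - (a - (s i)\<^sup>2) / 2"
   by (rule arg_cong2[where f = "(-)", OF ss ss])
  also have "\<dots> = - ((s (Suc i) - s i) * (s (Suc i) + s i)) / 2" by (simp add: power2_eq_square algebra_simps flip: diff_divide_distrib)
  finally have e: "s (Suc (Suc i)) - s (Suc i) = - ((s (Suc i) - s i) * (s (Suc i) + s i)) / 2" .
  have "(s (Suc i) - s i) * (s (Suc i) + s i) : IK (i + 1)" by (intro IK_mult Suc IK_closed(2) s1)
  then have "- ((s (Suc i) - s i) * (s (Suc i) + s i)) / 2 : IK (Suc i)"
   unfolding Suc_eq_plus1 by (intro IK_half IK_closed(4))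
  then show ?case by (simp only: e)
 qed
 obtain x where x: "!!i. x - s i : IK i" using IK_limit[of s] d by blast
 have "x = (x - s k) + s k" by simp
 then have xk: "x : IK k" using IK_closed(2)[OF x[of k] sk[of k]] by metis
 have "x\<^sup>2 + 2 * x - a : IK i" for i
 proof -
  have e: "x\<^sup>2 + 2 * x - a = (x - s i) * (x + s i) + 2 * (x - s (Suc i))"
   unfolding ss[of i] by (simp add: power2_eq_square field_simps)
  have "(x - s i) * (x + s i) : IK i"
   using IK_integers[OF IK_closed(2)[OF xk sk]] by (intro IK_mult_integers(1) x)
  moreover have "2 * (x - s (Suc i)) : IK i"
   by (rule IK_mult_integers(2)[OF IK_mono[OF _ x[of "Suc i"]]]) simp_all
  ultimately show ?thesis unfolding e by (rule IK_closed(2))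
 qed
 then have "x\<^sup>2 + 2 * x - a = 0" by (rule IK_Inter)
 then have "(1 + x)\<^sup>2 = 1 + a" by (simp add: power2_eq_square algebra_simps)
 then show ?thesis using xk by blast
qed

text \<open>\<open>2 + x + y\<close> is nonzero, so the factored difference of squares leaves
  \<open>x = y\<close>. This is what makes square roots of elements fixed by \<open>\<iota>\<close>
  fixed as well.\<close>

lemma sqrt_unique:
 assumes "x : IK 1" "y : IK 1" "(1 + x)\<^sup>2 = (1 + y)\<^sup>2"
 shows "x = (y :: 'k)"
proof -
 have "av (x + y) < 1" using IK_closed(2)[OF assms(1,2)] IK_1_iff[of "x + y"] by blast
 then have "av (2 + (x + y)) = av (2 :: 'k)" by (intro av_add_eq) simp
 then have "2 + (x + y) ~= 0" by (metis av_two(2) dist_self zero_neq_one)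
 moreover have "(2 + (x + y)) * (x - y) = 0" using assms(3) by (simp add: power2_eq_square algebra_simps)
 ultimately show ?thesis by simp
qed

lemma \<iota>_inverse: "\<iota> (inverse x) = inverse (\<iota> x)" and \<iota>_divide: "\<iota> (x / y) = \<iota> x / \<iota> y"
proof -
 have *: "\<iota> (inverse x) = inverse (\<iota> x)" for x
 proof (cases "x = 0")
  case False
  have "\<iota> x * \<iota> (inverse x) = \<iota> (x * inverse x)" by (rule \<iota>_simps(2)[symmetric])
  also have "\<dots> = 1" using False by simp
  finally show ?thesis by (rule inverse_unique[symmetric])
 qed simp
 show "\<iota> (inverse x) = inverse (\<iota> x)" by (rule *)
 show "\<iota> (x / y) = \<iota> x / \<iota> y" by (simp only: divide_inverse \<iota>_simps *)
qed

text \<open>The unit condition on \<open>\<gamma>\<close> itself is a consequence: two absolute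
  values at most 1 have product 1.\<close>

lemma U_KF_iff: "\<gamma> : U_KF \<longleftrightarrow> \<gamma> : \<O> & (EX \<nu>:\<O>. av \<nu> = 1 & \<gamma> * \<iota> \<gamma> = emb \<nu>)"
proof
 assume "\<gamma> : U_KF"
 then show "\<gamma> : \<O> & (EX \<nu>:\<O>. av \<nu> = 1 & \<gamma> * \<iota> \<gamma> = emb \<nu>)"
  unfolding U_KF_def by (auto simp: Units_integers integers_iff)
next
 assume *: "\<gamma> : \<O> & (EX \<nu>:\<O>. av \<nu> = 1 & \<gamma> * \<iota> \<gamma> = emb \<nu>)"
 then obtain \<nu> where \<nu>: "\<nu> : \<O>" "av \<nu> = 1" "\<gamma> * \<iota> \<gamma> = emb \<nu>" by blast
 have "av \<gamma> * av (\<iota> \<gamma>) = 1" using \<nu>(2,3) by (metis av_mult emb_av)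
 moreover have "av \<gamma> <= 1" "av (\<iota> \<gamma>) <= 1" using * by (auto simp: integers_iff[symmetric])
 ultimately have "av \<gamma> = 1" by (metis dual_order.antisym mult_left_le zero_le_dist)
 then show "\<gamma> : U_KF" unfolding U_KF_def using \<nu> by (auto simp: Units_integers)
qed

lemma U_integers [simp]: "\<gamma> : U_KF ==> \<gamma> : \<O>"
 by (simp add: U_KF_iff)

lemma U_av: "\<gamma> : U_KF ==> av \<gamma> = 1"
 by (simp add: U_KF_def Units_integers)

lemma U_nz: "\<gamma> : U_KF ==> \<gamma> ~= 0"
 using U_av by fastforce

lemma U_closed: "1 : U_KF" "\<gamma> : U_KF ==> \<delta> : U_KF ==> \<gamma> * \<delta> : U_KF" "\<gamma> : U_KF ==> inverse \<gamma> : U_KF"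
proof -
 show "1 : U_KF" unfolding U_KF_iff by (intro conjI bexI[of _ 1]) auto
 show "\<gamma> * \<delta> : U_KF" if \<gamma>: "\<gamma> : U_KF" and \<delta>: "\<delta> : U_KF"
 proof -
  obtain \<nu> where \<nu>: "\<nu> : \<O>" "av \<nu> = 1" "\<gamma> * \<iota> \<gamma> = emb \<nu>" using \<gamma> by (auto simp: U_KF_iff)
  obtain \<mu> where \<mu>: "\<mu> : \<O>" "av \<mu> = 1" "\<delta> * \<iota> \<delta> = emb \<mu>" using \<delta> by (auto simp: U_KF_iff)
  have "\<gamma> * \<delta> * \<iota> (\<gamma> * \<delta>) = (\<gamma> * \<iota> \<gamma>) * (\<delta> * \<iota> \<delta>)" by (simp add: ac_simps)
  also have "\<dots> = emb (\<nu> * \<mu>)" by (simp only: \<nu>(3) \<mu>(3) emb_simps)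
  finally show ?thesis unfolding U_KF_iff using \<gamma> \<delta> \<nu>(1,2) \<mu>(1,2) by (intro conjI bexI[of _ "\<nu> * \<mu>"]) auto
 qed
 show "inverse \<gamma> : U_KF" if \<gamma>: "\<gamma> : U_KF"
 proof -
  obtain \<nu> where \<nu>: "\<nu> : \<O>" "av \<nu> = 1" "\<gamma> * \<iota> \<gamma> = emb \<nu>" using \<gamma> by (auto simp: U_KF_iff)
  have "inverse \<gamma> * \<iota> (inverse \<gamma>) = inverse (\<gamma> * \<iota> \<gamma>)" by (simp add: \<iota>_inverse)
  also have "\<dots> = emb (inverse \<nu>)" by (simp only: \<nu>(3) emb_inverse)
  finally show ?thesis unfolding U_KF_iff using \<nu>(2) U_av[OF \<gamma>]
   by (intro conjI bexI[of _ "inverse \<nu>"]) (auto simp: integers_iff)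
 qed
qed

text \<open>Multiply \<open>g\<close> by the square root of
  \<open>emb \<nu> / (g * \<iota> g)\<close>. The radicand is fixed by \<open>\<iota>\<close>, hence
  so is its root near 1, and the norm becomes exactly \<open>emb \<nu>\<close>.\<close>

lemma lift_U:
 assumes k: "1 <= k" and g: "g : \<O>" and \<nu>: "\<nu> : \<O>" "av \<nu> = 1" and d: "g * \<iota> g - emb \<nu> : IK k"
 shows "EX \<gamma>:U_KF. \<gamma> - g : IK k"
proof -
 have "av (g * \<iota> g - emb \<nu>) < 1" using IK_mono[OF k d] IK_1_iff by blast
 then have "av (emb \<nu> + (g * \<iota> g - emb \<nu>)) = av (emb \<nu>)" by (intro av_add_eq) (simp add: \<nu>(2))
 then have gg: "av (g * \<iota> g) = 1" by (simp add: \<nu>(2))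
 then have nz: "g * \<iota> g ~= 0" by (metis dist_self zero_neq_one)
 define a where "a = emb \<nu> / (g * \<iota> g) - 1"
 have "a = - (g * \<iota> g - emb \<nu>) / (g * \<iota> g)" using nz by (simp add: a_def field_simps)
 then have "av a = av (g * \<iota> g - emb \<nu>)" using gg by (simp only: av_divide av_minus div_by_1)
 then have ak: "a : IK k" using d by (simp only: IK_iff)
 obtain x where x: "x : IK k" "(1 + x)\<^sup>2 = 1 + a" using sqrt_exists[OF k ak] by blast
 have m: "(1 + a) * (g * \<iota> g) = emb \<nu>" using nz by (simp add: a_def)
 have "\<iota> a = a" by (simp only: a_def \<iota>_simps \<iota>_divide mult.commute)
 moreover have "(1 + \<iota> x)\<^sup>2 = \<iota> ((1 + x)\<^sup>2)" by (simp only: \<iota>_simps)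
 ultimately have e: "(1 + \<iota> x)\<^sup>2 = (1 + x)\<^sup>2" by (simp only: x(2) \<iota>_simps)
 have x1: "x : IK 1" by (rule IK_mono[OF k x(1)])
 then have "\<iota> x : IK 1" by (simp only: \<iota>_IK)
 from sqrt_unique[OF this x1 e] have \<iota>x: "\<iota> x = x" .
 have e: "g * (1 + x) * \<iota> (g * (1 + x)) = emb \<nu>"
 proof -
  have "g * (1 + x) * \<iota> (g * (1 + x)) = (1 + x)\<^sup>2 * (g * \<iota> g)" by (simp only: \<iota>x \<iota>_simps power2_eq_square ac_simps)
  then show ?thesis by (simp only: m x(2))
 qed
 have "g * (1 + x) : U_KF"
  unfolding U_KF_iff using e \<nu> g IK_integers[OF x(1)] by (intro conjI bexI[of _ \<nu>]) auto
 moreover have "g * (1 + x) - g : IK k" using IK_mult_integers(2)[OF x(1) g] by (simp add: algebra_simps)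
 ultimately show ?thesis by blast
qed

section \<open>The centralizer of \<open>\<beta>\<close>\<close>

lemma red_mul_by: "red r (mul_by x) = red r (%y. y * x)"
 by (rule red_cong) (simp add: mul_by_def)

lemma red_one_plus: "red r (one_plus k X) = red r (%y. y + emb \<pi> ^ k * X y)"
 by (rule red_cong) (simp add: one_plus_def)

lemma sim_mul: "\<gamma> : U_KF ==> sim r (%x. x * \<gamma>)"
proof -
 assume "\<gamma> : U_KF"
 then obtain \<nu> where \<nu>: "\<nu> : \<O>" "av \<nu> = 1" "\<gamma> * \<iota> \<gamma> = emb \<nu>" by (auto simp: U_KF_iff)
 have "S (x * \<gamma>) (y * \<gamma>) = \<nu> * S x y" for x y
 proof -
  have "S (x * \<gamma>) (y * \<gamma>) = S x (y * \<gamma> * \<iota> \<gamma>)" by (rule S_mult_left)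
  also have "y * \<gamma> * \<iota> \<gamma> = emb \<nu> * y" using \<nu>(3) by (simp add: mult.assoc mult.commute)
  finally show ?thesis by (simp only: S_simps)
 qed
 then show ?thesis unfolding sim_def using \<nu>(1,2) by (intro bexI[of _ \<nu>]) (simp_all add: IF_closed(1))
qed

text \<open>\<open>O\<^sub>K\<close> consists of polynomials in \<open>\<beta>\<close>, so commuting
  with \<open>\<beta>\<close> means commuting with all multiplications, and \<open>X\<close> is
  determined by \<open>X 1\<close>; the induction keeps the error inside
  \<open>IK k\<close>.\<close>

lemma comm_imp_mul:
 assumes X: "lin X" and c: "!!x. x : \<O> ==> X (x * \<beta>) - X x * \<beta> : IK k"
 shows "cg k X (%x. x * X 1)"
 unfolding cg_def
proof
 fix x :: 'k assume x: "x : \<O>"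
 have X1: "X 1 : \<O>" using linear_onD(1)[OF X] by simp
 have "X (poly p \<beta>) - poly p \<beta> * X 1 : IK k & poly p \<beta> : \<O>"
  if "ALL i. poly.coeff p i : emb ` \<O>" for p
  using that
 proof (induction p)
  case 0
  show ?case using lin_zero[OF X] by (simp add: IK_closed(1))
 next
  case (pCons a p)
  have "a : emb ` \<O>" using pCons.prems[rule_format, of 0] by simp
  then obtain b where b: "b : \<O>" "a = emb b" by blast
  have "ALL i. poly.coeff p i : emb ` \<O>" using pCons.prems by (metis coeff_pCons_Suc)
  then have IH: "X (poly p \<beta>) - poly p \<beta> * X 1 : IK k" and pi: "poly p \<beta> : \<O>" using pCons.IH by auto
  have e: "poly (pCons a p) \<beta> = emb b * 1 + poly p \<beta> * \<beta>" by (simp add: b(2))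
  have "X (emb b * 1 + poly p \<beta> * \<beta>) = emb b * X 1 + X (poly p \<beta> * \<beta>)"
   using linear_onD(2)[OF X, of "emb b * 1" "poly p \<beta> * \<beta>"] linear_onD(3)[OF X, of b 1] b(1) pi by simp
  then have "X (poly (pCons a p) \<beta>) - poly (pCons a p) \<beta> * X 1 =
    (X (poly p \<beta> * \<beta>) - X (poly p \<beta>) * \<beta>) + (X (poly p \<beta>) - poly p \<beta> * X 1) * \<beta>"
   unfolding e by (simp add: algebra_simps)
  moreover have "(X (poly p \<beta>) - poly p \<beta> * X 1) * \<beta> : IK k" using IK_mult_integers(1)[OF IH \<beta>_int] .
  ultimately have "X (poly (pCons a p) \<beta>) - poly (pCons a p) \<beta> * X 1 : IK k"
   using IK_closed(2)[OF c[OF pi]] by simp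
  moreover have "poly (pCons a p) \<beta> : \<O>" unfolding e using b(1) pi by simp
  ultimately show ?case by blast
 qed
 moreover obtain p where "x = poly p \<beta>" "ALL i. poly.coeff p i : emb ` \<O>"
  using x unfolding gen adjoin_def by blast
 ultimately show "X x - x * X 1 : IK k" by blast
qed

text \<open>Testing the similitude relation for multiplication by \<open>X 1\<close> against the
  vector \<open>1\<close> shows that the norm of \<open>X 1\<close> is \<open>\<nu>\<close> modulo
  \<open>\<pi>\<^sup>k\<close>, and \<open>lift_U\<close> makes this exact.\<close>

lemma comm_sim_imp_U:
 assumes k: "1 <= k" and X: "lin X" "sim k X" and c: "!!x. x : \<O> ==> X (x * \<beta>) - X x * \<beta> : IK k"
 shows "EX \<gamma>:U_KF. cg k X (%x. x * \<gamma>)"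
proof -
 have X1: "X 1 : \<O>" using linear_onD(1)[OF X(1)] by simp
 have c1: "cg k X (%x. x * X 1)" by (rule comm_imp_mul[OF X(1) c])
 have "sim k (%x. x * X 1)" by (rule sim_cg[OF X lin_closed(7)[OF X1] c1])
 then obtain \<nu> where \<nu>: "\<nu> : \<O>" "av \<nu> = 1"
  "!!x y. x : \<O> ==> y : \<O> ==> S (x * X 1) (y * X 1) - \<nu> * S x y : IF k" by (auto simp: sim_def)
 have "X 1 * \<iota> (X 1) - emb \<nu> : IK k"
 proof (rule S_unimodular)
  show "X 1 * \<iota> (X 1) - emb \<nu> : \<O>" using X1 \<nu>(1) by simp
  fix x :: 'k assume x: "x : \<O>"
  have "S (x * X 1) (1 * X 1) = S x (1 * X 1 * \<iota> (X 1))" by (rule S_mult_left)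
  then have "S x (X 1 * \<iota> (X 1) - emb \<nu>) = S (x * X 1) (1 * X 1) - \<nu> * S x 1"
   using S_simps(8)[of x \<nu> 1] by (simp add: S_simps(4))
  then show "S x (X 1 * \<iota> (X 1) - emb \<nu>) : IF k" using \<nu>(3)[OF x, of 1] by simp
 qed
 from lift_U[OF k X1 \<nu>(1,2) this] obtain \<gamma> where \<gamma>: "\<gamma> : U_KF" "\<gamma> - X 1 : IK k" by blast
 have "cg k (%x. x * X 1) (%x. x * \<gamma>)"
  unfolding cg_def
 proof
  fix x :: 'k assume "x : \<O>"
  then have "x * (- (\<gamma> - X 1)) : IK k" by (intro IK_mult_integers(2) IK_closed(4) \<gamma>(2))
  then show "x * X 1 - x * \<gamma> : IK k" by (simp add: algebra_simps)
 qed
 with c1 \<gamma>(1) show ?thesis using cg_trans by blast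
qed

text \<open>\<open>comm_sim_imp_U\<close> at level \<open>r\<close> supplies the lift. Commutativity
  of the centralizer and the passage between its characters and those of \<open>U_KF\<close> rest on
  this description.\<close>

lemma G_centr_iff:
 assumes r: "1 <= r"
 shows "g : G_centr r \<beta> \<longleftrightarrow> (EX \<gamma>:U_KF. g = red r (%x. x * \<gamma>))"
proof
 have lb: "lin (%x. x * \<beta>)" by (rule lin_closed(7)[OF \<beta>_int])
 assume g: "g : G_centr r \<beta>"
 then have "g : carrier (G r)" by (simp add: G_centr_def)
 then obtain X where X: "lin X" "sim r X" "g = red r X" unfolding carrier_G[OF r] by blast
 have "compose (carrier (OK_mod r)) (red r X) (red r (%x. x * \<beta>)) =
   compose (carrier (OK_mod r)) (red r (%x. x * \<beta>)) (red r X)"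
  using g by (simp add: G_centr_def red_mul_by X(3))
 then have "red r (%x. X (x * \<beta>)) = red r (%x. X x * \<beta>)"
  by (simp only: compose_red[OF lb X(1)] compose_red[OF X(1) lb])
 then have "cg r (%x. X (x * \<beta>)) (%x. X x * \<beta>)"
  using red_eq[OF lin_closed(2)[OF X(1) lb] lin_closed(5)[OF X(1) \<beta>_int]] by blast
 then obtain \<gamma> where \<gamma>: "\<gamma> : U_KF" "cg r X (%x. x * \<gamma>)"
  using comm_sim_imp_U[OF r X(1,2)] cgD by blast
 then have "g = red r (%x. x * \<gamma>)" unfolding X(3) using red_eq[OF X(1) lin_closed(7)] by simp
 then show "EX \<gamma>:U_KF. g = red r (%x. x * \<gamma>)" using \<gamma>(1) by blast
next
 have lb: "lin (%x. x * \<beta>)" by (rule lin_closed(7)[OF \<beta>_int])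
 assume "EX \<gamma>:U_KF. g = red r (%x. x * \<gamma>)"
 then obtain \<gamma> where \<gamma>: "\<gamma> : U_KF" "g = red r (%x. x * \<gamma>)" by blast
 have l\<gamma>: "lin (%x. x * \<gamma>)" by (rule lin_closed(7)[OF U_integers[OF \<gamma>(1)]])
 have "compose (carrier (OK_mod r)) g (red r (%x. x * \<beta>)) = compose (carrier (OK_mod r)) (red r (%x. x * \<beta>)) g"
  unfolding \<gamma>(2) compose_red[OF lb l\<gamma>] compose_red[OF l\<gamma> lb] by (rule red_cong) simp
 then show "g : G_centr r \<beta>"
  unfolding G_centr_def red_mul_by using red_carrier[OF r l\<gamma> sim_mul[OF \<gamma>(1)]] \<gamma>(2) by simp
qed

lemma lin_U: "\<gamma> : U_KF ==> lin (%x. x * \<gamma>)"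
 by (rule lin_closed(7)) simp

lemma U_mult: "1 <= r ==> \<gamma> : U_KF ==> \<delta> : U_KF ==>
  red r (%x. x * \<gamma>) *_{G r} red r (%x. x * \<delta>) = red r (%x. x * (\<gamma> * \<delta>))"
 using G_mult[OF _ lin_U sim_mul lin_U sim_mul, of r \<gamma> \<delta>] by (simp add: mult.assoc)

lemma U_red_eq: "\<gamma> : U_KF ==> \<delta> : U_KF ==> red r (%x. x * \<gamma>) = red r (%x. x * \<delta>) \<longleftrightarrow> \<gamma> - \<delta> : IK r"
proof -
 assume *: "\<gamma> : U_KF" "\<delta> : U_KF"
 have "cg r (%x. x * \<gamma>) (%x. x * \<delta>) \<longleftrightarrow> \<gamma> - \<delta> : IK r"
 proof
  assume "cg r (%x. x * \<gamma>) (%x. x * \<delta>)"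
  from cgD[OF this, of 1] show "\<gamma> - \<delta> : IK r" by simp
 next
  assume d: "\<gamma> - \<delta> : IK r"
  show "cg r (%x. x * \<gamma>) (%x. x * \<delta>)"
   unfolding cg_def right_diff_distrib[symmetric] using IK_mult_integers(2)[OF d] by blast
 qed
 then show ?thesis using red_eq[OF lin_U[OF *(1)] lin_U[OF *(2)]] by blast
qed

lemma G_centr_subgroup:
 assumes r: "1 <= r"
 shows "subgroup (G_centr r \<beta>) (G r)"
proof -
 interpret group "G r" by (rule group_G[OF r])
 show ?thesis
 proof (rule subgroupI)
  show "G_centr r \<beta> \<subseteq> carrier (G r)" by (auto simp: G_centr_def)
  show "G_centr r \<beta> ~= {}" using U_closed(1) G_centr_iff[OF r] by blast
  fix g assume "g : G_centr r \<beta>"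
  then obtain \<gamma> where \<gamma>: "\<gamma> : U_KF" "g = red r (%x. x * \<gamma>)" using G_centr_iff[OF r] by blast
  have "inv_{G r} g = red r (%x. x * inverse \<gamma>)"
   unfolding \<gamma>(2)
  proof (rule G_inv[OF r lin_U[OF \<gamma>(1)] sim_mul[OF \<gamma>(1)] lin_U[OF U_closed(3)[OF \<gamma>(1)]] sim_mul[OF U_closed(3)[OF \<gamma>(1)]]])
   show "cg r (%x. x * \<gamma> * inverse \<gamma>) (%x. x)" using U_nz[OF \<gamma>(1)] by (simp add: cg_def IK_closed(1) mult.assoc)
  qed
  then show "inv_{G r} g : G_centr r \<beta>" using U_closed(3)[OF \<gamma>(1)] G_centr_iff[OF r] by blast
  fix h assume "h : G_centr r \<beta>"
  then obtain \<delta> where \<delta>: "\<delta> : U_KF" "h = red r (%x. x * \<delta>)" using G_centr_iff[OF r] by blast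
  show "g *_{G r} h : G_centr r \<beta>"
   unfolding \<gamma>(2) \<delta>(2) U_mult[OF r \<gamma>(1) \<delta>(1)] G_centr_iff[OF r] using U_closed(2)[OF \<gamma>(1) \<delta>(1)] by blast
 qed
qed

lemma G_centr_comm:
 assumes r: "1 <= r" and "g : G_centr r \<beta>" "h : G_centr r \<beta>"
 shows "g *_{G r} h = h *_{G r} g"
proof -
 obtain \<gamma> \<delta> where "\<gamma> : U_KF" "g = red r (%x. x * \<gamma>)" "\<delta> : U_KF" "h = red r (%x. x * \<delta>)"
  using assms(2,3) G_centr_iff[OF r] by blast
 then show ?thesis by (simp add: U_mult[OF r] mult.commute)
qed

lemma G_centr_K:
 assumes k: "1 <= k" "k <= r" and \<gamma>: "\<gamma> : U_KF"
 shows "red r (%x. x * \<gamma>) : K r k \<longleftrightarrow> \<gamma> - 1 : IK k"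
proof -
 have "cg k (%x. x * \<gamma>) (%x. x) \<longleftrightarrow> \<gamma> - 1 : IK k"
  using U_red_eq[OF \<gamma> U_closed(1), of k] red_eq[OF lin_U[OF \<gamma>] lin_closed(1), of k] by simp
 then show ?thesis using K_iff[OF k lin_U[OF \<gamma>] sim_mul[OF \<gamma>]] by blast
qed

end

section \<open>The character \<open>\<psi>\<^sub>\<beta>\<close>\<close>

context GO_beta
begin

definition ch :: "nat => 'f => complex" where
 "ch k u = \<tau> (inverse \<pi> ^ k * u)"

lemma \<tau>_integers: "u : \<O> ==> \<tau> u = 1"
proof -
 assume "u : \<O>"
 then have "u : {x. ALL y:\<O>. \<tau> (x * y) = 1}" by (simp only: \<tau>_conductor)
 then have "\<tau> (u * 1) = 1" using integers_closed(2) by blast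
 then show ?thesis by simp
qed

lemma \<tau>_nz: "\<tau> u ~= 0"
 using \<tau>_unitary[of u] by force

lemma \<tau>_cong: "u - v : \<O> ==> \<tau> u = \<tau> v"
 using \<tau>_add[of "u - v" v] \<tau>_integers[of "u - v"] by simp

lemma ch_nz: "ch k u ~= 0"
 by (simp add: ch_def \<tau>_nz)

lemma ch_add: "ch k (u + v) = ch k u * ch k v"
 by (simp add: ch_def distrib_left \<tau>_add)

lemma ch_shift: "j <= k ==> ch k (\<pi> ^ j * u) = ch (k - j) u"
proof -
 assume "j <= k"
 then have "inverse \<pi> ^ k = inverse \<pi> ^ (k - j) * inverse \<pi> ^ j" by (simp flip: power_add)
 moreover have "inverse \<pi> ^ j * (\<pi> ^ j * u) = u"
  by (simp add: mult.assoc[symmetric] power_mult_distrib[symmetric])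
 ultimately show ?thesis unfolding ch_def by (simp only: mult.assoc)
qed

lemma ch_IF: "u : IF k ==> ch k u = 1"
proof -
 assume "u : IF k"
 then obtain v where v: "v : \<O>" "u = \<pi> ^ k * v" using IF_decomp by blast
 then show ?thesis using ch_shift[of k k v] \<tau>_integers by (simp add: ch_def)
qed

lemma ch_cong: "u - v : IF k ==> ch k u = ch k v"
 using ch_add[of k "u - v" v] ch_IF[of "u - v" k] by simp

text \<open>Uses that \<open>O\<close> is the exact conductor of \<open>\<tau>\<close>, not only
  that \<open>\<tau>\<close> is trivial on it.\<close>

lemma ch_nondegenerate:
 assumes "u \<notin> IF k"
 shows "EX s:\<O>. ch k (u * s) ~= 1"
proof (rule ccontr)
 assume "\<not> ?thesis"
 then have "\<tau> (inverse \<pi> ^ k * u * s) = 1" if "s : \<O>" for s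
  using that by (simp add: ch_def mult.assoc)
 then have "inverse \<pi> ^ k * u : {x. ALL y:\<O>. \<tau> (x * y) = 1}" by blast
 then have i: "inverse \<pi> ^ k * u : \<O>" by (simp only: \<tau>_conductor)
 have "\<pi> ^ k * (inverse \<pi> ^ k * u) = u" by (simp add: mult.assoc[symmetric] power_inverse)
 then show False using pi_power_IF[OF i order_refl] assms by metis
qed

lemma tr_cong: "(!!x. x : \<O> ==> X x = Y x) ==> tr X = tr Y"
 unfolding tr_def using subsetD[OF basis_co(2)] by (intro sum.cong refl) simp

lemma tr_cong_IF: "(!!x. x : \<O> ==> X x - Y x : IK k) ==> tr X - tr Y : IF k"
 unfolding tr_simps(3)[symmetric] by (rule tr_IF)

lemma lin_cong:
 assumes "lin X" "!!x. x : \<O> ==> X x = Y x"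
 shows "lin Y"
 using assms(1) unfolding linear_on_def by (simp add: assms(2)[symmetric])

lemma B_mul_by:
 assumes X: "lin X" and that: "c : \<O>"
 shows "B X (mul_by c) = tr (%x. X x * c)"
proof -
 have "B X (mul_by c) = endo_trace OF OK (\<lambda>x\<in>\<O>. X x * c)"
  unfolding B_def
  by (rule arg_cong[where f = "endo_trace OF OK"])
   (use linear_onD(1)[OF X] in \<open>auto simp: compose_def mul_by_def fun_eq_iff\<close>)
 also have "\<dots> = tr (\<lambda>x\<in>\<O>. X x * c)"
  by (rule endo_trace_O, rule lin_cong[OF lin_closed(5)[OF X that]]) simp
 also have "\<dots> = tr (%x. X x * c)" by (rule tr_cong) simp
 finally show ?thesis .
qed

section \<open>Lie algebra elements and congruence subgroups\<close>

lemma endos_iff: "X : endos OF OK \<longleftrightarrow> lin X & X : extensional \<O>"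
 by (auto simp: endos_def linear_maps_def algebra_on_def linear_on_def)

lemma go_iff: "X : go OF OK S \<longleftrightarrow> lin X & X : extensional \<O> &
  (EX \<mu>:\<O>. ALL x:\<O>. ALL y:\<O>. S (X x) y + S x (X y) = \<mu> * S x y)"
 unfolding go_def mem_Collect_eq endos_iff by (simp add: algebra_on_def)

lemma four_nz [simp]: "(4 :: 'f) ~= 0" "(4 :: 'k) ~= 0"
 using mult_eq_0_iff[of "2 :: 'f" 2] mult_eq_0_iff[of "2 :: 'k" 2] by auto

text \<open>The only obstruction to \<open>1 + \<pi>\<^sup>k X\<close> being a similitude is the
  term \<open>\<pi>^(2 * k) * S (X x) (X y)\<close>, which vanishes modulo
  \<open>\<pi>\<^sup>r\<close> when \<open>r <= 2 * k\<close>.\<close>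

lemma sim_one_plus_go:
 assumes k: "1 <= k" "r <= 2 * k" and X: "lin X" and \<mu>: "\<mu> : \<O>"
  "!!x y. x : \<O> ==> y : \<O> ==> S (X x) y + S x (X y) = \<mu> * S x y"
 shows "sim r (%x. x + emb \<pi> ^ k * X x)"
proof -
 have "av (1 + \<pi> ^ k * \<mu>) = av (1 :: 'f)"
 proof (rule av_add_eq)
  have "\<pi> ^ k * \<mu> : IF 1" by (rule pi_power_IF[OF \<mu>(1) k(1)])
  then show "av (\<pi> ^ k * \<mu>) < av (1 :: 'f)" by (simp only: IF_1_iff av_one)
 qed
 show ?thesis
  unfolding sim_def
 proof (intro bexI[of _ "1 + \<pi> ^ k * \<mu>"] conjI ballI)
  fix x y :: 'k assume xy: "x : \<O>" "y : \<O>"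
  have "S (x + emb \<pi> ^ k * X x) (y + emb \<pi> ^ k * X y) - (1 + \<pi> ^ k * \<mu>) * S x y =
    \<pi> ^ k * (S (X x) y + S x (X y) - \<mu> * S x y) + \<pi> ^ (2 * k) * S (X x) (X y)"
   unfolding emb_simps(7)[symmetric] S_simps mult_2 power_add by (simp add: algebra_simps)
  also have "\<dots> = \<pi> ^ (2 * k) * S (X x) (X y)" by (simp only: \<mu>(2)[OF xy] diff_self mult_zero_right add_0_left)
  finally have e: "S (x + emb \<pi> ^ k * X x) (y + emb \<pi> ^ k * X y) - (1 + \<pi> ^ k * \<mu>) * S x y =
    \<pi> ^ (2 * k) * S (X x) (X y)" .
  show "S (x + emb \<pi> ^ k * X x) (y + emb \<pi> ^ k * X y) - (1 + \<pi> ^ k * \<mu>) * S x y : IF r"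
   unfolding e using linear_onD(1)[OF X] xy by (intro pi_power_IF k(2) S_integers) simp_all
 qed (use \<mu>(1) \<open>av (1 + \<pi> ^ k * \<mu>) = av 1\<close> in auto)
qed

text \<open>Projection to the Lie algebra: the similitude relation makes
  \<open>A + adj A - \<mu>\<close> vanish modulo \<open>\<pi>\<^sup>j\<close>, so replacing
  \<open>A\<close> by its skew part plus \<open>\<mu> / 2\<close> changes it by a multiple of
  \<open>\<pi>\<^sup>j\<close> and makes the relation exact.\<close>

lemma go_lift:
 assumes k: "1 <= k" and j: "j <= k" "j + k <= r" and A: "lin A" and s: "sim r (%x. x + emb \<pi> ^ k * A x)"
 shows "EX X \<mu>. lin X & \<mu> : \<O> &
  (ALL x:\<O>. ALL y:\<O>. S (X x) y + S x (X y) = \<mu> * S x y) & cg j A X"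
proof -
 have Ai: "A x : \<O>" if "x : \<O>" for x by (rule linear_onD(1)[OF A that])
 obtain \<nu> where \<nu>: "\<nu> : \<O>" "av \<nu> = 1" "!!x y. x : \<O> ==> y : \<O> ==>
   S (x + emb \<pi> ^ k * A x) (y + emb \<pi> ^ k * A y) - \<nu> * S x y : IF r" using s by (auto simp: sim_def)
 have expand: "S (x + emb \<pi> ^ k * A x) (y + emb \<pi> ^ k * A y) - \<nu> * S x y =
   (1 - \<nu>) * S x y + \<pi> ^ k * (S (A x) y + S x (A y) + \<pi> ^ k * S (A x) (A y))" for x y
  unfolding emb_simps(7)[symmetric] S_simps by (simp add: algebra_simps)
 \<comment> \<open>The multiplier is congruent to 1: compare the relation at \<open>y = 1\<close>
   for all \<open>x\<close> and use unimodularity.\<close>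
 have "emb (1 - \<nu>) : IK k"
 proof (rule S_unimodular)
  show "emb (1 - \<nu>) : \<O>" using \<nu>(1) by (simp only: emb_integers integers_closed)
  fix x :: 'k assume x: "x : \<O>"
  have i: "S (A x) 1 + S x (A 1) + \<pi> ^ k * S (A x) (A 1) : \<O>"
   using x Ai S_integers by (intro integers_closed(3,5,7)) simp_all
  have "(1 - \<nu>) * S x 1 + \<pi> ^ k * (S (A x) 1 + S x (A 1) + \<pi> ^ k * S (A x) (A 1)) : IF k"
   using IF_mono[of k r, OF _ \<nu>(3)[OF x integers_closed(2)]] j unfolding expand by simp
  from IF_closed(3)[OF this pi_power_IF[OF i order_refl]] have "(1 - \<nu>) * S x 1 : IF k" by simp
  then show "S x (emb (1 - \<nu>)) : IF k" using S_simps(8)[of x "1 - \<nu>" 1] by simp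
 qed
 then have "1 - \<nu> : IF k" by (simp only: emb_IK)
 then obtain \<mu>' where \<mu>': "\<mu>' : \<O>" "1 - \<nu> = \<pi> ^ k * \<mu>'" using IF_decomp by blast
 define \<mu> where "\<mu> = - \<mu>'"
 have \<mu>: "\<mu> : \<O>" "1 - \<nu> = - (\<pi> ^ k * \<mu>)" using \<mu>' by (simp_all add: \<mu>_def)
 have rel: "S (A x) y + S x (A y) - \<mu> * S x y : IF j" if xy: "x : \<O>" "y : \<O>" for x y
 proof -
  have "S (x + emb \<pi> ^ k * A x) (y + emb \<pi> ^ k * A y) - \<nu> * S x y =
    \<pi> ^ k * (S (A x) y + S x (A y) - \<mu> * S x y + \<pi> ^ k * S (A x) (A y))"
   unfolding expand \<mu>(2) by (simp add: algebra_simps)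
  then have "\<pi> ^ k * (S (A x) y + S x (A y) - \<mu> * S x y + \<pi> ^ k * S (A x) (A y)) : IF r"
   using \<nu>(3)[OF xy] by simp
  then have "S (A x) y + S x (A y) - \<mu> * S x y + \<pi> ^ k * S (A x) (A y) : IF (r - k)"
   using j by (intro IF_cancel) simp_all
  then have "S (A x) y + S x (A y) - \<mu> * S x y + \<pi> ^ k * S (A x) (A y) : IF j"
   using IF_mono[of j "r - k"] j by simp
  from IF_closed(3)[OF this pi_power_IF[OF S_integers[OF Ai Ai] j(1)], OF xy] show ?thesis by simp
 qed
 define X where "X x = (A x - adj A x) / 2 + emb (\<mu> / 2) * x" for x
 have X: "lin X"
  unfolding X_def
  by (intro lin_closed(3) lin_half lin_closed(4) A lin_adj lin_closed(6) lin_closed(1))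
   (simp only: emb_integers half_integers \<mu>(1))
 have "u / 2 = emb (inverse 2) * u" for u :: 'k
  by (simp only: emb_inverse emb_simps divide_inverse mult.commute)
 then have half: "S (u / 2) y = inverse 2 * S u y" "S x (u / 2) = inverse 2 * S x u" for u x y
  by (simp_all only: S_simps)
 have "S (X x) y + S x (X y) = \<mu> * S x y" if xy: "x : \<O>" "y : \<O>" for x y
 proof -
  have "S (A x) y = S x (adj A y)" "S (adj A x) y = S x (A y)"
   by (rule adj(2)[OF A xy(2,1)], subst S_sym, subst adj(2)[OF A xy, symmetric], rule S_sym)
  then have "S (X x) y + S x (X y) = \<mu> / 2 * S x y + \<mu> / 2 * S x y"
   unfolding X_def by (simp only: S_simps half) (simp add: algebra_simps)
  moreover have "\<mu> / 2 + \<mu> / 2 = \<mu>" by (simp add: add_divide_distrib[symmetric] mult_2[symmetric])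
  ultimately show ?thesis by (simp only: distrib_right[symmetric])
 qed
 moreover have "cg j A X"
  unfolding cg_def
 proof
  fix y :: 'k assume y: "y : \<O>"
  have "A y + adj A y - emb \<mu> * y : IK j"
  proof (rule S_unimodular)
   show "A y + adj A y - emb \<mu> * y : \<O>" using Ai y adj(1)[OF A y] \<mu>(1) by simp
   fix x :: 'k assume x: "x : \<O>"
   have "S x (A y + adj A y - emb \<mu> * y) = S (A x) y + S x (A y) - \<mu> * S x y"
    by (simp only: S_simps adj(2)[OF A y x]) simp
   then show "S x (A y + adj A y - emb \<mu> * y) : IF j" using rel[OF x y] by simp
  qed
  then have "(A y + adj A y - emb \<mu> * y) / 2 : IK j" by (rule IK_half)
  moreover have "A y - X y = (A y + adj A y - emb \<mu> * y) / 2"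
  proof -
   have "emb (\<mu> / 2) = emb \<mu> / 2" by (simp only: divide_inverse emb_simps emb_inverse)
   then show ?thesis unfolding X_def by (simp add: field_simps)
  qed
  ultimately show "A y - X y : IK j" by (simp only:)
 qed
 ultimately show ?thesis using X \<mu>(1) by (intro exI[of _ X] exI[of _ \<mu>] conjI ballI) simp_all
qed

lemma cg_one_plus: "k <= r ==> cg r (%x. x + emb \<pi> ^ k * A x) (%x. x + emb \<pi> ^ k * A' x) \<longleftrightarrow> cg (r - k) A A'"
proof -
 assume k: "k <= r"
 have "(x + emb \<pi> ^ k * A x) - (x + emb \<pi> ^ k * A' x) = emb \<pi> ^ k * (A x - A' x)" for x
  by (simp add: algebra_simps)
 moreover have "emb \<pi> ^ k * u : IK r \<longleftrightarrow> u : IK (r - k)" for u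
  using pi_power_mult_IK[of k u "r - k"] k by simp
 ultimately show ?thesis by (simp add: cg_def)
qed

lemma lin_one_plus: "lin A ==> lin (%x. x + emb \<pi> ^ k * A x)"
 by (intro lin_closed(3) lin_closed(1) lin_closed(6)) auto

lemma l_bounds:
 assumes "2 <= r"
 shows "1 <= l' r" "l' r <= l r" "l r <= r" "r - l r = l' r" "1 <= l r" "r <= 2 * l r" "l r + l' r = r" "1 <= r" "l' r <= r"
 using assms by (auto simp: l_def l'_def)

text \<open>The definition chooses \<open>X\<close> in the Lie algebra; the trace formula holds for
  every linear \<open>A\<close> giving the same element, since \<open>A\<close> and \<open>X\<close>
  agree modulo \<open>\<pi>^(l' r)\<close>, which \<open>ch (l' r)\<close> cannot see.\<close>

lemma psi_eq:
 assumes r: "2 <= r" and A: "lin A" and s: "sim r (%x. x + emb \<pi> ^ l r * A x)"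
 shows "psi r \<beta> (red r (%x. x + emb \<pi> ^ l r * A x)) = ch (l' r) (tr (%x. A x * \<beta>))"
proof -
 note L = l_bounds[OF r]
 let ?P = "%X. X : go OF OK S & red r (%x. x + emb \<pi> ^ l r * A x) = red r (one_plus (l r) X)"
 obtain X \<mu> where X: "lin X" "\<mu> : \<O>"
  "ALL x:\<O>. ALL y:\<O>. S (X x) y + S x (X y) = \<mu> * S x y" "cg (l' r) A X"
  using go_lift[OF L(5,2) _ A s] L(7) by auto
 have lX: "lin (restrict X \<O>)" by (rule lin_cong[OF X(1)]) simp
 have "restrict X \<O> : go OF OK S"
  unfolding go_iff using lX X(2,3) by (intro conjI bexI[of _ \<mu>]) auto
 moreover have "cg (l' r) A (restrict X \<O>)" using X(4) by (simp add: cg_def)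
 then have "red r (%x. x + emb \<pi> ^ l r * A x) = red r (one_plus (l r) (restrict X \<O>))"
  unfolding red_one_plus red_eq[OF lin_one_plus[OF A] lin_one_plus[OF lX]]
  by (simp only: cg_one_plus[OF L(3)] L(4))
 ultimately have ex: "?P (restrict X \<O>)" by blast
 define Y where "Y = (SOME X. ?P X)"
 have Y: "?P Y" unfolding Y_def by (rule someI[of ?P, OF ex])
 then have lY: "lin Y" by (simp add: go_iff)
 have "cg r (%x. x + emb \<pi> ^ l r * A x) (%x. x + emb \<pi> ^ l r * Y x)"
  using Y red_eq[OF lin_one_plus[OF A] lin_one_plus[OF lY]] by (simp add: red_one_plus)
 then have c: "cg (l' r) A Y" using cg_one_plus[OF L(3)] L(4) by simp
 have "tr (%x. A x * \<beta>) - tr (%x. Y x * \<beta>) : IF (l' r)"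
 proof (rule tr_cong_IF)
  fix x :: 'k assume "x : \<O>"
  from IK_mult_integers(1)[OF cgD[OF c this] \<beta>_int]
  show "A x * \<beta> - Y x * \<beta> : IK (l' r)" by (simp add: left_diff_distrib)
 qed
 then have "ch (l' r) (tr (%x. A x * \<beta>)) = ch (l' r) (tr (%x. Y x * \<beta>))" by (rule ch_cong)
 then show ?thesis
  unfolding psi_def Let_def Y_def[symmetric] B_mul_by[OF lY \<beta>_int] by (simp add: ch_def)
qed

text \<open>In the product of \<open>1 + \<pi>\<^sup>l A\<close> and
  \<open>1 + \<pi>\<^sup>l C\<close> the coefficient \<open>D\<close> deviates from
  \<open>A + C\<close> by a multiple of \<open>\<pi>\<^sup>l\<close>, and
  \<open>l' r <= l r\<close>.\<close>

lemma psi_mult: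
 assumes r: "2 <= r" and n: "g : K r (l r)" "h : K r (l r)"
 shows "psi r \<beta> (g *_{G r} h) = psi r \<beta> g * psi r \<beta> h"
proof -
 note L = l_bounds[OF r]
 obtain A where A: "lin A" "sim r (%x. x + emb \<pi> ^ l r * A x)" "g = red r (%x. x + emb \<pi> ^ l r * A x)"
  using K_lift[OF L(5,3) n(1)] by blast
 obtain C where C: "lin C" "sim r (%x. x + emb \<pi> ^ l r * C x)" "h = red r (%x. x + emb \<pi> ^ l r * C x)"
  using K_lift[OF L(5,3) n(2)] by blast
 define D where "D x = A x + C (x + emb \<pi> ^ l r * A x)" for x
 have D: "lin D" unfolding D_def by (intro lin_closed(3) A(1) lin_closed(2)[OF C(1)] lin_one_plus)
 have e: "(x + emb \<pi> ^ l r * A x) + emb \<pi> ^ l r * C (x + emb \<pi> ^ l r * A x) = x + emb \<pi> ^ l r * D x" for x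
  by (simp add: D_def algebra_simps)
 have s: "sim r (%x. x + emb \<pi> ^ l r * D x)"
  using sim_comp[OF lin_one_plus[OF A(1)] A(2) lin_one_plus[OF C(1)] C(2)] by (simp only: e)
 have m: "g *_{G r} h = red r (%x. x + emb \<pi> ^ l r * D x)"
  unfolding A(3) C(3) G_mult[OF L(8) lin_one_plus[OF A(1)] A(2) lin_one_plus[OF C(1)] C(2)] by (simp only: e)
 have "tr (%x. D x * \<beta>) - tr (%x. A x * \<beta> + C x * \<beta>) : IF (l' r)"
 proof (rule tr_cong_IF)
  fix x :: 'k assume x: "x : \<O>"
  have p: "emb \<pi> ^ l r * A x : IK (l' r)" using linear_onD(1)[OF A(1) x] L(2) by (rule pi_power_IK)
  have "C (x + emb \<pi> ^ l r * A x) = C x + C (emb \<pi> ^ l r * A x)"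
   by (rule linear_onD(2)[OF C(1) x IK_integers[OF p]])
  then have "D x * \<beta> - (A x * \<beta> + C x * \<beta>) = C (emb \<pi> ^ l r * A x) * \<beta>" by (simp add: D_def algebra_simps)
  then show "D x * \<beta> - (A x * \<beta> + C x * \<beta>) : IK (l' r)"
   using IK_mult_integers(1)[OF lin_IK[OF C(1) p] \<beta>_int] by simp
 qed
 then have "ch (l' r) (tr (%x. D x * \<beta>)) = ch (l' r) (tr (%x. A x * \<beta> + C x * \<beta>))" by (rule ch_cong)
 then show ?thesis
  unfolding m psi_eq[OF r D s] unfolding A(3) C(3) psi_eq[OF r A(1,2)] psi_eq[OF r C(1,2)]
  by (simp add: tr_simps(1) ch_add)
qed

lemma psi_nz:
 assumes r: "2 <= r" and n: "g : K r (l r)"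
 shows "psi r \<beta> g ~= 0"
 by (simp add: psi_def Let_def \<tau>_nz)

section \<open>Skew endomorphisms and the trace form\<close>

lemma S_beta: "S (x * \<beta>) y = - S x (y * \<beta>)"
 unfolding S_mult_left \<iota>_\<beta> by (simp add: S_simps)

lemma adj_comp:
 assumes X: "lin X" and Y: "lin Y" and y: "y : \<O>"
 shows "adj (%x. X (Y x)) y = adj Y (adj X y)"
proof (rule S_cancel)
 have XY: "lin (%x. X (Y x))" by (rule lin_closed(2)[OF X Y])
 show "adj (%x. X (Y x)) y : \<O>" by (rule adj(1)[OF XY y])
 show "adj Y (adj X y) : \<O>" by (intro adj(1) X Y y)
 fix x :: 'k assume x: "x : \<O>"
 have "S x (adj (%x. X (Y x)) y) = S (X (Y x)) y" by (rule adj(2)[OF XY y x, symmetric])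
 also have "\<dots> = S (Y x) (adj X y)" by (rule adj(2)[OF X y linear_onD(1)[OF Y x]])
 also have "\<dots> = S x (adj Y (adj X y))" by (rule adj(2)[OF Y adj(1)[OF X y] x])
 finally show "S x (adj (%x. X (Y x)) y) = S x (adj Y (adj X y))" .
qed

text \<open>
 A skew endomorphism is orthogonal to the self-adjoint ones for the trace form, so the trace form
 remains nondegenerate on skew endomorphisms.
\<close>

lemma skew_detect:
 assumes W: "lin W" and skew: "!!x y. x : \<O> ==> y : \<O> ==> S (W x) y + S x (W y) : IF k"
  and j: "j <= k" and x0: "x0 : \<O>" "W x0 \<notin> IK j"
 shows "EX Y. lin Y & (ALL x:\<O>. ALL y:\<O>. S (Y x) y + S x (Y y) = 0) & ch j (tr (%x. W (Y x))) ~= 1"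
proof -
 obtain Z' where Z': "lin Z'" "tr (%x. W (Z' x)) \<notin> IF j" using tr_nondegenerate[OF W x0] by blast
 note aZ = lin_adj[OF Z'(1)] and aW = lin_adj[OF W]
 \<comment> \<open>\<open>Q\<close> is exactly skew. Modulo \<open>\<pi>\<^sup>j\<close> its pairing
   with \<open>W\<close> is twice that of \<open>Z'\<close>, since \<open>adj\<close> preserves
   traces and reverses the sign of \<open>W\<close>; division by 2 keeps it nonzero.\<close>
 define Q where "Q x = Z' x - adj Z' x" for x
 have Q: "lin Q" unfolding Q_def by (rule lin_closed(4)[OF Z'(1) aZ])
 have wskew: "W y + adj W y : IK k" if y: "y : \<O>" for y
 proof (rule S_unimodular)
  show "W y + adj W y : \<O>" using linear_onD(1)[OF W y] adj(1)[OF W y] by simp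
  fix x :: 'k assume x: "x : \<O>"
  show "S x (W y + adj W y) : IF k"
   using skew[OF x y] unfolding S_simps adj(2)[OF W y x] by (simp add: add.commute)
 qed
 have t: "tr (%x. adj W (adj Z' x)) = tr (%x. W (Z' x))"
 proof -
  have "tr (%x. adj W (adj Z' x)) = tr (adj (%x. Z' (W x)))"
   by (rule tr_cong) (rule adj_comp[OF Z'(1) W, symmetric])
  also have "\<dots> = tr (%x. Z' (W x))" by (rule tr_adj[OF lin_closed(2)[OF Z'(1) W]])
  also have "\<dots> = tr (%x. W (Z' x))" by (rule tr_commute[OF Z'(1) W])
  finally show ?thesis .
 qed
 have d: "tr (%x. W (adj Z' x)) + tr (%x. W (Z' x)) : IF j"
  unfolding t[symmetric] tr_simps(1)[symmetric]
  using wskew IK_mono[OF j] linear_onD(1)[OF aZ] by (intro tr_IF) blast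
 have WQ: "tr (%x. W (Q x)) = tr (%x. W (Z' x)) - tr (%x. W (adj Z' x))"
  unfolding tr_simps(3)[symmetric]
  by (rule tr_cong) (simp only: Q_def lin_diff[OF W linear_onD(1)[OF Z'(1)] linear_onD(1)[OF aZ]])
 have "tr (%x. W (Q x)) \<notin> IF j"
 proof
  assume "tr (%x. W (Q x)) : IF j"
  from IF_half[OF IF_closed(2)[OF this d]] have "tr (%x. W (Z' x)) : IF j" unfolding WQ by simp
  then show False using Z'(2) by contradiction
 qed
 \<comment> \<open>Scaling by \<open>s\<close> turns a trace outside \<open>IF j\<close> into one on
   which \<open>ch j\<close> is nontrivial.\<close>
 then obtain s where s: "s : \<O>" "ch j (tr (%x. W (Q x)) * s) ~= 1" using ch_nondegenerate by blast
 have es: "emb s : \<O>" using s(1) by (simp only: emb_integers)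
 show ?thesis
 proof (intro exI[of _ "%x. emb s * Q x"] conjI ballI)
  show "lin (%x. emb s * Q x)" by (rule lin_closed(6)[OF Q es])
  have "tr (%x. W (emb s * Q x)) = tr (%x. emb s * W (Q x))"
   by (rule tr_cong) (rule linear_onD(3)[OF W s(1) linear_onD(1)[OF Q]])
  then show "ch j (tr (%x. W (emb s * Q x))) ~= 1" using s(2) by (simp add: tr_simps(4) mult.commute)
  fix x y :: 'k assume xy: "x : \<O>" "y : \<O>"
  have "S (Z' x) y = S x (adj Z' y)" "S (adj Z' x) y = S x (Z' y)"
   by (rule adj(2)[OF Z'(1) xy(2,1)], subst S_sym, subst adj(2)[OF Z'(1) xy, symmetric], rule S_sym)
  then show "S (emb s * Q x) y + S x (emb s * Q y) = 0"
   unfolding Q_def S_simps by (simp add: algebra_simps)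
 qed
qed

section \<open>The stabilizer of \<open>\<psi>\<^sub>\<beta>\<close>\<close>

text \<open>Composing with a lift of \<open>g\<close> or of its inverse moves between the condition
  on \<open>Ad\<close> and the commutation form, to which the lemmas on the centralizer
  apply.\<close>

lemma G_stab_iff:
 assumes r: "2 <= r" and X: "lin X" "sim r X"
 shows "red r X : G_stab r \<beta> \<longleftrightarrow> (ALL x:\<O>. X (x * \<beta>) - X x * \<beta> : IK (l' r))"
proof -
 note L = l_bounds[OF r]
 have lb: "lin (%x. x * \<beta>)" by (rule lin_closed(7)[OF \<beta>_int])
 obtain X' where X': "lin X'" "sim r X'" "cg r (%x. X' (X x)) (%x. x)" "cg r (%x. X (X' x)) (%x. x)"
  using sim_inverse[OF L(8) X] by blast
 have i: "inv_{G r} (red r X) = red r X'" by (rule G_inv[OF L(8) X X'(1-3)])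
 have l1: "lin (%x. X x * \<beta>)" by (rule lin_closed(5)[OF X(1) \<beta>_int])
 have l2: "lin (%x. X' (X x * \<beta>))" by (rule lin_closed(2)[OF X'(1) l1])
 have Xi: "X x : \<O>" "X' x : \<O>" if "x : \<O>" for x
  using linear_onD(1)[OF X(1) that] linear_onD(1)[OF X'(1) that] by auto
 have "Ad r (red r X) (red r (mul_by \<beta>)) = red r (%x. X' (X x * \<beta>))"
  unfolding Ad_def i red_mul_by compose_red[OF X(1) lb] by (rule compose_red[OF l1 X'(1)])
 then have "red_mod r (l' r) (Ad r (red r X) (red r (mul_by \<beta>))) = red (l' r) (%x. X' (X x * \<beta>))"
  by (simp only: red_mod_red[OF l2 L(9)])
 then have "red r X : G_stab r \<beta> \<longleftrightarrow> cg (l' r) (%x. X' (X x * \<beta>)) (%x. x * \<beta>)"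
  unfolding G_stab_def using red_carrier[OF L(8) X] red_eq[OF l2 lb] by (simp add: red_mul_by)
 also have "\<dots> \<longleftrightarrow> (ALL x:\<O>. X (x * \<beta>) - X x * \<beta> : IK (l' r))"
  unfolding cg_def
 proof (intro ball_cong refl)
  fix x :: 'k assume x: "x : \<O>"
  have xb: "x * \<beta> : \<O>" and Xb: "X x * \<beta> : \<O>" using x Xi by auto
  have e1: "X (X' (X x * \<beta>)) - X x * \<beta> : IK (l' r)" by (rule IK_mono[OF L(9) cgD[OF X'(4) Xb]])
  have e2: "X' (X (x * \<beta>)) - x * \<beta> : IK (l' r)" by (rule IK_mono[OF L(9) cgD[OF X'(3) xb]])
  show "X' (X x * \<beta>) - x * \<beta> : IK (l' r) \<longleftrightarrow> X (x * \<beta>) - X x * \<beta> : IK (l' r)"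
  proof
   assume "X' (X x * \<beta>) - x * \<beta> : IK (l' r)"
   then have "X (X' (X x * \<beta>)) - X (x * \<beta>) : IK (l' r)"
    using lin_IK[OF X(1)] lin_diff[OF X(1) Xi(2)[OF Xb] xb] by metis
   from IK_closed(3)[OF e1 this] show "X (x * \<beta>) - X x * \<beta> : IK (l' r)" by simp
  next
   assume "X (x * \<beta>) - X x * \<beta> : IK (l' r)"
   then have "X' (X (x * \<beta>)) - X' (X x * \<beta>) : IK (l' r)"
    using lin_IK[OF X'(1)] lin_diff[OF X'(1) Xi(1)[OF xb] Xb] by metis
   from IK_closed(3)[OF e2 this] show "X' (X x * \<beta>) - x * \<beta> : IK (l' r)" by simp
  qed
 qed
 finally show ?thesis .
qed

end

lemma (in group) subgroup_mult_normal:
 assumes C: "subgroup C G" and N: "N \<lhd> G"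
 shows "subgroup {c \<otimes> x | c x. c : C & x : N} G"
proof -
 have NG: "subgroup N G" by (rule normal_imp_subgroup[OF N])
 have cC: "c : C ==> c : carrier G" for c by (rule subgroup.mem_carrier[OF C])
 have cN: "x : N ==> x : carrier G" for x by (rule subgroup.mem_carrier[OF NG])
 show ?thesis
 proof (rule subgroupI)
  show "{c \<otimes> x | c x. c : C & x : N} \<subseteq> carrier G" using cC cN by auto
  show "{c \<otimes> x | c x. c : C & x : N} ~= {}" using subgroup.one_closed[OF C] subgroup.one_closed[OF NG] by blast
  fix g assume "g : {c \<otimes> x | c x. c : C & x : N}"
  then obtain c x where g: "g = c \<otimes> x" "c : C" "x : N" by blast
  have "inv g = inv c \<otimes> (c \<otimes> inv x \<otimes> inv c)"
   using g cC cN by (simp add: inv_mult_group m_assoc[symmetric])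
  moreover have "inv c : C" by (rule subgroup.m_inv_closed[OF C g(2)])
  moreover have "c \<otimes> inv x \<otimes> inv c : N"
   by (rule normal.inv_op_closed2[OF N cC[OF g(2)] subgroup.m_inv_closed[OF NG g(3)]])
  ultimately show "inv g : {c \<otimes> x | c x. c : C & x : N}" by blast
  fix h assume "h : {c \<otimes> x | c x. c : C & x : N}"
  then obtain d y where h: "h = d \<otimes> y" "d : C" "y : N" by blast
  define w where "w = inv d \<otimes> x \<otimes> d"
  have w: "w : carrier G" "d \<otimes> w = x \<otimes> d"
   unfolding w_def using g h cC cN by (simp_all add: m_assoc[symmetric])
  have "c \<otimes> d \<otimes> (w \<otimes> y) = c \<otimes> (d \<otimes> w) \<otimes> y" using g h cC cN w(1) by (simp add: m_assoc)
  then have "c \<otimes> d \<otimes> (inv d \<otimes> x \<otimes> d \<otimes> y) = c \<otimes> (x \<otimes> d) \<otimes> y" by (simp only: w(2)) (simp only: w_def)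
  also have "\<dots> = g \<otimes> h" using g h cC cN by (simp add: m_assoc)
  finally have "g \<otimes> h = c \<otimes> d \<otimes> (inv d \<otimes> x \<otimes> d \<otimes> y)" ..
  moreover have "c \<otimes> d : C" by (rule subgroup.m_closed[OF C g(2) h(2)])
  moreover have "inv d \<otimes> x \<otimes> d \<otimes> y : N"
   by (rule subgroup.m_closed[OF NG normal.inv_op_closed1[OF N cC[OF h(2)] g(3)] h(3)])
  ultimately show "g \<otimes> h : {c \<otimes> x | c x. c : C & x : N}" by blast
 qed
qed

text \<open>A scalar function realized on a nonzero vector inherits multiplicativity from the
  representation. For \<open>psi_Z\<close> this replaces a computation with the quadratic
  term.\<close>

lemma contains_character_mult:
 assumes V: "rep (G(|carrier := H|)) V P" and c: "contains_character V P Z \<chi>" and ZH: "Z \<subseteq> H"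
  and z: "z : Z" "w : Z" "z *_{G} w : Z"
 shows "\<chi> (z *_{G} w) = \<chi> z * \<chi> w"
proof -
 interpret rep "G(|carrier := H|)" V P by fact
 obtain v where v: "v : carrier V" "v ~= 0_{V}" "!!z. z : Z ==> P z v = \<chi> z \<odot>_{V} v"
  using c by (auto simp: contains_character_def)
 have zH: "z : H" "w : H" using z ZH by auto
 have "\<chi> (z *_{G} w) \<odot>_{V} v = P z (P w v)" using mult[of z w v] zH v(1) v(3)[OF z(3)] by simp
 also have "\<dots> = \<chi> w \<odot>_{V} (\<chi> z \<odot>_{V} v)" using smul[of z v "\<chi> w"] zH v(1) v(3)[OF z(1)] v(3)[OF z(2)] by simp
 also have "\<dots> = (\<chi> z * \<chi> w) \<odot>_{V} v" using v(1) by (simp add: smult_assoc[symmetric] mult.commute)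
 finally show ?thesis using smult_cancel v(1,2) by blast
qed

lemma charactersD:
 assumes "\<rho> : characters A"
 shows "x : carrier A ==> \<rho> x ~= 0" "x : carrier A ==> y : carrier A ==> \<rho> (x *_{A} y) = \<rho> x * \<rho> y"
  "\<rho> : extensional (carrier A)"
proof -
 have h: "\<rho> : hom A (units_of CC)" using assms by (simp add: characters_def)
 show "\<rho> x ~= 0" if "x : carrier A"
  using hom_in_carrier[OF h that] by (auto simp: units_of_def Units_def)
 show "\<rho> (x *_{A} y) = \<rho> x * \<rho> y" if "x : carrier A" "y : carrier A"
  using hom_mult[OF h that] by (simp add: units_of_def)
qed (use assms in \<open>simp add: characters_def\<close>)

section \<open>Conjugation of the character and the structure of its stabilizer\<close>

context GO_beta
begin

lemma K_quotient:
 assumes j: "1 <= j" "j <= r" and X: "lin X" "sim r X" and Y: "lin Y" "sim r Y" and c: "cg j X Y"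
 shows "inv_{G r} (red r Y) *_{G r} red r X : K r j"
proof -
 interpret \<phi>: group_hom "G r" "G j" "red_mod r j" by (rule red_mod_hom[OF j])
 have r: "1 <= r" using j by simp
 have g: "red r X : carrier (G r)" "red r Y : carrier (G r)"
  by (rule red_carrier[OF r X], rule red_carrier[OF r Y])
 have "red_mod r j (red r X) = red_mod r j (red r Y)"
  unfolding red_mod_red[OF X(1) j(2)] red_mod_red[OF Y(1) j(2)] red_eq[OF X(1) Y(1)] by (rule c)
 then have "red_mod r j (inv_{G r} (red r Y) *_{G r} red r X) = 1_{G j}" using g by simp
 then show ?thesis unfolding K_def kernel_def using g by simp
qed

text \<open>Cyclicity of the trace moves the conjugation from \<open>A\<close> to
  \<open>\<beta>\<close>, so the character changes by the pairing of \<open>A\<close> with the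
  conjugate of \<open>\<beta>\<close> minus \<open>\<beta>\<close>.\<close>

lemma psi_conj:
 assumes r: "2 <= r" and X: "lin X" "sim r X" and A: "lin A" "sim r (%x. x + emb \<pi> ^ l r * A x)"
  and X': "lin X'" "sim r X'" "cg r (%x. X' (X x)) (%x. x)"
 shows "psi r \<beta> (red r X *_{G r} red r (%x. x + emb \<pi> ^ l r * A x) *_{G r} inv_{G r} (red r X)) =
  psi r \<beta> (red r (%x. x + emb \<pi> ^ l r * A x)) * ch (l' r) (tr (%x. A (X (X' x * \<beta>) - x * \<beta>)))"
proof -
 note L = l_bounds[OF r]
 define D where "D x = X' (A (X x))" for x
 have lAX: "lin (%x. A (X x))" by (rule lin_closed(2)[OF A(1) X(1)])
 have D: "lin D" unfolding D_def by (rule lin_closed(2)[OF X'(1) lAX])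
 note op = lin_one_plus[OF A(1), of "l r"]
 have l1: "lin (%x. X x + emb \<pi> ^ l r * A (X x))" by (rule lin_closed(2)[OF op X(1)])
 have s1: "sim r (%x. X x + emb \<pi> ^ l r * A (X x))" by (rule sim_comp[OF X op A(2)])
 have l2: "lin (%x. X' (X x + emb \<pi> ^ l r * A (X x)))" by (rule lin_closed(2)[OF X'(1) l1])
 have s2: "sim r (%x. X' (X x + emb \<pi> ^ l r * A (X x)))" by (rule sim_comp[OF l1 s1 X'(1,2)])
 have Xi: "X x : \<O>" "X' x : \<O>" "A x : \<O>" if "x : \<O>" for x
  using linear_onD(1)[OF X(1) that] linear_onD(1)[OF X'(1) that] linear_onD(1)[OF A(1) that] by auto
 have c: "cg r (%x. X' (X x + emb \<pi> ^ l r * A (X x))) (%x. x + emb \<pi> ^ l r * D x)"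
  unfolding cg_def
 proof
  fix x :: 'k assume x: "x : \<O>"
  have "X' (emb (\<pi> ^ l r) * A (X x)) = emb (\<pi> ^ l r) * D x"
   unfolding D_def by (rule linear_onD(3)[OF X'(1)]) (use Xi x in auto)
  then have "X' (X x + emb \<pi> ^ l r * A (X x)) = X' (X x) + emb \<pi> ^ l r * D x"
   using linear_onD(2)[OF X'(1), of "X x" "emb \<pi> ^ l r * A (X x)"] Xi x by simp
  then show "X' (X x + emb \<pi> ^ l r * A (X x)) - (x + emb \<pi> ^ l r * D x) : IK r"
   using cgD[OF X'(3) x] by simp
 qed
 have sD: "sim r (%x. x + emb \<pi> ^ l r * D x)" by (rule sim_cg[OF l2 s2 lin_one_plus[OF D] c])
 have "red r X *_{G r} red r (%x. x + emb \<pi> ^ l r * A x) *_{G r} inv_{G r} (red r X) =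
   red r (%x. X' (X x + emb \<pi> ^ l r * A (X x)))"
  unfolding G_inv[OF L(8) X X'] G_mult[OF L(8) X op A(2)] by (rule G_mult[OF L(8) l1 s1 X'(1,2)])
 also have "\<dots> = red r (%x. x + emb \<pi> ^ l r * D x)" using red_eq[OF l2 lin_one_plus[OF D]] c by blast
 finally have e: "psi r \<beta> (red r X *_{G r} red r (%x. x + emb \<pi> ^ l r * A x) *_{G r} inv_{G r} (red r X)) =
   ch (l' r) (tr (%x. D x * \<beta>))" using psi_eq[OF r D sD] by simp
 have lb: "lin (%x. x * \<beta>)" by (rule lin_closed(7)[OF \<beta>_int])
 have "tr (%x. D x * \<beta>) = tr (%x. A (X (X' x * \<beta>)))"
  unfolding D_def using tr_commute[OF lin_closed(5)[OF X'(1) \<beta>_int] lAX] by simp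
 moreover have "tr (%x. A x * \<beta>) = tr (%x. A (x * \<beta>))" by (rule tr_commute[OF lb A(1)])
 moreover have "tr (%x. A (X (X' x * \<beta>) - x * \<beta>)) = tr (%x. A (X (X' x * \<beta>))) - tr (%x. A (x * \<beta>))"
  unfolding tr_simps(3)[symmetric] using Xi by (intro tr_cong lin_diff[OF A(1)]) simp_all
 ultimately have "tr (%x. D x * \<beta>) = tr (%x. A x * \<beta>) + tr (%x. A (X (X' x * \<beta>) - x * \<beta>))" by simp
 then show ?thesis unfolding e psi_eq[OF r A] by (simp add: ch_add)
qed

lemma G_stab_carrier: "g : G_stab r \<beta> ==> g : carrier (G r)"
 by (simp add: G_stab_def)

lemma G_stab_fixes_psi:
 assumes r: "2 <= r" and g: "g : G_stab r \<beta>" and k: "k : K r (l r)"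
 shows "psi r \<beta> (g *_{G r} k *_{G r} inv_{G r} g) = psi r \<beta> k"
proof -
 note L = l_bounds[OF r]
 obtain X where X: "lin X" "sim r X" "g = red r X" using G_stab_carrier[OF g] unfolding carrier_G[OF L(8)] by blast
 obtain X' where X': "lin X'" "sim r X'" "cg r (%x. X' (X x)) (%x. x)" "cg r (%x. X (X' x)) (%x. x)"
  using sim_inverse[OF L(8) X(1,2)] by blast
 obtain A where A: "lin A" "sim r (%x. x + emb \<pi> ^ l r * A x)" "k = red r (%x. x + emb \<pi> ^ l r * A x)"
  using K_lift[OF L(5,3) k] by blast
 have st: "X (x * \<beta>) - X x * \<beta> : IK (l' r)" if "x : \<O>" for x
  using g G_stab_iff[OF r X(1,2)] X(3) that by blast
 have "tr (%x. A (X (X' x * \<beta>) - x * \<beta>)) : IF (l' r)"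
 proof (rule tr_IF)
  fix x :: 'k assume x: "x : \<O>"
  have "X (X' x * \<beta>) - X (X' x) * \<beta> : IK (l' r)" by (rule st[OF linear_onD(1)[OF X'(1) x]])
  moreover have "(X (X' x) - x) * \<beta> : IK (l' r)" by (rule IK_mult_integers(1)[OF IK_mono[OF L(9) cgD[OF X'(4) x]] \<beta>_int])
  ultimately have "X (X' x * \<beta>) - X (X' x) * \<beta> + (X (X' x) - x) * \<beta> : IK (l' r)" by (rule IK_closed(2))
  then have "X (X' x * \<beta>) - x * \<beta> : IK (l' r)" by (simp add: left_diff_distrib)
  then show "A (X (X' x * \<beta>) - x * \<beta>) : IK (l' r)" by (rule lin_IK[OF A(1)])
 qed
 then show ?thesis unfolding X(3) A(3) psi_conj[OF r X(1,2) A(1,2) X'(1-3)] by (simp add: ch_IF)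
qed

text \<open>\<open>W\<close>, the conjugate of \<open>\<beta>\<close> minus \<open>\<beta>\<close>,
  is skew modulo \<open>\<pi>\<^sup>r\<close> because \<open>\<beta>\<close> is skew and
  \<open>X\<close> is a similitude, and it is nonzero modulo \<open>\<pi>^(l' r)\<close>.
  \<open>skew_detect\<close> finds a skew \<open>Y\<close> pairing nontrivially with it, and
  \<open>1 + \<pi>\<^sup>l Y\<close> belongs to the group as \<open>r <= 2 * l r\<close>.\<close>

lemma not_G_stab_moves_psi:
 assumes r: "2 <= r" and g: "g : carrier (G r)" "g \<notin> G_stab r \<beta>"
 shows "EX k:K r (l r). psi r \<beta> (g *_{G r} k *_{G r} inv_{G r} g) ~= psi r \<beta> k"
proof -
 note L = l_bounds[OF r]
 obtain X where X: "lin X" "sim r X" "g = red r X" using g(1) unfolding carrier_G[OF L(8)] by blast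
 obtain X' where X': "lin X'" "sim r X'" "cg r (%x. X' (X x)) (%x. x)" "cg r (%x. X (X' x)) (%x. x)"
  using sim_inverse[OF L(8) X(1,2)] by blast
 obtain \<nu> where \<nu>: "\<nu> : \<O>" "!!x y. x : \<O> ==> y : \<O> ==> S (X x) (X y) - \<nu> * S x y : IF r"
  using X(2) by (auto simp: sim_def)
 have Xi: "X x : \<O>" "X' x : \<O>" if "x : \<O>" for x
  using linear_onD(1)[OF X(1) that] linear_onD(1)[OF X'(1) that] by auto
 define W where "W x = X (X' x * \<beta>) - x * \<beta>" for x
 have W: "lin W"
  unfolding W_def
  by (rule lin_closed(4)[OF lin_closed(2)[OF X(1) lin_closed(5)[OF X'(1) \<beta>_int]] lin_closed(7)[OF \<beta>_int]])
 have skew: "S (W x) y + S x (W y) : IF r" if xy: "x : \<O>" "y : \<O>" for x y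
 proof -
  \<comment> \<open>Modulo \<open>\<pi>\<^sup>r\<close>, \<open>y\<close> is \<open>X b\<close> and
    \<open>x\<close> is \<open>X c\<close>; the claim then reduces to the similitude relation for
    \<open>X\<close> and the skewness of multiplication by \<open>\<beta>\<close>.\<close>
  define a b c d where "a = X' x * \<beta>" and "b = X' y" and "c = X' x" and "d = X' y * \<beta>"
  have i: "a : \<O>" "b : \<O>" "c : \<O>" "d : \<O>"
   using Xi xy by (auto simp: a_def b_def c_def d_def)
  have "S (X a) (X b - y) : IF r" "S (X c - x) (X d) : IF r"
   unfolding b_def c_def by (rule S_IF(2)[OF Xi(1)[OF i(1)] cgD[OF X'(4) xy(2)]], rule S_IF(1)[OF cgD[OF X'(4) xy(1)] Xi(1)[OF i(4)]])
  from IF_closed(2)[OF this] have e1: "S (X a) (X b - y) + S (X c - x) (X d) : IF r" .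
  have e2: "(S (X a) (X b) - \<nu> * S a b) + (S (X c) (X d) - \<nu> * S c d) : IF r" using \<nu>(2) i by (intro IF_closed(2))
  have "S a b + S c d = 0" "S (x * \<beta>) y = - S x (y * \<beta>)" unfolding a_def b_def c_def d_def S_beta by simp_all
  then have z: "\<nu> * S a b = - (\<nu> * S c d)" by (simp add: eq_neg_iff_add_eq_0 flip: distrib_left)
  have "S (W x) y + S x (W y) = S (X a) y + S x (X d)"
   unfolding W_def a_def[symmetric] d_def[symmetric] S_simps using \<open>S (x * \<beta>) y = _\<close> by simp
  also have "\<dots> = ((S (X a) (X b) - \<nu> * S a b) + (S (X c) (X d) - \<nu> * S c d)) - (S (X a) (X b - y) + S (X c - x) (X d))"
   unfolding z S_simps by simp
  finally show ?thesis using IF_closed(3)[OF e2 e1] by simp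
 qed
 have "EX x0:\<O>. W x0 \<notin> IK (l' r)"
 proof -
  \<comment> \<open>Evaluating \<open>W\<close> at \<open>X u\<close> turns it into the commutation
    defect of \<open>X\<close> at \<open>u\<close>, up to an error in
    \<open>IK (l' r)\<close>.\<close>
  obtain u where u: "u : \<O>" "X (u * \<beta>) - X u * \<beta> \<notin> IK (l' r)"
   using g(2) G_stab_iff[OF r X(1,2)] X(3) by blast
  have "(X' (X u) - u) * \<beta> : IK (l' r)"
   by (rule IK_mult_integers(1)[OF IK_mono[OF L(9) cgD[OF X'(3) u(1)]] \<beta>_int])
  then have "X (X' (X u) * \<beta> - u * \<beta>) : IK (l' r)" unfolding left_diff_distrib by (rule lin_IK[OF X(1)])
  then have "X (X' (X u) * \<beta>) - X (u * \<beta>) : IK (l' r)"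
   using lin_diff[OF X(1), of "X' (X u) * \<beta>" "u * \<beta>"] Xi u(1) by simp
  moreover have "W (X u) - (X (X' (X u) * \<beta>) - X (u * \<beta>)) = X (u * \<beta>) - X u * \<beta>" by (simp add: W_def)
  ultimately have "W (X u) \<notin> IK (l' r)" using IK_closed(3) u(2) by metis
  then show ?thesis using Xi u(1) by blast
 qed
 then obtain x0 where x0: "x0 : \<O>" "W x0 \<notin> IK (l' r)" by blast
 obtain Y where Y: "lin Y" "!!x y. x : \<O> ==> y : \<O> ==> S (Y x) y + S x (Y y) = 0"
  "ch (l' r) (tr (%x. W (Y x))) ~= 1"
  using skew_detect[OF W skew L(9) x0] by blast
 have sY: "sim r (%x. x + emb \<pi> ^ l r * Y x)"
  by (rule sim_one_plus_go[OF L(5,6) Y(1) integers_closed(1)]) (simp add: Y(2))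
 have cY: "cg (l r) (%x. x + emb \<pi> ^ l r * Y x) (%x. x)"
  unfolding cg_def using linear_onD(1)[OF Y(1)] pi_power_IK[OF _ order_refl] by simp
 have kN: "red r (%x. x + emb \<pi> ^ l r * Y x) : K r (l r)"
  using K_iff[OF L(5,3) lin_one_plus[OF Y(1)] sY] cY by blast
 have "ch (l' r) (tr (%x. Y (W x))) ~= 1" using Y(3) tr_commute[OF Y(1) W] by simp
 then have "psi r \<beta> (g *_{G r} red r (%x. x + emb \<pi> ^ l r * Y x) *_{G r} inv_{G r} g) ~=
   psi r \<beta> (red r (%x. x + emb \<pi> ^ l r * Y x))"
  unfolding X(3) psi_conj[OF r X(1,2) Y(1) sY X'(1-3)] using psi_nz[OF r kN] by (simp add: W_def)
 then show ?thesis using kN by blast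
qed

text \<open>Modulo \<open>\<pi>^(l' r)\<close> an element of the stabilizer commutes with
  \<open>\<beta>\<close>, hence is multiplication by some \<open>\<gamma>\<close> of
  \<open>U_KF\<close>; dividing by \<open>\<gamma>\<close> lands in the congruence subgroup.\<close>

lemma G_stab_eq:
 assumes r: "2 <= r"
 shows "G_stab r \<beta> = {c *_{G r} h | c h. c : G_centr r \<beta> & h : K r (l' r)}"
proof -
 note L = l_bounds[OF r]
 interpret group "G r" by (rule group_G[OF L(8)])
 show ?thesis
 proof (intro equalityI subsetI)
  fix g assume g: "g : G_stab r \<beta>"
  obtain X where X: "lin X" "sim r X" "g = red r X" using G_stab_carrier[OF g] unfolding carrier_G[OF L(8)] by blast
  have st: "X (x * \<beta>) - X x * \<beta> : IK (l' r)" if "x : \<O>" for x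
   using g G_stab_iff[OF r X(1,2)] X(3) that by blast
  obtain \<gamma> where \<gamma>: "\<gamma> : U_KF" "cg (l' r) X (%x. x * \<gamma>)"
   using comm_sim_imp_U[OF L(1) X(1) sim_mono[OF L(9) X(2)] st] by blast
  define c d where "c = red r (%x. x * \<gamma>)" and "d = red r (%x. x * inverse \<gamma>)"
  have c: "c : G_centr r \<beta>" "d : G_centr r \<beta>"
   unfolding c_def d_def G_centr_iff[OF L(8)] using \<gamma>(1) U_closed(3)[OF \<gamma>(1)] by blast+
  have cd: "c *_{G r} d = 1_{G r}"
   unfolding c_def d_def U_mult[OF L(8) \<gamma>(1) U_closed(3)[OF \<gamma>(1)]] G_one using U_nz[OF \<gamma>(1)] by simp
  note i = lin_U[OF U_closed(3)[OF \<gamma>(1)]] sim_mul[OF U_closed(3)[OF \<gamma>(1)], of r]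
  have dg: "d *_{G r} g = red r (%x. X (x * inverse \<gamma>))"
   unfolding d_def X(3) by (rule G_mult[OF L(8) i X(1,2)])
  have "cg (l' r) (%x. X (x * inverse \<gamma>)) (%x. x)"
   unfolding cg_def
  proof
   fix x :: 'k assume x: "x : \<O>"
   from cgD[OF \<gamma>(2) linear_onD(1)[OF i(1) x]] show "X (x * inverse \<gamma>) - x : IK (l' r)"
    using U_nz[OF \<gamma>(1)] by (simp add: mult.assoc)
  qed
  then have "d *_{G r} g : K r (l' r)"
   unfolding dg using K_iff[OF L(1,9) lin_closed(2)[OF X(1) i(1)] sim_comp[OF i X(1,2)]] by blast
  moreover have "g = c *_{G r} (d *_{G r} g)"
   using c G_stab_carrier[OF g] cd by (simp add: G_centr_def m_assoc[symmetric])
  ultimately show "g : {c *_{G r} h | c h. c : G_centr r \<beta> & h : K r (l' r)}" using c(1) by blast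
 next
  fix g assume "g : {c *_{G r} h | c h. c : G_centr r \<beta> & h : K r (l' r)}"
  then obtain c h where g: "g = c *_{G r} h" "c : G_centr r \<beta>" "h : K r (l' r)" by blast
  obtain \<gamma> where \<gamma>: "\<gamma> : U_KF" "c = red r (%x. x * \<gamma>)" using g(2) G_centr_iff[OF L(8)] by blast
  have "h : carrier (G r)" using g(3) by (simp add: K_def kernel_def)
  then obtain Y where Y: "lin Y" "sim r Y" "h = red r Y" unfolding carrier_G[OF L(8)] by blast
  have cY: "cg (l' r) Y (%x. x)" using g(3) K_iff[OF L(1,9) Y(1,2)] Y(3) by blast
  note i = lin_U[OF \<gamma>(1)] sim_mul[OF \<gamma>(1), of r]
  have e: "g = red r (%x. Y (x * \<gamma>))" unfolding g(1) \<gamma>(2) Y(3) by (rule G_mult[OF L(8) i Y(1,2)])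
  show "g : G_stab r \<beta>"
   unfolding e G_stab_iff[OF r lin_closed(2)[OF Y(1) i(1)] sim_comp[OF i Y(1,2)]]
  proof
   fix x :: 'k assume x: "x : \<O>"
   have xi: "x * \<beta> * \<gamma> : \<O>" "x * \<gamma> : \<O>" using x U_integers[OF \<gamma>(1)] by auto
   from IK_closed(3)[OF cgD[OF cY xi(1)] IK_mult_integers(1)[OF cgD[OF cY xi(2)] \<beta>_int]]
   show "Y (x * \<beta> * \<gamma>) - Y (x * \<gamma>) * \<beta> : IK (l' r)" by (simp add: algebra_simps)
  qed
 qed
qed

lemma G_stab_subgroup: "2 <= r ==> subgroup (G_stab r \<beta>) (G r)"
 unfolding G_stab_eq
 by (rule group.subgroup_mult_normal[OF group_G G_centr_subgroup K_normal]) (auto simp: l'_def)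

section \<open>The Lie algebra of the centralizer over the residue field\<close>

lemma go_mod_red:
 assumes X: "lin X"
 shows "red k X : go (OF_mod k) (OK_mod k) (S_mod k) \<longleftrightarrow>
  (EX \<mu>:\<O>. ALL x:\<O>. ALL y:\<O>. S (X x) y + S x (X y) - \<mu> * S x y : IF k)"
proof -
 have e: "S_mod k (red k X (cK k x)) (cK k y) +_{OF_mod k} S_mod k (cK k x) (red k X (cK k y)) =
   cF k \<mu> *_{OF_mod k} S_mod k (cK k x) (cK k y) \<longleftrightarrow> S (X x) y + S x (X y) - \<mu> * S x y : IF k"
  if "\<mu> : \<O>" "x : \<O>" "y : \<O>" for \<mu> x y
  using that red_apply[OF X] linear_onD(1)[OF X] S_integers by (simp add: S_mod_cK OF_mod_add OF_mod_mult cF_eq)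
 have "red k X : endos (OF_mod k) (OK_mod k)" using red_linear[OF X] red_ext by (simp add: endos_def)
 then show ?thesis
  unfolding go_def carrier_OF_mod carrier_OK_mod by (simp add: e)
qed

lemma g_centr_red:
 assumes X: "lin X"
 shows "red 1 X : carrier (g_centr \<beta>) \<longleftrightarrow>
  (EX \<mu>:\<O>. ALL x:\<O>. ALL y:\<O>. S (X x) y + S x (X y) - \<mu> * S x y : IF 1) &
  (ALL x:\<O>. X (x * \<beta>) - X x * \<beta> : IK 1)"
proof -
 have lb: "lin (%x. x * \<beta>)" by (rule lin_closed(7)[OF \<beta>_int])
 have "compose (carrier (OK_mod 1)) (red 1 X) (red 1 (mul_by \<beta>)) = compose (carrier (OK_mod 1)) (red 1 (mul_by \<beta>)) (red 1 X)
   \<longleftrightarrow> (ALL x:\<O>. X (x * \<beta>) - X x * \<beta> : IK 1)"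
  unfolding red_mul_by compose_red[OF lb X] compose_red[OF X lb]
   red_eq[OF lin_closed(2)[OF X lb] lin_closed(5)[OF X \<beta>_int]] cg_def by (rule refl)
 then show ?thesis unfolding g_centr_def partial_object.select_convs mem_Collect_eq go_mod_red[OF X] by blast
qed

text \<open>Commuting with \<open>\<beta>\<close> makes \<open>R\<close> multiplication by some
  \<open>x\<close> with \<open>x + \<iota> x\<close> congruent to \<open>\<mu>\<close>. Once this
  trace is exact, \<open>1 + \<pi>\<^sup>k x\<close> has norm \<open>1 + \<pi>\<^sup>k \<mu>\<close>
  modulo \<open>\<pi>^(2 * k)\<close>, and \<open>lift_U\<close> corrects it without changing
  \<open>x\<close> modulo \<open>\<pi>\<close>.\<close>

lemma g_centr_lift:
 assumes k: "1 <= k" and R: "R : carrier (g_centr \<beta>)"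
 shows "EX x:\<O>. 1 + emb \<pi> ^ k * x : U_KF & R = red 1 (%y. y * x)"
proof -
 have Rl: "R : linear_maps (OF_mod 1) (OK_mod 1) (OK_mod 1)" "R : extensional (carrier (OK_mod 1))"
  using R by (simp_all add: g_centr_def go_def endos_def)
 obtain X where X: "lin X" "ALL x:\<O>. R (cK 1 x) = cK 1 (X x)" using lin_lift[OF Rl(1)] by blast
 have RX: "R = red 1 X"
 proof (rule extensionalityI[OF Rl(2) red_ext])
  fix C assume "C : carrier (OK_mod 1)"
  then obtain x where x: "x : \<O>" "C = cK 1 x" by (auto simp only: carrier_OK_mod)
  then show "R C = red 1 X C" using bspec[OF X(2) x(1)] red_apply[OF X(1) x(1), of 1] by (simp only:)
 qed
 obtain \<mu> where \<mu>: "\<mu> : \<O>" "ALL x:\<O>. ALL y:\<O>. S (X x) y + S x (X y) - \<mu> * S x y : IF 1"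
  and c: "ALL x:\<O>. X (x * \<beta>) - X x * \<beta> : IK 1"
  using R unfolding RX g_centr_red[OF X(1)] by blast
 have X1: "X 1 : \<O>" by (rule linear_onD(1)[OF X(1) integers_closed(2)])
 have cX: "cg 1 X (%x. x * X 1)" using comm_imp_mul[OF X(1)] c by blast
 have "X 1 + \<iota> (X 1) - emb \<mu> : IK 1"
 proof (rule S_unimodular)
  show "X 1 + \<iota> (X 1) - emb \<mu> : \<O>" using X1 \<mu>(1) by simp
  fix x :: 'k assume x: "x : \<O>"
  have "S (x * X 1) 1 = S x (1 * \<iota> (X 1))" by (rule S_mult_left)
  then have "S x (X 1 + \<iota> (X 1) - emb \<mu>) = (S (X x) 1 + S x (X 1) - \<mu> * S x 1) - S (X x - x * X 1) 1"
   using S_simps(8)[of x \<mu> 1] by (simp add: S_simps(2-4))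
  moreover have "S (X x - x * X 1) 1 : IF 1" by (rule S_IF(1)[OF cgD[OF cX x] integers_closed(2)])
  moreover have "S (X x) 1 + S x (X 1) - \<mu> * S x 1 : IF 1" using \<mu>(2) x integers_closed(2) by blast
  ultimately show "S x (X 1 + \<iota> (X 1) - emb \<mu>) : IF 1" by (simp only: IF_closed(3))
 qed
 then have h: "(X 1 + \<iota> (X 1) - emb \<mu>) / 2 : IK 1" by (rule IK_half)
 \<comment> \<open>The trace error is fixed by \<open>\<iota>\<close>, so subtracting half of it
   makes the trace equal to \<open>emb \<mu>\<close>.\<close>
 define x1 where "x1 = X 1 - (X 1 + \<iota> (X 1) - emb \<mu>) / 2"
 have x1: "x1 : \<O>" unfolding x1_def using X1 IK_integers[OF h] by (rule integers_closed(4))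
 have "\<iota> 2 = 2" by (rule \<iota>_simps(10))
 then have "x1 + \<iota> x1 = emb \<mu>" unfolding x1_def by (simp add: \<iota>_divide field_simps)
 then have "(1 + emb \<pi> ^ k * x1) * \<iota> (1 + emb \<pi> ^ k * x1) - emb (1 + \<pi> ^ k * \<mu>) = emb \<pi> ^ (k + k) * (x1 * \<iota> x1)"
  by (simp add: algebra_simps power_add flip: \<open>x1 + \<iota> x1 = emb \<mu>\<close>)
 then have d: "(1 + emb \<pi> ^ k * x1) * \<iota> (1 + emb \<pi> ^ k * x1) - emb (1 + \<pi> ^ k * \<mu>) : IK (k + k)"
  using pi_power_IK[of "x1 * \<iota> x1" "k + k" "k + k"] x1 by simp
 have a: "av (1 + \<pi> ^ k * \<mu>) = av (1 :: 'f)"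
 proof (rule av_add_eq)
  have "\<pi> ^ k * \<mu> : IF 1" by (rule pi_power_IF[OF \<mu>(1) k(1)])
  then show "av (\<pi> ^ k * \<mu>) < av (1 :: 'f)" by (simp only: IF_1_iff av_one)
 qed
 have "EX \<gamma>:U_KF. \<gamma> - (1 + emb \<pi> ^ k * x1) : IK (k + k)"
  by (rule lift_U[OF _ _ _ _ d]) (use k x1 \<mu>(1) a in auto)
 then obtain \<gamma> where \<gamma>: "\<gamma> : U_KF" "\<gamma> - (1 + emb \<pi> ^ k * x1) : IK (k + k)" by blast
 obtain y where y: "y : \<O>" "\<gamma> - (1 + emb \<pi> ^ k * x1) = emb \<pi> ^ (k + k) * y" using IK_decomp[OF \<gamma>(2)] by blast
 define x2 where "x2 = x1 + emb \<pi> ^ k * y"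
 have "\<gamma> = 1 + emb \<pi> ^ k * x2" using y(2) by (simp add: x2_def power_add algebra_simps)
 moreover have x2: "x2 : \<O>" using x1 y(1) by (simp add: x2_def)
 moreover have "R = red 1 (%y. y * x2)"
 proof -
  have "X 1 - x2 = (X 1 + \<iota> (X 1) - emb \<mu>) / 2 - emb \<pi> ^ k * y" by (simp add: x2_def x1_def)
  then have dx: "X 1 - x2 : IK 1" using IK_closed(3)[OF h pi_power_IK[OF y(1) k]] by (simp only:)
  have "cg 1 (%x. x * X 1) (%x. x * x2)"
   unfolding cg_def right_diff_distrib[symmetric] using IK_mult_integers(2)[OF dx] by blast
  from cg_trans[OF cX this] show ?thesis unfolding RX red_eq[OF X(1) lin_closed(7)[OF x2]] .
 qed
 ultimately show ?thesis using \<gamma>(1) by blast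
qed

lemma g_centr_zero: "1_{g_centr \<beta>} = red 1 (%x. 0)" "red 1 (%x. 0) : carrier (g_centr \<beta>)"
proof -
 show "1_{g_centr \<beta>} = red 1 (%x. 0)"
 proof (rule extensionalityI[of _ "carrier (OK_mod 1)"])
  fix C assume C: "C : carrier (OK_mod 1)"
  then obtain x where x: "x : \<O>" "C = cK 1 x" by (auto simp only: carrier_OK_mod)
  show "1_{g_centr \<beta>} C = red 1 (%x. 0) C"
   unfolding x(2) red_apply[OF lin_closed(8) x(1)] using C x(2) by (simp add: g_centr_def OK_mod_zero)
 qed (simp add: g_centr_def, rule red_ext)
 show "red 1 (%x. 0) : carrier (g_centr \<beta>)"
  unfolding g_centr_red[OF lin_closed(8)]
  by (intro conjI bexI[of _ 0] ballI) (simp_all add: S_simps IF_closed(1) IK_closed(1))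
qed

lemma g_centr_add:
 assumes "lin X" "lin Y"
 shows "red 1 X *_{g_centr \<beta>} red 1 Y = red 1 (%x. X x + Y x)"
proof (rule extensionalityI[of _ "carrier (OK_mod 1)"])
 fix C assume C: "C : carrier (OK_mod 1)"
 then obtain x where x: "x : \<O>" "C = cK 1 x" by (auto simp only: carrier_OK_mod)
 have "(red 1 X *_{g_centr \<beta>} red 1 Y) C = red 1 X C +_{OK_mod 1} red 1 Y C"
  using C by (simp add: g_centr_def)
 then show "(red 1 X *_{g_centr \<beta>} red 1 Y) C = red 1 (%x. X x + Y x) C"
  unfolding x(2) red_apply[OF assms(1) x(1)] red_apply[OF assms(2) x(1)] red_apply[OF lin_closed(3)[OF assms] x(1)] OK_mod_add .
qed (simp add: g_centr_def, rule red_ext)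

end

section \<open>The case of odd \<open>r\<close>\<close>

context GO_beta
begin

context
 fixes r k :: nat
 assumes kr: "r = 2 * k + 1" "1 <= k"
begin

lemma odd_l: "l r = k + 1" "l' r = k" "l r - 1 = k" "2 <= r" "1 <= r" "k <= r" "k + 1 <= r" "1 <= k + 1" "r - k = k + 1" "r - (k + 1) = k"
 using kr by (auto simp: l_def l'_def)

abbreviation op :: "('k => 'k) => 'k => 'k" where
 "op A \<equiv> %x. x + emb \<pi> ^ k * A x"

abbreviation comm :: "('k => 'k) => 'k => 'k" where
 "comm A \<equiv> %x. A (x * \<beta>) - A x * \<beta>"

lemma lin_comm: "lin A ==> lin (comm A)"
 by (rule lin_closed(4)[OF lin_closed(2)[OF _ lin_closed(7)[OF \<beta>_int]] lin_closed(5)[OF _ \<beta>_int]])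

lemma scale_pow: "lin A ==> x : \<O> ==> A (emb \<pi> ^ j * x) = emb \<pi> ^ j * A x"
 using linear_onD(3)[of emb \<O> \<O> A "\<pi> ^ j" x] by simp

lemma add_pow: "lin A ==> x : \<O> ==> y : \<O> ==> A (x + emb \<pi> ^ j * y) = A x + emb \<pi> ^ j * A y"
 using linear_onD(2)[of emb \<O> \<O> A x "emb \<pi> ^ j * y"] scale_pow[of A y j] by simp

lemma op_op:
 assumes A: "lin A" and C: "lin C" and x: "x : \<O>"
 shows "op C (op A x) = x + emb \<pi> ^ k * (A x + C x) + emb \<pi> ^ (k + k) * C (A x)"
 using add_pow[OF C x linear_onD(1)[OF A x], of k] by (simp add: algebra_simps power_add)

text \<open>The two products differ by \<open>\<pi>^(k + k)\<close> times the bracket of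
  \<open>C\<close> and \<open>A\<close>, and \<open>k + 1 <= k + k\<close> because \<open>k\<close>
  is positive; so the reductions modulo \<open>\<pi>^(k + 1)\<close> commute.\<close>

lemma commutator_N:
 assumes h: "h : K r k" and g: "g : K r k"
 shows "inv_{G r} g *_{G r} h *_{G r} g *_{G r} inv_{G r} h : K r (k + 1)"
proof -
 define j where "j = k + 1"
 have j: "1 <= j" "j <= r" "j <= k + k" using kr by (auto simp: j_def)
 interpret \<phi>: group_hom "G r" "G j" "red_mod r j" by (rule red_mod_hom[OF j(1,2)])
 obtain A where A: "lin A" "sim r (op A)" "h = red r (op A)" using K_lift[OF kr(2) odd_l(6) h] by blast
 obtain C where C: "lin C" "sim r (op C)" "g = red r (op C)" using K_lift[OF kr(2) odd_l(6) g] by blast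
 have hg: "h : carrier (G r)" "g : carrier (G r)" using h g by (simp_all add: K_def kernel_def)
 note oA = lin_one_plus[OF A(1), of k] and oC = lin_one_plus[OF C(1), of k]
 have "cg j (%x. op C (op A x)) (%x. op A (op C x))"
  unfolding cg_def
 proof
  fix x :: 'k assume x: "x : \<O>"
  have "op C (op A x) - op A (op C x) = emb \<pi> ^ (k + k) * (C (A x) - A (C x))"
   unfolding op_op[OF A(1) C(1) x] op_op[OF C(1) A(1) x] by (simp add: algebra_simps)
  moreover have "C (A x) - A (C x) : \<O>"
   using linear_onD(1)[OF A(1)] linear_onD(1)[OF C(1)] x by simp
  ultimately show "op C (op A x) - op A (op C x) : IK j" using pi_power_IK[OF _ j(3)] by simp
 qed
 then have "red j (%x. op C (op A x)) = red j (%x. op A (op C x))"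
  unfolding red_eq[OF lin_closed(2)[OF oC oA] lin_closed(2)[OF oA oC]] .
 then have "red_mod r j (h *_{G r} g) = red_mod r j (g *_{G r} h)"
  unfolding A(3) C(3) G_mult[OF odd_l(5) oA A(2) oC C(2)] G_mult[OF odd_l(5) oC C(2) oA A(2)]
   red_mod_red[OF lin_closed(2)[OF oC oA] j(2)] red_mod_red[OF lin_closed(2)[OF oA oC] j(2)] .
 then have c: "red_mod r j h *_{G j} red_mod r j g = red_mod r j g *_{G j} red_mod r j h"
  using hg by simp
 define a b where "a = red_mod r j h" and "b = red_mod r j g"
 have ab: "a : carrier (G j)" "b : carrier (G j)" "a *_{G j} b = b *_{G j} a"
  using c hg by (simp_all add: a_def b_def)
 have "red_mod r j (inv_{G r} g *_{G r} h *_{G r} g *_{G r} inv_{G r} h) =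
   inv_{G j} b *_{G j} (a *_{G j} b) *_{G j} inv_{G j} a"
  using hg ab(1,2) by (simp add: a_def[symmetric] b_def[symmetric] \<phi>.H.m_assoc)
 also have "\<dots> = inv_{G j} b *_{G j} b *_{G j} (a *_{G j} inv_{G j} a)"
  unfolding ab(3) using ab(1,2) by (simp only: \<phi>.H.m_assoc \<phi>.H.m_closed \<phi>.H.inv_closed)
 also have "\<dots> = 1_{G j}" using ab(1,2) by simp
 finally show ?thesis unfolding j_def[symmetric] K_def kernel_def using hg by simp
qed

text \<open>The commutator deviates from 1 by \<open>\<pi>^(2 * k)\<close> times a Lie bracket, and
  \<open>2 * k = (k + 1) + (k - 1)\<close>; so \<open>D\<close> is \<open>\<pi>^(k - 1)\<close>
  times the bracket modulo \<open>\<pi>\<^sup>k\<close>, and \<open>ch k\<close> becomes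
  \<open>ch 1\<close>. Cyclicity of the trace then moves the bracket onto
  \<open>\<beta>\<close>.\<close>

lemma psi_commutator:
 assumes A: "lin A" "sim r (op A)" and C: "lin C" "sim r (op C)"
 defines "h \<equiv> red r (op A)" and "g \<equiv> red r (op C)"
 shows "psi r \<beta> (inv_{G r} g *_{G r} h *_{G r} g *_{G r} inv_{G r} h) = ch 1 (tr (%x. C (comm A x)))"
proof -
 interpret group "G r" by (rule group_G[OF odd_l(5)])
 note oA = lin_one_plus[OF A(1), of k] and oC = lin_one_plus[OF C(1), of k]
 have hg: "h : carrier (G r)" "g : carrier (G r)"
  unfolding h_def g_def by (rule red_carrier[OF odd_l(5) oA A(2)], rule red_carrier[OF odd_l(5) oC C(2)])
 have cid: "cg k (op A) (%x. x)" if "lin A" for A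
  unfolding cg_def using linear_onD(1)[OF that] pi_power_IK[OF _ order_refl] by simp
 have hk: "h : K r k" "g : K r k"
  unfolding h_def g_def using K_iff[OF kr(2) odd_l(6) oA A(2)] K_iff[OF kr(2) odd_l(6) oC C(2)] cid A(1) C(1) by blast+
 define z where "z = inv_{G r} g *_{G r} h *_{G r} g *_{G r} inv_{G r} h"
 have zN: "z : K r (k + 1)" unfolding z_def by (rule commutator_N[OF hk])
 obtain D where D: "lin D" "sim r (%x. x + emb \<pi> ^ (k + 1) * D x)" "z = red r (%x. x + emb \<pi> ^ (k + 1) * D x)"
  using K_lift[OF odd_l(8,7) zN] by blast
 note oD = lin_one_plus[OF D(1), of "k + 1"]
 have zc: "z : carrier (G r)" unfolding z_def using hg by simp
 have i: "A x : \<O>" "C x : \<O>" "D x : \<O>" if "x : \<O>" for x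
  using linear_onD(1)[OF A(1) that] linear_onD(1)[OF C(1) that] linear_onD(1)[OF D(1) that] by auto
 have "g *_{G r} (z *_{G r} h) = h *_{G r} g"
 proof -
  have "g *_{G r} (z *_{G r} h) = g *_{G r} inv_{G r} g *_{G r} (h *_{G r} g *_{G r} (inv_{G r} h *_{G r} h))"
   unfolding z_def using hg by (simp only: m_assoc m_closed inv_closed)
  then show ?thesis using hg by simp
 qed
 moreover have zh: "z *_{G r} h = red r (%x. op A (x + emb \<pi> ^ (k + 1) * D x))"
  unfolding D(3) h_def by (rule G_mult[OF odd_l(5) oD D(2) oA A(2)])
 moreover have "g *_{G r} red r (%x. op A (x + emb \<pi> ^ (k + 1) * D x)) =
   red r (%x. op A (op C x + emb \<pi> ^ (k + 1) * D (op C x)))"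
  unfolding g_def
  by (rule G_mult[OF odd_l(5) oC C(2) lin_closed(2)[OF oA oD] sim_comp[OF oD D(2) oA A(2)]])
 moreover have "h *_{G r} g = red r (%x. op C (op A x))"
  unfolding h_def g_def by (rule G_mult[OF odd_l(5) oA A(2) oC C(2)])
 ultimately have "red r (%x. op A (op C x + emb \<pi> ^ (k + 1) * D (op C x))) = red r (%x. op C (op A x))" by simp
 then have c: "cg r (%x. op A (op C x + emb \<pi> ^ (k + 1) * D (op C x))) (%x. op C (op A x))"
  unfolding red_eq[OF lin_closed(2)[OF lin_closed(2)[OF oA oD] oC] lin_closed(2)[OF oC oA]] .
 have Dc: "D x - emb \<pi> ^ (k - 1) * (C (A x) - A (C x)) : IK k" if x: "x : \<O>" for x
 proof -
  define u where "u = D (C x) + A (D (op C x))"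
  have oCx: "op C x : \<O>" by (rule linear_onD(1)[OF oC x])
  have u: "u : \<O>" unfolding u_def using i oCx x by simp
  \<comment> \<open>Here \<open>T\<close>, \<open>s\<close>, \<open>t\<close> stand for
    \<open>\<pi>^(k + 1)\<close>, \<open>\<pi>^(k - 1)\<close>, \<open>\<pi>\<^sup>k\<close>: the
    leading terms are isolated and the rest is collected behind \<open>T * t\<close>, which is
    \<open>\<pi>\<^sup>r\<close>.\<close>
  have alg: "Q + T * (d + t * a) - R = T * (d' - s * (c - c')) + T * t * (d'' + a)"
   if "Q - R = T * s * (c' - c)" "d = d' + t * d''" for Q R T s t c c' d d' d'' a :: 'k
  proof -
   have "Q = R + T * s * (c' - c)" using that(1) by (simp add: algebra_simps)
   then show ?thesis unfolding that(2) by (simp add: algebra_simps)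
  qed
  have "k + k = (k + 1) + (k - 1)" "r = (k + 1) + k" using kr by auto
  then have p: "emb \<pi> ^ (k + k) = emb \<pi> ^ (k + 1) * emb \<pi> ^ (k - 1)" "emb \<pi> ^ r = emb \<pi> ^ (k + 1) * emb \<pi> ^ k"
   by (metis power_add)+
  have "op A (op C x) - op C (op A x) = emb \<pi> ^ (k + 1) * emb \<pi> ^ (k - 1) * (A (C x) - C (A x))"
   unfolding op_op[OF A(1) C(1) x] op_op[OF C(1) A(1) x] p(1) right_diff_distrib by (simp add: add.commute)
  from alg[OF this add_pow[OF D(1) x i(2)[OF x]]]
  have e: "op A (op C x + emb \<pi> ^ (k + 1) * D (op C x)) - op C (op A x) =
    emb \<pi> ^ (k + 1) * (D x - emb \<pi> ^ (k - 1) * (C (A x) - A (C x))) + emb \<pi> ^ r * u"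
   unfolding p(2) u_def add_pow[OF oA oCx i(3)[OF oCx]] .
  have "(op A (op C x + emb \<pi> ^ (k + 1) * D (op C x)) - op C (op A x)) - emb \<pi> ^ r * u : IK r"
   by (rule IK_closed(3)[OF cgD[OF c x] pi_power_IK[OF u order_refl]])
  then have "emb \<pi> ^ (k + 1) * (D x - emb \<pi> ^ (k - 1) * (C (A x) - A (C x))) : IK r"
   unfolding e add_diff_cancel_right' .
  from IK_cancel[OF this odd_l(7)] show ?thesis by (simp only: odd_l(10))
 qed
 have "tr (%x. D x * \<beta>) - tr (%x. emb (\<pi> ^ (k - 1)) * ((C (A x) - A (C x)) * \<beta>)) : IF k"
 proof (rule tr_cong_IF)
  fix x :: 'k assume "x : \<O>"
  from IK_mult_integers(1)[OF Dc[OF this] \<beta>_int]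
  show "D x * \<beta> - emb (\<pi> ^ (k - 1)) * ((C (A x) - A (C x)) * \<beta>) : IK k" by (simp add: left_diff_distrib mult.assoc)
 qed
 then have "ch k (tr (%x. D x * \<beta>)) = ch k (tr (%x. emb (\<pi> ^ (k - 1)) * ((C (A x) - A (C x)) * \<beta>)))" by (rule ch_cong)
 also have "\<dots> = ch 1 (tr (%x. (C (A x) - A (C x)) * \<beta>))"
  unfolding tr_simps(4) using ch_shift[of "k - 1" k] kr(2) by simp
 also have "tr (%x. (C (A x) - A (C x)) * \<beta>) = tr (%x. C (comm A x))"
 proof -
  have lb: "lin (%x. x * \<beta>)" by (rule lin_closed(7)[OF \<beta>_int])
  have "tr (%x. C (A x) * \<beta>) = tr (%x. C (A (x * \<beta>)))" by (rule tr_commute[OF lb lin_closed(2)[OF C(1) A(1)]])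
  moreover have "tr (%x. A (C x) * \<beta>) = tr (%x. C (A x * \<beta>))"
   by (rule tr_commute[OF lin_closed(5)[OF A(1) \<beta>_int] C(1)])
  moreover have "tr (%x. C (comm A x)) = tr (%x. C (A (x * \<beta>))) - tr (%x. C (A x * \<beta>))"
   unfolding tr_simps(3)[symmetric] using i by (intro tr_cong lin_diff[OF C(1)]) simp_all
  ultimately show ?thesis by (simp only: left_diff_distrib tr_simps(3))
 qed
 finally have "ch k (tr (%x. D x * \<beta>)) = ch 1 (tr (%x. C (comm A x)))" .
 moreover have "psi r \<beta> z = ch k (tr (%x. D x * \<beta>))"
  unfolding D(3) using psi_eq[OF odd_l(4) D(1)] D(2) odd_l(1,2) by simp
 ultimately show ?thesis by (simp only: z_def)
qed

lemma K_go:
 assumes A: "lin A" "sim r (op A)"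
 shows "EX X \<mu>. lin X & \<mu> : \<O> &
  (ALL x:\<O>. ALL y:\<O>. S (X x) y + S x (X y) = \<mu> * S x y) & cg k A X"
 using go_lift[OF kr(2) order_refl _ A] kr(1) by simp

text \<open>The Lie algebra relation over the residue field comes from \<open>K_go\<close>, as
  congruence modulo \<open>\<pi>\<^sup>k\<close> implies congruence modulo
  \<open>\<pi>\<close>.\<close>

lemma Z_imp_g_centr:
 assumes A: "lin A" "sim r (op A)" and c: "ALL x:\<O>. comm A x : IK 1"
 shows "red 1 A : carrier (g_centr \<beta>)"
 unfolding g_centr_red[OF A(1)]
proof -
 obtain Y \<mu> where Y: "\<mu> : \<O>" "ALL x:\<O>. ALL y:\<O>. S (Y x) y + S x (Y y) = \<mu> * S x y" "cg k A Y"
  using K_go[OF A] by blast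
 have cAY: "A x - Y x : IK 1" if "x : \<O>" for x using cgD[OF cg_mono[OF kr(2) Y(3)] that] .
 show "(EX \<mu>:\<O>. ALL x:\<O>. ALL y:\<O>. S (A x) y + S x (A y) - \<mu> * S x y : IF 1) &
  (ALL x:\<O>. comm A x : IK 1)"
 proof (intro conjI c bexI[of _ \<mu>] ballI Y(1))
  fix x y :: 'k assume xy: "x : \<O>" "y : \<O>"
  have z: "\<mu> * S x y = S (Y x) y + S x (Y y)" using Y(2) xy by simp
  have "S (A x) y + S x (A y) - \<mu> * S x y = S (A x - Y x) y + S x (A y - Y y)"
   unfolding z S_simps(3,4) by simp
  then show "S (A x) y + S x (A y) - \<mu> * S x y : IF 1"
   using IF_closed(2)[OF S_IF(1)[OF cAY[OF xy(1)] xy(2)] S_IF(2)[OF xy(1) cAY[OF xy(2)]]] by (simp only:)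
 qed
qed

text \<open>Puts \<open>Z\<close> into the form in which \<open>psi_commutator\<close> sees it: the
  vanishing of \<open>comm A\<close> modulo \<open>\<pi>\<close> makes the pairing with every
  \<open>C\<close> trivial.\<close>

lemma Z_iff:
 assumes A: "lin A" "sim r (op A)"
 shows "red r (op A) : Z r \<beta> \<longleftrightarrow> (ALL x:\<O>. comm A x : IK 1)"
proof
 have cid: "cg k (op A) (%x. x)"
  unfolding cg_def using linear_onD(1)[OF A(1)] pi_power_IK[OF _ order_refl] by simp
 note oA = lin_one_plus[OF A(1), of k]
 have hk: "red r (op A) : K r k" using K_iff[OF kr(2) odd_l(6) oA A(2)] cid by blast
 show "ALL x:\<O>. comm A x : IK 1" if hZ: "red r (op A) : Z r \<beta>"
 proof
  fix x :: 'k assume x: "x : \<O>"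
  obtain X where X: "X : endos OF OK" "red r (op A) = red r (one_plus k X)" "red 1 X : carrier (g_centr \<beta>)"
   using hZ unfolding Z_def odd_l(3) by blast
  have lX: "lin X" using X(1) by (simp only: endos_iff)
  have "cg (k + 1) A X"
   using X(2) unfolding red_one_plus red_eq[OF oA lin_one_plus[OF lX]] cg_one_plus[OF odd_l(6)] odd_l(9) .
  then have c: "cg 1 A X" by (rule cg_mono[OF odd_l(8)])
  have "X (x * \<beta>) - X x * \<beta> : IK 1" using X(3) x unfolding g_centr_red[OF lX] by blast
  moreover have "A (x * \<beta>) - X (x * \<beta>) : IK 1" using x by (intro cgD[OF c]) simp
  ultimately have "(A (x * \<beta>) - X (x * \<beta>)) + (X (x * \<beta>) - X x * \<beta>) : IK 1" by (intro IK_closed(2))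
  from IK_closed(3)[OF this IK_mult_integers(1)[OF cgD[OF c x] \<beta>_int]]
  show "comm A x : IK 1" by (simp add: left_diff_distrib)
 qed
 assume c: "ALL x:\<O>. comm A x : IK 1"
 define X where "X = restrict A \<O>"
 have lX: "lin X" unfolding X_def by (rule lin_cong[OF A(1)]) simp
 have "red 1 A : carrier (g_centr \<beta>)" by (rule Z_imp_g_centr[OF A c])
 moreover have "red 1 X = red 1 A" by (rule red_cong) (simp add: X_def)
 moreover have "red r (op A) = red r (one_plus k X)" by (rule red_cong) (simp add: X_def one_plus_def)
 moreover have "X : endos OF OK" using lX by (simp add: endos_iff X_def)
 ultimately show "red r (op A) : Z r \<beta>" unfolding Z_def odd_l(3) using hk by auto
qed

lemma Z_K: "z : Z r \<beta> ==> z : K r k"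
 by (simp only: Z_def odd_l(3) mem_Collect_eq)

lemma comm_trace_trivial:
 assumes h: "h : Z r \<beta>" and g: "g : K r k"
 shows "psi r \<beta> (inv_{G r} g *_{G r} h *_{G r} g *_{G r} inv_{G r} h) = 1"
proof -
 obtain A where A: "lin A" "sim r (op A)" "h = red r (op A)" using K_lift[OF kr(2) odd_l(6) Z_K[OF h]] by blast
 obtain C where C: "lin C" "sim r (op C)" "g = red r (op C)" using K_lift[OF kr(2) odd_l(6) g] by blast
 have "ALL x:\<O>. comm A x : IK 1" using h unfolding A(3) Z_iff[OF A(1,2)] .
 then have "tr (%x. C (comm A x)) : IF 1" using lin_IK[OF C(1)] by (intro tr_IF) blast
 then show ?thesis unfolding A(3) C(3) psi_commutator[OF A(1,2) C(1,2)] by (rule ch_IF)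
qed

lemma S_half: "S (u / 2) v = S u v / 2" "S v (u / 2) = S v u / 2"
proof -
 have e: "u / 2 = emb (inverse 2) * u" by (simp only: emb_inverse emb_simps divide_inverse mult.commute)
 show "S (u / 2) v = S u v / 2" "S v (u / 2) = S v u / 2"
  unfolding e S_simps by (simp_all only: divide_inverse mult.commute)
qed

text \<open>Skew \<open>Y\<close> lift to the group through the second-order exponential \<open>1 + tY + t\<^sup>2Y\<^sup>2/2\<close>, \<open>t = \<pi>\<^sup>k\<close>.\<close>

lemma sim_exp:
 assumes Y: "lin Y" and skew: "!!x y. x : \<O> ==> y : \<O> ==> S (Y x) y + S x (Y y) = 0"
 shows "sim r (op (%x. Y x + emb \<pi> ^ k * (Y (Y x) / 2)))"
 unfolding sim_def
proof (intro bexI[of _ 1] conjI ballI)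
 fix x y :: 'k assume xy: "x : \<O>" "y : \<O>"
 have i: "Y x : \<O>" if "x : \<O>" for x by (rule linear_onD(1)[OF Y that])
 define t :: 'f where "t = \<pi> ^ k"
 have sk: "S (Y a) b = - S a (Y b)" if "a : \<O>" "b : \<O>" for a b
  using skew[OF that] by (simp add: eq_neg_iff_add_eq_0)
 define a b where "a = Y (Y x) / 2" and "b = Y (Y y) / 2"
 \<comment> \<open>The coefficients of \<open>t\<^sup>2\<close> and \<open>t\<^sup>3\<close>. Both
   cancel by skewness, and the term in \<open>t^4\<close> is zero modulo
   \<open>\<pi>\<^sup>r\<close> since \<open>4 * k >= 2 * k + 1\<close>.\<close>
 define P2 where "P2 = S (Y x) (Y y) + S a y + S x b"
 define P3 where "P3 = S (Y x) b + S a (Y y)"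
 have "P2 = S (Y x) (Y y) - S (Y x) (Y y) / 2 - S (Y x) (Y y) / 2"
  unfolding P2_def a_def b_def S_half using sk[of "Y x" y] sk[of x "Y y"] i xy by simp
 also have "\<dots> = 0" by (simp add: field_simps)
 finally have "P2 = 0" .
 moreover have "P3 = 0" unfolding P3_def a_def b_def S_half using sk[of "Y x" "Y y"] i xy by simp
 moreover have "S (op (%x. Y x + emb \<pi> ^ k * (Y (Y x) / 2)) x) (op (%x. Y x + emb \<pi> ^ k * (Y (Y x) / 2)) y) - 1 * S x y =
   t * (S (Y x) y + S x (Y y)) + t * t * P2 + t * t * t * P3 + t * t * t * t * S a b"
  unfolding emb_simps(7)[symmetric] t_def[symmetric] a_def[symmetric] b_def[symmetric] S_simps P2_def P3_def
  by (simp add: algebra_simps)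
 ultimately have "S (op (%x. Y x + emb \<pi> ^ k * (Y (Y x) / 2)) x) (op (%x. Y x + emb \<pi> ^ k * (Y (Y x) / 2)) y) - 1 * S x y =
   \<pi> ^ (k + k + k + k) * S a b"
  using skew[OF xy] by (simp add: t_def power_add)
 moreover have "\<pi> ^ (k + k + k + k) * S a b : IF r"
  unfolding a_def b_def using i xy kr by (intro pi_power_IF S_integers half_integers) simp_all
 ultimately show "S (op (%x. Y x + emb \<pi> ^ k * (Y (Y x) / 2)) x) (op (%x. Y x + emb \<pi> ^ k * (Y (Y x) / 2)) y) - 1 * S x y : IF r"
  by (simp only:)
qed simp_all

text \<open>Modulo \<open>\<pi>\<^sup>k\<close> the map \<open>A\<close> lies in the Lie algebra
  with multiplier \<open>\<mu>\<close>; bracketing with the skew \<open>\<beta>\<close> removes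
  \<open>\<mu>\<close>, so \<open>comm A\<close> is skew. \<open>skew_detect\<close> at level 1
  gives \<open>Y\<close>, and \<open>sim_exp\<close> lifts it to an element of
  \<open>K r k\<close>.\<close>

lemma commutator_nondegenerate:
 assumes h: "h : K r k" "h \<notin> Z r \<beta>"
 shows "EX g:K r k. psi r \<beta> (inv_{G r} g *_{G r} h *_{G r} g *_{G r} inv_{G r} h) ~= 1"
proof -
 obtain A where A: "lin A" "sim r (op A)" "h = red r (op A)" using K_lift[OF kr(2) odd_l(6) h(1)] by blast
 obtain x0 where x0: "x0 : \<O>" "comm A x0 \<notin> IK 1" using h(2) unfolding A(3) Z_iff[OF A(1,2)] by blast
 obtain X \<mu> where X: "lin X" "ALL x:\<O>. ALL y:\<O>. S (X x) y + S x (X y) = \<mu> * S x y" "cg k A X"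
  using K_go[OF A(1,2)] by blast
 have skew: "S (comm A x) y + S x (comm A y) : IF k" if xy: "x : \<O>" "y : \<O>" for x y
 proof -
  have d: "comm A x - comm X x : IK k" if "x : \<O>" for x
  proof -
   have "x * \<beta> : \<O>" using that by simp
   from IK_closed(3)[OF cgD[OF X(3) this] IK_mult_integers(1)[OF cgD[OF X(3) that] \<beta>_int]]
   show ?thesis by (simp add: algebra_simps)
  qed
  have "S (X (x * \<beta>)) y + S (x * \<beta>) (X y) = \<mu> * S (x * \<beta>) y" "S (X x) (y * \<beta>) + S x (X (y * \<beta>)) = \<mu> * S x (y * \<beta>)"
   using X(2) xy by auto
  then have e: "S (X (x * \<beta>)) y + - S x (X y * \<beta>) = - (\<mu> * S x (y * \<beta>))" "S (X x) (y * \<beta>) + S x (X (y * \<beta>)) = \<mu> * S x (y * \<beta>)"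
   unfolding S_beta by simp_all
  have "S (X (x * \<beta>)) y - S x (X y * \<beta>) + (S (X x) (y * \<beta>) + S x (X (y * \<beta>))) = 0"
   unfolding e(2) using e(1) by simp
  then have z: "S (comm X x) y + S x (comm X y) = 0" unfolding S_simps S_beta by (simp add: algebra_simps)
  have "S (comm A x) y + S x (comm A y) = S (comm A x - comm X x) y + S x (comm A y - comm X y) + (S (comm X x) y + S x (comm X y))"
   by (simp only: S_simps(3,4)) simp
  then show ?thesis
   unfolding z using IF_closed(2)[OF S_IF(1)[OF d[OF xy(1)] xy(2)] S_IF(2)[OF xy(1) d[OF xy(2)]]] by (simp only: add_0_right)
 qed
 obtain Y where Y: "lin Y" "!!x y. x : \<O> ==> y : \<O> ==> S (Y x) y + S x (Y y) = 0"
  "ch 1 (tr (%x. comm A (Y x))) ~= 1"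
  using skew_detect[OF lin_comm[OF A(1)] skew kr(2) x0] by blast
 \<comment> \<open>The quadratic correction makes \<open>op C\<close> a similitude and is divisible
   by \<open>\<pi>\<close>, so it does not affect the pairing at level 1.\<close>
 define C where "C x = Y x + emb \<pi> ^ k * (Y (Y x) / 2)" for x
 have lYY: "lin (%x. Y (Y x) / 2)" by (rule lin_half[OF lin_closed(2)[OF Y(1) Y(1)]])
 have C: "lin C" unfolding C_def by (intro lin_closed(3)[OF Y(1)] lin_closed(6)[OF lYY]) auto
 have sC: "sim r (op C)" unfolding C_def by (rule sim_exp[OF Y(1,2)])
 have cid: "cg k (op C) (%x. x)"
  unfolding cg_def using linear_onD(1)[OF C] pi_power_IK[OF _ order_refl] by simp
 have gk: "red r (op C) : K r k" using K_iff[OF kr(2) odd_l(6) lin_one_plus[OF C] sC] cid by blast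
 have "tr (%x. C (comm A x)) - tr (%x. Y (comm A x)) : IF 1"
 proof (rule tr_cong_IF)
  fix x :: 'k assume "x : \<O>"
  from pi_power_IK[OF linear_onD(1)[OF lYY linear_onD(1)[OF lin_comm[OF A(1)] this]] kr(2)]
  show "C (comm A x) - Y (comm A x) : IK 1" by (simp only: C_def add_diff_cancel_left')
 qed
 then have "ch 1 (tr (%x. C (comm A x))) = ch 1 (tr (%x. Y (comm A x)))" by (rule ch_cong)
 also have "tr (%x. Y (comm A x)) = tr (%x. comm A (Y x))" by (rule tr_commute[OF Y(1) lin_comm[OF A(1)]])
 finally have "psi r \<beta> (inv_{G r} (red r (op C)) *_{G r} h *_{G r} red r (op C) *_{G r} inv_{G r} h) ~= 1"
  unfolding A(3) psi_commutator[OF A(1,2) C sC] using Y(3) by simp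
 then show ?thesis using gk by blast
qed

lemma op_mul: "op (%y. y * x) = (%y. y * (1 + emb \<pi> ^ k * x))"
 by (simp add: fun_eq_iff algebra_simps)

lemma centr_H_iff: "c : G_centr r \<beta> \<inter> K r k \<longleftrightarrow>
  (EX x:\<O>. 1 + emb \<pi> ^ k * x : U_KF & c = red r (op (%y. y * x)))"
proof
 assume c: "c : G_centr r \<beta> \<inter> K r k"
 then obtain \<gamma> where \<gamma>: "\<gamma> : U_KF" "c = red r (%x. x * \<gamma>)" using G_centr_iff[OF odd_l(5)] by blast
 have "\<gamma> - 1 : IK k" using c G_centr_K[OF kr(2) odd_l(6) \<gamma>(1)] \<gamma>(2) by blast
 then obtain x where x: "x : \<O>" "\<gamma> - 1 = emb \<pi> ^ k * x" using IK_decomp by blast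
 then have "\<gamma> = 1 + emb \<pi> ^ k * x" by (simp add: algebra_simps)
 then show "EX x:\<O>. 1 + emb \<pi> ^ k * x : U_KF & c = red r (op (%y. y * x))"
  unfolding op_mul using x(1) \<gamma> by blast
next
 assume "EX x:\<O>. 1 + emb \<pi> ^ k * x : U_KF & c = red r (op (%y. y * x))"
 then obtain x where x: "x : \<O>" "1 + emb \<pi> ^ k * x : U_KF" "c = red r (%y. y * (1 + emb \<pi> ^ k * x))"
  unfolding op_mul by blast
 have "(1 + emb \<pi> ^ k * x) - 1 : IK k" using pi_power_IK[OF x(1) order_refl] by simp
 then have "c : K r k" unfolding x(3) using G_centr_K[OF kr(2) odd_l(6) x(2)] by blast
 then show "c : G_centr r \<beta> \<inter> K r k" using G_centr_iff[OF odd_l(5)] x(2,3) by blast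
qed

lemma centr_H_Z: "G_centr r \<beta> \<inter> K r k \<subseteq> Z r \<beta>"
proof
 fix c assume "c : G_centr r \<beta> \<inter> K r k"
 then obtain x where x: "x : \<O>" "1 + emb \<pi> ^ k * x : U_KF" "c = red r (op (%y. y * x))"
  unfolding centr_H_iff by blast
 have s: "sim r (op (%y. y * x))" unfolding op_mul by (rule sim_mul[OF x(2)])
 show "c : Z r \<beta>" unfolding x(3) Z_iff[OF lin_closed(7)[OF x(1)] s] by (simp add: IK_closed(1) mult.assoc mult.commute)
qed

lemma Z_lift:
 assumes z: "z : Z r \<beta>"
 shows "EX A. lin A & sim r (op A) & z = red r (op A) & red 1 A : carrier (g_centr \<beta>)"
proof -
 obtain A where A: "lin A" "sim r (op A)" "z = red r (op A)" using K_lift[OF kr(2) odd_l(6) Z_K[OF z]] by blast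
 have "red 1 A : carrier (g_centr \<beta>)" using z Z_imp_g_centr[OF A(1,2)] unfolding A(3) Z_iff[OF A(1,2)] by blast
 with A show ?thesis by (intro exI[of _ A] conjI)
qed

lemma cg_op: "red 1 A = red 1 C ==> lin A ==> lin C ==> cg (k + 1) (op A) (op C)"
 using cg_one_plus[of k "k + 1" A C] red_eq[of A C 1] by simp

text \<open>The residual class of \<open>A\<close> lifts to \<open>C \<inter> H\<close> by
  \<open>g_centr_lift\<close>; dividing by the lift leaves an element congruent to 1 modulo
  \<open>\<pi>^(k + 1)\<close>.\<close>

lemma Z_decomp:
 assumes z: "z : Z r \<beta>"
 shows "EX c:G_centr r \<beta> \<inter> K r k. EX w:K r (k + 1). z = c *_{G r} w"
proof -
 interpret group "G r" by (rule group_G[OF odd_l(5)])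
 obtain A where A: "lin A" "sim r (op A)" "z = red r (op A)" "red 1 A : carrier (g_centr \<beta>)"
  using Z_lift[OF z] by blast
 obtain x where x: "x : \<O>" "1 + emb \<pi> ^ k * x : U_KF" "red 1 A = red 1 (%y. y * x)"
  using g_centr_lift[OF kr(2) A(4)] by blast
 define c where "c = red r (op (%y. y * x))"
 have s: "sim r (op (%y. y * x))" unfolding op_mul by (rule sim_mul[OF x(2)])
 note lx = lin_closed(7)[OF x(1)]
 have c: "c : G_centr r \<beta> \<inter> K r k" unfolding c_def centr_H_iff using x(1,2) by blast
 have w: "inv_{G r} c *_{G r} z : K r (k + 1)"
  unfolding c_def A(3)
  by (rule K_quotient[OF odd_l(8,7) lin_one_plus[OF A(1)] A(2) lin_one_plus[OF lx] s cg_op[OF x(3) A(1) lx]])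
 have "c : carrier (G r)" "z : carrier (G r)" using c Z_K[OF z] by (simp_all add: K_def kernel_def)
 then have "z = c *_{G r} (inv_{G r} c *_{G r} z)" by (simp add: m_assoc[symmetric])
 then show ?thesis using c w by blast
qed

lemma N_Z: "K r (k + 1) \<subseteq> Z r \<beta>"
proof
 fix z assume z: "z : K r (k + 1)"
 obtain D where D: "lin D" "sim r (%x. x + emb \<pi> ^ (k + 1) * D x)" "z = red r (%x. x + emb \<pi> ^ (k + 1) * D x)"
  using K_lift[OF odd_l(8,7) z] by blast
 define A where "A x = emb \<pi> * D x" for x
 have A: "lin A" unfolding A_def by (rule lin_closed(6)[OF D(1)]) simp
 have e: "op A = (%x. x + emb \<pi> ^ (k + 1) * D x)" by (simp add: A_def fun_eq_iff)
 have s: "sim r (op A)" unfolding e by (rule D(2))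
 have Ai: "A x : IK 1" if "x : \<O>" for x
  using pi_power_IK[OF linear_onD(1)[OF D(1) that] order_refl, of 1] by (simp add: A_def)
 have "red r (op A) : Z r \<beta>"
  unfolding Z_iff[OF A s] using Ai \<beta>_int by (intro ballI IK_closed(3) IK_mult_integers(1)) simp_all
 then show "z : Z r \<beta>" unfolding e D(3) .
qed

text \<open>A product of a subgroup with a normal subgroup, which is how \<open>Z\<close> is seen to
  be a subgroup.\<close>

lemma Z_eq: "Z r \<beta> = {c *_{G r} w | c w. c : G_centr r \<beta> \<inter> K r k & w : K r (k + 1)}"
proof (intro equalityI subsetI)
 fix z assume "z : Z r \<beta>"
 then show "z : {c *_{G r} w | c w. c : G_centr r \<beta> \<inter> K r k & w : K r (k + 1)}" using Z_decomp by blast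
next
 fix z assume "z : {c *_{G r} w | c w. c : G_centr r \<beta> \<inter> K r k & w : K r (k + 1)}"
 then obtain c w where z: "z = c *_{G r} w" "c : G_centr r \<beta> \<inter> K r k" "w : K r (k + 1)" by blast
 obtain x where x: "x : \<O>" "1 + emb \<pi> ^ k * x : U_KF" "c = red r (op (%y. y * x))"
  using z(2) unfolding centr_H_iff by blast
 have s: "sim r (op (%y. y * x))" unfolding op_mul by (rule sim_mul[OF x(2)])
 note lx = lin_closed(7)[OF x(1)]
 note ox = lin_one_plus[OF lx, of k]
 have "w : carrier (G r)" using z(3) by (simp add: K_def kernel_def)
 then obtain Y where Y: "lin Y" "sim r Y" "w = red r Y" unfolding carrier_G[OF odd_l(5)] by blast
 have cY: "cg (k + 1) Y (%x. x)" using z(3) K_iff[OF odd_l(8,7) Y(1,2)] Y(3) by blast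
 have ze: "z = red r (%y. Y (op (%y. y * x) y))" unfolding z(1) x(3) Y(3) by (rule G_mult[OF odd_l(5) ox s Y(1,2)])
 note lz = lin_closed(2)[OF Y(1) ox] and sz = sim_comp[OF ox s Y(1,2)]
 have cz: "cg (k + 1) (%y. Y (op (%y. y * x) y)) (op (%y. y * x))"
  unfolding cg_def by (intro ballI cgD[OF cY] linear_onD(1)[OF ox])
 have c0: "cg k (op (%y. y * x)) (%y. y)"
  unfolding cg_def using x(1) pi_power_IK[OF _ order_refl] by simp
 have "z : K r k" unfolding ze by (rule iffD2[OF K_iff[OF kr(2) odd_l(6) lz sz] cg_trans[OF cg_mono[OF le_add1 cz] c0]])
 then obtain A where A: "lin A" "sim r (op A)" "z = red r (op A)" using K_lift[OF kr(2) odd_l(6)] by blast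
 have "cg r (op A) (%y. Y (op (%y. y * x) y))"
  by (rule iffD1[OF red_eq[OF lin_one_plus[OF A(1)] lz] trans[OF A(3)[symmetric] ze]])
 from cg_trans[OF cg_mono[OF odd_l(7) this] cz] have "cg (k + 1 - k) A (%y. y * x)"
  by (rule iffD1[OF cg_one_plus[OF le_add1]])
 then have c1: "cg 1 A (%y. y * x)" by (simp only: add_diff_cancel_left')
 have "comm A y : IK 1" if y: "y : \<O>" for y
 proof -
  have "y * \<beta> : \<O>" using y by simp
  from IK_closed(3)[OF cgD[OF c1 this] IK_mult_integers(1)[OF cgD[OF c1 y] \<beta>_int]]
  show ?thesis by (simp add: algebra_simps)
 qed
 then show "z : Z r \<beta>" unfolding A(3) Z_iff[OF A(1,2)] by blast
qed

lemma Z_subgroup: "subgroup (Z r \<beta>) (G r)"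
proof -
 interpret group "G r" by (rule group_G[OF odd_l(5)])
 show ?thesis
  unfolding Z_eq
  by (rule subgroup_mult_normal[OF subgroups_Inter_pair[OF G_centr_subgroup[OF odd_l(5)]
     normal_imp_subgroup[OF K_normal[OF kr(2) odd_l(6)]]] K_normal[OF odd_l(8,7)]])
qed

section \<open>Extensions of the character to Z\<close>

definition gauss :: "('k => 'k) => complex" where
 "gauss A = \<tau> (inverse \<pi> ^ (k + 1) * tr (%x. A x * \<beta>) - inverse (2 * \<pi>) * tr (%x. A (A x) * \<beta>))"

text \<open>\<open>gauss\<close> is the factor free of \<open>\<rho>\<close>. Two choices of
  \<open>X\<close> for the same element agree modulo \<open>\<pi>^(k + 1)\<close>; this changes the
  linear term by an element of \<open>O\<close> and the quadratic one by
  \<open>\<pi> / (2 * \<pi>)\<close> times such an element, both invisible to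
  \<open>\<tau>\<close>.\<close>

lemma psi_Z_eq:
 assumes A: "lin A"
 shows "psi_Z r \<beta> \<rho> (red r (op A)) = gauss A * \<rho> (red 1 A)"
proof -
 let ?P = "%X. X : endos OF OK & red r (op A) = red r (one_plus (l r - 1) X)"
 have "restrict A \<O> : endos OF OK"
  unfolding endos_iff using lin_cong[OF A, of "restrict A \<O>"] by simp
 moreover have "red r (op A) = red r (one_plus (l r - 1) (restrict A \<O>))"
  unfolding odd_l(3) by (rule red_cong) (simp add: one_plus_def)
 ultimately have ex: "?P (restrict A \<O>)" by (rule conjI)
 define Y where "Y = (SOME X. ?P X)"
 have Y: "?P Y" unfolding Y_def by (rule someI[of ?P, OF ex])
 then have lY: "lin Y" by (simp only: endos_iff)
 have c: "cg (k + 1) A Y"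
  using conjunct2[OF Y] unfolding odd_l(3) red_one_plus red_eq[OF lin_one_plus[OF A] lin_one_plus[OF lY]]
   cg_one_plus[OF odd_l(6)] odd_l(9) .
 have c1: "cg 1 A Y" by (rule cg_mono[OF odd_l(8) c])
 have B2: "B (compose \<O> Y Y) (mul_by \<beta>) = tr (%x. Y (Y x) * \<beta>)"
 proof -
  have "lin (compose \<O> Y Y)" by (rule lin_cong[OF lin_closed(2)[OF lY lY]]) (simp add: compose_def)
  then have "B (compose \<O> Y Y) (mul_by \<beta>) = tr (%x. compose \<O> Y Y x * \<beta>)" by (rule B_mul_by) simp
  also have "\<dots> = tr (%x. Y (Y x) * \<beta>)" by (rule tr_cong) (simp add: compose_def)
  finally show ?thesis .
 qed
 have d1: "tr (%x. A x * \<beta>) - tr (%x. Y x * \<beta>) : IF (k + 1)"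
 proof (rule tr_cong_IF)
  fix x :: 'k assume "x : \<O>"
  from IK_mult_integers(1)[OF cgD[OF c this] \<beta>_int]
  show "A x * \<beta> - Y x * \<beta> : IK (k + 1)" by (simp only: left_diff_distrib)
 qed
 have d2: "tr (%x. A (A x) * \<beta>) - tr (%x. Y (Y x) * \<beta>) : IF 1"
 proof (rule tr_cong_IF)
  fix x :: 'k assume x: "x : \<O>"
  have i: "A x : \<O>" "Y x : \<O>" using linear_onD(1)[OF A x] linear_onD(1)[OF lY x] .
  have "A (A x - Y x) : IK 1" by (rule lin_IK[OF A cgD[OF c1 x]])
  from IK_closed(2)[OF this cgD[OF c1 i(2)]] have "A (A x) - Y (Y x) : IK 1" using lin_diff[OF A i] by simp
  from IK_mult_integers(1)[OF this \<beta>_int] show "A (A x) * \<beta> - Y (Y x) * \<beta> : IK 1" by (simp only: left_diff_distrib)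
 qed
 obtain u v where u: "u : \<O>" "tr (%x. A x * \<beta>) - tr (%x. Y x * \<beta>) = \<pi> ^ (k + 1) * u"
  and v: "v : \<O>" "tr (%x. A (A x) * \<beta>) - tr (%x. Y (Y x) * \<beta>) = \<pi> ^ 1 * v"
  using IF_decomp[OF d1] IF_decomp[OF d2] by blast
 have "gauss A = \<tau> (inverse \<pi> ^ (k + 1) * tr (%x. Y x * \<beta>) - inverse (2 * \<pi>) * tr (%x. Y (Y x) * \<beta>))"
  unfolding gauss_def
 proof (rule \<tau>_cong)
  have "(inverse \<pi> ^ (k + 1) * tr (%x. A x * \<beta>) - inverse (2 * \<pi>) * tr (%x. A (A x) * \<beta>)) -
    (inverse \<pi> ^ (k + 1) * tr (%x. Y x * \<beta>) - inverse (2 * \<pi>) * tr (%x. Y (Y x) * \<beta>)) =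
    inverse \<pi> ^ (k + 1) * (tr (%x. A x * \<beta>) - tr (%x. Y x * \<beta>)) -
    inverse (2 * \<pi>) * (tr (%x. A (A x) * \<beta>) - tr (%x. Y (Y x) * \<beta>))" by (simp only: algebra_simps)
  also have "inverse \<pi> ^ (k + 1) * (tr (%x. A x * \<beta>) - tr (%x. Y x * \<beta>)) = u"
   unfolding u(2) mult.assoc[symmetric] power_mult_distrib[symmetric] by simp
  also have "inverse (2 * \<pi>) * (tr (%x. A (A x) * \<beta>) - tr (%x. Y (Y x) * \<beta>)) = v / 2"
   unfolding v(2) by (simp add: field_simps)
  finally show "(inverse \<pi> ^ (k + 1) * tr (%x. A x * \<beta>) - inverse (2 * \<pi>) * tr (%x. A (A x) * \<beta>)) -
    (inverse \<pi> ^ (k + 1) * tr (%x. Y x * \<beta>) - inverse (2 * \<pi>) * tr (%x. Y (Y x) * \<beta>)) : \<O>"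
   using u(1) v(1) by simp
 qed
 moreover have "red 1 A = red 1 Y" using c1 unfolding red_eq[OF A lY] .
 ultimately show ?thesis
  unfolding psi_Z_def Let_def Y_def[symmetric] B_mul_by[OF lY \<beta>_int] B2 by (simp only: odd_l(1))
qed

text \<open>For \<open>A = \<pi> D\<close> the residual class is zero and the quadratic term
  acquires the integral factor \<open>\<pi>\<^sup>2 / (2 * \<pi>)\<close>; what remains is the
  linear term of \<open>psi\<close>.\<close>

lemma psi_Z_N:
 assumes \<rho>: "\<rho> : characters (g_centr \<beta>)" and z: "z : K r (k + 1)"
 shows "psi_Z r \<beta> \<rho> z = psi r \<beta> z"
proof -
 obtain D where D: "lin D" "sim r (%x. x + emb \<pi> ^ (k + 1) * D x)" "z = red r (%x. x + emb \<pi> ^ (k + 1) * D x)"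
  using K_lift[OF odd_l(8,7) z] by blast
 define A where "A x = emb \<pi> * D x" for x
 have A: "lin A" unfolding A_def by (rule lin_closed(6)[OF D(1)]) simp
 have e: "op A = (%x. x + emb \<pi> ^ (k + 1) * D x)" by (simp add: A_def fun_eq_iff)
 have "\<rho> (red 1 (%x. 0)) = 1"
 proof -
  have "red 1 (%x. 0) *_{g_centr \<beta>} red 1 (%x. 0) = red 1 (%x. 0)"
   using g_centr_add[OF lin_closed(8) lin_closed(8)] by (simp only: add_0_right)
  then have "\<rho> (red 1 (%x. 0)) * \<rho> (red 1 (%x. 0)) = \<rho> (red 1 (%x. 0))"
   using charactersD(2)[OF \<rho> g_centr_zero(2) g_centr_zero(2)] by (simp only:)
  then show ?thesis using charactersD(1)[OF \<rho> g_centr_zero(2)] by simp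
 qed
 moreover have "red 1 A = red 1 (%x. 0)"
  unfolding red_eq[OF A lin_closed(8)] cg_def
 proof
  fix x :: 'k assume "x : \<O>"
  from pi_power_IK[OF linear_onD(1)[OF D(1) this] order_refl, of 1]
  show "A x - 0 : IK 1" by (simp only: A_def power_one_right diff_0_right)
 qed
 ultimately have "psi_Z r \<beta> \<rho> z = gauss A" unfolding D(3) e[symmetric] psi_Z_eq[OF A] by (simp only: mult_1_right)
 also have "\<dots> = ch k (tr (%x. D x * \<beta>))"
 proof -
  have t1: "tr (%x. A x * \<beta>) = \<pi> * tr (%x. D x * \<beta>)" by (simp add: A_def mult.assoc tr_simps(4))
  have t2: "tr (%x. A (A x) * \<beta>) = \<pi> * (\<pi> * tr (%x. D (D x) * \<beta>))"
  proof -
   have "tr (%x. A (A x) * \<beta>) = tr (%x. emb \<pi> * (emb \<pi> * (D (D x) * \<beta>)))"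
   proof (rule tr_cong)
    fix x :: 'k assume "x : \<O>"
    from linear_onD(3)[OF D(1) pi_integers(1) linear_onD(1)[OF D(1) this]]
    show "A (A x) * \<beta> = emb \<pi> * (emb \<pi> * (D (D x) * \<beta>))" by (simp only: A_def mult.assoc)
   qed
   then show ?thesis by (simp only: tr_simps(4))
  qed
  have i: "\<pi> * tr (%x. D (D x) * \<beta>) / 2 : \<O>"
   using tr_integers[OF lin_closed(5)[OF lin_closed(2)[OF D(1) D(1)] \<beta>_int]] by (intro half_integers integers_closed(5)) auto
  show ?thesis
   unfolding gauss_def ch_def
  proof (rule \<tau>_cong)
   have e1: "inverse \<pi> ^ (k + 1) * tr (%x. A x * \<beta>) = inverse \<pi> ^ k * tr (%x. D x * \<beta>)" unfolding t1 by simp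
   have e2: "inverse (2 * \<pi>) * tr (%x. A (A x) * \<beta>) = \<pi> * tr (%x. D (D x) * \<beta>) / 2" unfolding t2 by (simp add: field_simps)
   have "a - b - a = - b" for a b :: 'f by simp
   then show "inverse \<pi> ^ (k + 1) * tr (%x. A x * \<beta>) - inverse (2 * \<pi>) * tr (%x. A (A x) * \<beta>) -
     inverse \<pi> ^ k * tr (%x. D x * \<beta>) : \<O>" unfolding e1 e2 using integers_closed(6)[OF i] by (simp only:)
  qed
 qed
 also have "\<dots> = psi r \<beta> z"
  unfolding D(3) using psi_eq[OF odd_l(4) D(1)] D(2) unfolding odd_l(1,2) by (simp only:)
 finally show ?thesis .
qed

lemma gauss_nz: "gauss A ~= 0"
 by (simp add: gauss_def \<tau>_nz)

text \<open>The common factor \<open>gauss\<close> cancels, and every class of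
  \<open>g_centr\<close> is attained on \<open>C \<inter> H\<close>.\<close>

lemma psi_Z_inj:
 assumes \<rho>: "\<rho> : characters (g_centr \<beta>)" "\<rho>' : characters (g_centr \<beta>)"
  and e: "ALL z:Z r \<beta>. psi_Z r \<beta> \<rho> z = psi_Z r \<beta> \<rho>' z"
 shows "\<rho> = \<rho>'"
proof (rule extensionalityI[OF charactersD(3)[OF \<rho>(1)] charactersD(3)[OF \<rho>(2)]])
 fix R assume "R : carrier (g_centr \<beta>)"
 then obtain x where x: "x : \<O>" "1 + emb \<pi> ^ k * x : U_KF" "R = red 1 (%y. y * x)"
  using g_centr_lift[OF kr(2)] by blast
 have "red r (op (%y. y * x)) : G_centr r \<beta> \<inter> K r k" unfolding centr_H_iff using x(1,2) by blast
 then have "psi_Z r \<beta> \<rho> (red r (op (%y. y * x))) = psi_Z r \<beta> \<rho>' (red r (op (%y. y * x)))"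
  using centr_H_Z e by blast
 then show "\<rho> R = \<rho>' R" unfolding psi_Z_eq[OF lin_closed(7)[OF x(1)]] x(3) using gauss_nz by simp
qed

text \<open>The quotient of \<open>\<chi>\<close> by one multiplicative extension
  \<open>\<psi>'\<close> is trivial on \<open>K r (k + 1)\<close>, so it depends only on the class
  in \<open>g_centr\<close> and defines \<open>\<rho>\<close> there. The extension
  \<open>\<psi>'\<close> is kept abstract; it will be \<open>psi_Z\<close> for the trivial
  \<open>\<rho>\<close>.\<close>

lemma psi_Z_surj:
 assumes base_mult: "!!z w. z : Z r \<beta> ==> w : Z r \<beta> ==> \<psi>' (z *_{G r} w) = \<psi>' z * \<psi>' w"
  and base_eq: "!!A. lin A ==> red 1 A : carrier (g_centr \<beta>) ==> \<psi>' (red r (op A)) = gauss A"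
  and base_N: "!!z. z : K r (k + 1) ==> \<psi>' z = psi r \<beta> z"
  and \<chi>: "!!z w. z : Z r \<beta> ==> w : Z r \<beta> ==> \<chi> (z *_{G r} w) = \<chi> z * \<chi> w"
  and \<chi>_N: "!!z. z : K r (k + 1) ==> \<chi> z = psi r \<beta> z" and \<chi>_nz: "!!z. z : Z r \<beta> ==> \<chi> z ~= 0"
 shows "EX \<rho>:characters (g_centr \<beta>). ALL z:Z r \<beta>. psi_Z r \<beta> \<rho> z = \<chi> z"
proof -
 interpret group "G r" by (rule group_G[OF odd_l(5)])
 define f where "f z = \<chi> z / \<psi>' z" for z
 have base_nz: "\<psi>' z ~= 0" if z: "z : Z r \<beta>" for z
 proof -
  obtain A where A: "lin A" "z = red r (op A)" "red 1 A : carrier (g_centr \<beta>)" using Z_lift[OF z] by blast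
  show ?thesis unfolding A(2) base_eq[OF A(1,3)] by (rule gauss_nz)
 qed
 have f_mult: "f (z *_{G r} w) = f z * f w" if "z : Z r \<beta>" "w : Z r \<beta>" for z w
  using \<chi>[OF that] base_mult[OF that] by (simp add: f_def)
 have f_N: "f z = 1" if z: "z : K r (k + 1)" for z
  using base_nz[of z] N_Z z \<chi>_N[OF z] base_N[OF z] by (auto simp: f_def)
 have f_cong: "f z = f w"
  if X: "lin X" "sim r X" "z = red r X" and Y: "lin Y" "sim r Y" "w = red r Y" and c: "cg (k + 1) X Y"
   and z: "z : Z r \<beta>" "w : Z r \<beta>" for z w X Y
 proof -
  have N: "inv_{G r} w *_{G r} z : K r (k + 1)" unfolding X(3) Y(3) by (rule K_quotient[OF odd_l(8,7) X(1,2) Y(1,2) c])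
  have g: "z : carrier (G r)" "w : carrier (G r)" using Z_K z by (auto simp: K_def kernel_def)
  have "f z = f (w *_{G r} (inv_{G r} w *_{G r} z))" using g by (simp add: m_assoc[symmetric])
  also have "\<dots> = f w" using f_mult[OF z(2), of "inv_{G r} w *_{G r} z"] N N_Z f_N[OF N] by auto
  finally show ?thesis .
 qed
 \<comment> \<open>Each class is represented by an \<open>x\<close> with
   \<open>1 + \<pi>\<^sup>k x\<close> in \<open>U_KF\<close>, so that \<open>f\<close> can be
   evaluated at an actual element \<open>z x\<close> of \<open>Z\<close>.\<close>
 define Q where "Q R x \<longleftrightarrow> x : \<O> & 1 + emb \<pi> ^ k * x : U_KF & R = red 1 (%y. y * x)" for R x
 define X where "X R = (SOME x. Q R x)" for R
 have X: "Q R (X R)" if "R : carrier (g_centr \<beta>)" for R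
 proof -
  have "EX x. Q R x" using g_centr_lift[OF kr(2) that] by (auto simp only: Q_def)
  then show ?thesis unfolding X_def by (rule someI_ex)
 qed
 define z where "z x = red r (op (%y. y * x))" for x
 have sx: "sim r (op (%y. y * x))" "z x : Z r \<beta>" "lin (%y. y * x)" if "Q R x" for R x
 proof -
  have x: "x : \<O>" "1 + emb \<pi> ^ k * x : U_KF" using that by (simp_all add: Q_def)
  show "sim r (op (%y. y * x))" unfolding op_mul by (rule sim_mul[OF x(2)])
  have "z x : G_centr r \<beta> \<inter> K r k" unfolding z_def centr_H_iff using x by blast
  then show "z x : Z r \<beta>" using centr_H_Z by blast
  show "lin (%y. y * x)" by (rule lin_closed(7)[OF x(1)])
 qed
 have key: "f w = f (z (X R))"
  if A: "lin A" "sim r (op A)" "w = red r (op A)" "w : Z r \<beta>" and R: "R = red 1 A" "R : carrier (g_centr \<beta>)" for w A R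
 proof -
  have Q: "Q R (X R)" by (rule X[OF R(2)])
  have "red 1 A = red 1 (%y. y * X R)" using Q R(1) by (simp only: Q_def)
  from cg_op[OF this A(1) sx(3)[OF Q]] show ?thesis
   by (rule f_cong[OF lin_one_plus[OF A(1)] A(2,3) lin_one_plus[OF sx(3)[OF Q]] sx(1)[OF Q] z_def _ A(4) sx(2)[OF Q]])
 qed
 define \<rho> where "\<rho> = (\<lambda>R\<in>carrier (g_centr \<beta>). f (z (X R)))"
 have "\<rho> : hom (g_centr \<beta>) (units_of CC)"
 proof (rule homI)
  fix R assume R: "R : carrier (g_centr \<beta>)"
  have "f (z (X R)) ~= 0" using sx(2)[OF X[OF R]] \<chi>_nz base_nz by (simp add: f_def)
  then have "\<rho> R * inverse (\<rho> R) = 1" using R by (simp add: \<rho>_def)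
  then show "\<rho> R : carrier (units_of CC)"
   by (auto simp: units_of_def Units_def mult.commute intro!: exI[of _ "inverse (\<rho> R)"])
  fix R' assume R': "R' : carrier (g_centr \<beta>)"
  note Q = X[OF R] and Q' = X[OF R']
  \<comment> \<open>\<open>(1 + \<pi>\<^sup>k x) (1 + \<pi>\<^sup>k x') = 1 + \<pi>\<^sup>k
    E\<close>, and \<open>E\<close> is \<open>x + x'\<close> modulo \<open>\<pi>\<close>:
    multiplication in \<open>Z\<close> becomes addition in \<open>g_centr\<close>.\<close>
  define E where "E y = y * X R + y * X R' + emb \<pi> ^ k * (y * X R * X R')" for y
  have Xi: "X R : \<O>" "X R' : \<O>" using Q Q' by (simp_all add: Q_def)
  have E: "lin E" unfolding E_def
   by (intro lin_closed(3) lin_closed(6) lin_closed(5) lin_closed(7) Xi integers_closed(7) pi_integers(2))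
  have oE: "op E = (%y. op (%y. y * X R') (op (%y. y * X R) y))"
   by (simp add: E_def fun_eq_iff algebra_simps)
  have s: "sim r (op E)" unfolding oE by (rule sim_comp[OF lin_one_plus[OF sx(3)[OF Q]] sx(1)[OF Q] lin_one_plus[OF sx(3)[OF Q']] sx(1)[OF Q']])
  have m: "z (X R) *_{G r} z (X R') = red r (op E)"
   unfolding oE z_def by (rule G_mult[OF odd_l(5) lin_one_plus[OF sx(3)[OF Q]] sx(1)[OF Q] lin_one_plus[OF sx(3)[OF Q']] sx(1)[OF Q']])
  have mZ: "z (X R) *_{G r} z (X R') : Z r \<beta>"
   by (rule subgroup.m_closed[OF Z_subgroup sx(2)[OF Q] sx(2)[OF Q']])
  have R1: "R *_{g_centr \<beta>} R' = red 1 E"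
  proof -
   have "R *_{g_centr \<beta>} R' = red 1 (%y. y * X R) *_{g_centr \<beta>} red 1 (%y. y * X R')"
    using Q Q' by (simp only: Q_def)
   also have "\<dots> = red 1 (%y. y * X R + y * X R')" by (rule g_centr_add[OF sx(3)[OF Q] sx(3)[OF Q']])
   also have "\<dots> = red 1 E"
    unfolding red_eq[OF lin_closed(3)[OF sx(3)[OF Q] sx(3)[OF Q']] E] cg_def
   proof
    fix y :: 'k assume "y : \<O>"
    then have "emb \<pi> ^ k * (y * X R * X R') : IK 1" using Xi by (intro pi_power_IK kr(2)) simp
    from IK_closed(4)[OF this] show "y * X R + y * X R' - E y : IK 1" by (simp add: E_def)
   qed
   finally show ?thesis .
  qed
  have "red 1 E : carrier (g_centr \<beta>)"
   using mZ unfolding m Z_iff[OF E s] by (rule Z_imp_g_centr[OF E s])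
  then have RR: "R *_{g_centr \<beta>} R' : carrier (g_centr \<beta>)" unfolding R1 .
  have "f (z (X R) *_{G r} z (X R')) = f (z (X (R *_{g_centr \<beta>} R')))"
   by (rule key[OF E s m mZ R1 RR])
  then show "\<rho> (R *_{g_centr \<beta>} R') = \<rho> R *_{units_of CC} \<rho> R'"
   using R R' RR f_mult[OF sx(2)[OF Q] sx(2)[OF Q']] by (simp add: \<rho>_def units_of_def)
 qed
 then have "\<rho> : characters (g_centr \<beta>)" by (simp add: characters_def \<rho>_def)
 moreover have "psi_Z r \<beta> \<rho> w = \<chi> w" if w: "w : Z r \<beta>" for w
 proof -
  obtain A where A: "lin A" "sim r (op A)" "w = red r (op A)" "red 1 A : carrier (g_centr \<beta>)" using Z_lift[OF w] by blast
  have "psi_Z r \<beta> \<rho> w = \<psi>' w * f w"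
   unfolding key[OF A(1-3) w refl A(4)] using A(4) by (simp only: A(3) psi_Z_eq[OF A(1)] base_eq[OF A(1,4)] \<rho>_def restrict_apply' if_True)
  then show ?thesis using base_nz[OF w] by (simp add: f_def)
 qed
 ultimately show ?thesis by blast
qed

end

end

section \<open>The bijection\<close>

lemma algebra_on_simps [simp]:
 "carrier (algebra_on e A) = A" "0_{algebra_on e A} = 0" "x +_{algebra_on e A} y = x + y"
 "a \<odot>_{algebra_on e A} x = e a * x"
 by (simp_all add: algebra_on_def)

lemma cvs_CC: "cvs (algebra_on id (UNIV :: complex set))"
 by (rule cvsI) (auto simp: algebra_simps intro: exI[of _ "- _"])

lemma linear_maps_scalar: "(%v. c * v) : linear_maps CC (algebra_on id UNIV) (algebra_on id UNIV)"
 by (simp add: linear_maps_def algebra_simps)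

lemma one_dim_rep:
 assumes G: "group G" and mult: "!!g h. g : carrier G ==> h : carrier G ==> \<chi> (g *_{G} h) = \<chi> g * \<chi> h"
  and nz: "!!g. g : carrier G ==> \<chi> g ~= (0 :: complex)"
 shows "rep G (algebra_on id UNIV) (%g v. \<chi> g * v)"
proof (rule repI[OF G cvs_CC])
 interpret group G by fact
 have "\<chi> 1_{G} * \<chi> 1_{G} = \<chi> 1_{G}" using mult[of "1_{G}" "1_{G}"] by simp
 then have "\<chi> 1_{G} = 1" using nz[of "1_{G}"] by simp
 then show "\<chi> 1_{G} * v = v" for v by simp
qed (use mult linear_maps_scalar in auto)

lemma one_dim_irreducible:
 assumes "group G" "!!g h. g : carrier G ==> h : carrier G ==> \<chi> (g *_{G} h) = \<chi> g * \<chi> h"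
  and "!!g. g : carrier G ==> \<chi> g ~= (0 :: complex)"
 shows "irreducible_rep G (algebra_on id UNIV) (%g v. \<chi> g * v)"
 unfolding irreducible_rep_def
proof (intro conjI allI impI)
 show "group_rep G (algebra_on id UNIV) (%g v. \<chi> g * v)" by (rule rep.group_rep[OF one_dim_rep[OF assms]])
 have "(1 :: complex) ~= 0" by simp
 then show "carrier (algebra_on id UNIV) ~= {0_{algebra_on id (UNIV :: complex set)}}"
  unfolding algebra_on_simps by blast
 fix W assume W: "submodule W CC (algebra_on id (UNIV :: complex set)) & (ALL g:carrier G. (%v. \<chi> g * v) ` W \<subseteq> W)"
 have sm: "a * w : W" if "w : W" for a w
  using submodule.smult_closed[OF conjunct1[OF W], of a w] that by simp
 have z: "0 : W"
  using subgroup.one_closed[OF submodule.axioms(1)[OF conjunct1[OF W]]] by (simp add: algebra_on_def)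
 show "W = {0_{algebra_on id (UNIV :: complex set)}} \<or> W = carrier (algebra_on id UNIV)"
 proof (cases "W \<subseteq> {0}")
  case False
  then obtain w where "w : W" "w ~= 0" by blast
  then have "x : W" for x using sm[of w "x / w"] by simp
  then have "W = UNIV" by blast
  then show ?thesis by simp
 qed (use z in auto)
qed

context heis_data
begin

text \<open>Two factorizations differ by \<open>c\<close> in \<open>C \<inter> H\<close>, where
  \<open>U\<close> is trivial and \<open>P\<close> acts by the scalar \<open>\<theta> c\<close>;
  what \<open>\<theta>\<close> gains on one side, \<open>P\<close> loses on the other.\<close>

lemma factor_indep:
 assumes \<theta>: "\<theta> : Theta" and g: "g : C" "g' : C" and h: "h : H" "h' : H" and e: "g \<otimes> h = g' \<otimes> h'"
  and v: "v : carrier (V (idx \<theta>))"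
 shows "\<theta> g \<odot>_{V (idx \<theta>)} U (idx \<theta>) g (P (idx \<theta>) h v) = \<theta> g' \<odot>_{V (idx \<theta>)} U (idx \<theta>) g' (P (idx \<theta>) h' v)"
proof -
 note i = idx[OF \<theta>]
 interpret U: rep "G(|carrier := C|)" "V (idx \<theta>)" "U (idx \<theta>)" by (rule rep_U[OF i(1)])
 interpret P: rep "G(|carrier := H|)" "V (idx \<theta>)" "P (idx \<theta>)" by (rule rep_P[OF i(1)])
 define c where "c = inv g \<otimes> g'"
 have cG: "c : carrier G" unfolding c_def using CG g by simp
 have gc: "g' = g \<otimes> c" unfolding c_def using CG g by (simp add: m_assoc[symmetric])
 have "g \<otimes> h = g \<otimes> (c \<otimes> h')" unfolding e using gc m_assoc[OF CG[OF g(1)] cG HG[OF h(2)]] by simp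
 then have hc: "h = c \<otimes> h'" using CG[OF g(1)] HG[OF h(1)] HG[OF h(2)] cG by simp
 have "c = h \<otimes> inv h'" unfolding hc using HG[OF h(2)] cG by (simp add: m_assoc)
 then have cH: "c : H" using H_closed h by simp
 have cC: "c : C" unfolding c_def using C_closed g by simp
 have cZ: "c : Z" using CHZ cC cH by blast
 have Pv: "P (idx \<theta>) h' v : carrier (V (idx \<theta>))" using h v by simp
 have "U (idx \<theta>) c (P (idx \<theta>) h' v) = P (idx \<theta>) h' v" using U_one[OF i(1), of c] cC cH Pv by (simp add: GL_simps(2))
 then have "U (idx \<theta>) g' (P (idx \<theta>) h' v) = U (idx \<theta>) g (P (idx \<theta>) h' v)"
  unfolding gc using U.mult[of g c "P (idx \<theta>) h' v"] g(1) cC Pv by simp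
 moreover have "P (idx \<theta>) h v = \<theta> c \<odot>_{V (idx \<theta>)} P (idx \<theta>) h' v"
  unfolding hc using P.mult[of c h' v] cH h v P_scalar[OF i(1) cZ Pv] i(2)[OF cC cH] by simp
 moreover have "\<theta> g' = \<theta> g * \<theta> c" unfolding gc by (rule \<theta>_mult(1)[OF \<theta> g(1) cC])
 ultimately show ?thesis using U.smul[of g "P (idx \<theta>) h' v" "\<theta> c"] g Pv by (simp add: U.smult_assoc)
qed

end

context GO_beta
begin

abbreviation theta_res :: "nat => ('k => complex) => ('k set => 'k set) => complex" where
 "theta_res r \<theta> \<equiv> restrict (theta_mod r \<theta>) (G_centr r \<beta>)"

text \<open>The lift chosen by \<open>SOME\<close> differs from \<open>\<gamma>\<close> by an
  element of \<open>IK r\<close>, which \<open>\<theta>\<close> does not see.\<close>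

lemma theta_mod_eq:
 assumes \<theta>: "\<theta> : theta_set r \<beta>" and \<gamma>: "\<gamma> : U_KF"
 shows "theta_mod r \<theta> (red r (%x. x * \<gamma>)) = \<theta> \<gamma>"
proof -
 let ?P = "%\<delta>. \<delta> : U_KF & red r (%x. x * \<gamma>) = red r (mul_by \<delta>)"
 have "?P \<gamma>" by (simp add: \<gamma> red_mul_by)
 then have P: "?P (SOME \<delta>. ?P \<delta>)" by (rule someI[of ?P])
 then have "\<gamma> - (SOME \<delta>. ?P \<delta>) : IK r" using U_red_eq[OF \<gamma> conjunct1[OF P]] by (simp add: red_mul_by)
 then have "\<theta> \<gamma> = \<theta> (SOME \<delta>. ?P \<delta>)" using \<theta> \<gamma> P unfolding theta_set_def by blast
 then show ?thesis unfolding theta_mod_def by (rule sym)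
qed

lemma psi_mul:
 assumes r: "2 <= r" and x: "x : \<O>" "1 + emb (\<pi> ^ l r) * x : U_KF"
 shows "psi r \<beta> (red r (%y. y * (1 + emb (\<pi> ^ l r) * x))) = \<tau> (inverse \<pi> ^ l' r * Tr (\<beta> * x))"
proof -
 have e: "(%y. y * (1 + emb (\<pi> ^ l r) * x)) = (%y. y + emb \<pi> ^ l r * (y * x))" by (simp add: fun_eq_iff algebra_simps)
 have s: "sim r (%y. y + emb \<pi> ^ l r * (y * x))" unfolding e[symmetric] by (rule sim_mul[OF x(2)])
 have "psi r \<beta> (red r (%y. y * (1 + emb (\<pi> ^ l r) * x))) = ch (l' r) (tr (%y. y * x * \<beta>))"
  unfolding e by (rule psi_eq[OF r lin_closed(7)[OF x(1)] s])
 also have "tr (%y. y * x * \<beta>) = Tr (\<beta> * x)" using tr_mult[of "\<beta> * x"] by (simp add: ac_simps)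
 finally show ?thesis by (simp only: ch_def)
qed

text \<open>The image of \<open>U_KF\<close> modulo \<open>\<pi>\<^sup>r\<close> is the centralizer,
  so characters factoring through it correspond; the prescribed values on
  \<open>1 + \<pi>\<^sup>l x\<close> become agreement with \<open>psi\<close> on
  \<open>K r (l r)\<close>, because the trace of a multiplication is \<open>Tr\<close>.\<close>

lemma theta_res_bij:
 assumes r: "2 <= r"
 shows "bij_betw (theta_res r) (theta_set r \<beta>)
  {\<theta> : characters ((G r)(|carrier := G_centr r \<beta>|)). ALL c:G_centr r \<beta> \<inter> K r (l r). \<theta> c = psi r \<beta> c}"
  (is "bij_betw _ _ ?T")
proof -
 note L = l_bounds[OF r]
 have C: "red r (%x. x * \<gamma>) : G_centr r \<beta>" if "\<gamma> : U_KF" for \<gamma> using G_centr_iff[OF L(8)] that by blast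
 have unit: "w : carrier (units_of CC) \<longleftrightarrow> w ~= 0" for w :: complex
 proof
  show "w : carrier (units_of CC) ==> w ~= 0" by (auto simp: units_of_def Units_def)
  assume "w ~= 0"
  then have "w * inverse w = 1" by simp
  then show "w : carrier (units_of CC)"
   by (auto simp: units_of_def Units_def mult.commute intro!: exI[of _ "inverse w"])
 qed
 have chU: "\<theta> : characters (ring_on U_KF) \<longleftrightarrow> (ALL \<gamma>:U_KF. \<theta> \<gamma> ~= 0) &
   (ALL \<gamma>:U_KF. ALL \<delta>:U_KF. \<theta> (\<gamma> * \<delta>) = \<theta> \<gamma> * \<theta> \<delta>) & \<theta> : extensional U_KF" for \<theta> :: "'k => complex"
  unfolding characters_def hom_def Pi_def Int_iff mem_Collect_eq ring_on_simps unit by (simp add: units_of_def Ball_def)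
 have chC: "\<theta> : characters ((G r)(|carrier := G_centr r \<beta>|)) \<longleftrightarrow> (ALL c:G_centr r \<beta>. \<theta> c ~= 0) &
   (ALL c:G_centr r \<beta>. ALL d:G_centr r \<beta>. \<theta> (c *_{G r} d) = \<theta> c * \<theta> d) & \<theta> : extensional (G_centr r \<beta>)" for \<theta>
  unfolding characters_def hom_def Pi_def Int_iff mem_Collect_eq unit by (simp add: units_of_def Ball_def)
 have K: "red r (%x. x * \<gamma>) : K r (l r) \<longleftrightarrow> (EX x:\<O>. \<gamma> = 1 + emb (\<pi> ^ l r) * x)" if \<gamma>: "\<gamma> : U_KF" for \<gamma>
  unfolding G_centr_K[OF L(5,3) \<gamma>]
 proof
  assume "\<gamma> - 1 : IK (l r)"
  then obtain x where "x : \<O>" "\<gamma> - 1 = emb \<pi> ^ l r * x" using IK_decomp by blast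
  then show "EX x:\<O>. \<gamma> = 1 + emb (\<pi> ^ l r) * x" by (intro bexI[of _ x]) (simp_all add: algebra_simps)
 next
  assume "EX x:\<O>. \<gamma> = 1 + emb (\<pi> ^ l r) * x"
  then obtain x where "x : \<O>" "\<gamma> = 1 + emb (\<pi> ^ l r) * x" by blast
  then show "\<gamma> - 1 : IK (l r)" using pi_power_IK[of x "l r" "l r"] by simp
 qed
 have val: "theta_res r \<theta> (red r (%x. x * \<gamma>)) = \<theta> \<gamma>" if "\<theta> : theta_set r \<beta>" "\<gamma> : U_KF" for \<theta> \<gamma>
  using theta_mod_eq[OF that] C[OF that(2)] by simp
 show ?thesis
 proof (rule bij_betwI')
  fix \<theta> \<theta>' assume \<theta>: "\<theta> : theta_set r \<beta>" "\<theta>' : theta_set r \<beta>"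
  show "theta_res r \<theta> = theta_res r \<theta>' \<longleftrightarrow> \<theta> = \<theta>'"
  proof
   assume e: "theta_res r \<theta> = theta_res r \<theta>'"
   show "\<theta> = \<theta>'"
   proof (rule extensionalityI[of _ U_KF])
    show "\<theta> : extensional U_KF" "\<theta>' : extensional U_KF" using \<theta> chU by (auto simp: theta_set_def)
    fix \<gamma> assume "\<gamma> : U_KF"
    then show "\<theta> \<gamma> = \<theta>' \<gamma>" using val[OF \<theta>(1)] val[OF \<theta>(2)] e by metis
   qed
  qed simp
 next
  fix \<theta> assume \<theta>: "\<theta> : theta_set r \<beta>"
  then have c: "\<theta> : characters (ring_on U_KF)" by (simp add: theta_set_def)
  have "theta_res r \<theta> : characters ((G r)(|carrier := G_centr r \<beta>|))"
   unfolding chC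
  proof (intro conjI ballI)
   fix g assume "g : G_centr r \<beta>"
   then obtain \<gamma> where \<gamma>: "\<gamma> : U_KF" "g = red r (%x. x * \<gamma>)" using G_centr_iff[OF L(8)] by blast
   show "theta_res r \<theta> g ~= 0" unfolding \<gamma>(2) val[OF \<theta> \<gamma>(1)] using c \<gamma>(1) unfolding chU by blast
   fix h assume "h : G_centr r \<beta>"
   then obtain \<delta> where \<delta>: "\<delta> : U_KF" "h = red r (%x. x * \<delta>)" using G_centr_iff[OF L(8)] by blast
   show "theta_res r \<theta> (g *_{G r} h) = theta_res r \<theta> g * theta_res r \<theta> h"
    unfolding \<gamma>(2) \<delta>(2) U_mult[OF L(8) \<gamma>(1) \<delta>(1)] val[OF \<theta> \<gamma>(1)] val[OF \<theta> \<delta>(1)] val[OF \<theta> U_closed(2)[OF \<gamma>(1) \<delta>(1)]]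
    using c \<gamma>(1) \<delta>(1) unfolding chU by blast
  qed simp
  moreover have "theta_res r \<theta> g = psi r \<beta> g" if g: "g : G_centr r \<beta> \<inter> K r (l r)" for g
  proof -
   obtain \<gamma> where \<gamma>: "\<gamma> : U_KF" "g = red r (%x. x * \<gamma>)" using g G_centr_iff[OF L(8)] by blast
   obtain x where x: "x : \<O>" "\<gamma> = 1 + emb (\<pi> ^ l r) * x" using g K[OF \<gamma>(1)] \<gamma>(2) by blast
   have u: "1 + emb (\<pi> ^ l r) * x : U_KF" using \<gamma>(1) x(2) by (simp only:)
   have "\<theta> (1 + emb (\<pi> ^ l r) * x) = \<tau> (inverse \<pi> ^ l' r * Tr (\<beta> * x))"
    using \<theta> x(1) u unfolding theta_set_def by blast
   then show ?thesis unfolding \<gamma>(2) x(2) psi_mul[OF r x(1) u] val[OF \<theta> u] .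
  qed
  ultimately show "theta_res r \<theta> : ?T" by blast
 next
  fix \<phi> assume \<phi>: "\<phi> : ?T"
  then have c: "\<phi> : characters ((G r)(|carrier := G_centr r \<beta>|))" by blast
  define \<theta> where "\<theta> = (\<lambda>\<gamma>\<in>U_KF. \<phi> (red r (%x. x * \<gamma>)))"
  have v: "\<theta> \<gamma> = \<phi> (red r (%x. x * \<gamma>))" if "\<gamma> : U_KF" for \<gamma> using that by (simp add: \<theta>_def)
  have t: "\<theta> : theta_set r \<beta>"
   unfolding theta_set_def mem_Collect_eq chU
  proof (intro conjI ballI impI)
   show "\<theta> \<gamma> ~= 0" if "\<gamma> : U_KF" for \<gamma> using c C[OF that] unfolding chC v[OF that] by blast
   show "\<theta> (\<gamma> * \<delta>) = \<theta> \<gamma> * \<theta> \<delta>" if \<gamma>: "\<gamma> : U_KF" and \<delta>: "\<delta> : U_KF" for \<gamma> \<delta>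
    unfolding v[OF \<gamma>] v[OF \<delta>] v[OF U_closed(2)[OF \<gamma> \<delta>]] U_mult[OF L(8) \<gamma> \<delta>, symmetric]
    using c C[OF \<gamma>] C[OF \<delta>] unfolding chC by blast
   show "\<theta> : extensional U_KF" by (simp add: \<theta>_def)
   show "\<theta> \<gamma> = \<theta> \<delta>" if "\<gamma> : U_KF" "\<delta> : U_KF" "\<gamma> - \<delta> : IK r" for \<gamma> \<delta>
    unfolding v[OF that(1)] v[OF that(2)]
    by (rule arg_cong[where f = \<phi>, OF iffD2[OF U_red_eq[OF that(1,2)] that(3)]])
   fix x assume x: "x : \<O>" "1 + emb (\<pi> ^ l r) * x : U_KF"
   have "red r (%y. y * (1 + emb (\<pi> ^ l r) * x)) : G_centr r \<beta> \<inter> K r (l r)"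
    using C[OF x(2)] K[OF x(2)] x(1) by blast
   then have "\<phi> (red r (%y. y * (1 + emb (\<pi> ^ l r) * x))) = psi r \<beta> (red r (%y. y * (1 + emb (\<pi> ^ l r) * x)))"
    using \<phi> by blast
   then show "\<theta> (1 + emb (\<pi> ^ l r) * x) = \<tau> (inverse \<pi> ^ l' r * Tr (\<beta> * x))"
    unfolding v[OF x(2)] psi_mul[OF r x] .
  qed
  moreover have "\<phi> = theta_res r \<theta>"
  proof (rule extensionalityI[of _ "G_centr r \<beta>"])
   show "\<phi> : extensional (G_centr r \<beta>)" using c unfolding chC by blast
   fix g assume "g : G_centr r \<beta>"
   then obtain \<gamma> where \<gamma>: "\<gamma> : U_KF" "g = red r (%x. x * \<gamma>)" using G_centr_iff[OF L(8)] by blast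
   show "\<phi> g = theta_res r \<theta> g" unfolding \<gamma>(2) val[OF t \<gamma>(1)] v[OF \<gamma>(1)] ..
  qed simp
  ultimately show "EX \<theta>:theta_set r \<beta>. \<phi> = theta_res r \<theta>" by blast
 qed
qed

lemma factors:
 assumes "g : G_centr r \<beta>" "h : K r j"
 shows "EX g' h'. factors r \<beta> j (g *_{G r} h) = (g', h') & g' : G_centr r \<beta> & h' : K r j & g *_{G r} h = g' *_{G r} h'"
proof -
 let ?P = "%(g', h'). g' : G_centr r \<beta> & h' : K r j & g *_{G r} h = g' *_{G r} h'"
 have "?P (g, h)" using assms by simp
 then have "?P (SOME p. ?P p)" by (rule someI[of ?P])
 moreover obtain g' h' where e: "factors r \<beta> j (g *_{G r} h) = (g', h')" by (cases "factors r \<beta> j (g *_{G r} h)")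
 ultimately show ?thesis unfolding e[unfolded factors_def] by (intro exI[of _ g'] exI[of _ h']) (simp add: e)
qed

text \<open>Bridges the abstract bijection and the concrete definitions: \<open>s\<close> is known
  at some factorization only, namely the one picked by \<open>factors\<close>, and
  \<open>factor_indep\<close> extends the formula to all of them.\<close>

lemma bij_from_heis:
 fixes V :: "'i => (complex, 'v) module"
 assumes r: "2 <= r"
  and hd: "heis_data (G r) (K r (l r)) Z' H (G_centr r \<beta>) (G_stab r \<beta>) (psi r \<beta>) I \<psi>Z V P U"
  and s: "!!\<theta> g h. \<theta> : theta_set r \<beta> ==> g : G_centr r \<beta> ==> h : H ==>
   EX g' h'. g' : G_centr r \<beta> & h' : H & g *_{G r} h = g' *_{G r} h' &
    s \<theta> (g *_{G r} h) = (\<lambda>v\<in>carrier (V (i \<theta>)). theta_mod r \<theta> g' \<odot>_{V (i \<theta>)} U (i \<theta>) g' (P (i \<theta>) h' v))"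
  and i: "!!\<theta>. \<theta> : theta_set r \<beta> ==> i \<theta> = (THE i. i : I & (ALL g:G_centr r \<beta> \<inter> H. theta_mod r \<theta> g = \<psi>Z i g))"
 shows "bij_betw (%\<theta>. iso_class (G r) (ind_module (G r) (G_stab r \<beta>) (V (i \<theta>)) (s \<theta>))
   (ind_rep (G r) (G_stab r \<beta>) (V (i \<theta>)) (s \<theta>)))
  (theta_set r \<beta>) (Irr_containing (G r) (K r (l r)) (psi r \<beta>))"
proof -
 interpret D: heis_data "G r" "K r (l r)" Z' H "G_centr r \<beta>" "G_stab r \<beta>" "psi r \<beta>" I \<psi>Z V P U by (rule hd)
 have b: "bij_betw (theta_res r) (theta_set r \<beta>) D.Theta" using theta_res_bij[OF r] unfolding D.Theta_def .
 \<comment> \<open>\<open>Ind_bij\<close> is indexed by characters of the centralizer,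
   \<open>s\<close> by characters of \<open>U_KF\<close>; \<open>R\<close> translates back.\<close>
 define R where "R = inv_into (theta_set r \<beta>) (theta_res r)"
 have R: "R (theta_res r \<theta>) = \<theta>" if "\<theta> : theta_set r \<beta>" for \<theta>
  unfolding R_def using b that by (intro inv_into_f_f) (simp_all add: bij_betw_def)
 have ix: "D.idx (theta_res r \<theta>) = i \<theta>" if "\<theta> : theta_set r \<beta>" for \<theta>
  unfolding D.idx_def i[OF that] by (rule arg_cong[where f = The]) (simp add: fun_eq_iff)
 interpret heis_sigma "G r" "K r (l r)" Z' H "G_centr r \<beta>" "G_stab r \<beta>" "psi r \<beta>" I \<psi>Z V P U "%\<theta>. s (R \<theta>)"
 proof
  fix \<phi> g h assume \<phi>: "\<phi> : D.Theta" and g: "g : G_centr r \<beta>" and h: "h : H"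
  obtain \<theta> where \<theta>: "\<theta> : theta_set r \<beta>" "\<phi> = theta_res r \<theta>" using \<phi> b by (auto simp: bij_betw_def)
  obtain g' h' where gh: "g' : G_centr r \<beta>" "h' : H" "g *_{G r} h = g' *_{G r} h'"
   "s \<theta> (g *_{G r} h) = (\<lambda>v\<in>carrier (V (i \<theta>)). theta_mod r \<theta> g' \<odot>_{V (i \<theta>)} U (i \<theta>) g' (P (i \<theta>) h' v))"
   using s[OF \<theta>(1) g h] by blast
  have ip: "D.idx \<phi> = i \<theta>" unfolding \<theta>(2) by (rule ix[OF \<theta>(1)])
  have Rp: "R \<phi> = \<theta>" unfolding \<theta>(2) by (rule R[OF \<theta>(1)])
  show "s (R \<phi>) (g *_{G r} h) =
   (\<lambda>v\<in>carrier (V (D.idx \<phi>)). \<phi> g \<odot>_{V (D.idx \<phi>)} U (D.idx \<phi>) g (P (D.idx \<phi>) h v))"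
   unfolding Rp gh(4)
  proof (rule extensionalityI[of _ "carrier (V (i \<theta>))"])
   fix v assume v: "v : carrier (V (i \<theta>))"
   have "\<phi> g' = theta_mod r \<theta> g'" using gh(1) by (simp add: \<theta>(2))
   with D.factor_indep[OF \<phi> g gh(1) h gh(2,3), unfolded ip, OF v] v
   show "(\<lambda>v\<in>carrier (V (i \<theta>)). theta_mod r \<theta> g' \<odot>_{V (i \<theta>)} U (i \<theta>) g' (P (i \<theta>) h' v)) v =
    (\<lambda>v\<in>carrier (V (D.idx \<phi>)). \<phi> g \<odot>_{V (D.idx \<phi>)} U (D.idx \<phi>) g (P (D.idx \<phi>) h v)) v"
    by (simp add: ip)
  qed (simp_all add: ip)
 qed
 have "bij_betw ((%\<theta>. iso_class (G r) (ind_module (G r) (G_stab r \<beta>) (V (D.idx \<theta>)) (s (R \<theta>)))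
   (ind_rep (G r) (G_stab r \<beta>) (V (D.idx \<theta>)) (s (R \<theta>)))) \<circ> theta_res r)
  (theta_set r \<beta>) (Irr_containing (G r) (K r (l r)) (psi r \<beta>))"
  by (rule bij_betw_trans[OF b Ind_bij])
 then show ?thesis
  by (rule bij_betw_cong[THEN iffD1, rotated]) (simp only: comp_def ix R)
qed

text \<open>A degenerate instance: with \<open>N = Z = H\<close> nondegeneracy is vacuous,
  \<open>P\<close> is \<open>psi\<close> on a line, \<open>U\<close> is trivial and the index set is
  a point. Commutators lie in the kernel of \<open>psi\<close> because it is invariant under the
  stabilizer.\<close>

lemma heis_even:
 assumes r: "2 <= r" and ev: "l' r = l r"
 shows "heis_data (G r) (K r (l r)) (K r (l r)) (K r (l r)) (G_centr r \<beta>) (G_stab r \<beta>) (psi r \<beta>)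
  {()} (%_. psi r \<beta>) (%_. algebra_on id UNIV) (%_ k v. psi r \<beta> k * v) (%_ _ v. v)"
proof -
 note L = l_bounds[OF r]
 interpret group "G r" by (rule group_G[OF L(8)])
 note N = K_normal[OF L(5,3)] and C = G_centr_subgroup[OF L(8)] and T = G_stab_subgroup[OF r]
 note NG = normal_imp_subgroup[OF N]
 have gN: "group ((G r)(|carrier := K r (l r)|))" by (rule subgroup_imp_group[OF NG])
 have Nc: "k : K r (l r) ==> k : carrier (G r)" for k by (rule subgroup.mem_carrier[OF NG])
 have NT: "k : G_stab r \<beta>" if k: "k : K r (l r)" for k
 proof -
  have "k = 1_{G r} *_{G r} k" using Nc[OF k] by simp
  then show ?thesis unfolding G_stab_eq[OF r] ev using subgroup.one_closed[OF C] k by blast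
 qed
 have CT: "c : G_stab r \<beta>" if c: "c : G_centr r \<beta>" for c
 proof -
  have "c = c *_{G r} 1_{G r}" using subgroup.mem_carrier[OF C c] by simp
  then show ?thesis unfolding G_stab_eq[OF r] ev using subgroup.one_closed[OF NG] c by blast
 qed
 have psi1: "psi r \<beta> 1_{G r} = 1"
  using psi_mult[OF r subgroup.one_closed[OF NG] subgroup.one_closed[OF NG]] psi_nz[OF r subgroup.one_closed[OF NG]] by simp
 have scal: "(%v :: complex. v) : carrier (GL CC (algebra_on id UNIV))"
  by (auto simp: GL_simps linear_maps_def Bij_def bij_betw_def extensional_def)
 have invid: "inv_{GL CC (algebra_on id UNIV)} (%v :: complex. v) = (%v. v)"
  by (rule GL_inv_eqI[OF scal scal]) simp_all
 have one: "1_{GL CC (algebra_on id UNIV)} = (%v :: complex. v)" by (simp add: GL_simps fun_eq_iff)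
 have conj: "psi r \<beta> (inv_{G r} x *_{G r} k *_{G r} x) = psi r \<beta> k" if x: "x : G_stab r \<beta>" and k: "k : K r (l r)" for x k
  using G_stab_fixes_psi[OF r subgroup.m_inv_closed[OF T x] k] subgroup.mem_carrier[OF T x] by simp
 have comm: "inv_{G r} k *_{G r} h *_{G r} k *_{G r} inv_{G r} h : K r (l r)"
  "psi r \<beta> (inv_{G r} k *_{G r} h *_{G r} k *_{G r} inv_{G r} h) = 1"
  if h: "h : K r (l r)" and k: "k : K r (l r)" for h k
 proof -
  have c: "inv_{G r} k *_{G r} h *_{G r} k : K r (l r)" "inv_{G r} h : K r (l r)"
   using NG h k by (simp_all add: subgroup.m_closed subgroup.m_inv_closed)
  show "inv_{G r} k *_{G r} h *_{G r} k *_{G r} inv_{G r} h : K r (l r)"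
   by (rule subgroup.m_closed[OF NG c])
  have "psi r \<beta> (inv_{G r} k *_{G r} h *_{G r} k *_{G r} inv_{G r} h) = psi r \<beta> h * psi r \<beta> (inv_{G r} h)"
   unfolding psi_mult[OF r c] conj[OF NT[OF k] h] ..
  also have "\<dots> = 1" using psi_mult[OF r h c(2)] Nc[OF h] psi1 by simp
  finally show "psi r \<beta> (inv_{G r} k *_{G r} h *_{G r} k *_{G r} inv_{G r} h) = 1" .
 qed
 show ?thesis
 proof (rule heis_data.intro)
  show "irreducible_rep ((G r)(|carrier := K r (l r)|)) (algebra_on id UNIV) (%k v. psi r \<beta> k * v)"
   by (rule one_dim_irreducible[OF gN]) (simp_all add: psi_mult[OF r] psi_nz[OF r])
  show "contains_character (algebra_on id UNIV) (%k v. psi r \<beta> k * v) (K r (l r)) (psi r \<beta>)"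
   unfolding contains_character_def by (intro bexI[of _ 1]) simp_all
  show "(%_ v. v) : hom ((G r)(|carrier := G_centr r \<beta>|)) (GL CC (algebra_on id (UNIV :: complex set)))"
   by (rule homI) (use scal in \<open>simp_all add: GL_simps(3)[OF scal scal] compose_def fun_eq_iff\<close>)
  show "EX c:G_centr r \<beta> \<inter> K r (l r). EX w:K r (l r). z = c *_{G r} w" if "z : K r (l r)" for z
   using that Nc[OF that] subgroup.one_closed[OF C] subgroup.one_closed[OF NG]
   by (intro bexI[of _ "1_{G r}"] bexI[of _ z]) simp_all
  show "EX k:K r (l r). psi r \<beta> (x *_{G r} k *_{G r} inv_{G r} x) ~= psi r \<beta> k"
   if "x : carrier (G r)" "x \<notin> G_stab r \<beta>" for x by (rule not_G_stab_moves_psi[OF r that])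
  show "c *_{G r} d = d *_{G r} c" if "c : G_centr r \<beta>" "d : G_centr r \<beta>" for c d
   by (rule G_centr_comm[OF L(8) that])
  show "G_stab r \<beta> = {c *_{G r} h | c h. c : G_centr r \<beta> & h : K r (l r)}" using G_stab_eq[OF r] unfolding ev .
  show "psi r \<beta> (inv_{G r} g *_{G r} x *_{G r} g) * v = (inv_{GL CC (algebra_on id UNIV)} (%v. v)) (psi r \<beta> x * v)"
   if "g : G_centr r \<beta>" "x : K r (l r)" for g x and v :: complex
   unfolding invid conj[OF CT[OF that(1)] that(2)] ..
  show "(%v :: complex. v) = 1_{GL CC (algebra_on id UNIV)}" by (rule one[symmetric])
  show "psi r \<beta> (x *_{G r} k *_{G r} inv_{G r} x) = psi r \<beta> k" if "x : G_stab r \<beta>" "k : K r (l r)" for x k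
   by (rule G_stab_fixes_psi[OF r that])
  show "psi r \<beta> (x *_{G r} y) = psi r \<beta> x * psi r \<beta> y" if "x : K r (l r)" "y : K r (l r)" for x y
   by (rule psi_mult[OF r that])
  show "psi r \<beta> x ~= 0" if "x : K r (l r)" for x by (rule psi_nz[OF r that])
  show "EX i:{()}. ALL z:K r (l r). psi r \<beta> z = \<chi> z" if "!!x. x : K r (l r) ==> \<chi> x = psi r \<beta> x" for \<chi>
   using that by simp
 qed (simp_all add: group_axioms finite_G N NG C T comm)
qed

lemma heis_odd:
 fixes V :: "_ => (complex, 'v) module"
 assumes kr: "r = 2 * k + 1" "1 <= k" and ic: "intertwiner_choice r \<beta> V P U"
 shows "heis_data (G r) (K r (l r)) (Z r \<beta>) (K r k) (G_centr r \<beta>) (G_stab r \<beta>) (psi r \<beta>)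
  (characters (g_centr \<beta>)) (psi_Z r \<beta>) V P U"
proof -
 note ol = odd_l[OF kr]
 note L = l_bounds[OF ol(4)]
 interpret group "G r" by (rule group_G[OF L(8)])
 have H: "K r k \<lhd> G r" by (rule K_normal[OF kr(2) ol(6)])
 have N: "K r (k + 1) \<lhd> G r" by (rule K_normal[OF ol(8,7)])
 note C = G_centr_subgroup[OF L(8)] and T = G_stab_subgroup[OF ol(4)]
 note ic' = ic[unfolded intertwiner_choice_def ol(3), rule_format]
 show ?thesis
  unfolding ol(1)
 proof (rule heis_data.intro)
  show "group (G r)" "finite (carrier (G r))" "K r (k + 1) \<lhd> G r" "K r k \<lhd> G r" "subgroup (Z r \<beta>) (G r)"
   "subgroup (G_centr r \<beta>) (G r)" "subgroup (G_stab r \<beta>) (G r)" "K r (k + 1) \<subseteq> Z r \<beta>"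
   by (fact group_axioms finite_G N H Z_subgroup[OF kr] C T N_Z[OF kr])+
  show "Z r \<beta> \<subseteq> K r k" using Z_K[OF kr] by blast
  show "c *_{G r} d = d *_{G r} c" if "c : G_centr r \<beta>" "d : G_centr r \<beta>" for c d
   by (rule G_centr_comm[OF L(8) that])
  show "G_stab r \<beta> = {c *_{G r} h | c h. c : G_centr r \<beta> & h : K r k}" using G_stab_eq[OF ol(4)] unfolding ol(2) .
  show "psi r \<beta> (x *_{G r} y) = psi r \<beta> x * psi r \<beta> y" if "x : K r (k + 1)" "y : K r (k + 1)" for x y
   by (rule psi_mult[OF ol(4)]) (use that in \<open>simp_all only: ol(1)\<close>)
  show "psi r \<beta> (x *_{G r} y *_{G r} inv_{G r} x) = psi r \<beta> y" if "x : G_stab r \<beta>" "y : K r (k + 1)" for x y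
   by (rule G_stab_fixes_psi[OF ol(4) that(1)]) (use that in \<open>simp only: ol(1)\<close>)
  show "EX y:K r (k + 1). psi r \<beta> (x *_{G r} y *_{G r} inv_{G r} x) ~= psi r \<beta> y"
   if "x : carrier (G r)" "x \<notin> G_stab r \<beta>" for x using not_G_stab_moves_psi[OF ol(4) that] unfolding ol(1) .
  show "G_centr r \<beta> \<inter> K r k \<subseteq> Z r \<beta>" by (rule centr_H_Z[OF kr])
  show "EX c:G_centr r \<beta> \<inter> K r k. EX w:K r (k + 1). z = c *_{G r} w" if "z : Z r \<beta>" for z
   by (rule Z_decomp[OF kr that])
  show "inv_{G r} g *_{G r} h *_{G r} g *_{G r} inv_{G r} h : K r (k + 1)" if "h : K r k" "g : K r k" for h g
   by (rule commutator_N[OF kr that])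
  show "psi r \<beta> (inv_{G r} g *_{G r} h *_{G r} g *_{G r} inv_{G r} h) = 1" if "h : Z r \<beta>" "g : K r k" for h g
   by (rule comm_trace_trivial[OF kr that])
  show "EX g:K r k. psi r \<beta> (inv_{G r} g *_{G r} h *_{G r} g *_{G r} inv_{G r} h) ~= 1"
   if "h : K r k" "h \<notin> Z r \<beta>" for h by (rule commutator_nondegenerate[OF kr that])
  show "psi r \<beta> x ~= 0" if "x : K r (k + 1)" for x
   by (rule psi_nz[OF ol(4)]) (use that in \<open>simp only: ol(1)\<close>)
  show "psi_Z r \<beta> \<rho> x = psi r \<beta> x" if "\<rho> : characters (g_centr \<beta>)" "x : K r (k + 1)" for \<rho> x
   by (rule psi_Z_N[OF kr that])
  show "\<rho> = \<rho>'" if "\<rho> : characters (g_centr \<beta>)" "\<rho>' : characters (g_centr \<beta>)"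
   "ALL z:Z r \<beta>. psi_Z r \<beta> \<rho> z = psi_Z r \<beta> \<rho>' z" for \<rho> \<rho>' by (rule psi_Z_inj[OF kr that])
  fix \<chi> assume \<chi>: "!!z w. z : Z r \<beta> ==> w : Z r \<beta> ==> \<chi> (z *_{G r} w) = \<chi> z * \<chi> w"
   "!!x. x : K r (k + 1) ==> \<chi> x = psi r \<beta> x" "!!z. z : Z r \<beta> ==> \<chi> z ~= 0"
  \<comment> \<open>Base point for \<open>psi_Z_surj\<close>: the trivial character, whose
    \<open>psi_Z\<close> is \<open>gauss\<close> on lifts and is multiplicative because the given
    representation contains it.\<close>
  define \<rho>0 :: "('k set => 'k set) => complex" where "\<rho>0 = (\<lambda>R\<in>carrier (g_centr \<beta>). 1)"
  \<comment> \<open>Closure under addition makes \<open>\<rho>0\<close> a homomorphism, since off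
    the carrier it takes the default value instead of 1.\<close>
  have add: "R *_{g_centr \<beta>} R' : carrier (g_centr \<beta>)" if R: "R : carrier (g_centr \<beta>)" "R' : carrier (g_centr \<beta>)" for R R'
  proof -
   obtain x where x: "x : \<O>" "R = red 1 (%y. y * x)" using g_centr_lift[OF kr(2) R(1)] by blast
   obtain x' where x': "x' : \<O>" "R' = red 1 (%y. y * x')" using g_centr_lift[OF kr(2) R(2)] by blast
   note lx = lin_closed(7)[OF x(1)] and lx' = lin_closed(7)[OF x'(1)]
   obtain \<mu> where \<mu>: "\<mu> : \<O>" "ALL a:\<O>. ALL b:\<O>. S (a * x) b + S a (b * x) - \<mu> * S a b : IF 1"
    using R(1) unfolding x(2) g_centr_red[OF lx] by blast
   obtain \<mu>' where \<mu>': "\<mu>' : \<O>" "ALL a:\<O>. ALL b:\<O>. S (a * x') b + S a (b * x') - \<mu>' * S a b : IF 1"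
    using R(2) unfolding x'(2) g_centr_red[OF lx'] by blast
   show ?thesis
    unfolding x(2) x'(2) g_centr_add[OF lx lx'] g_centr_red[OF lin_closed(3)[OF lx lx']]
   proof (intro conjI bexI[of _ "\<mu> + \<mu>'"] ballI)
    fix a b :: 'k assume ab: "a : \<O>" "b : \<O>"
    have "(S (a * x) b + S a (b * x) - \<mu> * S a b) + (S (a * x') b + S a (b * x') - \<mu>' * S a b) : IF 1"
     using \<mu>(2) \<mu>'(2) ab by (intro IF_closed(2)) simp_all
    then show "S (a * x + a * x') b + S a (b * x + b * x') - (\<mu> + \<mu>') * S a b : IF 1"
     by (simp add: S_simps algebra_simps)
   next
    fix a :: 'k
    have "a * \<beta> * x + a * \<beta> * x' - (a * x + a * x') * \<beta> = 0" by (simp add: algebra_simps)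
    then show "a * \<beta> * x + a * \<beta> * x' - (a * x + a * x') * \<beta> : IK 1" by (simp only: IK_closed(1))
   qed (use \<mu>(1) \<mu>'(1) in simp)
  qed
  have \<rho>0: "\<rho>0 : characters (g_centr \<beta>)"
   using add by (auto simp: characters_def hom_def \<rho>0_def units_of_def Units_def)
  have irr: "irreducible_rep ((G r)(|carrier := K r k|)) (V \<rho>0) (P \<rho>0)" and
   con: "contains_character (V \<rho>0) (P \<rho>0) (Z r \<beta>) (psi_Z r \<beta> \<rho>0)" using ic'[OF \<rho>0] by blast+
  have rp: "rep ((G r)(|carrier := K r k|)) (V \<rho>0) (P \<rho>0)"
   by (rule irreducible_imp_rep[OF subgroup_imp_group[OF normal_imp_subgroup[OF H]] irr])
  show "EX \<rho>:characters (g_centr \<beta>). ALL z:Z r \<beta>. psi_Z r \<beta> \<rho> z = \<chi> z"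
  proof (rule psi_Z_surj[OF kr, where \<psi>' = "psi_Z r \<beta> \<rho>0"])
   show "psi_Z r \<beta> \<rho>0 (z *_{G r} w) = psi_Z r \<beta> \<rho>0 z * psi_Z r \<beta> \<rho>0 w" if "z : Z r \<beta>" "w : Z r \<beta>" for z w
   proof (rule contains_character_mult[OF rp con])
    show "Z r \<beta> \<subseteq> K r k" using Z_K[OF kr] by blast
   qed (use that subgroup.m_closed[OF Z_subgroup[OF kr]] in blast)+
   show "psi_Z r \<beta> \<rho>0 (red r (%x. x + emb \<pi> ^ k * A x)) = gauss k A" if "lin A" "red 1 A : carrier (g_centr \<beta>)" for A
    unfolding psi_Z_eq[OF kr that(1)] using that(2) by (simp add: \<rho>0_def)
  qed (use psi_Z_N[OF kr \<rho>0] \<chi> in blast)+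
 qed (use ic' in blast)+
qed

theorem ind_sigma_bij:
 fixes V :: "_ => (complex, 'v) module"
 assumes r: "2 <= r" and ic: "odd r ==> intertwiner_choice r \<beta> V P U"
 shows "bij_betw (ind_sigma r \<beta> V P U) (theta_set r \<beta>) (Irr_containing (G r) (K r (l r)) (psi r \<beta>))"
proof (cases "even r")
 case True
 then have ev: "l' r = l r" by (auto simp: l_def l'_def)
 have "bij_betw (%\<theta>. iso_class (G r) (ind_module (G r) (G_stab r \<beta>) (algebra_on id UNIV) (sigma_even r \<beta> \<theta>))
   (ind_rep (G r) (G_stab r \<beta>) (algebra_on id UNIV) (sigma_even r \<beta> \<theta>)))
  (theta_set r \<beta>) (Irr_containing (G r) (K r (l r)) (psi r \<beta>))"
 proof (rule bij_from_heis[OF r heis_even[OF r ev]])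
  fix \<theta> g h assume \<theta>: "\<theta> : theta_set r \<beta>" and g: "g : G_centr r \<beta>" and h: "h : K r (l r)"
  obtain g' h' where f: "factors r \<beta> (l r) (g *_{G r} h) = (g', h')" "g' : G_centr r \<beta>" "h' : K r (l r)"
   "g *_{G r} h = g' *_{G r} h'" using factors[OF g h] by blast
  have "sigma_even r \<beta> \<theta> (g *_{G r} h) = (\<lambda>v\<in>carrier (algebra_on id UNIV).
    theta_mod r \<theta> g' \<odot>_{algebra_on id UNIV} (psi r \<beta> h' * v))"
   unfolding sigma_even_def f(1) by (simp add: mult.assoc fun_eq_iff)
  then show "EX g' h'. g' : G_centr r \<beta> & h' : K r (l r) & g *_{G r} h = g' *_{G r} h' &
   sigma_even r \<beta> \<theta> (g *_{G r} h) = (\<lambda>v\<in>carrier (algebra_on id UNIV).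
    theta_mod r \<theta> g' \<odot>_{algebra_on id UNIV} (psi r \<beta> h' * v))"
   using f(2-4) by (intro exI[of _ g'] exI[of _ h'] conjI)
 qed simp
 then show ?thesis using True by (simp add: ind_sigma_def[abs_def])
next
 case False
 then obtain k where k: "r = 2 * k + 1" by (elim oddE)
 then have kr: "r = 2 * k + 1" "1 <= k" using r by auto
 note ol = odd_l[OF kr]
 have "bij_betw (%\<theta>. iso_class (G r) (ind_module (G r) (G_stab r \<beta>) (V (rho_of r \<beta> \<theta>)) (sigma_odd r \<beta> V P U \<theta>))
   (ind_rep (G r) (G_stab r \<beta>) (V (rho_of r \<beta> \<theta>)) (sigma_odd r \<beta> V P U \<theta>)))
  (theta_set r \<beta>) (Irr_containing (G r) (K r (l r)) (psi r \<beta>))"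
 proof (rule bij_from_heis[OF r heis_odd[OF kr ic[OF False]]])
  fix \<theta> g h assume \<theta>: "\<theta> : theta_set r \<beta>" and g: "g : G_centr r \<beta>" and h: "h : K r k"
  obtain g' h' where f: "factors r \<beta> k (g *_{G r} h) = (g', h')" "g' : G_centr r \<beta>" "h' : K r k"
   "g *_{G r} h = g' *_{G r} h'" using factors[OF g h] by blast
  have "sigma_odd r \<beta> V P U \<theta> (g *_{G r} h) = (\<lambda>v\<in>carrier (V (rho_of r \<beta> \<theta>)).
    theta_mod r \<theta> g' \<odot>_{V (rho_of r \<beta> \<theta>)} U (rho_of r \<beta> \<theta>) g' (P (rho_of r \<beta> \<theta>) h' v))"
   unfolding sigma_odd_def ol(3) f(1) Let_def by simp
  then show "EX g' h'. g' : G_centr r \<beta> & h' : K r k & g *_{G r} h = g' *_{G r} h' &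
   sigma_odd r \<beta> V P U \<theta> (g *_{G r} h) = (\<lambda>v\<in>carrier (V (rho_of r \<beta> \<theta>)).
    theta_mod r \<theta> g' \<odot>_{V (rho_of r \<beta> \<theta>)} U (rho_of r \<beta> \<theta>) g' (P (rho_of r \<beta> \<theta>) h' v))"
   using f(2-4) by (intro exI[of _ g'] exI[of _ h'] conjI)
 qed (simp only: rho_of_def ol(3))
 then show ?thesis using False by (simp add: ind_sigma_def[abs_def])
qed

end

theorem proposition5p3p4:
  fixes emb :: "'f::nonarch_local_field \<Rightarrow> 'k::nonarch_local_field"
    and \<pi> :: 'f and \<tau> :: "'f \<Rightarrow> complex" and \<iota> :: "'k \<Rightarrow> 'k" and \<epsilon> \<beta> :: 'k and n m r :: nat
    and V :: "(('k set \<Rightarrow> 'k set) \<Rightarrow> complex) \<Rightarrow> (complex, 'v) module"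
    and P U :: "(('k set \<Rightarrow> 'k set) \<Rightarrow> complex) \<Rightarrow> ('k set \<Rightarrow> 'k set) \<Rightarrow> 'v \<Rightarrow> 'v"
  assumes "unramified_GO emb \<pi> \<tau> \<iota> \<epsilon> n"
    and "n = 2 * m"
    and "r \<ge> 2"
    and "\<beta> \<in> integers" and "integers = adjoin emb \<beta>" and "\<iota> \<beta> = - \<beta>"
    and "odd r \<Longrightarrow> unramified_GO.intertwiner_choice emb \<pi> \<tau> \<iota> \<epsilon> r \<beta> V P U"
  shows "bij_betw
    (unramified_GO.ind_sigma emb \<pi> \<tau> \<iota> \<epsilon> r \<beta> V P U)
    (unramified_GO.theta_set emb \<pi> \<tau> \<iota> r \<beta>)
    (Irr_containing (unramified_GO.G emb \<pi> \<iota> \<epsilon> r)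
       (unramified_GO.K emb \<pi> \<iota> \<epsilon> r (unramified_GO.l r))
       (unramified_GO.psi emb \<pi> \<tau> \<iota> \<epsilon> r \<beta>))"
proof -
 interpret GO_beta emb \<pi> \<tau> \<iota> \<epsilon> n \<beta>
  using assms(1,4-6) by (intro GO_beta.intro GO_beta_axioms.intro)
 show ?thesis using assms(3,7) by (rule ind_sigma_bij)
qed


end
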